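(* Let $p\ge 3$ be a prime and let $T|S$ be a finite, purely ramified extension of discrete valuation rings of residue characteristic $p$, with fields of fractions $L|K$, such that $L|K$ is Galois with group $G=\langle\sigma\rangle$ cyclic of order $p$. Let $t$ generate the maximal ideal of $T$, let $s=\mathrm{N}_{L|K}(t)$ (a generator of the maximal ideal of $S$), and put $b:=\mathrm{val}_t(t^\sigma-t)-1$; assume $b\ge 1$. Write $b=p\underline{b}+\overline{b}$ with $\overline{b}\in[0,p-1]$, and assume $\mathrm{val}_s(p)\ge b-\underline{b}$. Then there are isomorphisms of graded $S$-algebras \[ S\big[h^{(1)}_j\ (j\in[0,p-1]\setminus\{\overline b\});\ h^{(2)}_0\big]\big/ I \;\xrightarrow{\ \sim\ }\; \mathrm{Ext}^\ast_{T\wr G}(T,T)\;\xrightarrow{\ \sim\ }\;\mathrm{H}^\ast(G,T;S), \] where the left hand side is a quotient of the graded commutative polynomial ring over $S$ in generators $h^{(1)}_j$ of degree $1$ ($j\in[0,p-1]\setminus\{\overline b\}$) and $h^{(2)}_0$ of degree $2$, and $I$ is the ideal generated by \begin{itemize} \item $s^{\underline b+1}h^{(1)}_j$ for $j\in[0,\overline b-1]$, and $s^{\underline b}h^{(1)}_j$ for $j\in[\overline b+1,p-1]$; \item $s^{b-\underline b}h^{(2)}_0$; \item $h^{(1)}_j h^{(1)}_k-\delta_{\overline{j+k},\overline{2b}}\; s^{\,b+\underline{j+k-2b}}\;(\overline{b-j})^{-1}\,h^{(2)}_0$ for $j,k\in[0,p-1]\setminus\{\overline b\}$. \end{itemize}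 Here, for an integer $i$, $i=p\underline{i}+\overline{i}$ with $\overline i\in[0,p-1]$; $\delta$ is the Kronecker delta; and $(\overline{b-j})^{-1}$ is the inverse in $S$ of the integer $\overline{b-j}\in[1,p-1]$.
   Context: "Purely ramified" means totally ramified with trivial residue field extension. $\mathrm{val}_t$, $\mathrm{val}_s$ denote the normalized valuations (with $\mathrm{val}(0)=+\infty$, so the hypothesis $\mathrm{val}_s(p)\ge b-\underline b$ is void in characteristic $p$). For $y\in T$ and $\rho\in G$, $y^\rho$ denotes the image of $y$ under $\rho$. The twisted group ring $T\wr G$ is the free $T$-module $\{\sum_{\rho\in G}\rho y_\rho: y_\rho\in T\}$ with multiplication induced by $(\rho y)(\tau z)=(\rho\tau)(y^\tau z)$ for $\rho,\tau\in G$, $y,z\in T$. Modules are right modules; $T$ is a right $T\wr G$-module via $x\cdot(\rho y)=x^\rho y$. $\mathrm{Ext}^\ast_{T\wr G}(T,T)$ carries the Yoneda product. $\mathrm{H}^\ast(G,T;S):=\mathrm{Ext}^\ast_{SG}(S,T)$ (with $S$ the trivial module) carries the cup product induced by the multiplication of $T$ (on cochains of the bar resolution: $(g_0,\dots,g_{i+j})(a\cup b)=(g_0,\dots,g_i)a\cdot(g_i,\dots,g_{i+j})b$). "Graded commutative" means homogeneous elements $x,y$ satisfy $xy=(-1)^{\deg x\deg y}yx$. *)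

theory Defs
  imports "HOL-Algebra.Algebraic_Closure_Type" "HOL-Library.Extended_Nat"
begin

section \<open>Discrete valuation rings inside a field\<close>

text \<open>The field $L$ is the type \<open>'l\<close>; $S$, $T$ and $K$ are subsets of it, with the
  inherited operations.\<close>

definition ring_on :: "'l::field set \<Rightarrow> 'l ring"
  where "ring_on R = ring_of_type_algebra\<lparr>carrier := R\<rparr>"

definition dvr :: "'l::field set \<Rightarrow> bool"
  where "dvr R \<longleftrightarrow> principal_domain (ring_on R) \<and> \<not> Ring.field (ring_on R) \<and>
                  (\<exists>!M. maximalideal M (ring_on R))"

definition uniformizer :: "'l::field set \<Rightarrow> 'l \<Rightarrow> bool"
  where "uniformizer R \<pi> \<longleftrightarrow> \<pi> \<in> R \<and> maximalideal (PIdl\<^bsub>ring_on R\<^esub> \<pi>) (ring_on R)"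

text \<open>For a uniformizer \<open>\<pi>\<close> of the discrete valuation ring \<open>R\<close>, this is the normalized
  valuation on elements of \<open>R\<close>; \<open>val R \<pi> 0 = \<infinity>\<close>.\<close>

definition val :: "'l::field set \<Rightarrow> 'l \<Rightarrow> 'l \<Rightarrow> enat"
  where "val R \<pi> x = Sup {enat n | n. \<exists>y\<in>R. x = \<pi> ^ n * y}"

definition residue_char :: "'l::field set \<Rightarrow> nat \<Rightarrow> bool"
  where "residue_char R p \<longleftrightarrow> (\<forall>M. maximalideal M (ring_on R) \<longrightarrow>
     (let k = ring_on R Quot M in \<forall>n::nat. [n] \<cdot>\<^bsub>k\<^esub> \<one>\<^bsub>k\<^esub> = \<zero>\<^bsub>k\<^esub> \<longleftrightarrow> p dvd n))"

definition fraction_field :: "'l::field set \<Rightarrow> 'l set"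
  where "fraction_field R = {x / y | x y. x \<in> R \<and> y \<in> R \<and> y \<noteq> 0}"

definition finite_extension :: "'l::field set \<Rightarrow> 'l set \<Rightarrow> bool"
  where "finite_extension S T \<longleftrightarrow> S \<subseteq> T \<and>
     (\<exists>B. finite B \<and> B \<subseteq> T \<and> T = {\<Sum>v\<in>B. c v * v | c. c \<in> B \<rightarrow> S})"

text \<open>Ramification index equal to the degree of the extension of fraction fields, and
  $S \to T/\tau T$ surjective, that is, trivial residue field extension.\<close>

definition purely_ramified :: "'l::field set \<Rightarrow> 'l set \<Rightarrow> bool"
  where "purely_ramified S T \<longleftrightarrow> (\<exists>\<pi> \<tau> n. uniformizer S \<pi> \<and> uniformizer T \<tau> \<and>
     ring.dimension ring_of_type_algebra n (fraction_field S) (fraction_field T) \<and>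
     val T \<tau> \<pi> = enat n \<and>
     (\<forall>x\<in>T. \<exists>y\<in>S. \<exists>z\<in>T. x = y + \<tau> * z))"

definition galois_group :: "'l::field set \<Rightarrow> ('l \<Rightarrow> 'l) set"
  where "galois_group K =
     {\<rho> \<in> ring_iso ring_of_type_algebra ring_of_type_algebra. \<forall>x\<in>K. \<rho> x = x}"

definition galois_extension :: "'l::field set \<Rightarrow> bool"
  where "galois_extension K \<longleftrightarrow> (\<exists>n. ring.dimension ring_of_type_algebra n K (UNIV :: 'l set)) \<and>
     {x. \<forall>\<rho>\<in>galois_group K. \<rho> x = x} = K"

definition galois_norm :: "('l::field \<Rightarrow> 'l) set \<Rightarrow> 'l \<Rightarrow> 'l"
  where "galois_norm G x = (\<Prod>\<rho>\<in>G. \<rho> x)"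

section \<open>Right modules, projective resolutions and Ext\<close>

text \<open>The record \<^typ>\<open>('a, 'm) module\<close> serves three purposes. As a right module over
  \<open>A\<close>, \<open>a \<odot>\<^bsub>M\<^esub> x\<close> stands for $x \cdot a$. As a not necessarily commutative algebra
  over \<open>S\<close>, it carries the scalar multiplication by \<open>S\<close>. As an \<open>S\<close>-module, its
  multiplicative fields are irrelevant and left undefined.\<close>

definition right_module :: "('a, 'r) ring_scheme \<Rightarrow> ('a, 'm, 'n) module_scheme \<Rightarrow> bool"
  where "right_module A M \<longleftrightarrow> ring A \<and> abelian_group M \<and>
     (\<forall>a\<in>carrier A. \<forall>x\<in>carrier M. a \<odot>\<^bsub>M\<^esub> x \<in> carrier M) \<and>
     (\<forall>a\<in>carrier A. \<forall>b\<in>carrier A. \<forall>x\<in>carrier M.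
        (a \<oplus>\<^bsub>A\<^esub> b) \<odot>\<^bsub>M\<^esub> x = a \<odot>\<^bsub>M\<^esub> x \<oplus>\<^bsub>M\<^esub> b \<odot>\<^bsub>M\<^esub> x) \<and>
     (\<forall>a\<in>carrier A. \<forall>x\<in>carrier M. \<forall>y\<in>carrier M.
        a \<odot>\<^bsub>M\<^esub> (x \<oplus>\<^bsub>M\<^esub> y) = a \<odot>\<^bsub>M\<^esub> x \<oplus>\<^bsub>M\<^esub> a \<odot>\<^bsub>M\<^esub> y) \<and>
     (\<forall>a\<in>carrier A. \<forall>b\<in>carrier A. \<forall>x\<in>carrier M.
        (a \<otimes>\<^bsub>A\<^esub> b) \<odot>\<^bsub>M\<^esub> x = b \<odot>\<^bsub>M\<^esub> (a \<odot>\<^bsub>M\<^esub> x)) \<and>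
     (\<forall>x\<in>carrier M. \<one>\<^bsub>A\<^esub> \<odot>\<^bsub>M\<^esub> x = x)"

definition right_hom ::
  "('a, 'r) ring_scheme \<Rightarrow> ('a, 'm, 'x) module_scheme \<Rightarrow> ('a, 'n, 'y) module_scheme \<Rightarrow> ('m \<Rightarrow> 'n) set"
  where "right_hom A M N = {f \<in> carrier M \<rightarrow>\<^sub>E carrier N.
     (\<forall>x\<in>carrier M. \<forall>y\<in>carrier M. f (x \<oplus>\<^bsub>M\<^esub> y) = f x \<oplus>\<^bsub>N\<^esub> f y) \<and>
     (\<forall>a\<in>carrier A. \<forall>x\<in>carrier M. f (a \<odot>\<^bsub>M\<^esub> x) = a \<odot>\<^bsub>N\<^esub> f x)}"

definition free_right_module :: "('a, 'r) ring_scheme \<Rightarrow> 'x set \<Rightarrow> ('a, 'x \<Rightarrow> 'a) module"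
  where "free_right_module A U =
     \<lparr>carrier = {f. (\<forall>x\<in>U. f x \<in> carrier A) \<and> (\<forall>x. x \<notin> U \<longrightarrow> f x = \<zero>\<^bsub>A\<^esub>) \<and>
                    finite {x. f x \<noteq> \<zero>\<^bsub>A\<^esub>}},
      monoid.mult = undefined, one = undefined,
      ring.zero = (\<lambda>_. \<zero>\<^bsub>A\<^esub>), add = (\<lambda>f g x. f x \<oplus>\<^bsub>A\<^esub> g x),
      module.smult = (\<lambda>a f x. f x \<otimes>\<^bsub>A\<^esub> a)\<rparr>"

text \<open>Projective means: direct summand of a free module. The basis may be taken within the
  type of \<open>P\<close>, since \<open>P\<close> is a quotient of the free module on \<open>carrier P\<close>.\<close>

definition projective_module :: "('a, 'r) ring_scheme \<Rightarrow> ('a, 'm) module \<Rightarrow> bool"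
  where "projective_module A P \<longleftrightarrow> right_module A P \<and>
     (\<exists>U :: 'm set. \<exists>i \<in> right_hom A P (free_right_module A U).
        \<exists>r \<in> right_hom A (free_right_module A U) P. \<forall>x\<in>carrier P. r (i x) = x)"

text \<open>$\cdots \to P_1 \to P_0 \to M \to 0$, with \<open>d n\<close> the map $P_{n+1} \to P_n$ and
  \<open>\<epsilon>\<close> the augmentation.\<close>

definition projective_resolution ::
  "('a, 'r) ring_scheme \<Rightarrow> ('a, 'k) module \<Rightarrow> (nat \<Rightarrow> ('a, 'm) module) \<Rightarrow> (nat \<Rightarrow> 'm \<Rightarrow> 'm) \<Rightarrow>
   ('m \<Rightarrow> 'k) \<Rightarrow> bool"
  where "projective_resolution A M P d \<epsilon> \<longleftrightarrow>
     (\<forall>n. projective_module A (P n)) \<and>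
     (\<forall>n. d n \<in> right_hom A (P (Suc n)) (P n)) \<and>
     \<epsilon> \<in> right_hom A (P 0) M \<and>
     \<epsilon> ` carrier (P 0) = carrier M \<and>
     d 0 ` carrier (P 1) = a_kernel (P 0) M \<epsilon> \<and>
     (\<forall>n. d (Suc n) ` carrier (P (Suc (Suc n))) = a_kernel (P (Suc n)) (P n) (d n))"

text \<open>$\mathrm{Hom}_A(M,N)$ as a module over the ground ring of the algebra \<open>A\<close>.\<close>

definition hom_module ::
  "('s, 'a) module \<Rightarrow> ('a, 'm) module \<Rightarrow> ('a, 'n) module \<Rightarrow> ('s, 'm \<Rightarrow> 'n) module"
  where "hom_module A M N =
     \<lparr>carrier = right_hom A M N, monoid.mult = undefined, one = undefined,
      ring.zero = (\<lambda>x\<in>carrier M. \<zero>\<^bsub>N\<^esub>),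
      add = (\<lambda>f g. \<lambda>x\<in>carrier M. f x \<oplus>\<^bsub>N\<^esub> g x),
      module.smult = (\<lambda>s f. \<lambda>x\<in>carrier M. (s \<odot>\<^bsub>A\<^esub> \<one>\<^bsub>A\<^esub>) \<odot>\<^bsub>N\<^esub> f x)\<rparr>"

definition ext_coboundary ::
  "(nat \<Rightarrow> ('a, 'm) module) \<Rightarrow> (nat \<Rightarrow> 'm \<Rightarrow> 'm) \<Rightarrow> nat \<Rightarrow> ('m \<Rightarrow> 'n) \<Rightarrow> ('m \<Rightarrow> 'n)"
  where "ext_coboundary P d n f = (\<lambda>x\<in>carrier (P (Suc n)). f (d n x))"

definition ext_cocycles ::
  "('s, 'a) module \<Rightarrow> (nat \<Rightarrow> ('a, 'm) module) \<Rightarrow> (nat \<Rightarrow> 'm \<Rightarrow> 'm) \<Rightarrow> ('a, 'n) module \<Rightarrow> nat \<Rightarrow>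
   ('m \<Rightarrow> 'n) set"
  where "ext_cocycles A P d N n = {f \<in> right_hom A (P n) N.
     ext_coboundary P d n f = \<zero>\<^bsub>hom_module A (P (Suc n)) N\<^esub>}"

definition ext_coboundaries ::
  "('s, 'a) module \<Rightarrow> (nat \<Rightarrow> ('a, 'm) module) \<Rightarrow> (nat \<Rightarrow> 'm \<Rightarrow> 'm) \<Rightarrow> ('a, 'n) module \<Rightarrow> nat \<Rightarrow>
   ('m \<Rightarrow> 'n) set"
  where "ext_coboundaries A P d N n =
     (case n of 0 \<Rightarrow> {\<zero>\<^bsub>hom_module A (P 0) N\<^esub>}
      | Suc m \<Rightarrow> ext_coboundary P d m ` right_hom A (P m) N)"

definition ext_class ::
  "('s, 'a) module \<Rightarrow> (nat \<Rightarrow> ('a, 'm) module) \<Rightarrow> (nat \<Rightarrow> 'm \<Rightarrow> 'm) \<Rightarrow> ('a, 'n) module \<Rightarrow> nat \<Rightarrow>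
   ('m \<Rightarrow> 'n) \<Rightarrow> ('m \<Rightarrow> 'n) set"
  where "ext_class A P d N n f =
     ext_coboundaries A P d N n +>\<^bsub>hom_module A (P n) N\<^esub> f"

text \<open>$\mathrm{Ext}^n_A(M,N)$ computed from the resolution \<open>P\<close> of $M$: the cohomology
  in degree \<open>n\<close> of $\mathrm{Hom}_A(P_\bullet,N)$.\<close>

definition ext_module ::
  "('s, 'a) module \<Rightarrow> (nat \<Rightarrow> ('a, 'm) module) \<Rightarrow> (nat \<Rightarrow> 'm \<Rightarrow> 'm) \<Rightarrow> ('a, 'n) module \<Rightarrow> nat \<Rightarrow>
   ('s, ('m \<Rightarrow> 'n) set) module"
  where "ext_module A P d N n =
     \<lparr>carrier = ext_class A P d N n ` ext_cocycles A P d N n,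
      monoid.mult = undefined, one = undefined,
      ring.zero = ext_coboundaries A P d N n,
      add = set_add (hom_module A (P n) N),
      module.smult = (\<lambda>s U. \<Union>f\<in>U. ext_class A P d N n (s \<odot>\<^bsub>hom_module A (P n) N\<^esub> f))\<rparr>"

section \<open>Graded algebras\<close>

record ('s, 'a) graded_algebra = "('s, 'a) module" +
  homog :: "nat \<Rightarrow> 'a set"

definition graded_algebra_iso ::
  "'s set \<Rightarrow> ('s, 'a) graded_algebra \<Rightarrow> ('s, 'b) graded_algebra \<Rightarrow> ('a \<Rightarrow> 'b) set"
  where "graded_algebra_iso S A B = {\<phi> \<in> ring_iso A B.
     (\<forall>s\<in>S. \<forall>x\<in>carrier A. \<phi> (s \<odot>\<^bsub>A\<^esub> x) = s \<odot>\<^bsub>B\<^esub> \<phi> x) \<and>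
     (\<forall>n. \<phi> ` homog A n = homog B n)}"

text \<open>The direct sum of the modules \<open>E n\<close>, with multiplication
  \<open>pr i j\<close> from $E_i \times E_j$ to $E_{i+j}$ and unit \<open>u\<close> in $E_0$.\<close>

definition total_algebra ::
  "(nat \<Rightarrow> ('s, 'c) module) \<Rightarrow> (nat \<Rightarrow> nat \<Rightarrow> 'c \<Rightarrow> 'c \<Rightarrow> 'c) \<Rightarrow> 'c \<Rightarrow> ('s, nat \<Rightarrow> 'c) graded_algebra"
  where "total_algebra E pr u =
     \<lparr>carrier = {x. (\<forall>n. x n \<in> carrier (E n)) \<and> finite {n. x n \<noteq> \<zero>\<^bsub>E n\<^esub>}},
      monoid.mult = (\<lambda>x y n. \<Oplus>\<^bsub>E n\<^esub>i\<in>{..n}. pr i (n - i) (x i) (y (n - i))),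
      one = (\<lambda>n. if n = 0 then u else \<zero>\<^bsub>E n\<^esub>),
      ring.zero = (\<lambda>n. \<zero>\<^bsub>E n\<^esub>),
      add = (\<lambda>x y n. x n \<oplus>\<^bsub>E n\<^esub> y n),
      module.smult = (\<lambda>s x n. s \<odot>\<^bsub>E n\<^esub> x n),
      homog = (\<lambda>n. {x. x n \<in> carrier (E n) \<and> (\<forall>m. m \<noteq> n \<longrightarrow> x m = \<zero>\<^bsub>E m\<^esub>)})\<rparr>"

subsection \<open>Yoneda product\<close>

text \<open>The lifts of a cocycle $f : P_i \to M$ to chain maps
  $(F_k : P_{i+k} \to P_k)_{k \ge 0}$.\<close>

definition chain_lifts ::
  "('a, 'r) ring_scheme \<Rightarrow> (nat \<Rightarrow> ('a, 'm) module) \<Rightarrow> (nat \<Rightarrow> 'm \<Rightarrow> 'm) \<Rightarrow> ('m \<Rightarrow> 'k) \<Rightarrow> nat \<Rightarrow>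
   ('m \<Rightarrow> 'k) \<Rightarrow> (nat \<Rightarrow> 'm \<Rightarrow> 'm) set"
  where "chain_lifts A P d \<epsilon> i f = {F.
     (\<forall>k. F k \<in> right_hom A (P (i + k)) (P k)) \<and>
     (\<forall>x\<in>carrier (P i). \<epsilon> (F 0 x) = f x) \<and>
     (\<forall>k. \<forall>x\<in>carrier (P (i + Suc k)). d k (F (Suc k) x) = F k (d (i + k) x))}"

text \<open>Maps act on the right modules in the order in which they are written: the product of the
  class of $f$ in degree $i$ and the class of $g$ in degree $j$ is represented by
  $P_{i+j} \to P_j \to M$, a lift of $f$ followed by $g$. The union is over all representatives
  and lifts, as in \<^const>\<open>rcoset_mult\<close>.\<close>

definition yoneda_product ::
  "('s, 'a) module \<Rightarrow> ('a, 'k) module \<Rightarrow> (nat \<Rightarrow> ('a, 'm) module) \<Rightarrow> (nat \<Rightarrow> 'm \<Rightarrow> 'm) \<Rightarrow> ('m \<Rightarrow> 'k) \<Rightarrow>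
   nat \<Rightarrow> nat \<Rightarrow> ('m \<Rightarrow> 'k) set \<Rightarrow> ('m \<Rightarrow> 'k) set \<Rightarrow> ('m \<Rightarrow> 'k) set"
  where "yoneda_product A M P d \<epsilon> i j U V =
     (\<Union>f\<in>U. \<Union>g\<in>V. \<Union>F\<in>chain_lifts A P d \<epsilon> i f.
        ext_class A P d M (i + j) (\<lambda>x\<in>carrier (P (i + j)). g (F j x)))"

text \<open>$\mathrm{Ext}^*_A(M,M)$.\<close>

definition ext_algebra ::
  "('s, 'a) module \<Rightarrow> ('a, 'k) module \<Rightarrow> (nat \<Rightarrow> ('a, 'm) module) \<Rightarrow> (nat \<Rightarrow> 'm \<Rightarrow> 'm) \<Rightarrow> ('m \<Rightarrow> 'k) \<Rightarrow>
   ('s, nat \<Rightarrow> ('m \<Rightarrow> 'k) set) graded_algebra"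
  where "ext_algebra A M P d \<epsilon> =
     total_algebra (ext_module A P d M) (yoneda_product A M P d \<epsilon>) (ext_class A P d M 0 \<epsilon>)"

section \<open>Twisted group ring and group cohomology\<close>

text \<open>As $y^{\rho\tau} = (y^\rho)^\tau$, the product $\rho\tau$ in the group is
  \<open>\<tau> \<circ> \<rho>\<close>. The function \<open>y\<close> stands for $\sum_\rho \rho\, y_\rho$.\<close>

definition twisted_group_ring ::
  "('l::field \<Rightarrow> 'l) set \<Rightarrow> 'l set \<Rightarrow> ('l, ('l \<Rightarrow> 'l) \<Rightarrow> 'l) module"
  where "twisted_group_ring G T =
     \<lparr>carrier = {y. (\<forall>\<rho>\<in>G. y \<rho> \<in> T) \<and> (\<forall>\<rho>. \<rho> \<notin> G \<longrightarrow> y \<rho> = 0)},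
      monoid.mult = (\<lambda>y z \<kappa>. \<Sum>(\<rho>, \<tau>)\<in>{(\<rho>, \<tau>) \<in> G \<times> G. \<tau> \<circ> \<rho> = \<kappa>}. \<tau> (y \<rho>) * z \<tau>),
      one = (\<lambda>\<kappa>. if \<kappa> = id then 1 else 0),
      ring.zero = (\<lambda>_. 0),
      add = (\<lambda>y z \<kappa>. y \<kappa> + z \<kappa>),
      module.smult = (\<lambda>s y \<kappa>. s * y \<kappa>)\<rparr>"

definition group_ring ::
  "('l::field \<Rightarrow> 'l) set \<Rightarrow> 'l set \<Rightarrow> ('l, ('l \<Rightarrow> 'l) \<Rightarrow> 'l) module"
  where "group_ring G S =
     \<lparr>carrier = {y. (\<forall>\<rho>\<in>G. y \<rho> \<in> S) \<and> (\<forall>\<rho>. \<rho> \<notin> G \<longrightarrow> y \<rho> = 0)},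
      monoid.mult = (\<lambda>y z \<kappa>. \<Sum>(\<rho>, \<tau>)\<in>{(\<rho>, \<tau>) \<in> G \<times> G. \<tau> \<circ> \<rho> = \<kappa>}. y \<rho> * z \<tau>),
      one = (\<lambda>\<kappa>. if \<kappa> = id then 1 else 0),
      ring.zero = (\<lambda>_. 0),
      add = (\<lambda>y z \<kappa>. y \<kappa> + z \<kappa>),
      module.smult = (\<lambda>s y \<kappa>. s * y \<kappa>)\<rparr>"

text \<open>$T$ with $x \cdot \rho y = x^\rho y$, both as a right module over the twisted group ring
  and, with $y \in S$, over the group ring $SG$.\<close>

definition galois_module ::
  "('l::field \<Rightarrow> 'l) set \<Rightarrow> 'l set \<Rightarrow> (('l \<Rightarrow> 'l) \<Rightarrow> 'l, 'l) module"
  where "galois_module G T =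
     \<lparr>carrier = T, monoid.mult = (*), one = 1, ring.zero = 0, add = (+),
      module.smult = (\<lambda>a x. \<Sum>\<rho>\<in>G. \<rho> x * a \<rho>)\<rparr>"

text \<open>The homogeneous bar resolution of the trivial module $S$ over $SG$: in degree $n$ the
  free $S$-module on $G^{n+1}$ with $(g_0,\dots,g_n)\rho = (g_0\rho,\dots,g_n\rho)$, and
  $(g_0,\dots,g_{n+1}) \mapsto
    \sum_i (-1)^i (g_0,\dots,g_{i-1},g_{i+1},\dots,g_{n+1})$.\<close>

definition bar_tuples :: "'g set \<Rightarrow> nat \<Rightarrow> 'g list set"
  where "bar_tuples G n = {w. set w \<subseteq> G \<and> length w = Suc n}"

definition bar_module ::
  "('l::field \<Rightarrow> 'l) set \<Rightarrow> 'l set \<Rightarrow> nat \<Rightarrow> (('l \<Rightarrow> 'l) \<Rightarrow> 'l, ('l \<Rightarrow> 'l) list \<Rightarrow> 'l) module"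
  where "bar_module G S n =
     \<lparr>carrier = {f. (\<forall>w\<in>bar_tuples G n. f w \<in> S) \<and> (\<forall>w. w \<notin> bar_tuples G n \<longrightarrow> f w = 0)},
      monoid.mult = undefined, one = undefined,
      ring.zero = (\<lambda>_. 0),
      add = (\<lambda>f g w. f w + g w),
      module.smult = (\<lambda>a f w. \<Sum>(v, \<rho>)\<in>{(v, \<rho>) \<in> bar_tuples G n \<times> G. map (\<lambda>g. \<rho> \<circ> g) v = w}.
                 f v * a \<rho>)\<rparr>"

definition bar_diff ::
  "('l::field \<Rightarrow> 'l) set \<Rightarrow> 'l set \<Rightarrow> nat \<Rightarrow> (('l \<Rightarrow> 'l) list \<Rightarrow> 'l) \<Rightarrow> (('l \<Rightarrow> 'l) list \<Rightarrow> 'l)"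
  where "bar_diff G S n = (\<lambda>f\<in>carrier (bar_module G S (Suc n)). \<lambda>w.
     \<Sum>(v, i)\<in>{(v, i) \<in> bar_tuples G (Suc n) \<times> {..Suc n}. take i v @ drop (Suc i) v = w}.
       (-1) ^ i * f v)"

text \<open>The basis element of a free module belonging to \<open>w\<close>.\<close>

definition basis_elem :: "'w \<Rightarrow> 'w \<Rightarrow> 'l::field"
  where "basis_elem w = (\<lambda>v. if v = w then 1 else 0)"

definition bar_cup ::
  "('l::field \<Rightarrow> 'l) set \<Rightarrow> 'l set \<Rightarrow> nat \<Rightarrow> nat \<Rightarrow> ((('l \<Rightarrow> 'l) list \<Rightarrow> 'l) \<Rightarrow> 'l) \<Rightarrow>
   ((('l \<Rightarrow> 'l) list \<Rightarrow> 'l) \<Rightarrow> 'l) \<Rightarrow> (('l \<Rightarrow> 'l) list \<Rightarrow> 'l) \<Rightarrow> 'l"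
  where "bar_cup G S i j a b = (\<lambda>f\<in>carrier (bar_module G S (i + j)).
     \<Sum>w\<in>bar_tuples G (i + j).
       a (basis_elem (take (Suc i) w)) * b (basis_elem (drop i w)) * f w)"

definition cup_product ::
  "('l::field \<Rightarrow> 'l) set \<Rightarrow> 'l set \<Rightarrow> 'l set \<Rightarrow> nat \<Rightarrow> nat \<Rightarrow> ((('l \<Rightarrow> 'l) list \<Rightarrow> 'l) \<Rightarrow> 'l) set \<Rightarrow>
   ((('l \<Rightarrow> 'l) list \<Rightarrow> 'l) \<Rightarrow> 'l) set \<Rightarrow> ((('l \<Rightarrow> 'l) list \<Rightarrow> 'l) \<Rightarrow> 'l) set"
  where "cup_product G T S i j U V = (\<Union>a\<in>U. \<Union>b\<in>V.
     ext_class (group_ring G S) (bar_module G S) (bar_diff G S) (galois_module G T) (i + j)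
       (bar_cup G S i j a b))"

text \<open>$\mathrm{H}^*(G,T;S) = \mathrm{Ext}^*_{SG}(S,T)$, computed from the bar resolution. The
  unit is the class of the cochain mapping each $(g_0)$ to $1$.\<close>

definition group_cohomology_algebra ::
  "('l::field \<Rightarrow> 'l) set \<Rightarrow> 'l set \<Rightarrow> 'l set \<Rightarrow>
   ('l, nat \<Rightarrow> ((('l \<Rightarrow> 'l) list \<Rightarrow> 'l) \<Rightarrow> 'l) set) graded_algebra"
  where "group_cohomology_algebra G T S = total_algebra
     (ext_module (group_ring G S) (bar_module G S) (bar_diff G S) (galois_module G T))
     (cup_product G T S)
     (ext_class (group_ring G S) (bar_module G S) (bar_diff G S) (galois_module G T) 0
        (\<lambda>f\<in>carrier (bar_module G S 0). \<Sum>w\<in>bar_tuples G 0. f w))"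

section \<open>Graded commutative polynomial rings and their quotients\<close>

text \<open>The free associative algebra over \<open>S\<close> on the set \<open>U\<close> of generators, where
  \<open>x\<close> has degree \<open>wt x\<close>. Noncommutative monomials are lists.\<close>

definition free_algebra :: "'l::field set \<Rightarrow> 'x set \<Rightarrow> ('x \<Rightarrow> nat) \<Rightarrow> ('l, 'x list \<Rightarrow> 'l) graded_algebra"
  where "free_algebra S U wt =
     \<lparr>carrier = {f. range f \<subseteq> S \<and> (\<forall>w. w \<notin> lists U \<longrightarrow> f w = 0) \<and> finite {w. f w \<noteq> 0}},
      monoid.mult = (\<lambda>f g w. \<Sum>k\<le>length w. f (take k w) * g (drop k w)),
      one = basis_elem [],
      ring.zero = (\<lambda>_. 0),
      add = (\<lambda>f g w. f w + g w),
      module.smult = (\<lambda>s f w. s * f w),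
      homog = (\<lambda>n. {f. range f \<subseteq> S \<and> finite {w. f w \<noteq> 0} \<and>
                    (\<forall>w. f w \<noteq> 0 \<longrightarrow> w \<in> lists U \<and> sum_list (map wt w) = n)})\<rparr>"

definition graded_quotient ::
  "('s, 'a) graded_algebra \<Rightarrow> 'a set \<Rightarrow> ('s, 'a set) graded_algebra"
  where "graded_quotient A I =
     \<lparr>carrier = carrier (A Quot I), monoid.mult = monoid.mult (A Quot I), one = one (A Quot I),
      ring.zero = ring.zero (A Quot I), add = add (A Quot I),
      module.smult = (\<lambda>s U. \<Union>x\<in>U. I +>\<^bsub>A\<^esub> (s \<odot>\<^bsub>A\<^esub> x)),
      homog = (\<lambda>n. (\<lambda>x. I +>\<^bsub>A\<^esub> x) ` homog A n)\<rparr>"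

definition graded_commutators :: "('s, 'a) graded_algebra \<Rightarrow> 'a set"
  where "graded_commutators A =
     {x \<otimes>\<^bsub>A\<^esub> y \<ominus>\<^bsub>A\<^esub> (if even (m * n) then y \<otimes>\<^bsub>A\<^esub> x else \<ominus>\<^bsub>A\<^esub> (y \<otimes>\<^bsub>A\<^esub> x)) | x y m n.
        x \<in> homog A m \<and> y \<in> homog A n}"

definition gc_polynomial_ring ::
  "'l::field set \<Rightarrow> 'x set \<Rightarrow> ('x \<Rightarrow> nat) \<Rightarrow> ('l, ('x list \<Rightarrow> 'l) set) graded_algebra"
  where "gc_polynomial_ring S U wt =
     (let F = free_algebra S U wt in graded_quotient F (Idl\<^bsub>F\<^esub> (graded_commutators F)))"

definition gc_generator ::
  "'l::field set \<Rightarrow> 'x set \<Rightarrow> ('x \<Rightarrow> nat) \<Rightarrow> 'x \<Rightarrow> ('x list \<Rightarrow> 'l) set"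
  where "gc_generator S U wt x =
     (let F = free_algebra S U wt in Idl\<^bsub>F\<^esub> (graded_commutators F) +>\<^bsub>F\<^esub> basis_elem [x])"

datatype hgen = H1 nat | H2

fun hdeg :: "hgen \<Rightarrow> nat"
  where "hdeg (H1 j) = 1" | "hdeg H2 = 2"

definition hgens :: "nat \<Rightarrow> nat \<Rightarrow> hgen set"
  where "hgens p b = H1 ` ({0..p - 1} - {b mod p}) \<union> {H2}"

text \<open>In the products of two generators of degree one, the exponent
  $b + \underline{j+k-2b}$ is nonnegative for $p \ge 3$ and $b \ge 1$, so that \<open>nat\<close>
  does not truncate it.\<close>

definition hrelations :: "'l::field set \<Rightarrow> 'l \<Rightarrow> nat \<Rightarrow> nat \<Rightarrow> (hgen list \<Rightarrow> 'l) set set"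
  where "hrelations S s p b =
     (let R = gc_polynomial_ring S (hgens p b) hdeg;
          h1 = (\<lambda>j. gc_generator S (hgens p b) hdeg (H1 j));
          h2 = gc_generator S (hgens p b) hdeg H2;
          J = {0..p - 1} - {b mod p}
      in {s ^ (b div p + 1) \<odot>\<^bsub>R\<^esub> h1 j | j. j < b mod p} \<union>
         {s ^ (b div p) \<odot>\<^bsub>R\<^esub> h1 j | j. j \<in> {b mod p + 1..p - 1}} \<union>
         {s ^ (b - b div p) \<odot>\<^bsub>R\<^esub> h2} \<union>
         {h1 j \<otimes>\<^bsub>R\<^esub> h1 k \<ominus>\<^bsub>R\<^esub>
            ((if (j + k) mod p = (2 * b) mod p then 1 else 0)
               * s ^ nat (int b + (int j + int k - 2 * int b) div int p)
               * inverse (of_int ((int b - int j) mod int p))) \<odot>\<^bsub>R\<^esub> h2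
          | j k. j \<in> J \<and> k \<in> J})"

definition h_algebra ::
  "'l::field set \<Rightarrow> 'l \<Rightarrow> nat \<Rightarrow> nat \<Rightarrow> ('l, (hgen list \<Rightarrow> 'l) set set) graded_algebra"
  where "h_algebra S s p b =
     (let R = gc_polynomial_ring S (hgens p b) hdeg
      in graded_quotient R (Idl\<^bsub>R\<^esub> (hrelations S s p b)))"

end

theory Submission
 imports Defs
begin

section \<open>Idea of the proof\<close>

text \<open>For every projective resolution over $T \wr G$, and for the bar resolution, cohomology in degree
$n$ is a subquotient of $T$: fixed elements modulo traces in even positive degrees, elements of trace
zero modulo $\delta T$ with $\delta = \sigma - 1$ in odd degrees. In these terms the product of
$\delta u$ and $v$ in odd degrees is, up to a global sign, the class of $\mathrm{Tr}(v\, u^\sigma)$.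
As $\delta$ raises $t$-adic valuations by exactly $b$ off the multiples of $p$, a symplectic Gram-Schmidt
process for the form $\mathrm{Tr}(u v^\sigma - v u^\sigma)$ produces generators in degree one with the
stated products; the remaining relations are read off valuations.\<close>

section \<open>Discrete valuation rings\<close>

text \<open>Both algebras enter the presentation only through \<open>cohomology_model\<close>:
  representatives in \<open>T\<close>, congruences between them, and a sign \<chi> that is -1 for
  the Yoneda and 1 for the cup product. Sending \<open>H2\<close> to the class of \<chi> absorbs the
  sign, so one argument serves for both algebras. Associativity of the products is never assumed.
  Words are evaluated from the right, and multiplicativity of this evaluation has one critical case,
  three odd factors. There both bracketings vanish: \<open>p \<ge> 3\<close> makes the product of
  two odd classes so divisible that it kills every odd class (\<open>triple_product\<close>). Powers
  of \<open>t\<close> alone would control products only to leading order. Splitting Tr(\<delta> w *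
  \<sigma> u) into an alternating half and Tr(\<delta> u * \<delta> w) / 2, which is the trace of an
  integral element, shows that only an alternating form matters, and such a form can be brought to
  hyperbolic pairs. The freedom left, one unit of the fixed field for each pair, is used to obtain
  the constants 1/(b-j).\<close>

lemma ring_on_simps [simp]:
 "carrier (ring_on R) = R" "x \<otimes>\<^bsub>ring_on R\<^esub> y = x * y" "\<one>\<^bsub>ring_on R\<^esub> = 1"
 "\<zero>\<^bsub>ring_on R\<^esub> = 0" "x \<oplus>\<^bsub>ring_on R\<^esub> y = x + y"
 by (simp_all add: ring_on_def ring_of_type_algebra_def)

lemma cgenideal_ring_on: "PIdl\<^bsub>ring_on R\<^esub> a = {x * a | x. x \<in> R}"
 by (simp add: cgenideal_def)

lemma ring_on_cring_closed:
 assumes "cring (ring_on R)"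
 shows "0 \<in> R" "1 \<in> R" "x \<in> R ==> y \<in> R ==> x + y \<in> R" "x \<in> R ==> y \<in> R ==> x * y \<in> R"
  "x \<in> R ==> - x \<in> R"
proof -
 interpret cring "ring_on R" by fact
 show "0 \<in> R" "1 \<in> R" using zero_closed one_closed by simp_all
 show "x \<in> R ==> y \<in> R ==> x + y \<in> R" "x \<in> R ==> y \<in> R ==> x * y \<in> R"
  using a_closed[of x y] m_closed[of x y] by simp_all
 show "- x \<in> R" if "x \<in> R"
 proof -
  have "(\<ominus>\<^bsub>ring_on R\<^esub> x) + x = 0" using l_neg[of x] that by simp
  then have "\<ominus>\<^bsub>ring_on R\<^esub> x = - x" by (simp add: eq_neg_iff_add_eq_0)
  then show ?thesis using a_inv_closed[of x] that by simp
 qed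
qed

locale dvr_in_field =
 fixes R :: "'l::field set" and \<pi> :: 'l
 assumes R: "dvr R" and unif: "uniformizer R \<pi>"
begin

lemma principal: "principal_domain (ring_on R)"
 using R by (simp add: dvr_def)

lemma cring_R: "cring (ring_on R)"
 using principal by (simp add: principal_domain_def domain_def)

lemmas closed [simp, intro] = ring_on_cring_closed[OF cring_R]

lemma diff_closed [simp, intro]: "x \<in> R ==> y \<in> R ==> x - y \<in> R"
 using closed(3)[of x "- y"] closed(5)[of y] by simp

lemma power_closed [simp, intro]: "x \<in> R ==> x ^ n \<in> R"
 by (induction n) auto

lemma pi_in [simp, intro]: "\<pi> \<in> R"
 using unif by (simp add: uniformizer_def)

lemma maximal: "maximalideal {x * \<pi> | x. x \<in> R} (ring_on R)"
 using unif by (simp add: uniformizer_def cgenideal_ring_on)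

lemma pi_nonzero: "\<pi> ~= 0"
proof
 interpret cring "ring_on R" by (rule cring_R)
 assume "\<pi> = 0"
 moreover have "{x * 0 | x. x \<in> R} = {0}" using closed(1) by auto
 ultimately have "Ring.field (ring_on R)" using maximal zeromaximalideal_eq_field by simp
 then show False using R by (simp add: dvr_def)
qed

lemma pi_not_unit: "inverse \<pi> \<notin> R"
proof
 assume h: "inverse \<pi> \<in> R"
 have "x \<in> {x * \<pi> | x. x \<in> R}" if "x \<in> R" for x
 proof -
  have "x = (x * inverse \<pi>) * \<pi>" using pi_nonzero by simp
  then show ?thesis using that h by blast
 qed
 moreover have "{x * \<pi> | x. x \<in> R} \<subseteq> R" by auto
 ultimately have "{x * \<pi> | x. x \<in> R} = R" by blast
 then show False using maximalideal.I_notcarr[OF maximal] by simp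
qed

text \<open>A non-unit has an irreducible divisor, which generates a maximal ideal of a principal
  domain. There is only one maximal ideal, so this divisor is a multiple of \<pi>.\<close>

lemma unit_or_divisible: "(x ~= 0 & inverse x \<in> R) \<or> (\<exists>y\<in>R. x = \<pi> * y)" if "x \<in> R"
proof -
 interpret principal_domain "ring_on R" by (rule principal)
 consider "x = 0" | "x \<in> Units (ring_on R)" | "x ~= 0" "x \<notin> Units (ring_on R)" by blast
 then show ?thesis
 proof cases
  case 1
  then show ?thesis using closed(1) by force
 next
  case 2
  then obtain y where "y \<in> R" "y * x = 1" by (auto simp: Units_def)
  then have "inverse x = y" "x ~= 0" using inverse_unique[of x y] by (auto simp: mult.commute)
  then show ?thesis using \<open>y \<in> R\<close> by simp
 next
  case 3
  then have "x \<in> carrier (ring_on R) - {\<zero>\<^bsub>ring_on R\<^esub>}" using that by simp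
  from exists_irreducible_divisor[OF this 3(2)] obtain q
   where q: "q \<in> R" "ring_irreducible\<^bsub>ring_on R\<^esub> q" "q divides\<^bsub>ring_on R\<^esub> x"
   by (metis ring_on_simps(1))
  from irreducible_imp_maximalideal[of q] q
  have "maximalideal (PIdl\<^bsub>ring_on R\<^esub> q) (ring_on R)" by simp
  then have "PIdl\<^bsub>ring_on R\<^esub> q = PIdl\<^bsub>ring_on R\<^esub> \<pi>"
   using R unif unfolding dvr_def uniformizer_def by blast
  then have "q \<in> {x * \<pi> | x. x \<in> R}"
   using q(1) closed(2) unfolding cgenideal_ring_on by force
  then show ?thesis using q(3) by (auto simp: factor_def mult_ac)
 qed
qed

text \<open>Krull's intersection theorem by hand: the elements divisible by all powers of \<pi> form
  an ideal with a generator \<open>a = \<pi> * a'\<close>, where \<open>a'\<close> lies in the ideal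
  again, say \<open>a' = c * a\<close>. Then \<open>a' * (1 - c * \<pi>) = 0\<close>, and the second
  factor is nonzero because \<pi> is not a unit.\<close>

lemma no_infinite_divisibility:
 assumes "!!n::nat. \<exists>y\<in>R. x = \<pi> ^ n * y"
 shows "x = 0"
proof -
 interpret principal_domain "ring_on R" by (rule principal)
 define I where "I = {x. \<forall>n::nat. \<exists>y\<in>R. x = \<pi> ^ n * y}"
 have IR: "I \<subseteq> R" unfolding I_def by (auto dest: spec[of _ 0])
 have "ideal I (ring_on R)"
 proof (rule idealI)
  show "ring (ring_on R)" by (rule ring_axioms)
  show "subgroup I (add_monoid (ring_on R))"
  proof (rule group.subgroupI)
   show "Group.group (add_monoid (ring_on R))" by (rule a_group)
   show "I \<subseteq> carrier (add_monoid (ring_on R))" using IR by simp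
   have "0 \<in> I" unfolding I_def using closed(1) by force
   then show "I ~= {}" by blast
   fix a assume a: "a \<in> I"
   then have aR: "a \<in> R" using IR by auto
   have "inv\<^bsub>add_monoid (ring_on R)\<^esub> a = - a"
    using minus_equality[of "- a" a] aR by (simp add: a_inv_def)
   moreover have "- a \<in> I" unfolding I_def
   proof (intro CollectI allI)
    fix n :: nat
    obtain y where "y \<in> R" "a = \<pi> ^ n * y" using a unfolding I_def by blast
    then show "\<exists>y\<in>R. - a = \<pi> ^ n * y" by (intro bexI[of _ "- y"]) auto
   qed
   ultimately show "inv\<^bsub>add_monoid (ring_on R)\<^esub> a \<in> I" by simp
   fix c assume c: "c \<in> I"
   have "a + c \<in> I" unfolding I_def
   proof (intro CollectI allI)
    fix n :: nat
    obtain y z where "y \<in> R" "a = \<pi> ^ n * y" "z \<in> R" "c = \<pi> ^ n * z"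
     using a c unfolding I_def by blast
    then show "\<exists>y\<in>R. a + c = \<pi> ^ n * y" by (intro bexI[of _ "y + z"]) (auto simp: algebra_simps)
   qed
   then show "a \<otimes>\<^bsub>add_monoid (ring_on R)\<^esub> c \<in> I" by simp
  qed
  fix a x assume a: "a \<in> I" and x: "x \<in> carrier (ring_on R)"
  have "x * a \<in> I" unfolding I_def
  proof (intro CollectI allI)
   fix n :: nat
   obtain y where "y \<in> R" "a = \<pi> ^ n * y" using a unfolding I_def by blast
   then show "\<exists>y\<in>R. x * a = \<pi> ^ n * y" using x by (intro bexI[of _ "x * y"]) auto
  qed
  then show "x \<otimes>\<^bsub>ring_on R\<^esub> a \<in> I" "a \<otimes>\<^bsub>ring_on R\<^esub> x \<in> I" by (simp_all add: mult.commute)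
 qed
 then obtain a where a: "a \<in> R" "I = {x * a | x. x \<in> R}"
  using exists_gen[of I] by (auto simp: cgenideal_ring_on)
 have "a \<in> I" unfolding a(2) using a(1) closed(2) by force
 then obtain a' where a': "a' \<in> R" "a = \<pi> * a'" unfolding I_def by (auto dest: spec[of _ 1])
 have "a' \<in> I" unfolding I_def
 proof (intro CollectI allI)
  fix n :: nat
  obtain y where "y \<in> R" "a = \<pi> ^ Suc n * y" using \<open>a \<in> I\<close> unfolding I_def by blast
  then show "\<exists>y\<in>R. a' = \<pi> ^ n * y" using a' pi_nonzero by auto
 qed
 then obtain c where "c \<in> R" "a' = c * a" using a by blast
 then have "a' * (1 - c * \<pi>) = 0" using a' by (simp add: algebra_simps)
 moreover have "1 - c * \<pi> ~= 0"
 proof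
  assume "1 - c * \<pi> = 0"
  then have "inverse \<pi> = c" using inverse_unique[of \<pi> c] by (simp add: mult.commute)
  then show False using pi_not_unit \<open>c \<in> R\<close> by simp
 qed
 ultimately have "a = 0" using a' by simp
 moreover have "x \<in> I" using assms unfolding I_def by blast
 ultimately show "x = 0" using a by auto
qed

lemma factorization: "\<exists>n u. u \<in> R & inverse u \<in> R & x = \<pi> ^ n * u" if "x \<in> R" "x ~= 0"
proof (rule ccontr)
 assume no: "\<not> ?thesis"
 have "\<exists>y\<in>R. x = \<pi> ^ n * y" for n
 proof (induction n)
  case (Suc n)
  then obtain y where y: "y \<in> R" "x = \<pi> ^ n * y" by blast
  then obtain z where "z \<in> R" "y = \<pi> * z" using unit_or_divisible[of y] no by blast
  then show ?case using y by auto
 qed (use that in auto)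
 then show False using no_infinite_divisibility that by blast
qed

end

section \<open>The valuation of \<open>T\<close>, extended to all of L with values in the
  integers\<close>

locale subring_of_field =
 fixes T :: "'l::field set"
 assumes zero_T [simp, intro]: "0 \<in> T" and one_T [simp, intro]: "1 \<in> T"
  and add_T [simp, intro]: "x \<in> T ==> y \<in> T ==> x + y \<in> T"
  and mult_T [simp, intro]: "x \<in> T ==> y \<in> T ==> x * y \<in> T"
  and uminus_T [simp, intro]: "x \<in> T ==> - x \<in> T"
begin

lemma diff_T [simp, intro]: "x \<in> T ==> y \<in> T ==> x - y \<in> T"
 using add_T[of x "- y"] uminus_T[of y] by simp

lemma power_T [simp, intro]: "x \<in> T ==> x ^ n \<in> T"
 by (induction n) auto

lemma sum_T: "(!!i. i \<in> I ==> f i \<in> T) ==> sum f I \<in> T"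
 by (induction I rule: infinite_finite_induct) auto

lemma of_nat_T [simp, intro]: "of_nat n \<in> T"
 by (induction n) auto

lemma of_int_T [simp, intro]: "of_int n \<in> T"
 by (cases n) auto

end

locale valuation_frame = subring_of_field T for T :: "'l::field set" +
 fixes t :: 'l
 assumes t_T [simp, intro]: "t \<in> T" and t_nonzero [simp]: "t ~= 0" and t_not_unit: "inverse t \<notin> T"
  and fact_T: "x \<in> T ==> x ~= 0 ==> \<exists>n u. u \<in> T & inverse u \<in> T & x = t ^ n * u"
  and frac_T: "\<exists>y\<in>T. \<exists>z\<in>T. z ~= 0 & x = y / z"
begin

definition tunit :: "'l => bool" where "tunit u \<longleftrightarrow> u \<in> T & inverse u \<in> T & u ~= 0"

definition \<nu> :: "'l => int" where "\<nu> x = (THE n. tunit (x * t powi (- n)))"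

text \<open>The fractional ideal t^n T, for any integer n. Zero is a separate alternative because
  \<open>\<nu> 0\<close> is an unspecified integer; estimates for elements that may vanish are
  therefore stated with \<open>F\<close>.\<close>

definition F :: "int => 'l set" where "F n = {x. x = 0 \<or> \<nu> x \<ge> n}"

lemma tunit_mult: "tunit u ==> tunit v ==> tunit (u * v)"
 by (auto simp: tunit_def)

lemma tunit_inverse: "tunit u ==> tunit (inverse u)"
 by (auto simp: tunit_def)

lemma tunit_powi_iff: "tunit (t powi n) \<longleftrightarrow> n = 0"
proof -
 have pos: "\<not> tunit (t powi int n)" if "n > 0" for n
 proof
  assume "tunit (t powi int n)"
  then have "inverse (t ^ n) \<in> T" by (auto simp: tunit_def)
  then have "t ^ (n - 1) * inverse (t ^ n) \<in> T" by auto
  moreover have "t ^ (n - 1) * inverse (t ^ n) = inverse t"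
   using that by (cases n) (auto simp: field_simps)
  ultimately show False using t_not_unit by simp
 qed
 show ?thesis
 proof (cases n rule: linorder_cases[of _ 0])
  case less
  then show ?thesis using pos[of "nat (- n)"] tunit_inverse[of "t powi n"]
   by (auto simp: power_int_minus)
 next
  case greater
  then show ?thesis using pos[of "nat n"] by auto
 qed (auto simp: tunit_def)
qed

lemma decompose: assumes "x ~= 0" shows "\<exists>n u. tunit u & x = t powi n * u"
proof -
 obtain y z where yz: "y \<in> T" "z \<in> T" "z ~= 0" "x = y / z" using frac_T by blast
 then have "y ~= 0" using assms by auto
 obtain m u n v where "u \<in> T" "inverse u \<in> T" "y = t ^ m * u" "v \<in> T" "inverse v \<in> T" "z = t ^ n * v"
  using fact_T yz \<open>y ~= 0\<close> by meson
 then have "tunit u" "tunit v" "x = t powi (int m - int n) * (u * inverse v)"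
  using yz \<open>y ~= 0\<close> by (auto simp: tunit_def power_int_diff field_simps)
 then show ?thesis using tunit_mult tunit_inverse by blast
qed

lemma nu_unique: "tunit u ==> \<nu> (t powi n * u) = n"
 unfolding \<nu>_def
proof (rule the_equality)
 assume u: "tunit u"
 have "t powi n * u * t powi - n = u" by (simp add: power_int_minus field_simps)
 then show "tunit (t powi n * u * t powi - n)" using u by (simp only:)
 fix m assume "tunit (t powi n * u * t powi - m)"
 then have "tunit ((t powi n * u * t powi - m) * inverse u)" using u tunit_mult tunit_inverse by blast
 moreover have "(t powi n * u * t powi - m) * inverse u = t powi (n - m)"
  using u by (auto simp: tunit_def power_int_diff power_int_minus field_simps)
 ultimately show "m = n" using tunit_powi_iff by simp
qed

lemma nu_decompose: assumes "x ~= 0" obtains u where "tunit u" "x = t powi \<nu> x * u"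
 using decompose[OF assms] nu_unique by metis

lemma nu_mult: assumes "x ~= 0" "y ~= 0" shows "\<nu> (x * y) = \<nu> x + \<nu> y"
proof -
 obtain u v where "tunit u" "x = t powi \<nu> x * u" "tunit v" "y = t powi \<nu> y * v"
  using nu_decompose assms by metis
 then have "x * y = t powi (\<nu> x + \<nu> y) * (u * v)" "tunit (u * v)"
  by (auto simp: power_int_add tunit_mult) (metis mult.assoc mult.left_commute)
 then show ?thesis using nu_unique by metis
qed

lemma nu_one [simp]: "\<nu> 1 = 0"
 using nu_unique[of 1 0] by (simp add: tunit_def)

lemma nu_t [simp]: "\<nu> t = 1"
 using nu_unique[of 1 1] by (simp add: tunit_def)

lemma nu_powi [simp]: "\<nu> (t powi n) = n"
 using nu_unique[of 1 n] by (simp add: tunit_def)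

lemma nu_tpow [simp]: "\<nu> (t ^ n) = int n"
 using nu_powi[of "int n"] by simp

lemma nu_tunit: "tunit u ==> \<nu> u = 0"
 using nu_unique[of u 0] by simp

lemma nu_uminus [simp]: "\<nu> (- x) = \<nu> x"
proof (cases "x = 0")
 case False
 have "\<nu> (-1) = 0" by (rule nu_tunit) (auto simp: tunit_def)
 then show ?thesis using nu_mult[of "-1" x] False by simp
qed simp

lemma nu_inverse: "x ~= 0 ==> \<nu> (inverse x) = - \<nu> x"
 using nu_mult[of x "inverse x"] by simp

lemma nu_divide: "x ~= 0 ==> y ~= 0 ==> \<nu> (x / y) = \<nu> x - \<nu> y"
 using nu_mult[of x "inverse y"] nu_inverse[of y] by (simp add: divide_inverse)

lemma nu_power: "x ~= 0 ==> \<nu> (x ^ n) = int n * \<nu> x"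
 by (induction n) (auto simp: nu_mult algebra_simps)

lemma nu_power_int: "x ~= 0 ==> \<nu> (x powi n) = n * \<nu> x"
 by (cases n) (auto simp: power_int_def nu_power nu_inverse algebra_simps simp del: power_Suc)

lemma nu_prod: "finite I ==> (!!i. i \<in> I ==> f i ~= 0) ==> \<nu> (prod f I) = (\<Sum>i\<in>I. \<nu> (f i))"
 by (induction I rule: finite_induct) (auto simp: nu_mult)

lemma mem_T_iff: "x \<in> T \<longleftrightarrow> x = 0 \<or> \<nu> x \<ge> 0"
proof (cases "x = 0")
 case False
 show ?thesis
 proof
  assume "x \<in> T"
  then obtain n u where "u \<in> T" "inverse u \<in> T" "x = t ^ n * u" using fact_T False by blast
  then have "x = t powi int n * u" "tunit u" using False by (auto simp: tunit_def)
  then show "x = 0 \<or> \<nu> x \<ge> 0" using nu_unique[of u "int n"] by simp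
 next
  assume "x = 0 \<or> \<nu> x \<ge> 0"
  then have n: "\<nu> x \<ge> 0" using False by simp
  obtain u where "tunit u" "x = t powi \<nu> x * u" using False nu_decompose by metis
  moreover have "t powi \<nu> x = t ^ nat (\<nu> x)" using n by (simp add: power_int_def)
  ultimately show "x \<in> T" by (metis mult_T power_T t_T tunit_def)
 qed
qed simp

lemma tunit_iff: "tunit x \<longleftrightarrow> x ~= 0 & \<nu> x = 0"
proof
 assume "x ~= 0 & \<nu> x = 0"
 then show "tunit x" using mem_T_iff[of x] mem_T_iff[of "inverse x"] by (simp add: tunit_def nu_inverse)
qed (use nu_tunit in \<open>auto simp: tunit_def\<close>)

lemma F_iff: "x \<in> F n \<longleftrightarrow> x * t powi (- n) \<in> T"
 by (cases "x = 0") (auto simp: F_def mem_T_iff nu_mult)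

lemma F_0: "F 0 = T"
 using F_iff[of _ 0] by auto

lemma F_zero [simp, intro]: "0 \<in> F n"
 by (simp add: F_def)

lemma F_nu: "x \<in> F (\<nu> x)"
 by (simp add: F_def)

lemma F_add [intro]: "x \<in> F n ==> y \<in> F n ==> x + y \<in> F n"
 by (simp add: F_iff algebra_simps add_T)

lemma F_uminus [intro]: "x \<in> F n ==> - x \<in> F n"
 by (simp add: F_def)

lemma F_diff [intro]: "x \<in> F n ==> y \<in> F n ==> x - y \<in> F n"
 using F_add[of x n "- y"] F_uminus[of y n] by simp

lemma F_sum: "(!!i. i \<in> I ==> f i \<in> F n) ==> sum f I \<in> F n"
 by (induction I rule: infinite_finite_induct) auto

lemma F_mult: "x \<in> F m ==> y \<in> F n ==> x * y \<in> F (m + n)"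
 by (cases "x = 0 \<or> y = 0") (auto simp: F_def nu_mult)

lemma F_mult_T: "x \<in> T ==> y \<in> F n ==> x * y \<in> F n"
 using F_mult[of x 0 y n] by (simp add: F_0)

lemma F_mono: "x \<in> F m ==> n \<le> m ==> x \<in> F n"
 by (auto simp: F_def)

lemma F_T: "x \<in> F n ==> 0 \<le> n ==> x \<in> T"
 by (auto simp: F_def mem_T_iff)

text \<open>By the ultrametric inequality a perturbation of higher valuation changes nothing.
  Leading-term computations are concluded with this.\<close>

lemma nu_eqI: assumes "y ~= 0" "\<nu> y = n" "x - y \<in> F (n + 1)" shows "x ~= 0" "\<nu> x = n"
proof -
 have y: "y \<in> F n" "y \<notin> F (n + 1)" using assms by (auto simp: F_def)
 have "x \<in> F n" using F_add[OF F_mono[OF assms(3)] y(1)] by simp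
 moreover have "x \<notin> F (n + 1)" using F_diff[OF _ assms(3), of x] y by auto
 ultimately show "x ~= 0" "\<nu> x = n" by (auto simp: F_def)
qed

text \<open>Summands of distinct valuations cannot cancel: otherwise the summand of least valuation
  m < n is the total minus the other summands, all of which lie in \<open>F (m + 1)\<close>.\<close>

lemma sum_distinct_nu:
 assumes "finite I" and "!!i j. i \<in> I ==> j \<in> I ==> i ~= j ==> f i ~= 0 ==> f j ~= 0 ==> \<nu> (f i) ~= \<nu> (f j)"
  and "sum f I \<in> F n" and "i \<in> I"
 shows "f i \<in> F n"
proof (rule ccontr)
 assume "f i \<notin> F n"
 define J where "J = {i \<in> I. f i ~= 0}"
 have J: "finite J" "i \<in> J" using assms(1,4) \<open>f i \<notin> F n\<close> by (auto simp: J_def)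
 define m where "m = Min ((%i. \<nu> (f i)) ` J)"
 have "m \<in> (%i. \<nu> (f i)) ` J" unfolding m_def using J by (intro Min_in) auto
 then obtain k where k: "k \<in> J" "\<nu> (f k) = m" by auto
 have min: "m \<le> \<nu> (f j)" if "j \<in> J" for j unfolding m_def using J that by auto
 have "m < n" using min[OF J(2)] \<open>f i \<notin> F n\<close> by (auto simp: F_def)
 have "f j \<in> F (m + 1)" if "j \<in> I - {k}" for j
 proof (cases "f j = 0")
  case False
  then have "\<nu> (f j) ~= m" using assms(2)[of j k] that k by (auto simp: J_def)
  then show ?thesis using min[of j] that False by (auto simp: F_def J_def)
 qed simp
 then have "sum f (I - {k}) \<in> F (m + 1)" by (intro F_sum)
 moreover have "sum f I \<in> F (m + 1)" using F_mono[OF assms(3)] \<open>m < n\<close> by simp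
 moreover have "f k = sum f I - sum f (I - {k})"
  using assms(1) k by (simp add: sum.remove[of I k] J_def)
 ultimately have "f k \<in> F (m + 1)" by auto
 then show False using k by (auto simp: F_def J_def)
qed

end

section \<open>Cyclic groups of automorphisms\<close>

locale cyclic_action = subring_of_field T for T :: "'l::field set" +
 fixes S :: "'l set" and \<sigma> :: "'l => 'l" and p :: nat and G :: "('l => 'l) set"
 assumes sigma_add: "\<sigma> (x + y) = \<sigma> x + \<sigma> y" and sigma_mult: "\<sigma> (x * y) = \<sigma> x * \<sigma> y"
  and sigma_one: "\<sigma> 1 = 1" and sigma_T: "x \<in> T ==> \<sigma> x \<in> T"
  and G_eq: "G = range (\<lambda>k::nat. \<sigma> ^^ k)" and card_G: "card G = p" and p_ge_2: "2 \<le> p"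
  and S_eq: "S = {x \<in> T. \<sigma> x = x}"
begin

definition \<delta> :: "'l => 'l" where "\<delta> x = \<sigma> x - x"

definition Tr :: "'l => 'l" where "Tr x = (\<Sum>\<rho>\<in>G. \<rho> x)"

lemma G_induct [consumes 1, case_names id sigma]:
 assumes "\<rho> \<in> G" "P id" "!!\<rho>. \<rho> \<in> G ==> P \<rho> ==> P (\<sigma> \<circ> \<rho>)"
 shows "P \<rho>"
proof -
 obtain k where "\<rho> = \<sigma> ^^ k" using assms(1) G_eq by auto
 moreover have "\<sigma> ^^ k \<in> G & P (\<sigma> ^^ k)"
 proof (induction k)
  case 0
  have "\<sigma> ^^ 0 \<in> G" unfolding G_eq by (rule rangeI)
  then show ?case using assms(2) by (simp add: id_def)
 next
  case (Suc k)
  have "\<sigma> ^^ Suc k \<in> G" unfolding G_eq by (rule rangeI)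
  then show ?case using assms(3)[of "\<sigma> ^^ k"] Suc unfolding funpow.simps by blast
 qed
 ultimately show ?thesis by simp
qed

lemma id_G [simp, intro]: "id \<in> G"
 unfolding G_eq by (rule range_eqI[of _ _ 0]) auto

lemma sigma_G [simp, intro]: "\<sigma> \<in> G"
 unfolding G_eq by (rule range_eqI[of _ _ 1]) auto

lemma G_comp [simp, intro]: "\<rho> \<in> G ==> \<tau> \<in> G ==> \<rho> \<circ> \<tau> \<in> G"
 by (auto simp: G_eq funpow_add[symmetric])

lemma G_commute: "\<rho> \<in> G ==> \<tau> \<in> G ==> \<rho> \<circ> \<tau> = \<tau> \<circ> \<rho>"
 by (auto simp: G_eq funpow_add[symmetric] add.commute)

lemma G_commute': "\<rho> \<in> G ==> \<tau> \<in> G ==> \<rho> (\<tau> x) = \<tau> (\<rho> x)"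
 using G_commute[of \<rho> \<tau>] by (metis comp_apply)

lemma G_add: "\<rho> \<in> G ==> \<rho> (x + y) = \<rho> x + \<rho> y"
 by (induction arbitrary: x y rule: G_induct) (auto simp: sigma_add)

lemma G_mult: "\<rho> \<in> G ==> \<rho> (x * y) = \<rho> x * \<rho> y"
 by (induction arbitrary: x y rule: G_induct) (auto simp: sigma_mult)

lemma G_one [simp]: "\<rho> \<in> G ==> \<rho> 1 = 1"
 by (induction rule: G_induct) (auto simp: sigma_one)

lemma G_zero [simp]: "\<rho> \<in> G ==> \<rho> 0 = 0"
 using G_add[of \<rho> 0 0] by (metis add_cancel_right_right add_0)

lemma G_uminus: "\<rho> \<in> G ==> \<rho> (- x) = - \<rho> x"
 using G_add[of \<rho> x "- x"] by (simp add: eq_neg_iff_add_eq_0 add.commute)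

lemma G_diff: "\<rho> \<in> G ==> \<rho> (x - y) = \<rho> x - \<rho> y"
 using G_add[of \<rho> x "- y"] by (simp add: G_uminus)

lemma G_sum: "\<rho> \<in> G ==> \<rho> (sum f I) = (\<Sum>i\<in>I. \<rho> (f i))"
 by (induction I rule: infinite_finite_induct) (auto simp: G_add)

lemma G_prod: "\<rho> \<in> G ==> \<rho> (prod f I) = (\<Prod>i\<in>I. \<rho> (f i))"
 by (induction I rule: infinite_finite_induct) (auto simp: G_mult)

lemma G_power: "\<rho> \<in> G ==> \<rho> (x ^ n) = \<rho> x ^ n"
 by (induction n) (auto simp: G_mult)

lemma G_inverse: "\<rho> \<in> G ==> \<rho> (inverse x) = inverse (\<rho> x)"
 using G_mult[of \<rho> x "inverse x"] by (cases "x = 0") (auto intro: inverse_unique[symmetric])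

lemma G_divide: "\<rho> \<in> G ==> \<rho> (x / y) = \<rho> x / \<rho> y"
 by (simp add: divide_inverse G_mult G_inverse)

lemma G_eq_0_iff [simp]: "\<rho> \<in> G ==> \<rho> x = 0 \<longleftrightarrow> x = 0"
 using G_mult[of \<rho> x "inverse x"] by (cases "x = 0") auto

lemma G_inj: "\<rho> \<in> G ==> inj \<rho>"
 by (rule injI) (metis G_diff G_eq_0_iff right_minus_eq)

lemma G_T [simp, intro]: "\<rho> \<in> G ==> x \<in> T ==> \<rho> x \<in> T"
 by (induction rule: G_induct) (auto simp: sigma_T)

lemma G_fixed: "\<rho> \<in> G ==> \<sigma> x = x ==> \<rho> x = x"
 by (induction rule: G_induct) auto

lemma finite_G [simp, intro]: "finite G"
 using card_G p_ge_2 by (intro card_ge_0_finite) simp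

text \<open>Powers repeat because \<open>G\<close> is finite, and injectivity allows cancellation,
  so some power of \<sigma> is the identity. With n the least such exponent, the powers below n
  enumerate \<open>G\<close>, and counting gives n = p.\<close>

lemma sigma_order: "\<sigma> ^^ p = id" and G_bij: "bij_betw (%k. \<sigma> ^^ k) {..<p} G"
proof -
 have "\<not> inj (\<lambda>k::nat. \<sigma> ^^ k)"
  using finite_G finite_imageD[of "\<lambda>k::nat. \<sigma> ^^ k" UNIV] by (auto simp: G_eq)
 then obtain i j :: nat where ij: "i < j" "\<sigma> ^^ i = \<sigma> ^^ j"
  unfolding inj_def by (metis nat_neq_iff)
 have cancel: "\<sigma> ^^ (j - i) = id" if "i \<le> j" "\<sigma> ^^ i = \<sigma> ^^ j" for i j
 proof
  fix x
  have "(\<sigma> ^^ i) ((\<sigma> ^^ (j - i)) x) = (\<sigma> ^^ i) x"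
   using that by (metis comp_apply funpow_add le_add_diff_inverse)
  then show "(\<sigma> ^^ (j - i)) x = id x"
   using G_inj[of "\<sigma> ^^ i"] by (auto simp: G_eq inj_def)
 qed
 define n where "n = (LEAST n. 0 < n & \<sigma> ^^ n = id)"
 have n: "0 < n & \<sigma> ^^ n = id"
  unfolding n_def by (rule LeastI[of _ "j - i"]) (use cancel ij in auto)
 have least: "\<sigma> ^^ m ~= id" if "0 < m" "m < n" for m
  using not_less_Least[of m] that unfolding n_def by auto
 have inj: "inj_on (%k. \<sigma> ^^ k) {..<n}"
 proof (rule linorder_inj_onI)
  fix a c assume "a < c" "a \<in> {..<n}" "c \<in> {..<n}"
  then show "\<sigma> ^^ a ~= \<sigma> ^^ c" using cancel[of a c] least[of "c - a"] by auto
 qed auto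
 have "\<sigma> ^^ k = \<sigma> ^^ (k mod n)" for k
 proof -
  have "\<sigma> ^^ (n * q) = id" for q
   using n by (simp add: funpow_mult[symmetric] flip: id_def)
  then have "\<sigma> ^^ (k mod n + n * (k div n)) = \<sigma> ^^ (k mod n)"
   by (simp only: funpow_add comp_id)
  then show ?thesis by (simp only: mod_mult_div_eq)
 qed
 then have "G = (%k. \<sigma> ^^ k) ` {..<n}" unfolding G_eq using n
  by (auto simp: image_iff) (metis lessThan_iff mod_less_divisor)
 then have bij: "bij_betw (%k. \<sigma> ^^ k) {..<n} G" using inj by (simp add: bij_betw_def)
 then have "n = p" using bij_betw_same_card card_G by fastforce
 then show "\<sigma> ^^ p = id" "bij_betw (%k. \<sigma> ^^ k) {..<p} G" using n bij by auto
qed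

lemma sigma_not_id [simp]: "\<sigma> ~= id" "id ~= \<sigma>"
proof -
 have "inj_on (%k. \<sigma> ^^ k) {..<p}" using G_bij by (simp add: bij_betw_def)
 then have "\<sigma> ^^ 0 ~= \<sigma> ^^ 1" using p_ge_2 by (auto dest: inj_onD[of _ _ 0 1])
 then show "\<sigma> ~= id" "id ~= \<sigma>" by (auto simp: id_def)
qed

lemma sum_G: "(\<Sum>\<rho>\<in>G. f \<rho>) = (\<Sum>k<p. f (\<sigma> ^^ k))"
 using sum.reindex_bij_betw[OF G_bij, of f] by simp

lemma G_inverse_ex: "\<rho> \<in> G ==> \<exists>\<tau>\<in>G. \<tau> \<circ> \<rho> = id & \<rho> \<circ> \<tau> = id"
proof (induction rule: G_induct)
 case id
 show ?case by (rule bexI[of _ id]) simp_all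
next
 case (sigma \<rho>)
 then obtain \<tau> where \<tau>: "\<tau> \<in> G" "\<tau> \<circ> \<rho> = id" "\<rho> \<circ> \<tau> = id" by blast
 define c where "c = \<sigma> ^^ (p - 1)"
 have c: "c \<in> G" "\<sigma> \<circ> c = id" "c \<circ> \<sigma> = id"
  using sigma_order p_ge_2 funpow_Suc_right[of "p - 1" \<sigma>] funpow.simps(2)[of "p - 1" \<sigma>]
  by (auto simp: c_def G_eq)
 have "(\<tau> \<circ> c) \<circ> (\<sigma> \<circ> \<rho>) = \<tau> \<circ> (c \<circ> \<sigma>) \<circ> \<rho>" "(\<sigma> \<circ> \<rho>) \<circ> (\<tau> \<circ> c) = \<sigma> \<circ> (\<rho> \<circ> \<tau>) \<circ> c"
  by (simp_all add: comp_assoc)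
 then have "(\<tau> \<circ> c) \<circ> (\<sigma> \<circ> \<rho>) = id" "(\<sigma> \<circ> \<rho>) \<circ> (\<tau> \<circ> c) = id"
  using c \<tau> by (simp_all only: comp_id)
 then show ?case using G_comp[OF \<tau>(1) c(1)] by blast
qed

text \<open>The inverse function; on \<open>G\<close> it is the group inverse, so that no separate
  group structure is set up.\<close>

abbreviation ginv :: "('l => 'l) => 'l => 'l" where "ginv \<equiv> inv_into UNIV"

lemma inv_G [simp, intro]: "\<rho> \<in> G ==> ginv \<rho> \<in> G"
 and inv_comp [simp]: "\<rho> \<in> G ==> ginv \<rho> \<circ> \<rho> = id" "\<rho> \<in> G ==> \<rho> \<circ> ginv \<rho> = id"
 using G_inverse_ex[of \<rho>] inv_unique_comp by metis+

lemma inv_app [simp]: "\<rho> \<in> G ==> ginv \<rho> (\<rho> x) = x" "\<rho> \<in> G ==> \<rho> (ginv \<rho> x) = x"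
 using inv_comp[of \<rho>] by (metis comp_apply id_apply)+

lemma inv_comp_cancel [simp]:
 "\<rho> \<in> G ==> ginv \<rho> \<circ> (\<rho> \<circ> f) = f" "\<rho> \<in> G ==> \<rho> \<circ> (ginv \<rho> \<circ> f) = f"
 by (simp_all add: comp_assoc[symmetric])

lemma comp_inv_cancel [simp]:
 "\<rho> \<in> G ==> (f \<circ> \<rho>) \<circ> ginv \<rho> = f" "\<rho> \<in> G ==> (f \<circ> ginv \<rho>) \<circ> \<rho> = f"
 by (simp_all add: comp_assoc)

lemma inv_inv [simp]: "\<rho> \<in> G ==> ginv (ginv \<rho>) = \<rho>"
 using inv_unique_comp[of "ginv \<rho>" \<rho>] by simp

lemma inv_distrib: "\<rho> \<in> G ==> \<tau> \<in> G ==> ginv (\<rho> \<circ> \<tau>) = ginv \<rho> \<circ> ginv \<tau>"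
proof -
 assume h: "\<rho> \<in> G" "\<tau> \<in> G"
 have "ginv \<rho> \<circ> ginv \<tau> = ginv \<tau> \<circ> ginv \<rho>" using h by (intro G_commute) simp_all
 then show ?thesis using h
  by (intro inv_unique_comp ext) (simp_all add: G_commute'[of "ginv \<rho>" "ginv \<tau>"])
qed

lemma bij_comp_left: "\<tau> \<in> G ==> bij_betw (%\<rho>. \<tau> \<circ> \<rho>) G G"
 by (rule bij_betw_byWitness[of _ "%\<rho>. ginv \<tau> \<circ> \<rho>"]) auto

lemma bij_comp_right: "\<tau> \<in> G ==> bij_betw (%\<rho>. \<rho> \<circ> \<tau>) G G"
 by (rule bij_betw_byWitness[of _ "%\<rho>. \<rho> \<circ> ginv \<tau>"]) (auto simp del: o_apply)

lemma sum_shift: "\<tau> \<in> G ==> (\<Sum>\<rho>\<in>G. f (\<tau> \<circ> \<rho>)) = (\<Sum>\<rho>\<in>G. f \<rho>)"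
 using sum.reindex_bij_betw[OF bij_comp_left, of \<tau> f] by simp

lemma sum_shift': "\<tau> \<in> G ==> (\<Sum>\<rho>\<in>G. f (\<rho> \<circ> \<tau>)) = (\<Sum>\<rho>\<in>G. f \<rho>)"
 using sum.reindex_bij_betw[OF bij_comp_right, of \<tau> f] by simp

lemma Tr_add: "Tr (x + y) = Tr x + Tr y"
 by (simp add: Tr_def G_add sum.distrib)

lemma Tr_zero [simp]: "Tr 0 = 0"
 by (simp add: Tr_def)

lemma Tr_uminus: "Tr (- x) = - Tr x"
 by (simp add: Tr_def G_uminus sum_negf)

lemma Tr_diff: "Tr (x - y) = Tr x - Tr y"
 by (simp add: Tr_def G_diff sum_subtractf)

lemma Tr_sum: "Tr (sum f I) = (\<Sum>i\<in>I. Tr (f i))"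
 by (induction I rule: infinite_finite_induct) (auto simp: Tr_add)

lemma Tr_fixed_mult: "\<sigma> a = a ==> Tr (a * x) = a * Tr x"
 by (simp add: Tr_def G_mult G_fixed sum_distrib_left)

lemma Tr_G: "\<rho> \<in> G ==> Tr (\<rho> x) = Tr x"
 using sum_shift'[of \<rho> "%\<rho>. \<rho> x"] by (simp add: Tr_def)

lemma Tr_sigma [simp]: "Tr (\<sigma> x) = Tr x"
 by (rule Tr_G) simp

lemma G_Tr: "\<rho> \<in> G ==> \<rho> (Tr x) = Tr x"
 using sum_shift[of \<rho> "%\<rho>. \<rho> x"] by (simp add: Tr_def G_sum)

lemma Tr_T [intro]: "x \<in> T ==> Tr x \<in> T"
 unfolding Tr_def by (auto intro: sum_T)

lemma Tr_S [intro]: "x \<in> T ==> Tr x \<in> S"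
 using G_Tr[of \<sigma>] by (auto simp: S_eq)

lemma Tr_delta [simp]: "Tr (\<delta> x) = 0"
 by (simp add: \<delta>_def Tr_diff)

lemma delta_add: "\<delta> (x + y) = \<delta> x + \<delta> y"
 by (simp add: \<delta>_def sigma_add)

lemma delta_zero [simp]: "\<delta> 0 = 0"
 by (simp add: \<delta>_def)

lemma delta_diff: "\<delta> (x - y) = \<delta> x - \<delta> y"
 by (simp add: \<delta>_def G_diff)

lemma delta_uminus: "\<delta> (- x) = - \<delta> x"
 by (simp add: \<delta>_def G_uminus)

lemma delta_sum: "\<delta> (sum f I) = (\<Sum>i\<in>I. \<delta> (f i))"
 by (induction I rule: infinite_finite_induct) (auto simp: delta_add)

lemma delta_fixed_mult: "\<sigma> a = a ==> \<delta> (a * x) = a * \<delta> x"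
 by (simp add: \<delta>_def sigma_mult right_diff_distrib)

lemma delta_T [intro]: "x \<in> T ==> \<delta> x \<in> T"
 by (simp add: \<delta>_def)

lemma S_T: "x \<in> S ==> x \<in> T" and S_sigma: "x \<in> S ==> \<sigma> x = x"
 by (simp_all add: S_eq)

lemma S_G: "x \<in> S ==> \<rho> \<in> G ==> \<rho> x = x"
 by (simp add: S_eq G_fixed)

lemma S_closed [simp, intro]: "0 \<in> S" "1 \<in> S" "x \<in> S ==> y \<in> S ==> x + y \<in> S"
 "x \<in> S ==> y \<in> S ==> x * y \<in> S" "x \<in> S ==> - x \<in> S" "x \<in> S ==> y \<in> S ==> x - y \<in> S"
 by (auto simp: S_eq sigma_add sigma_mult sigma_one G_uminus G_diff)

lemma S_power [simp, intro]: "x \<in> S ==> x ^ n \<in> S"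
 by (induction n) auto

lemma S_sum: "(!!i. i \<in> I ==> f i \<in> S) ==> sum f I \<in> S"
 by (induction I rule: infinite_finite_induct) auto

end

section \<open>Arithmetic of a wildly ramified extension of degree p\<close>

text \<open>Lagrange interpolation of X^k at the points \<open>Xs\<close> returns X^k, since both
  polynomials have degree below \<open>card Xs\<close>; the formula compares the coefficients in
  degree \<open>card Xs - 1\<close>. With the conjugates of t as points it is Euler's formula for
  Tr(t^k / f'(t)), f the minimal polynomial of t.\<close>

lemma euler_lagrange:
 fixes Xs :: "'a::field set"
 assumes Xs: "finite Xs" and k: "k < card Xs"
 shows "(\<Sum>x\<in>Xs. x ^ k / (\<Prod>y\<in>Xs - {x}. x - y)) = (if k = card Xs - 1 then 1 else 0)"
proof -
 define L where "L x = (\<Prod>y\<in>Xs - {x}. [:- y, 1:])" for x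
 define c where "c x = (\<Prod>y\<in>Xs - {x}. x - y)" for x
 define P where "P = (\<Sum>x\<in>Xs. smult (x ^ k / c x) (L x))"
 have deg: "degree (L x) = card Xs - 1" "coeff (L x) (card Xs - 1) = 1" if "x \<in> Xs" for x
 proof -
  have "degree (L x) = (\<Sum>y\<in>Xs - {x}. degree [:- y, 1:])"
   unfolding L_def by (rule degree_prod_eq_sum_degree) auto
  then show d: "degree (L x) = card Xs - 1" using Xs that by simp
  have "lead_coeff (L x) = 1" unfolding L_def by (simp add: lead_coeff_prod)
  then show "coeff (L x) (card Xs - 1) = 1" by (simp add: d)
 qed
 have L: "poly (L x) y = (if x = y then c x else 0)" if "x \<in> Xs" "y \<in> Xs" for x y
  using that Xs by (auto simp: L_def c_def poly_prod)
 have c: "c x ~= 0" if "x \<in> Xs" for x using Xs by (simp add: c_def)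
 have "P = Polynomial.monom 1 k"
 proof (rule poly_eqI_degree)
  fix y assume y: "y \<in> Xs"
  have "poly P y = (\<Sum>x\<in>Xs. if x = y then y ^ k else 0)"
   unfolding P_def poly_sum poly_smult by (rule sum.cong) (auto simp: L y c)
  then show "poly P y = poly (Polynomial.monom 1 k) y" using Xs y by (simp add: poly_monom)
 next
  have "degree P \<le> card Xs - 1" unfolding P_def
   by (rule degree_sum_le) (use deg Xs in \<open>auto intro: order_trans[OF degree_smult_le]\<close>)
  then show "degree P < card Xs" using k by linarith
  show "degree (Polynomial.monom (1::'a) k) < card Xs" using k
   by (simp add: Polynomial.degree_monom_eq)
 qed
 then have "coeff P (card Xs - 1) = (if k = card Xs - 1 then 1 else 0)" by simp
 moreover have "coeff P (card Xs - 1) = (\<Sum>x\<in>Xs. x ^ k / c x)"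
  unfolding P_def coeff_sum coeff_smult by (rule sum.cong) (simp_all only: deg mult_1_right)
 ultimately show ?thesis by (simp add: c_def)
qed

lemma int_dvd_mod_0: "int p dvd n ==> (n + m) mod int p = m mod int p"
 by (metis add_0 dvd_imp_mod_0 mod_add_left_eq)

text \<open>The arithmetic input, freed of ideals and residue fields. Together
  \<open>fixed_nu\<close> and \<open>adapted_span\<close> express that degree and ramification index
  are both p: valuations of fixed elements are multiples of p, and p vectors of valuations distinct
  modulo p span L over the fixed field.\<close>

locale wild_extension =
 valuation_frame T t + cyclic_action T S \<sigma> p G
 for T S :: "'l::field set" and t :: 'l and \<sigma> :: "'l => 'l" and p :: nat and G :: "('l => 'l) set" +
 fixes b :: nat and s :: 'l
 assumes prime_p: "prime p" and p_ge_3: "3 \<le> p" and b_pos: "1 \<le> b"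
  and delta_t: "\<delta> t ~= 0" "\<nu> (\<delta> t) = int b + 1"
  and p_F1: "of_nat p \<in> F 1"
  and fixed_nu: "\<sigma> a = a ==> a ~= 0 ==> int p dvd \<nu> a"
  and s_norm: "s = (\<Prod>\<rho>\<in>G. \<rho> t)"
  and adapted_span: "finite (I :: nat set) ==> card I = p ==> (!!i. i \<in> I ==> w i ~= 0) ==>
   inj_on (%i. \<nu> (w i) mod int p) I ==> \<exists>a. (\<forall>i\<in>I. \<sigma> (a i) = a i) & x = (\<Sum>i\<in>I. a i * w i)"
begin

definition fixed :: "'l => bool" where "fixed a \<longleftrightarrow> \<sigma> a = a"

lemma fixed_simps [simp, intro]:
 "fixed 0" "fixed 1" "fixed x ==> fixed y ==> fixed (x + y)" "fixed x ==> fixed y ==> fixed (x * y)"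
 "fixed x ==> fixed (- x)" "fixed x ==> fixed y ==> fixed (x - y)" "fixed x ==> fixed (inverse x)"
 "fixed x ==> fixed y ==> fixed (x / y)" "fixed (Tr z)"
 by (simp_all add: fixed_def sigma_add sigma_mult sigma_one G_uminus G_diff G_inverse G_divide G_Tr)

lemma fixed_power [simp, intro]: "fixed x ==> fixed (x ^ n)" "fixed x ==> fixed (x powi k)"
proof -
 have 1: "fixed (x ^ n)" if "fixed x" for x n using that by (induction n) auto
 then show "fixed (x ^ n)" if "fixed x" using that .
 show "fixed (x powi k)" if "fixed x" using 1 that by (auto simp: power_int_def)
qed

lemma fixed_of_nat [simp, intro]: "fixed (of_nat n)" "fixed (of_int k)"
proof -
 show 1: "fixed (of_nat n)" for n by (induction n) auto
 show "fixed (of_int k)" using 1 by (cases k) (auto simp del: of_nat_Suc)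
qed

lemma fixed_S: "x \<in> S \<longleftrightarrow> x \<in> T & fixed x"
 by (simp add: S_eq fixed_def)

lemma fixed_dvd: "fixed a ==> a ~= 0 ==> int p dvd \<nu> a"
 using fixed_nu by (simp add: fixed_def)

text \<open>Bezout gives \<open>c * n = 1 - a * p\<close>, which has valuation zero because p has
  positive valuation. Both factors on the left are integral, so each has valuation zero.\<close>

lemma tunit_of_int: assumes "\<not> int p dvd n" shows "tunit (of_int n)"
proof -
 have "coprime (int p) n" using prime_p assms prime_imp_coprime[of "int p" n] by simp
 then obtain a c where "a * int p + c * n = 1" by (metis bezout_int coprime_iff_gcd_eq_1)
 then have 1: "of_int c * of_int n = 1 - of_int a * (of_nat p :: 'l)"
  by (metis add_diff_cancel_left' of_int_1 of_int_add of_int_mult of_int_of_nat_eq)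
 have "of_int a * of_nat p \<in> F 1" using F_mult_T[of "of_int a", OF _ p_F1] by simp
 then have "- (of_int a * of_nat p) \<in> F 1" by (rule F_uminus)
 then have *: "of_int c * of_int n ~= (0::'l)" "\<nu> (of_int c * of_int n) = 0"
  using nu_eqI[of 1 0 "of_int c * of_int n"] 1 by auto
 then have "\<nu> (of_int c) + \<nu> (of_int n) = 0" using nu_mult by force
 moreover have "\<nu> (of_int c) \<ge> 0" "\<nu> (of_int n) \<ge> 0"
  using * mem_T_iff[of "of_int c"] mem_T_iff[of "of_int n"] by auto
 ultimately show ?thesis using * by (auto simp: tunit_iff)
qed

lemma nu_of_int: "\<not> int p dvd n ==> of_int n ~= (0::'l)" "\<not> int p dvd n ==> \<nu> (of_int n) = 0"
 using tunit_of_int by (auto simp: tunit_iff)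

lemma two: "(2::'l) ~= 0" "\<nu> 2 = 0" "inverse 2 \<in> S" "1 / 2 \<in> S"
proof -
 have "\<not> int p dvd 2" using p_ge_3 by (auto dest: zdvd_imp_le)
 then have *: "tunit 2" using tunit_of_int[of 2] by simp
 then show "(2::'l) ~= 0" "\<nu> 2 = 0" by (auto simp: tunit_iff)
 have "fixed (of_nat 2)" by (rule fixed_of_nat)
 then have "fixed (inverse 2)" by (metis fixed_simps(7) of_nat_numeral)
 then show "inverse 2 \<in> S" using * by (simp add: fixed_S tunit_def)
 then show "1 / 2 \<in> S" by (simp add: inverse_eq_divide)
qed

text \<open>As b >= 1, the difference of \<open>\<sigma> t\<close> and t lies in \<open>F 2\<close>,
  so \<open>\<sigma> t\<close> is a uniformizer again. Units go to units, and x is a power of t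
  times a unit.\<close>

lemma nu_sigma [simp]: "\<nu> (\<sigma> x) = \<nu> x"
proof (cases "x = 0")
 case False
 have "\<delta> t \<in> F (int b + 1)" using F_nu[of "\<delta> t"] delta_t by simp
 then have "\<sigma> t - t \<in> F 2" using b_pos by (auto simp: \<delta>_def intro: F_mono)
 then have st: "\<sigma> t ~= 0" "\<nu> (\<sigma> t) = 1" using nu_eqI[of t 1 "\<sigma> t"] by auto
 obtain u where u: "tunit u" "x = t powi \<nu> x * u" using nu_decompose False by metis
 have "\<sigma> u \<in> T" "inverse (\<sigma> u) \<in> T" "\<sigma> u ~= 0"
  using u(1) sigma_T[of "inverse u"] by (auto simp: tunit_def G_inverse sigma_T)
 then have su: "\<sigma> u ~= 0" "\<nu> (\<sigma> u) = 0" using tunit_iff[of "\<sigma> u"] by (auto simp: tunit_def)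
 have "\<sigma> (t powi n) = \<sigma> t powi n" for n
  by (auto simp: power_int_def G_power G_inverse)
 then have "\<sigma> x = \<sigma> t powi \<nu> x * \<sigma> u" using u(2) by (metis sigma_mult)
 then show ?thesis using st su by (simp add: nu_mult nu_power_int)
qed simp

lemma nu_G [simp]: "\<rho> \<in> G ==> \<nu> (\<rho> x) = \<nu> x"
 by (induction rule: G_induct) auto

lemma F_G: "\<rho> \<in> G ==> x \<in> F n ==> \<rho> x \<in> F n"
 by (auto simp: F_def)

lemma s_props: "s ~= 0" "\<nu> s = int p" "fixed s" "s \<in> S"
proof -
 show 0: "s ~= 0" by (simp add: s_norm)
 have "\<nu> s = (\<Sum>\<rho>\<in>G. \<nu> (\<rho> t))" unfolding s_norm by (rule nu_prod) auto
 then show 1: "\<nu> s = int p" by (simp add: card_G)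
 have "\<sigma> s = (\<Prod>\<rho>\<in>G. (\<sigma> \<circ> \<rho>) t)" by (simp add: s_norm G_prod)
 also have "\<dots> = s" unfolding s_norm
  using prod.reindex_bij_betw[OF bij_comp_left[OF sigma_G], of "%\<rho>. \<rho> t"] by simp
 finally show 2: "fixed s" by (simp add: fixed_def)
 show "s \<in> S" using 0 1 2 mem_T_iff[of s] by (simp add: fixed_S)
qed

lemma nu_s_pow [simp]: "\<nu> (s ^ n) = int p * int n" "\<nu> (s powi k) = int p * k"
 using s_props by (simp_all add: nu_power nu_power_int mult.commute)

text \<open>The quotient \<open>a / s ^ n\<close> is fixed, so it lies in \<open>S\<close> as soon
  as it is integral, and s has valuation p.\<close>

lemma S_dvd_iff: assumes "fixed a" shows "(\<exists>c\<in>S. a = s ^ n * c) \<longleftrightarrow> a \<in> F (int p * int n)"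
proof
 assume "\<exists>c\<in>S. a = s ^ n * c"
 then obtain c where "c \<in> S" "a = s ^ n * c" by blast
 then show "a \<in> F (int p * int n)"
  using F_mult[OF F_nu[of "s ^ n"], of c 0] by (simp add: F_0 S_T)
next
 assume a: "a \<in> F (int p * int n)"
 have "a / s ^ n \<in> S"
  using a assms s_props by (cases "a = 0") (auto simp: fixed_S mem_T_iff F_def nu_divide)
 then show "\<exists>c\<in>S. a = s ^ n * c" using s_props by (intro bexI[of _ "a / s ^ n"]) auto
qed

text \<open>Valuations of fixed elements are multiples of p, so any bound above p(k-1) rounds up to
  pk.\<close>

lemma fixed_F_ceil: assumes "fixed a" "a \<in> F m" "m > int p * (k - 1)" shows "a \<in> F (int p * k)"
proof (cases "a = 0")
 case False
 then obtain q where q: "\<nu> a = int p * q" using fixed_dvd[OF assms(1)] by blast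
 then have "int p * (k - 1) < int p * q" using assms(2,3) False by (auto simp: F_def)
 then have "k \<le> q" using p_ge_3 by simp
 then have "int p * k \<le> int p * q" by (intro mult_left_mono) auto
 then show ?thesis using q by (simp add: F_def)
qed simp

subsection \<open>The operator sigma - 1\<close>

definition c0 :: 'l where "c0 = \<delta> t / t"

lemma c0: "c0 ~= 0" "\<nu> c0 = int b"
 using delta_t by (simp_all add: c0_def nu_divide)

lemma F_of_diff: "x - y \<in> F m ==> y \<in> F n ==> n \<le> m ==> x \<in> F n"
 using F_add[of "x - y" n y] F_mono[of "x - y" m n] by simp

lemma delta_t_c0: "\<delta> t = c0 * t"
 by (simp add: c0_def)

lemma delta_mult: "\<delta> (x * y) = x * \<delta> y + \<delta> x * y + \<delta> x * \<delta> y"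
 by (simp add: \<delta>_def sigma_mult algebra_simps)

lemma delta_fixed: "fixed a ==> \<delta> a = 0"
 by (simp add: fixed_def \<delta>_def)

lemma delta_fixed_mult': "fixed a ==> \<delta> (a * x) = a * \<delta> x"
 by (simp add: delta_fixed_mult fixed_def)

text \<open>To first order \<delta> is a derivation with \<delta> t = c0 t, where c0 has valuation
  b. The twisted Leibniz rule has the extra term \<open>\<delta> t * \<delta> (t ^ n)\<close>, which
  is negligible because b >= 1.\<close>

lemma delta_tpow: "\<delta> (t ^ n) - of_nat n * c0 * t ^ n \<in> F (int n + int b + 1)"
proof (induction n)
 case 0
 then show ?case by (simp add: delta_fixed)
next
 case (Suc n)
 have 1: "\<delta> (t ^ Suc n) - of_nat (Suc n) * c0 * t ^ Suc n =
  t * (\<delta> (t ^ n) - of_nat n * c0 * t ^ n) + \<delta> t * \<delta> (t ^ n)"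
  by (simp add: delta_mult delta_t_c0 algebra_simps)
 have "of_nat n * c0 * t ^ n \<in> F (int n + int b)"
  using F_mult[OF F_mult_T[OF of_nat_T F_nu[of c0], of n] F_nu[of "t ^ n"]] c0 by (simp add: add.commute)
 with Suc have "\<delta> (t ^ n) \<in> F (int n + int b)" by (rule F_of_diff) simp
 from F_mult[OF F_nu[of "\<delta> t"] this] have "\<delta> t * \<delta> (t ^ n) \<in> F (int (Suc n) + int b + 1)"
  using delta_t b_pos by (auto elim!: F_mono)
 moreover have "t * (\<delta> (t ^ n) - of_nat n * c0 * t ^ n) \<in> F (int (Suc n) + int b + 1)"
  using F_mult[OF F_nu[of t] Suc] by (simp add: add_ac)
 ultimately show ?case unfolding 1 by blast
qed

lemma c0_tpow_F: "of_nat n * c0 * t ^ n \<in> F (int n + int b)"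
 using F_mult[OF F_mult_T[OF of_nat_T F_nu[of c0], of n] F_nu[of "t ^ n"]] c0 by (simp add: add.commute)

lemma delta_tpow_F: "\<delta> (t ^ n) \<in> F (int n + int b)"
 using delta_tpow c0_tpow_F by (rule F_of_diff) simp

lemma inj_on_mod_p: "inj_on (%i. int i mod int p) {..<p}"
 by (rule inj_onI) (simp flip: of_nat_mod)

text \<open>\<open>T\<close> is generated over \<open>S\<close> by the powers of \<open>t\<close>, and \<open>\<delta>\<close> vanishes on \<open>S\<close>.\<close>

lemma delta_F_T: assumes "x \<in> T" shows "\<delta> x \<in> F (int b + 1)"
proof -
 obtain a where a: "\<forall>i\<in>{..<p}. \<sigma> (a i) = a i" "x = (\<Sum>i<p. a i * t ^ i)"
  using adapted_span[of "{..<p}" "%i. t ^ i" x] inj_on_mod_p by auto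
 have dv: "int p dvd \<nu> (a i)" if "a i ~= 0" "i < p" for i using a(1) that fixed_nu by auto
 have in0: "a i * t ^ i \<in> F 0" if "i < p" for i
 proof (rule sum_distinct_nu[of "{..<p}" "%i. a i * t ^ i"])
  show "(\<Sum>i<p. a i * t ^ i) \<in> F 0" using a(2) assms F_0 by simp
  fix i j assume ij: "i \<in> {..<p}" "j \<in> {..<p}" "i ~= j" "a i * t ^ i ~= 0" "a j * t ^ j ~= 0"
  show "\<nu> (a i * t ^ i) ~= \<nu> (a j * t ^ j)"
  proof
   assume "\<nu> (a i * t ^ i) = \<nu> (a j * t ^ j)"
   then have "(\<nu> (a i) + int i) mod int p = (\<nu> (a j) + int j) mod int p" using ij by (simp add: nu_mult)
   then show False using ij dv[of i] dv[of j] inj_onD[OF inj_on_mod_p, of i j] by (simp add: int_dvd_mod_0)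
  qed
 qed (use that in auto)
 have "\<delta> (a i * t ^ i) \<in> F (int b + 1)" if i: "i < p" for i
 proof (cases "a i = 0 \<or> i = 0")
  case True
  then show ?thesis using a(1) i by (auto simp: \<delta>_def)
 next
  case False
  then have "\<nu> (a i) + int i \<ge> 0" using in0[OF i] by (auto simp: F_def nu_mult)
  moreover obtain q where q: "\<nu> (a i) = int p * q" using dv[of i] False i by blast
  ultimately have "int p * q > int p * (-1)" using i by linarith
  then have "q > -1" using p_ge_3 mult_less_cancel_left_pos[of "int p" "-1" q] by simp
  then have "q \<ge> 0" by simp
  then have "\<nu> (a i) \<ge> 0" using q by simp
  then have "a i \<in> T" by (simp add: mem_T_iff)
  then show ?thesis using delta_fixed_mult[of "a i" "t ^ i"] a(1) i False
   F_mult_T[of "a i", OF _ F_mono[OF delta_tpow_F[of i], of "int b + 1"]] by auto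
 qed
 then show ?thesis unfolding a(2) delta_sum by (auto intro: F_sum)
qed

text \<open>A power of the fixed element s moves x into \<open>T\<close>, where it becomes t^m times
  a unit; by \<open>delta_F_T\<close> the unit contributes only to higher order.\<close>

lemma delta_leading: "\<delta> x - of_int (\<nu> x) * c0 * x \<in> F (\<nu> x + int b + 1)"
proof (cases "x = 0")
 case False
 define k where "k = nat (- \<nu> x)"
 define y where "y = x * s ^ k"
 have nuy: "\<nu> y = \<nu> x + int p * int k" "y ~= 0" using False s_props by (auto simp: y_def nu_mult)
 have "1 * int k \<le> int p * int k" using p_ge_3 by (intro mult_right_mono) auto
 moreover have "- \<nu> x \<le> int k" by (simp add: k_def)
 ultimately have "\<nu> y \<ge> 0" unfolding nuy by linarith
 define m where "m = nat (\<nu> y)"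
 have m: "\<nu> y = int m" using \<open>\<nu> y \<ge> 0\<close> by (simp add: m_def)
 obtain u where u: "tunit u" "y = t ^ m * u" using nu_decompose[OF nuy(2)] m by auto
 have uT: "u \<in> T" "\<delta> u \<in> F (int b + 1)" using u delta_F_T by (auto simp: tunit_def)
 have "\<delta> y - of_nat m * c0 * y = (\<delta> (t ^ m) - of_nat m * c0 * t ^ m) * u + (t ^ m + \<delta> (t ^ m)) * \<delta> u"
  unfolding u(2) delta_mult by (simp add: algebra_simps)
 moreover have "(\<delta> (t ^ m) - of_nat m * c0 * t ^ m) * u \<in> F (int m + int b + 1)"
  using F_mult_T[OF uT(1) delta_tpow[of m]] by (simp add: mult.commute)
 moreover have "t ^ m + \<delta> (t ^ m) \<in> F (int m)"
  using F_add[OF F_nu[of "t ^ m"], of "\<delta> (t ^ m)"] F_mono[OF delta_tpow_F[of m]] by simp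
 then have "(t ^ m + \<delta> (t ^ m)) * \<delta> u \<in> F (int m + (int b + 1))" using uT(2) by (rule F_mult)
 ultimately have y: "\<delta> y - of_nat m * c0 * y \<in> F (int m + int b + 1)" by (auto simp: add_ac)
 have s: "s ^ k ~= 0" "fixed (s ^ k)" using s_props by auto
 have "\<delta> y = s ^ k * \<delta> x" using delta_fixed_mult'[OF s(2), of x] by (simp add: y_def mult.commute)
 \<comment> \<open>The shift by \<open>s ^ k\<close> has replaced the integer factor
   \<open>\<nu> x\<close> by m. The surplus \<open>p * k\<close> is harmless since p lies in
   \<open>F 1\<close>.\<close>
 moreover have "of_nat m = of_int (\<nu> x) + of_nat p * (of_nat k :: 'l)"
  using m nuy(1) by (metis of_int_add of_int_mult of_int_of_nat_eq)
 ultimately have "\<delta> x - of_int (\<nu> x) * c0 * x =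
   (\<delta> y - of_nat m * c0 * y) * inverse (s ^ k) + of_nat p * (of_nat k * (c0 * x))"
  using s(1) by (simp add: y_def field_simps)
 moreover have "(\<delta> y - of_nat m * c0 * y) * inverse (s ^ k) \<in> F (\<nu> x + int b + 1)"
  using F_mono[OF F_mult[OF y F_nu[of "inverse (s ^ k)"]], of "\<nu> x + int b + 1"] s(1) m nuy(1)
  by (simp add: nu_inverse)
 moreover have "of_nat p * (of_nat k * (c0 * x)) \<in> F (\<nu> x + int b + 1)"
  using F_mult[OF p_F1 F_mult_T[OF of_nat_T F_nu[of "c0 * x"]], of k] c0 False by (simp add: nu_mult add_ac)
 ultimately show ?thesis by auto
qed simp

lemma delta_F: assumes "x \<in> F n" shows "\<delta> x \<in> F (n + int b)"
proof (cases "x = 0")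
 case False
 have "of_int (\<nu> x) * c0 * x \<in> F (\<nu> x + int b)"
  using F_mult[OF F_mult_T[OF of_int_T F_nu[of c0]] F_nu[of x]] c0 by (simp add: add.commute)
 with delta_leading have "\<delta> x \<in> F (\<nu> x + int b)" by (rule F_of_diff) simp
 moreover have "n \<le> \<nu> x" using assms False by (simp add: F_def)
 ultimately show ?thesis using F_mono by simp
qed simp

text \<open>The leading coefficient is the integer \<open>\<nu> x\<close>, which is a unit when p
  does not divide it.\<close>

lemma nu_delta: assumes "\<not> int p dvd \<nu> x" "x ~= 0" shows "\<delta> x ~= 0" "\<nu> (\<delta> x) = \<nu> x + int b"
proof -
 have "of_int (\<nu> x) * c0 * x ~= 0" "\<nu> (of_int (\<nu> x) * c0 * x) = \<nu> x + int b"
  using nu_of_int[OF assms(1)] assms(2) c0 by (auto simp: nu_mult)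
 from nu_eqI[OF this delta_leading] show "\<delta> x ~= 0" "\<nu> (\<delta> x) = \<nu> x + int b" by auto
qed

subsection \<open>The trace\<close>

lemma sigma_pow_t: "(\<sigma> ^^ k) t - t - of_nat k * \<delta> t \<in> F (int b + 2)"
proof (induction k)
 case (Suc k)
 define y where "y = (\<sigma> ^^ k) t - t"
 have "of_nat k * \<delta> t \<in> F (int b + 1)" using F_mult_T[OF of_nat_T F_nu[of "\<delta> t"]] delta_t by simp
 with Suc have "y \<in> F (int b + 1)" unfolding y_def by (rule F_of_diff) simp
 then have "\<delta> y \<in> F (int b + 1 + int b)" by (rule delta_F)
 then have "\<delta> y \<in> F (int b + 2)" by (rule F_mono) (use b_pos in simp)
 moreover have "(\<sigma> ^^ Suc k) t - t - of_nat (Suc k) * \<delta> t = (y - of_nat k * \<delta> t) + \<delta> y"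
  by (simp add: y_def \<delta>_def G_diff algebra_simps)
 moreover have "y - of_nat k * \<delta> t \<in> F (int b + 2)" using Suc by (simp add: y_def)
 ultimately show ?case using F_add by metis
qed simp

text \<open>Up to higher order \<sigma>^k t - t is k times \<delta> t, and k is a unit for 0 < k <
  p: all nontrivial elements of \<open>G\<close> have the same ramification number.\<close>

lemma nu_G_t: assumes "\<rho> \<in> G" "\<rho> ~= id" shows "t - \<rho> t ~= 0" "\<nu> (t - \<rho> t) = int b + 1"
proof -
 obtain k where k: "\<rho> = \<sigma> ^^ k" "k < p" using assms(1) G_bij by (auto simp: bij_betw_def)
 then have "k ~= 0" using assms(2) by (auto simp: id_def)
 then have "\<not> int p dvd int k" using k(2) by (auto dest: dvd_imp_le)
 then have "of_nat k * \<delta> t ~= 0" "\<nu> (of_nat k * \<delta> t) = int b + 1"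
  using nu_of_int[of "int k"] delta_t by (auto simp: nu_mult)
 then have "\<rho> t - t ~= 0" "\<nu> (\<rho> t - t) = int b + 1"
  using nu_eqI[of "of_nat k * \<delta> t" "int b + 1" "\<rho> t - t"] sigma_pow_t[of k] k(1) by (auto simp: add_ac)
 then show "t - \<rho> t ~= 0" "\<nu> (t - \<rho> t) = int b + 1" using nu_uminus[of "\<rho> t - t"] by auto
qed

text \<open>The different: the derivative of the minimal polynomial of \<open>t\<close> at \<open>t\<close>.\<close>

definition Df :: 'l where "Df = (\<Prod>\<tau>\<in>G - {id}. t - \<tau> t)"

lemma Df: "Df ~= 0" "\<nu> Df = (int p - 1) * (int b + 1)"
proof -
 show "Df ~= 0" using nu_G_t by (simp add: Df_def)
 have "\<nu> Df = (\<Sum>\<tau>\<in>G - {id}. \<nu> (t - \<tau> t))" unfolding Df_def by (rule nu_prod) (use nu_G_t in auto)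
 also have "\<dots> = (\<Sum>\<tau>\<in>G - {id}. int b + 1)" by (rule sum.cong) (use nu_G_t in auto)
 finally show "\<nu> Df = (int p - 1) * (int b + 1)" using p_ge_3 by (simp add: card_G of_nat_diff)
qed

text \<open>\<open>euler_lagrange\<close> at the conjugates of t. These are pairwise distinct
  because only the identity fixes t, and \<rho> sends \<open>Df\<close> to the product of the
  differences between \<open>\<rho> t\<close> and the other conjugates.\<close>

lemma Tr_euler: assumes "k < p" shows "Tr (t ^ k / Df) = (if k = p - 1 then 1 else 0)"
proof -
 have inj: "inj_on (%\<rho>. \<rho> t) G"
 proof (rule inj_onI)
  fix \<rho> \<tau> assume h: "\<rho> \<in> G" "\<tau> \<in> G" "\<rho> t = \<tau> t"
  then have "(ginv \<rho> \<circ> \<tau>) t = t" by (metis comp_apply inv_app(1))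
  then have "ginv \<rho> \<circ> \<tau> = id" using nu_G_t(1)[of "ginv \<rho> \<circ> \<tau>"] h by fastforce
  then have "\<rho> \<circ> (ginv \<rho> \<circ> \<tau>) = \<rho>" by simp
  then show "\<rho> = \<tau>" using h by simp
 qed
 define Xs where "Xs = (%\<rho>. \<rho> t) ` G"
 have Xs: "card Xs = p" "finite Xs" using inj by (auto simp: Xs_def card_image card_G)
 have "\<rho> (t ^ k / Df) = (\<rho> t) ^ k / (\<Prod>y\<in>Xs - {\<rho> t}. \<rho> t - y)" if r: "\<rho> \<in> G" for \<rho>
 proof -
  have "\<rho> Df = (\<Prod>\<tau>\<in>G - {id}. \<rho> t - (\<rho> \<circ> \<tau>) t)" using r by (simp add: Df_def G_prod G_diff)
  also have "\<dots> = (\<Prod>\<tau>\<in>G - {\<rho>}. \<rho> t - \<tau> t)"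
  proof (rule prod.reindex_bij_betw[of "%\<tau>. \<rho> \<circ> \<tau>"])
   show "bij_betw ((\<circ>) \<rho>) (G - {id}) (G - {\<rho>})"
    using bij_betw_DiffI[OF bij_comp_left[OF r], of "{id}" "{\<rho>}"] r by (auto simp: bij_betw_def)
  qed
  also have "\<dots> = (\<Prod>y\<in>Xs - {\<rho> t}. \<rho> t - y)"
  proof (rule prod.reindex_bij_betw[of "%\<tau>. \<tau> t"])
   show "bij_betw (%\<tau>. \<tau> t) (G - {\<rho>}) (Xs - {\<rho> t})"
    using inj r by (auto simp: bij_betw_def Xs_def inj_on_def)
  qed
  finally show ?thesis using r by (simp add: G_divide G_power)
 qed
 then have "Tr (t ^ k / Df) = (\<Sum>\<rho>\<in>G. (\<rho> t) ^ k / (\<Prod>y\<in>Xs - {\<rho> t}. \<rho> t - y))"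
  by (simp add: Tr_def)
 also have "\<dots> = (\<Sum>x\<in>Xs. x ^ k / (\<Prod>y\<in>Xs - {x}. x - y))"
  unfolding Xs_def by (subst sum.reindex[OF inj]) simp
 finally show ?thesis using euler_lagrange[of Xs k] Xs assms by simp
qed

text \<open>By Euler's formula the trace of x is the coefficient of t^(p-1) in
  \<open>x * Df\<close>. The summands \<open>a i * t ^ i\<close> have valuations distinct modulo p,
  so a bound for \<open>x * Df\<close> holds for each of them.\<close>

lemma Tr_coeff: "\<exists>a. (\<forall>i<p. fixed (a i)) & x * Df = (\<Sum>i<p. a i * t ^ i) & Tr x = a (p - 1) &
  (\<forall>n. x * Df \<in> F n --> (\<forall>i<p. a i * t ^ i \<in> F n))"
proof -
 obtain a where a: "\<forall>i\<in>{..<p}. \<sigma> (a i) = a i" "x * Df = (\<Sum>i<p. a i * t ^ i)"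
  using adapted_span[of "{..<p}" "%i. t ^ i" "x * Df"] inj_on_mod_p by auto
 have "x = (\<Sum>i<p. a i * (t ^ i / Df))" using a(2) Df(1) by (simp add: sum_divide_distrib[symmetric] field_simps)
 then have "Tr x = (\<Sum>i<p. Tr (a i * (t ^ i / Df)))" by (simp only: Tr_sum)
 also have "\<dots> = (\<Sum>i<p. a i * Tr (t ^ i / Df))"
  by (rule sum.cong[OF refl], rule Tr_fixed_mult) (use a(1) in blast)
 also have "\<dots> = (\<Sum>i<p. if i = p - 1 then a i else 0)" by (rule sum.cong) (auto simp: Tr_euler)
 also have "\<dots> = a (p - 1)" using p_ge_3 by simp
 finally have tr: "Tr x = a (p - 1)" .
 have "a i * t ^ i \<in> F n" if "i < p" "x * Df \<in> F n" for i n
 proof (rule sum_distinct_nu[of "{..<p}" "%i. a i * t ^ i"])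
  fix i j assume ij: "i \<in> {..<p}" "j \<in> {..<p}" "i ~= j" "a i * t ^ i ~= 0" "a j * t ^ j ~= 0"
  show "\<nu> (a i * t ^ i) ~= \<nu> (a j * t ^ j)"
  proof
   assume "\<nu> (a i * t ^ i) = \<nu> (a j * t ^ j)"
   then have "(\<nu> (a i) + int i) mod int p = (\<nu> (a j) + int j) mod int p" using ij by (simp add: nu_mult)
   then show False using ij fixed_nu[of "a i"] fixed_nu[of "a j"] a(1) inj_onD[OF inj_on_mod_p, of i j]
    by (simp add: int_dvd_mod_0)
  qed
 qed (use that a in auto)
 then show ?thesis using a tr by (intro exI[of _ a] conjI) (simp_all add: fixed_def)
qed

text \<open>Multiplication by \<open>Df\<close> gains (p-1)(b+1); reading off the coefficient of
  t^(p-1) loses p-1.\<close>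

lemma Tr_F_strong: assumes "x \<in> F n" shows "Tr x \<in> F (n + (int p - 1) * int b)"
proof -
 obtain a where a: "Tr x = a (p - 1)" "\<forall>n. x * Df \<in> F n --> (\<forall>i<p. a i * t ^ i \<in> F n)"
  using Tr_coeff[of x] by blast
 have "x * Df \<in> F (n + (int p - 1) * (int b + 1))" using F_mult[OF assms F_nu[of Df]] Df by simp
 then have "Tr x * t ^ (p - 1) \<in> F (n + (int p - 1) * (int b + 1))" using a p_ge_3 by auto
 then show ?thesis using p_ge_3
  by (cases "Tr x = 0") (auto simp: F_def nu_mult of_nat_diff algebra_simps)
qed

text \<open>If \<open>\<nu> x\<close> is congruent to b, then \<open>\<nu> (x * Df)\<close> is
  congruent to -1 modulo p. So among the summands \<open>a i * t ^ i\<close> only that with i = p-1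
  can attain this valuation, and its coefficient is the trace.\<close>

lemma nu_Tr: assumes "x ~= 0" "int p dvd \<nu> x - int b"
 shows "Tr x ~= 0" "\<nu> (Tr x) = \<nu> x + (int p - 1) * int b"
proof -
 obtain a where a: "\<forall>i<p. fixed (a i)" "x * Df = (\<Sum>i<p. a i * t ^ i)" "Tr x = a (p - 1)"
  "\<forall>n. x * Df \<in> F n --> (\<forall>i<p. a i * t ^ i \<in> F n)" using Tr_coeff[of x] by blast
 define m where "m = \<nu> (x * Df)"
 have m: "m = \<nu> x + (int p - 1) * (int b + 1)" using assms(1) Df by (simp add: m_def nu_mult)
 have *: "a i * t ^ i \<in> F (m + 1)" if "i < p - 1" for i
 proof -
  have i: "a i * t ^ i \<in> F m" using a(4) F_nu[of "x * Df"] that by (auto simp: m_def)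
  show ?thesis
  proof (cases "a i = 0")
   case False
   have "\<nu> (a i * t ^ i) ~= m"
   proof
    assume "\<nu> (a i * t ^ i) = m"
    then have "\<nu> (a i) + int i = (\<nu> x - int b) + (int p * (int b + 1) - 1)"
     using False m by (simp add: nu_mult algebra_simps)
    then have "int i + 1 = ((\<nu> x - int b) - \<nu> (a i)) + int p * (int b + 1)" by simp
    moreover have "int p dvd (\<nu> x - int b) - \<nu> (a i)" using assms(2) fixed_dvd[of "a i"] a(1) that False by auto
    ultimately have "int p dvd int i + 1" by (simp add: dvd_add)
    then show False using that zdvd_imp_le[of "int p" "int i + 1"] by auto
   qed
   then show ?thesis using i False by (auto simp: F_def)
  qed simp
 qed
 have "{..<p} = insert (p - 1) {..<p - 1}" using p_ge_3 by auto
 then have "a (p - 1) * t ^ (p - 1) - x * Df = - (\<Sum>i<p - 1. a i * t ^ i)" using a(2) by simp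
 moreover have "(\<Sum>i<p - 1. a i * t ^ i) \<in> F (m + 1)" using * by (auto intro: F_sum)
 ultimately have d: "a (p - 1) * t ^ (p - 1) - x * Df \<in> F (m + 1)" by auto
 have "x * Df ~= 0" using assms(1) Df by simp
 from nu_eqI[OF this m_def[symmetric] d]
 show "Tr x ~= 0" "\<nu> (Tr x) = \<nu> x + (int p - 1) * int b"
  using a(3) m p_ge_3 by (auto simp: nu_mult of_nat_diff algebra_simps)
qed

end

context wild_extension
begin

subsection \<open>An alternating form on L\<close>

text \<open>Twice the alternating part of the bilinear form sending u, w to Tr(\<delta> w * \<sigma>
  u); see \<open>Tr_delta_sigma\<close>.\<close>

definition \<omega> :: "'l => 'l => 'l" where "\<omega> u v = Tr (u * \<sigma> v - v * \<sigma> u)"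

lemma omega_self [simp]: "\<omega> u u = 0"
 by (simp add: \<omega>_def)

lemma omega_swap: "\<omega> v u = - \<omega> u v"
 by (simp add: \<omega>_def flip: Tr_uminus)

lemma omega_fixed [simp]: "fixed (\<omega> u v)"
 by (simp add: \<omega>_def)

lemma omega_diff_left: "\<omega> (u - u') v = \<omega> u v - \<omega> u' v"
 unfolding \<omega>_def Tr_diff[symmetric] by (simp add: G_diff algebra_simps)

lemma omega_scale_left: "fixed a ==> \<omega> (a * u) v = a * \<omega> u v"
proof -
 assume a: "fixed a"
 have "a * u * \<sigma> v - v * \<sigma> (a * u) = a * (u * \<sigma> v - v * \<sigma> u)"
  using a by (simp add: sigma_mult fixed_def algebra_simps)
 then show ?thesis using a by (simp add: \<omega>_def Tr_fixed_mult fixed_def)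
qed

lemma omega_scale_right: "fixed a ==> \<omega> u (a * v) = a * \<omega> u v"
 using omega_swap[of "a * v" u] omega_swap[of v u] omega_scale_left[of a v u] by simp

lemma omega_sum_left: "\<omega> (sum f I) v = (\<Sum>i\<in>I. \<omega> (f i) v)"
proof (induction I rule: infinite_finite_induct)
 case (insert x I)
 then show ?case using omega_diff_left[of "f x + sum f I" "sum f I" v] by simp
qed (auto simp: \<omega>_def)

text \<open>Invariance of the trace moves \<sigma> away from u. The operator left on v is, up to
  \<sigma>, equal to 2\<delta> + \<delta>^2; since 2 is a unit, it raises valuations exactly as
  \<delta> does.\<close>

lemma omega_eq: "\<omega> u v = Tr (u * (\<sigma> v - ginv \<sigma> v))"
proof -
 have "Tr (v * \<sigma> u) = Tr (ginv \<sigma> (v * \<sigma> u))" by (rule Tr_G[symmetric]) simp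
 also have "ginv \<sigma> (v * \<sigma> u) = u * ginv \<sigma> v" by (simp add: G_mult mult.commute)
 finally show ?thesis by (simp add: \<omega>_def Tr_diff right_diff_distrib)
qed

lemma sigma_diff: "\<sigma> (\<sigma> v - ginv \<sigma> v) = 2 * \<delta> v + \<delta> (\<delta> v)"
 by (simp add: \<delta>_def G_diff)

lemma sigma_diff_F: assumes "v \<in> F n" shows "\<sigma> v - ginv \<sigma> v \<in> F (n + int b)"
proof -
 have "2 * \<delta> v \<in> F (n + int b)" using F_mult_T[OF of_nat_T delta_F[OF assms], of 2] by simp
 moreover have "\<delta> (\<delta> v) \<in> F (n + int b)"
  using delta_F[OF delta_F[OF assms]] by (rule F_mono) simp
 ultimately have "\<sigma> (\<sigma> v - ginv \<sigma> v) \<in> F (n + int b)" unfolding sigma_diff by (rule F_add)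
 from F_G[OF _ this, of "ginv \<sigma>"] show ?thesis by simp
qed

lemma nu_sigma_diff: assumes "v ~= 0" "\<not> int p dvd \<nu> v"
 shows "\<sigma> v - ginv \<sigma> v ~= 0" "\<nu> (\<sigma> v - ginv \<sigma> v) = \<nu> v + int b"
proof -
 note d = nu_delta[OF assms(2,1)]
 have 1: "2 * \<delta> v ~= 0" "\<nu> (2 * \<delta> v) = \<nu> v + int b"
  using d two(1,2) nu_mult[of 2 "\<delta> v"] by auto
 have "\<delta> (\<delta> v) \<in> F (\<nu> v + int b + 1)"
  using delta_F[OF F_nu[of "\<delta> v"]] d b_pos by (auto elim!: F_mono)
 then have "\<sigma> (\<sigma> v - ginv \<sigma> v) - 2 * \<delta> v \<in> F (\<nu> v + int b + 1)" unfolding sigma_diff by simp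
 from nu_eqI[OF 1 this] have n: "\<sigma> (\<sigma> v - ginv \<sigma> v) ~= 0" "\<nu> (\<sigma> (\<sigma> v - ginv \<sigma> v)) = \<nu> v + int b"
  by simp_all
 show "\<sigma> v - ginv \<sigma> v ~= 0" using n(1) by (metis G_zero sigma_G)
 show "\<nu> (\<sigma> v - ginv \<sigma> v) = \<nu> v + int b" using n(2) by (simp only: nu_sigma)
qed

lemma omega_F: assumes "u \<in> F m" "v \<in> F n" shows "\<omega> u v \<in> F (m + n + int p * int b)"
 using Tr_F_strong[OF F_mult[OF assms(1) sigma_diff_F[OF assms(2)]]]
 by (simp add: omega_eq algebra_simps)

text \<open>The operator on v in \<open>omega_eq\<close> adds b to the valuation, and the condition
  on \<open>\<nu> u + \<nu> v\<close> is the one under which the trace attains its bound and adds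
  another (p-1)b.\<close>

lemma nu_omega: assumes "u ~= 0" "v ~= 0" "\<not> int p dvd \<nu> v" "int p dvd \<nu> u + \<nu> v"
 shows "\<omega> u v ~= 0" "\<nu> (\<omega> u v) = \<nu> u + \<nu> v + int p * int b"
proof -
 define x where "x = u * (\<sigma> v - ginv \<sigma> v)"
 have x: "x ~= 0" "\<nu> x = \<nu> u + \<nu> v + int b" unfolding x_def
  using nu_sigma_diff[OF assms(2,3)] assms(1) nu_mult[of u "\<sigma> v - ginv \<sigma> v"] by auto
 then have "int p dvd \<nu> x - int b" using assms(4) by simp
 from nu_Tr[OF x(1) this] show "\<omega> u v ~= 0" "\<nu> (\<omega> u v) = \<nu> u + \<nu> v + int p * int b"
  unfolding omega_eq x_def[symmetric] by (simp_all add: x algebra_simps)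
qed

lemma not_p_dvd: "1 \<le> i ==> i < p ==> \<not> int p dvd int i"
 by (auto dest: dvd_imp_le)

text \<open>An index set closed under i -> p - i that grows from both ends, so that each induction
  step adds one hyperbolic pair.\<close>

definition symm :: "nat => nat set" where "symm m = {1..m} \<union> {p - m..<p}"

text \<open>Symplectic Gram-Schmidt; the correction terms do not disturb the valuations because the
 form takes values in the fixed field, whose valuations are divisible by \<open>p\<close>.\<close>

lemma gram_schmidt: "2 * m < p ==> \<exists>u. (\<forall>i\<in>symm m. u i ~= 0 & \<nu> (u i) = int i) &
  (\<forall>i\<in>symm m. \<forall>k\<in>symm m. i + k ~= p --> \<omega> (u i) (u k) = 0)"
proof (induction m)
 case 0
 then show ?case by (auto simp: symm_def)
next
 case (Suc m)
 then obtain u where u: "!!i. i \<in> symm m ==> u i ~= 0 & \<nu> (u i) = int i"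
  "!!i k. i \<in> symm m ==> k \<in> symm m ==> i + k ~= p ==> \<omega> (u i) (u k) = 0" by auto
 have R: "1 \<le> r" "r < p" "p - r \<in> symm m" if "r \<in> symm m" for r
  using that Suc.prems by (auto simp: symm_def)
 \<comment> \<open>The coordinate of \<open>t ^ i\<close> along \<open>u r\<close>: among the
   earlier vectors only \<open>u (p - r)\<close> pairs nontrivially with \<open>u r\<close>.\<close>
 define c where "c i r = \<omega> (t ^ i) (u (p - r)) / \<omega> (u r) (u (p - r))" for i r
 define w where "w i = t ^ i - (\<Sum>r\<in>symm m. c i r * u r)" for i
 have om: "\<omega> (u r) (u (p - r)) ~= 0" "\<nu> (\<omega> (u r) (u (p - r))) = int p + int p * int b" if "r \<in> symm m" for r
  using nu_omega[of "u r" "u (p - r)"] u(1)[OF that] u(1)[OF R(3)[OF that]] R[OF that] R[OF R(3)[OF that]]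
   not_p_dvd[of "p - r"] by (auto simp: of_nat_diff)
 have cf: "fixed (c i r)" for i r by (simp add: c_def)
 have w_nu: "w i ~= 0 & \<nu> (w i) = int i" if i: "i < p" "i \<notin> symm m" for i
 proof -
  have "c i r * u r \<in> F (int i + 1)" if r: "r \<in> symm m" for r
  proof (cases "c i r = 0")
   case False
   have "\<omega> (t ^ i) (u (p - r)) \<in> F (int i + int (p - r) + int p * int b)"
    using omega_F[OF F_nu F_nu, of "t ^ i" "u (p - r)"] u(1)[OF R(3)[OF r]] by simp
   then have n: "\<nu> (c i r) \<ge> int i - int r"
    using False om[OF r] R[OF r] by (auto simp: c_def F_def nu_divide of_nat_diff)
   \<comment> \<open>Equality would make i - r a multiple of p, since \<open>c i r\<close> is fixed;
     but i and r are distinct and below p. The strict inequality is what leaves the valuation of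
     \<open>t ^ i\<close> unchanged by the correction.\<close>
   have "\<nu> (c i r) ~= int i - int r"
   proof
    assume "\<nu> (c i r) = int i - int r"
    then have "int p dvd int i - int r" using fixed_dvd[OF cf False] by simp
    then have "int i = int r" using i(1) R(2)[OF r] zdvd_imp_le[of "int p" "\<bar>int i - int r\<bar>"] by force
    then show False using i(2) r by simp
   qed
   then show ?thesis using n u(1)[OF r] False by (auto simp: F_def nu_mult)
  qed simp
  then have "(\<Sum>r\<in>symm m. c i r * u r) \<in> F (int i + 1)" by (rule F_sum)
  then have "w i - t ^ i \<in> F (int i + 1)" by (auto simp: w_def)
  then show ?thesis using nu_eqI[of "t ^ i" "int i" "w i"] by simp
 qed
 have w_orth: "\<omega> (w i) (u k) = 0" if k: "k \<in> symm m" for i k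
 proof -
  have "\<omega> (w i) (u k) = \<omega> (t ^ i) (u k) - (\<Sum>r\<in>symm m. c i r * \<omega> (u r) (u k))"
   unfolding w_def omega_diff_left omega_sum_left by (simp add: omega_scale_left cf)
  also have "(\<Sum>r\<in>symm m. c i r * \<omega> (u r) (u k)) = (\<Sum>r\<in>symm m. if r = p - k then \<omega> (t ^ i) (u k) else 0)"
  proof (rule sum.cong[OF refl])
   fix r assume r: "r \<in> symm m"
   show "c i r * \<omega> (u r) (u k) = (if r = p - k then \<omega> (t ^ i) (u k) else 0)"
   proof (cases "r = p - k")
    case True
    then have "p - r = k" using R[OF k] by simp
    then show ?thesis using True om[OF r] by (simp add: c_def)
   qed (use u(2)[OF r k] R[OF r] R[OF k] in auto)
  qed
  also have "\<dots> = \<omega> (t ^ i) (u k)" using R(3)[OF k] by (simp add: symm_def)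
  finally show ?thesis by simp
 qed
 \<comment> \<open>The new pair of complementary indices. Nothing is required of the form between
   the two new vectors, as i0 + i1 = p, and it vanishes on each vector with itself.\<close>
 define i0 i1 where "i0 = m + 1" and "i1 = p - (m + 1)"
 have new: "i0 < p" "i1 < p" "i0 \<notin> symm m" "i1 \<notin> symm m" "i0 + i1 = p" "i0 ~= i1"
  "symm (Suc m) = insert i0 (insert i1 (symm m))"
  using Suc.prems by (auto simp: symm_def i0_def i1_def)
 define u' where "u' i = (if i \<in> symm m then u i else w i)" for i
 have "\<omega> (u' i) (u' k) = 0" if "i \<in> symm (Suc m)" "k \<in> symm (Suc m)" "i + k ~= p" for i k
 proof -
  consider "i \<in> symm m" "k \<in> symm m" | "i \<in> symm m" "k \<notin> symm m" | "i \<notin> symm m" "k \<in> symm m"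
   | "i \<notin> symm m" "k \<notin> symm m" by blast
  then show ?thesis
  proof cases
   case 1
   then show ?thesis using u(2)[OF 1 that(3)] by (simp add: u'_def)
  next
   case 2
   have "\<omega> (u i) (w k) = - \<omega> (w k) (u i)" by (rule omega_swap)
   then show ?thesis using 2 w_orth[OF 2(1)] by (simp add: u'_def)
  next
   case 3
   then show ?thesis using w_orth[OF 3(2)] by (simp add: u'_def)
  next
   case 4
   then have "i = k" using that new(5,7) by auto
   then show ?thesis by simp
  qed
 qed
 moreover have "u' i ~= 0 & \<nu> (u' i) = int i" if "i \<in> symm (Suc m)" for i
  using that new u(1)[of i] w_nu[of i] by (auto simp: u'_def)
 ultimately show ?case by (intro exI[of _ u'] conjI ballI impI) simp_all
qed

text \<open>Only the member of each pair with index below p/2 is rescaled. The form on a pair has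
  valuation p(b+1), the valuation of s^(b+1), so the factor is a unit of the fixed field and keeps
  valuations. The prescribed value turns into \<open>gam\<close> after halving and shifting by
  powers of s.\<close>

lemma gram_schmidt_normalized: "\<exists>u. (\<forall>i\<in>{1..<p}. u i ~= 0 & \<nu> (u i) = int i) &
  (\<forall>i\<in>{1..<p}. \<forall>k\<in>{1..<p}. i + k ~= p --> \<omega> (u i) (u k) = 0) &
  (\<forall>i\<in>{1..<p}. 2 * i < p --> \<omega> (u i) (u (p - i)) = 2 * s ^ (b + 1) / of_nat (p - i))"
proof -
 define m where "m = (p - 1) div 2"
 have "odd p" using prime_p p_ge_3 prime_odd_nat[of p] by simp
 then have symm: "symm m = {1..<p}" "2 * m < p" using p_ge_3 by (auto simp: symm_def m_def elim!: oddE)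
 obtain u where u: "!!i. i \<in> {1..<p} ==> u i ~= 0 & \<nu> (u i) = int i"
  "!!i k. i \<in> {1..<p} ==> k \<in> {1..<p} ==> i + k ~= p ==> \<omega> (u i) (u k) = 0"
  using gram_schmidt[OF symm(2)] unfolding symm(1) by blast
 define c where "c i = (if 2 * i < p then 2 * s ^ (b + 1) / of_nat (p - i) / \<omega> (u i) (u (p - i)) else 1)" for i
 have two_f: "fixed 2" using fixed_of_nat(1)[of 2] by simp
 have cf: "fixed (c i)" for i using two_f s_props(3) by (auto simp: c_def simp del: power_Suc)
 have om: "\<omega> (u i) (u (p - i)) ~= 0" "\<nu> (\<omega> (u i) (u (p - i))) = int p + int p * int b" if "i \<in> {1..<p}" for i
  using nu_omega[of "u i" "u (p - i)"] u(1)[OF that] u(1)[of "p - i"] that not_p_dvd[of "p - i"]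
  by (auto simp: of_nat_diff)
 have c: "c i ~= 0 & \<nu> (c i) = 0" if i: "i \<in> {1..<p}" for i
 proof -
  have nd: "\<not> int p dvd int (p - i)" by (rule not_p_dvd) (use i in auto)
  have n: "of_nat (p - i) ~= (0::'l)" "\<nu> (of_nat (p - i)) = 0"
   using nu_of_int[OF nd] by (simp_all only: of_int_of_nat_eq not_False_eq_True)
  have A: "2 * s ^ (b + 1) ~= 0" "\<nu> (2 * s ^ (b + 1)) = int p + int p * int b"
   using two s_props(1) nu_mult[OF two(1), of "s ^ (b + 1)"] nu_s_pow(1)[of "b + 1"]
   by (simp_all add: algebra_simps del: power_Suc)
  have gen: "A / D / W ~= 0 & \<nu> (A / D / W) = 0"
   if "A ~= 0" "D ~= 0" "W ~= 0" "\<nu> A = \<nu> W" "\<nu> D = 0" for A D W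
   using that by (simp add: nu_divide nu_mult)
  have "2 * s ^ (b + 1) / of_nat (p - i) / \<omega> (u i) (u (p - i)) ~= 0 &
   \<nu> (2 * s ^ (b + 1) / of_nat (p - i) / \<omega> (u i) (u (p - i))) = 0"
   by (rule gen[OF A(1) n(1) om(1)[OF i] _ n(2)]) (simp only: A(2) om(2)[OF i])
  then show ?thesis unfolding c_def by (cases "2 * i < p") (simp_all only: if_True if_False one_neq_zero nu_one simp_thms)
 qed
 define v where "v i = c i * u i" for i
 have "v i ~= 0 & \<nu> (v i) = int i" if "i \<in> {1..<p}" for i
  using c[OF that] u(1)[OF that] by (simp add: v_def nu_mult)
 moreover have vo: "\<omega> (v i) (v k) = c i * (c k * \<omega> (u i) (u k))" for i k
  using cf by (simp add: v_def omega_scale_left omega_scale_right)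
 moreover have "\<omega> (v i) (v (p - i)) = 2 * s ^ (b + 1) / of_nat (p - i)" if "i \<in> {1..<p}" "2 * i < p" for i
 proof -
  have "\<not> 2 * (p - i) < p" using that by auto
  then have "c (p - i) = 1" by (simp add: c_def)
  then show ?thesis using om[OF that(1)] that(2) unfolding vo by (simp add: c_def)
 qed
 ultimately show ?thesis using u(2) by (intro exI[of _ v] conjI ballI impI) simp_all
qed

subsection \<open>Generators of the first cohomology\<close>

definition J :: "nat set" where "J = {0..p - 1} - {b mod p}"

text \<open>For j in \<open>J\<close>, the least m such that s^m brings an element of valuation j -
  b into \<open>T\<close>; the two cases are the rounding of (b-j)/p upwards.\<close>

definition mu :: "nat => nat" where "mu j = (if j < b mod p then b div p + 1 else b div p)"

definition gam :: "nat => nat => 'l" where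
 "gam j k = (if (j + k) mod p = (2 * b) mod p then 1 else 0)
        * s ^ nat (int b + (int j + int k - 2 * int b) div int p)
        * inverse (of_int ((int b - int j) mod int p))"

lemma finite_J [simp]: "finite J"
 by (simp add: J_def)

lemma J_props: assumes "j \<in> J" shows "j < p" "\<not> int p dvd int j - int b" "j ~= b mod p"
proof -
 show j: "j < p" "j ~= b mod p" using assms p_ge_3 by (auto simp: J_def)
 show "\<not> int p dvd int j - int b"
 proof
  assume "int p dvd int j - int b"
  then have "int j mod int p = int b mod int p" by (simp add: mod_eq_dvd_iff)
  then have "j mod p = b mod p" by (metis of_nat_eq_iff of_nat_mod)
  then show False using j by simp
 qed
qed

lemma gam_S: assumes "j \<in> J" shows "gam j k \<in> S"
proof -
 have "\<not> int p dvd (int b - int j) mod int p"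
  using J_props(2)[OF assms] by (simp add: dvd_mod_iff dvd_diff_commute)
 from tunit_of_int[OF this] have "inverse (of_int ((int b - int j) mod int p)) \<in> S"
  by (auto simp: tunit_def fixed_S)
 then show ?thesis using s_props(4) by (auto simp: gam_def)
qed

text \<open>Writing \<open>\<nu> c = p * q\<close>, the left side is a condition on q alone, because
  j and b mod p are distinct residues; \<open>mu j\<close> is its threshold.\<close>

lemma mu_iff: assumes "fixed c" "c ~= 0" "j \<in> J"
 shows "(\<nu> c + int j - int b \<ge> 0) \<longleftrightarrow> \<nu> c \<ge> int p * int (mu j)"
proof -
 obtain q where q: "\<nu> c = int p * q" using fixed_dvd[OF assms(1,2)] by blast
 have b: "int b = int p * int (b div p) + int (b mod p)" by (metis mult_div_mod_eq of_nat_add of_nat_mult)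
 have bp: "int (b mod p) < int p" using p_ge_3 by simp
 have j: "int j < int p" "j ~= b mod p" using J_props[OF assms(3)] by auto
 define e where "e = q - int (b div p)"
 have "\<nu> c + int j - int b = int p * e + int j - int (b mod p)" unfolding q b e_def by (simp add: algebra_simps)
 moreover have "(int p * e + int j - int (b mod p) \<ge> 0) \<longleftrightarrow> e \<ge> (if j < b mod p then 1 else 0)"
 proof -
  have P: "int p * e \<ge> int p" if "e \<ge> 1" using that mult_left_mono[of 1 e "int p"] by simp
  have N: "int p * e \<le> - int p" if "e \<le> -1" using that mult_left_mono[of e "-1" "int p"] by simp
  consider "e \<ge> 1" | "e = 0" | "e \<le> -1" by linarith
  then show ?thesis
  proof cases
   case 1
   have "int p * e + int j - int (b mod p) \<ge> 0" using P[OF 1] bp by linarith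
   then show ?thesis using 1 by simp
  next
   case 2 then show ?thesis using j by auto
  next
   case 3
   have "int p * e + int j - int (b mod p) < 0" using N[OF 3] j(1) by linarith
   then show ?thesis using 3 by simp
  qed
 qed
 moreover have "\<nu> c \<ge> int p * int (mu j) \<longleftrightarrow> q \<ge> int (mu j)" using q p_ge_3 by simp
 moreover have "q \<ge> int (mu j) \<longleftrightarrow> e \<ge> (if j < b mod p then 1 else 0)" by (auto simp: mu_def e_def)
 ultimately show ?thesis by (simp only:)
qed

text \<open>The bound (p-1)b for traces of integral elements rounds up to the multiple p(b - b div
  p) of p, since the two differ by b mod p. It is attained at t^(b mod p), whose valuation is
  congruent to b, and then \<open>S\<close>-linearity gives everything divisible by that power of
  s.\<close>

lemma TrT_eq: "Tr ` T = {s ^ (b - b div p) * c | c. c \<in> S}"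
proof -
 define M where "M = b - b div p"
 have bM: "int M = int b - int (b div p)" by (simp add: M_def)
 have b: "int b = int p * int (b div p) + int (b mod p)" by (metis mult_div_mod_eq of_nat_add of_nat_mult)
 have pM: "int p * int M = (int p - 1) * int b + int (b mod p)" unfolding bM using b by (simp add: algebra_simps)
 have bp: "int (b mod p) < int p" using p_ge_3 by simp
 have "\<exists>c. Tr x = s ^ M * c & c \<in> S" if "x \<in> T" for x
 proof -
  have "Tr x \<in> F ((int p - 1) * int b)" using Tr_F_strong[of x 0] that F_0 by simp
  then have "Tr x \<in> F (int p * int M)" by (rule fixed_F_ceil[rotated]) (use pM bp in \<open>auto simp: algebra_simps\<close>)
  then show ?thesis using S_dvd_iff[of "Tr x" M] by auto
 qed
 moreover have "s ^ M * c \<in> Tr ` T" if "c \<in> S" for c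
 proof -
  define x where "x = t ^ (b mod p)"
  have "int p dvd \<nu> x - int b" unfolding x_def using b by (metis add_diff_cancel_right' dvd_diff_commute dvd_triv_left nu_tpow)
  then have n: "Tr x ~= 0" "\<nu> (Tr x) = int p * int M" using nu_Tr[of x] by (auto simp: x_def pM)
  define r where "r = s ^ M / Tr x"
  have r: "r ~= 0" "\<nu> r = 0" "fixed r" using n s_props by (simp_all add: r_def nu_divide)
  then have "r \<in> S" by (simp add: fixed_S mem_T_iff)
  then have rc: "r * c \<in> S" using that by blast
  have "Tr (r * c * x) = (r * c) * Tr x" using rc by (simp add: Tr_fixed_mult S_sigma)
  also have "\<dots> = s ^ M * c" using n by (simp add: r_def)
  finally show ?thesis using S_T[OF rc] by (metis image_eqI mult_T power_T t_T x_def)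
 qed
 ultimately show ?thesis by (auto simp: M_def)
qed

text \<open>Multiplied by p the expression becomes (p-2)b + j + k. Thus the conversion by
  \<open>nat\<close> in \<open>gam\<close> does not truncate where it matters.\<close>

lemma exponent_nonneg: assumes "j \<in> J" "k \<in> J" "int p dvd int j + int k - 2 * int b"
 shows "int b + (int j + int k - 2 * int b) div int p \<ge> 0"
proof -
 have "int p * (int b + (int j + int k - 2 * int b) div int p) = int p * int b + (int j + int k - 2 * int b)"
  using assms(3) by (simp add: distrib_left)
 moreover have "int p * int b \<ge> 2 * int b" using p_ge_3 by (intro mult_right_mono) auto
 ultimately have "int p * (int b + (int j + int k - 2 * int b) div int p) \<ge> 0" by linarith
 then show ?thesis using p_ge_3 by (simp add: zero_le_mult_iff)
qed

text \<open>Since Tr(\<sigma> w * \<sigma> u) = Tr(w * u), the symmetric part is half the trace of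
  \<open>\<delta> u * \<delta> w\<close>. When both factors are integral it is a coboundary in even
  degree, and only \<omega> remains visible in cohomology.\<close>

lemma Tr_delta_sigma: "Tr (\<delta> w * \<sigma> u) = \<omega> u w / 2 + Tr (\<delta> u * \<delta> w) / 2"
proof -
 have "Tr (\<sigma> w * \<sigma> u) = Tr (w * u)" using Tr_sigma[of "w * u"] by (simp add: sigma_mult)
 then have "2 * Tr (\<delta> w * \<sigma> u) = \<omega> u w + Tr (\<delta> u * \<delta> w)"
  by (simp add: \<omega>_def \<delta>_def Tr_diff Tr_add algebra_simps)
 then show ?thesis using two(1) by (simp add: add_divide_distrib[symmetric] field_simps)
qed

lemma TrT_add: "x \<in> Tr ` T ==> y \<in> Tr ` T ==> x + y \<in> Tr ` T"
 by (elim imageE) (simp add: Tr_add[symmetric] imageI)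

lemma TrT_smult: "a \<in> S ==> y \<in> Tr ` T ==> a * y \<in> Tr ` T"
 by (elim imageE) (simp add: Tr_fixed_mult[symmetric] S_sigma S_T imageI)

lemma p_TrT: "of_nat p \<in> Tr ` T"
 by (rule image_eqI[of _ _ 1]) (auto simp: Tr_def card_G)

text \<open>The normalized vectors have valuations 1 to p-1. That with index the residue
  \<open>r j\<close> of j - b, shifted by the power \<open>q j\<close> of s, has valuation j - b;
  residue 0 does not occur because j is not b mod p. Matching indices \<open>r j + r k = p\<close>
  is the condition in the Kronecker delta.\<close>

lemma generators: "\<exists>u. (\<forall>j\<in>J. u j ~= 0 & \<nu> (u j) = int j - int b) &
  (\<forall>j\<in>J. \<forall>k\<in>J. \<omega> (u j) (u k) / 2 - gam j k \<in> Tr ` T)"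
proof -
 obtain u where u: "!!i. i \<in> {1..<p} ==> u i ~= 0 & \<nu> (u i) = int i"
  "!!i k. i \<in> {1..<p} ==> k \<in> {1..<p} ==> i + k ~= p ==> \<omega> (u i) (u k) = 0"
  "!!i. i \<in> {1..<p} ==> 2 * i < p ==> \<omega> (u i) (u (p - i)) = 2 * s ^ (b + 1) / of_nat (p - i)"
  using gram_schmidt_normalized by metis
 define r where "r j = nat ((int j - int b) mod int p)" for j
 define q where "q j = (int j - int b) div int p" for j
 define v where "v j = s powi q j * u (r j)" for j
 have r: "r j \<in> {1..<p}" "int (r j) = (int j - int b) mod int p" "int p * q j + int (r j) = int j - int b"
  if "j \<in> J" for j
 proof -
  have "(int j - int b) mod int p ~= 0" "(int j - int b) mod int p < int p" "(int j - int b) mod int p \<ge> 0"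
   using J_props(2)[OF that] p_ge_3 by (auto simp: dvd_eq_mod_eq_0)
  then show "r j \<in> {1..<p}" "int (r j) = (int j - int b) mod int p"
   "int p * q j + int (r j) = int j - int b" by (auto simp: r_def q_def)
 qed
 have rb: "(int b - int j) mod int p = int (p - r j)" if "j \<in> J" for j
 proof -
  have "int b - int j = int (p - r j) + int p * (- q j - 1)"
   using r[OF that] by (auto simp: of_nat_diff algebra_simps)
  then have "(int b - int j) mod int p = int (p - r j) mod int p" by (metis mod_mult_self2)
  also have "\<dots> = int (p - r j)" by (rule mod_pos_pos_trivial) (use r(1)[OF that] in auto)
  finally show ?thesis .
 qed
 have "v j ~= 0 & \<nu> (v j) = int j - int b" if "j \<in> J" for j
  using u(1)[OF r(1)[OF that]] r(3)[OF that] s_props(1) by (simp add: v_def nu_mult)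
 moreover have "\<omega> (v j) (v k) / 2 - gam j k \<in> Tr ` T" if j: "j \<in> J" and k: "k \<in> J" for j k
 proof -
  have om: "\<omega> (v j) (v k) = s powi (q j + q k) * \<omega> (u (r j)) (u (r k))"
   using s_props by (simp add: v_def omega_scale_left omega_scale_right power_int_add)
  have dvd_iff: "int p dvd int j + int k - 2 * int b \<longleftrightarrow> r j + r k = p"
  proof -
   have e: "int j + int k - 2 * int b = int p * (q j + q k) + (int (r j) + int (r k))"
    using r(3)[OF j] r(3)[OF k] by (simp add: algebra_simps)
   have "int p dvd int (r j + r k) \<longleftrightarrow> r j + r k = p"
   proof
    assume "int p dvd int (r j + r k)"
    then obtain c where c: "r j + r k = p * c" by (metis dvdE of_nat_dvd_iff)
    moreover have "0 < r j + r k" "r j + r k < 2 * p" using r(1)[OF j] r(1)[OF k] by auto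
    ultimately have "0 < c" "c < 2" by (auto simp: mult.commute[of p])
    then show "r j + r k = p" using c by (cases "c = 1") auto
   qed simp
   then show ?thesis unfolding e by (simp add: dvd_add_right_iff)
  qed
  have mod_iff: "(j + k) mod p = (2 * b) mod p \<longleftrightarrow> r j + r k = p"
  proof -
   have "(j + k) mod p = (2 * b) mod p \<longleftrightarrow> int (j + k) mod int p = int (2 * b) mod int p"
    by (metis of_nat_eq_iff of_nat_mod)
   also have "\<dots> \<longleftrightarrow> int p dvd int j + int k - 2 * int b" by (simp add: mod_eq_dvd_iff)
   finally show ?thesis using dvd_iff by simp
  qed
  show ?thesis
  proof (cases "r j + r k = p")
   case False
   then have "\<omega> (v j) (v k) = 0" "gam j k = 0"
    using om u(2)[OF r(1)[OF j] r(1)[OF k]] mod_iff by (simp_all add: gam_def)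
   then show ?thesis by (auto intro: image_eqI[of _ _ 0])
  next
   case True
   define e where "e = nat (int b + (int j + int k - 2 * int b) div int p)"
   have e0: "int e = int b + (int j + int k - 2 * int b) div int p"
    using exponent_nonneg[OF j k] dvd_iff True by (simp add: e_def)
   have "int j + int k - 2 * int b = int p * (q j + q k + 1)"
    using r(3)[OF j] r(3)[OF k] True by (simp add: algebra_simps flip: of_nat_add)
   then have e: "q j + q k + int (b + 1) = int e" using e0 p_ge_3 by simp
   have se: "s powi (q j + q k) * s ^ (b + 1) = s ^ e"
   proof -
    have "s powi (q j + q k) * s powi int (b + 1) = s powi int e"
     using s_props(1) e by (metis power_int_add)
    then show ?thesis by (simp only: power_int_of_nat)
   qed
   have g: "gam j k = s ^ e / of_nat (r k)"
   proof -
    have "(int b - int j) mod int p = int (r k)" using rb[OF j] True by linarith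
    then show ?thesis using True mod_iff by (simp add: gam_def e_def divide_inverse)
   qed
   have rk: "p - r j = r k" "p - r k = r j" using True by auto
   show ?thesis
   proof (cases "2 * r j < p")
    case True
    then have "\<omega> (v j) (v k) = 2 * (s powi (q j + q k) * s ^ (b + 1)) / of_nat (r k)"
     using u(3)[OF r(1)[OF j]] om rk by simp
    then have "\<omega> (v j) (v k) / 2 = gam j k" using se g two(1) by simp
    then show ?thesis by (auto intro: image_eqI[of _ _ 0])
   next
    case False
    \<comment> \<open>Here only the swapped product is normalized. Swapping yields -s^e / r_j where
      s^e / r_k is wanted; the two differ by a multiple of r_j + r_k = p, and p = Tr 1 is a
      trace.\<close>
    have "odd p" using prime_p p_ge_3 prime_odd_nat[of p] by simp
    then have "2 * r j ~= p" by auto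
    then have "2 * r k < p" using False rk True by linarith
    then have "\<omega> (v k) (v j) = 2 * (s powi (q j + q k) * s ^ (b + 1)) / of_nat (r j)"
     using u(3)[OF r(1)[OF k]] om omega_swap[of "u (r j)" "u (r k)"] omega_swap[of "v j" "v k"] rk by simp
    then have "\<omega> (v j) (v k) = - (2 * s ^ e / of_nat (r j))"
     unfolding omega_swap[of "v j" "v k"] by (simp only: se)
    then have w: "\<omega> (v j) (v k) / 2 = - (s ^ e / of_nat (r j))" using two(1) by simp
    have tu: "tunit (of_nat (r j))" "tunit (of_nat (r k))"
     using tunit_of_int[of "int (r j)"] tunit_of_int[of "int (r k)"] not_p_dvd[of "r j"] not_p_dvd[of "r k"]
      r(1)[OF j] r(1)[OF k] by auto
    have "of_nat (r j) + of_nat (r k) = (of_nat p :: 'l)" using True by (metis of_nat_add)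
    moreover have "- (x / a) - x / c = - (x * inverse a * inverse c) * P"
     if "a ~= 0" "c ~= 0" "a + c = P" for x a c P :: 'l
     unfolding that(3)[symmetric] using that(1,2) by (simp add: field_simps)
    ultimately have "\<omega> (v j) (v k) / 2 - gam j k = - (s ^ e * inverse (of_nat (r j)) * inverse (of_nat (r k))) * of_nat p"
     unfolding w g using tu unfolding tunit_def by blast
    moreover have "- (s ^ e * inverse (of_nat (r j)) * inverse (of_nat (r k))) \<in> S"
     using tu s_props(4) by (auto simp: tunit_def fixed_S)
    ultimately show ?thesis using TrT_smult[OF _ p_TrT] by metis
   qed
  qed
 qed
 ultimately show ?thesis by (intro exI[of _ v] conjI ballI) simp_all
qed

end

section \<open>Cocycles and coboundaries inside \<open>T\<close>, in terms of the chosen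
  generators\<close>

context wild_extension
begin

definition gu :: "nat => 'l" where
 "gu = (SOME u. (\<forall>j\<in>J. u j ~= 0 & \<nu> (u j) = int j - int b) &
  (\<forall>j\<in>J. \<forall>k\<in>J. \<omega> (u j) (u k) / 2 - gam j k \<in> Tr ` T))"

text \<open>The cocycle representing the generator of degree one with index j. Its preimage
  \<open>gu j\<close> is kept because odd products are computed from preimages under
  \<delta>.\<close>

definition gx :: "nat => 'l" where "gx j = \<delta> (gu j)"

lemma gu: assumes "j \<in> J"
 shows "gu j ~= 0" "\<nu> (gu j) = int j - int b" "k \<in> J ==> \<omega> (gu j) (gu k) / 2 - gam j k \<in> Tr ` T"
 using someI_ex[OF generators] assms unfolding gu_def[symmetric] by blast+

lemma gx: assumes "j \<in> J" shows "gx j ~= 0" "\<nu> (gx j) = int j" "gx j \<in> T" "Tr (gx j) = 0"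
proof -
 have "\<not> int p dvd \<nu> (gu j)" using gu(2)[OF assms] J_props(2)[OF assms] by simp
 from nu_delta[OF this gu(1)[OF assms]] show 1: "gx j ~= 0" "\<nu> (gx j) = int j"
  using gu(2)[OF assms] by (simp_all add: gx_def)
 show "gx j \<in> T" using 1 by (simp add: mem_T_iff)
 show "Tr (gx j) = 0" by (simp add: gx_def)
qed

lemma lessThan_p: "{..<p} = insert (b mod p) J" "b mod p \<notin> J"
 using p_ge_3 by (auto simp: J_def)

lemma nu_fixed_mult_mod: "fixed a ==> a ~= 0 ==> w ~= 0 ==> \<nu> (a * w) mod int p = \<nu> w mod int p"
 using fixed_dvd[of a] by (simp add: nu_mult int_dvd_mod_0)

text \<open>\<open>gx j\<close> has valuation j, so adding a vector of the missing valuation b mod p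
  gives an adapted basis. That vector has nonzero trace, so its coefficient vanishes for elements of
  trace zero. The other coefficients are integral because summands of distinct valuations cannot
  cancel and valuations of fixed elements round up to multiples of p.\<close>

lemma kernel_trace: assumes "y \<in> T" "Tr y = 0"
 shows "\<exists>c. (\<forall>j\<in>J. c j \<in> S) & y = (\<Sum>j\<in>J. c j * gx j)"
proof -
 \<comment> \<open>The family of valuations 0 to p-1: the index left out of \<open>J\<close> is
   filled by a power of t.\<close>
 define w where "w i = (if i = b mod p then t ^ i else gx i)" for i
 have wJ: "w j = gx j" if "j \<in> J" for j using that lessThan_p(2) by (auto simp: w_def)
 have w: "w i ~= 0" "\<nu> (w i) = int i" if "i < p" for i
  using that gx(1,2)[of i] lessThan_p(1) by (auto simp: w_def)
 have "inj_on (%i. \<nu> (w i) mod int p) {..<p}"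
  using inj_on_mod_p by (rule inj_on_cong[THEN iffD2, rotated]) (simp add: w)
 then obtain a where a: "\<forall>i\<in>{..<p}. \<sigma> (a i) = a i" "y = (\<Sum>i<p. a i * w i)"
  using adapted_span[of "{..<p}" w y] w by auto
 have af: "fixed (a i)" if "i < p" for i using a(1) that by (simp add: fixed_def)
 have bp: "b mod p < p" using p_ge_3 by simp
 have y: "y = a (b mod p) * t ^ (b mod p) + (\<Sum>j\<in>J. a j * gx j)"
 proof -
  have "y = a (b mod p) * w (b mod p) + (\<Sum>j\<in>J. a j * w j)"
   using a(2) lessThan_p by simp
  also have "(\<Sum>j\<in>J. a j * w j) = (\<Sum>j\<in>J. a j * gx j)" by (rule sum.cong) (simp_all add: wJ)
  finally show ?thesis by (simp add: w_def)
 qed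
 have "Tr (a j * gx j) = 0" if "j \<in> J" for j
  using af[OF J_props(1)[OF that]] gx(4)[OF that] by (simp add: fixed_def Tr_fixed_mult)
 then have "Tr y = a (b mod p) * Tr (t ^ (b mod p))"
  using af[OF bp] by (simp add: y Tr_add Tr_sum fixed_def Tr_fixed_mult)
 moreover have "int p dvd int (b mod p) - int b"
  by (metis dvd_minus_mod dvd_diff_commute of_nat_mod)
 then have "Tr (t ^ (b mod p)) ~= 0" using nu_Tr(1)[of "t ^ (b mod p)"] by simp
 ultimately have "a (b mod p) = 0" using assms(2) by simp
 then have y': "y = (\<Sum>j\<in>J. a j * gx j)" using y by simp
 have "a j \<in> S" if j: "j \<in> J" for j
 proof -
  have "a j * gx j \<in> F 0"
  proof (rule sum_distinct_nu[of J "%j. a j * gx j"])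
   show "(\<Sum>j\<in>J. a j * gx j) \<in> F 0" using y' assms(1) F_0 by simp
   fix i j assume ij: "i \<in> J" "j \<in> J" "i ~= j" "a i * gx i ~= 0" "a j * gx j ~= 0"
   have "\<nu> (a i * gx i) mod int p = int i" "\<nu> (a j * gx j) mod int p = int j"
    using nu_fixed_mult_mod[OF af[of i], of "gx i"] nu_fixed_mult_mod[OF af[of j], of "gx j"]
     gx(2)[OF ij(1)] gx(2)[OF ij(2)] J_props(1)[OF ij(1)] J_props(1)[OF ij(2)] ij(4,5) by auto
   then show "\<nu> (a i * gx i) ~= \<nu> (a j * gx j)" using ij(3) by auto
  qed (use j in auto)
  show ?thesis
  proof (cases "a j = 0")
   case False
   then have n: "\<nu> (a j) + int j \<ge> 0"
    using \<open>a j * gx j \<in> F 0\<close> gx(1,2)[OF j] by (simp add: F_def nu_mult)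
   then have "a j \<in> F (- int j)" by (simp add: F_def)
   then have "a j \<in> F (int p * 0)"
    by (rule fixed_F_ceil[OF af[OF J_props(1)[OF j]]]) (use J_props(1)[OF j] in auto)
   then show ?thesis using F_0 af[OF J_props(1)[OF j]] by (simp add: fixed_S)
  qed simp
 qed
 then show ?thesis using y' by blast
qed

text \<open>An additive Hilbert 90, explicit in the generators: each \<open>gx j\<close> is \<delta>
  of \<open>gu j\<close>, and coefficients in \<open>S\<close> commute with \<delta>. The preimage
  is found in L and need not be integral.\<close>

lemma hilbert90: assumes "y \<in> T" "Tr y = 0" shows "\<exists>u. \<delta> u = y"
proof -
 obtain c where c: "\<forall>j\<in>J. c j \<in> S" "y = (\<Sum>j\<in>J. c j * gx j)" using kernel_trace[OF assms] by blast
 have "\<delta> (\<Sum>j\<in>J. c j * gu j) = y"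
  unfolding delta_sum c(2) gx_def by (rule sum.cong) (use c(1) in \<open>auto simp: delta_fixed_mult S_sigma\<close>)
 then show ?thesis by blast
qed

text \<open>A preimage z in \<open>T\<close> differs from the sum of the \<open>c j * gu j\<close>
  by a fixed element. That element has valuation 0 modulo p, the summand of index j has valuation j
  - b, and these residues are distinct. So integrality of z forces integrality of every summand,
  which means that \<open>s ^ mu j\<close> divides \<open>c j\<close>.\<close>

lemma delta_image_iff: assumes c: "!!j. j \<in> J ==> c j \<in> S"
 shows "(\<Sum>j\<in>J. c j * gx j) \<in> \<delta> ` T \<longleftrightarrow> (\<forall>j\<in>J. \<exists>c'\<in>S. c j = s ^ mu j * c')"
proof -
 have cf: "fixed (c j)" if "j \<in> J" for j using c[OF that] by (simp add: fixed_S)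
 have d: "\<delta> (\<Sum>j\<in>J. c j * gu j) = (\<Sum>j\<in>J. c j * gx j)"
  unfolding delta_sum gx_def by (rule sum.cong) (use c in \<open>auto simp: delta_fixed_mult S_sigma\<close>)
 have key: "(\<exists>c'\<in>S. c j = s ^ mu j * c') \<longleftrightarrow> c j * gu j \<in> F 0" if j: "j \<in> J" for j
 proof (cases "c j = 0")
  case False
  have "(\<exists>c'\<in>S. c j = s ^ mu j * c') \<longleftrightarrow> \<nu> (c j) \<ge> int p * int (mu j)"
   using S_dvd_iff[OF cf[OF j]] False by (simp add: F_def)
  also have "\<dots> \<longleftrightarrow> \<nu> (c j) + int j - int b \<ge> 0" using mu_iff[OF cf[OF j] False j] by simp
  also have "\<dots> \<longleftrightarrow> c j * gu j \<in> F 0"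
   using False gu(1)[OF j] by (simp add: F_def nu_mult gu(2)[OF j] add_diff_eq)
  finally show ?thesis .
 qed (auto intro: bexI[of _ 0])
 show ?thesis
 proof
  assume "\<forall>j\<in>J. \<exists>c'\<in>S. c j = s ^ mu j * c'"
  then have "(\<Sum>j\<in>J. c j * gu j) \<in> F 0" using key by (intro F_sum) auto
  then have "(\<Sum>j\<in>J. c j * gu j) \<in> T" by (simp only: F_0)
  then show "(\<Sum>j\<in>J. c j * gx j) \<in> \<delta> ` T" unfolding d[symmetric] by (rule imageI)
 next
  assume "(\<Sum>j\<in>J. c j * gx j) \<in> \<delta> ` T"
  then obtain z where z: "z \<in> T" "\<delta> z = (\<Sum>j\<in>J. c j * gx j)" by auto
  define f where "f = z - (\<Sum>j\<in>J. c j * gu j)"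
  have "\<delta> f = 0" by (simp add: f_def delta_diff z d)
  then have ff: "fixed f" by (simp add: \<delta>_def fixed_def)
  define g where "g i = (if i = b mod p then f else c i * gu i)" for i
  have gJ: "g j = c j * gu j" if "j \<in> J" for j using that lessThan_p(2) by (auto simp: g_def)
  have "(\<Sum>i<p. g i) = g (b mod p) + (\<Sum>j\<in>J. g j)" using lessThan_p by simp
  also have "(\<Sum>j\<in>J. g j) = (\<Sum>j\<in>J. c j * gu j)" by (rule sum.cong) (simp_all add: gJ)
  finally have "(\<Sum>i<p. g i) = z" by (simp add: g_def f_def)
  then have sF: "(\<Sum>i<p. g i) \<in> F 0" using z(1) F_0 by simp
  have gm: "(\<nu> (g i) + int b) mod int p = int i" if "i < p" "g i ~= 0" for i
  proof (cases "i = b mod p")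
   case True
   then have "int p dvd \<nu> (g i)" using fixed_dvd[OF ff] that(2) by (simp add: g_def)
   then show ?thesis using True by (simp add: int_dvd_mod_0 of_nat_mod)
  next
   case False
   then have j: "i \<in> J" using that(1) lessThan_p(1) by auto
   then have "\<nu> (g i) = \<nu> (c i) + (int i - int b)" using gJ[OF j] that(2) gu(2)[OF j] by (simp add: nu_mult)
   moreover have "int p dvd \<nu> (c i)" using fixed_dvd[OF cf[OF j]] that(2) gJ[OF j] by auto
   ultimately show ?thesis using that(1) int_dvd_mod_0[of p "\<nu> (c i)" "int i"] by simp
  qed
  have "g i \<in> F 0" if "i < p" for i
  proof (rule sum_distinct_nu[OF _ _ sF])
   fix i j assume "i \<in> {..<p}" "j \<in> {..<p}" "i ~= j" "g i ~= 0" "g j ~= 0"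
   then show "\<nu> (g i) ~= \<nu> (g j)" using gm[of i] gm[of j] by auto
  qed (use that in auto)
  then have "c j * gu j \<in> F 0" if "j \<in> J" for j using gJ[OF that] J_props(1)[OF that] by metis
  then show "\<forall>j\<in>J. \<exists>c'\<in>S. c j = s ^ mu j * c'" using key by blast
 qed
qed

lemma Tr_gx_sigma_gu: assumes "j \<in> J" "k \<in> J" shows "Tr (gx k * \<sigma> (gu j)) - gam j k \<in> Tr ` T"
proof -
 have "inverse 2 * Tr (gx j * gx k) \<in> Tr ` T"
  by (rule TrT_smult[OF two(3)]) (use gx(3) assms in auto)
 then have "Tr (gx j * gx k) / 2 \<in> Tr ` T" by (simp only: divide_inverse_commute)
 from TrT_add[OF gu(3)[OF assms] this] show ?thesis
  unfolding gx_def Tr_delta_sigma by (simp add: algebra_simps)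
qed

text \<open>Expanding v in the generators allows u to be taken in \<open>F (- b)\<close>. The trace
  then lies in \<open>F ((p - 2) * b)\<close>, hence in \<open>F b\<close> as p >= 3. Since p(mu j -
  1) < b for every j, rounding makes it divisible by all the \<open>s ^ mu j\<close>, so it
  annihilates every odd class.\<close>

lemma triple_product:
 assumes y: "y \<in> T" "Tr y = 0" and v: "v \<in> T" "Tr v = 0" "\<delta> u = v" and w: "w \<in> T" "Tr w = 0"
 shows "Tr (w * \<sigma> u) * y \<in> \<delta> ` T"
proof -
 obtain c where c: "\<forall>j\<in>J. c j \<in> S" "y = (\<Sum>j\<in>J. c j * gx j)" using kernel_trace[OF y] by blast
 obtain d where d: "\<forall>j\<in>J. d j \<in> S" "v = (\<Sum>j\<in>J. d j * gx j)" using kernel_trace[OF v(1,2)] by blast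
 define u' where "u' = (\<Sum>j\<in>J. d j * gu j)"
 have "\<delta> u' = v" unfolding u'_def d(2) delta_sum gx_def
  by (rule sum.cong) (use d(1) in \<open>auto simp: delta_fixed_mult S_sigma\<close>)
 \<comment> \<open>Two preimages of v differ by a fixed element, which comes out of the trace and
   meets Tr w = 0.\<close>
 then have "\<sigma> (u - u') = u - u'" using v(3) by (simp add: \<delta>_def G_diff algebra_simps)
 then have "Tr (w * \<sigma> (u - u')) = 0" using Tr_fixed_mult[of "u - u'" w] w(2) by (simp add: mult.commute)
 then have a: "Tr (w * \<sigma> u) = Tr (w * \<sigma> u')" by (simp add: G_diff Tr_diff right_diff_distrib)
 have "u' \<in> F (- int b)" unfolding u'_def
 proof (rule F_sum)
  fix j assume j: "j \<in> J"
  then have "gu j \<in> F (- int b)" using gu(2)[OF j] by (simp add: F_def)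
  then show "d j * gu j \<in> F (- int b)" using d(1) j F_mult_T S_T by blast
 qed
 then have "w * \<sigma> u' \<in> F (- int b)" using F_mult_T[OF w(1)] F_G[OF sigma_G] by blast
 then have "Tr (w * \<sigma> u') \<in> F (- int b + (int p - 1) * int b)" by (rule Tr_F_strong)
 then have "Tr (w * \<sigma> u') \<in> F (int b)"
 proof (rule F_mono)
  have "3 * int b \<le> int p * int b" using p_ge_3 by (intro mult_right_mono) auto
  then show "int b \<le> - int b + (int p - 1) * int b" by (simp add: algebra_simps)
 qed
 then have aF: "Tr (w * \<sigma> u) \<in> F (int b)" using a by simp
 have aS: "\<exists>e\<in>S. Tr (w * \<sigma> u) = s ^ mu j * e" if "j \<in> J" for j
 proof -
  have "int b = int p * int (b div p) + int (b mod p)" by (metis mult_div_mod_eq of_nat_add of_nat_mult)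
  then have "int b > int p * (int (mu j) - 1)" using p_ge_3 by (auto simp: mu_def algebra_simps)
  from fixed_F_ceil[OF _ aF this] have "Tr (w * \<sigma> u) \<in> F (int p * int (mu j))" by simp
  then show ?thesis using S_dvd_iff[of "Tr (w * \<sigma> u)" "mu j"] by auto
 qed
 have "0 \<le> int b" by simp
 then have AS: "Tr (w * \<sigma> u) \<in> S" using F_T[OF aF] by (simp add: fixed_S)
 have "Tr (w * \<sigma> u) * y = (\<Sum>j\<in>J. (Tr (w * \<sigma> u) * c j) * gx j)"
  unfolding c(2) sum_distrib_left by (simp add: mult.assoc)
 also have "\<dots> \<in> \<delta> ` T"
 proof (subst delta_image_iff)
  show "Tr (w * \<sigma> u) * c j \<in> S" if "j \<in> J" for j using AS c(1) that by auto
  show "\<forall>j\<in>J. \<exists>c'\<in>S. Tr (w * \<sigma> u) * c j = s ^ mu j * c'"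
  proof
   fix j assume j: "j \<in> J"
   then obtain e where "e \<in> S" "Tr (w * \<sigma> u) = s ^ mu j * e" using aS by blast
   then show "\<exists>c'\<in>S. Tr (w * \<sigma> u) * c j = s ^ mu j * c'"
    using c(1) j by (intro bexI[of _ "e * c j"]) auto
  qed
 qed
 finally show ?thesis .
qed

end

section \<open>Right modules and resolutions\<close>

locale rmod =
 fixes A :: "('a, 'r) ring_scheme" and M :: "('a, 'm, 'n) module_scheme"
 assumes right_module: "right_module A M"
begin

sublocale R: ring A
 using right_module by (simp add: right_module_def)

sublocale M: abelian_group M
 using right_module by (simp add: right_module_def)

lemma smult_closed [simp, intro]: "a \<in> carrier A ==> x \<in> carrier M ==> a \<odot>\<^bsub>M\<^esub> x \<in> carrier M"
 and smult_l_distr: "a \<in> carrier A ==> b \<in> carrier A ==> x \<in> carrier M ==>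
    (a \<oplus>\<^bsub>A\<^esub> b) \<odot>\<^bsub>M\<^esub> x = a \<odot>\<^bsub>M\<^esub> x \<oplus>\<^bsub>M\<^esub> b \<odot>\<^bsub>M\<^esub> x"
 and smult_r_distr: "a \<in> carrier A ==> x \<in> carrier M ==> y \<in> carrier M ==>
    a \<odot>\<^bsub>M\<^esub> (x \<oplus>\<^bsub>M\<^esub> y) = a \<odot>\<^bsub>M\<^esub> x \<oplus>\<^bsub>M\<^esub> a \<odot>\<^bsub>M\<^esub> y"
 and smult_assoc: "a \<in> carrier A ==> b \<in> carrier A ==> x \<in> carrier M ==>
    (a \<otimes>\<^bsub>A\<^esub> b) \<odot>\<^bsub>M\<^esub> x = b \<odot>\<^bsub>M\<^esub> (a \<odot>\<^bsub>M\<^esub> x)"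
 and smult_one [simp]: "x \<in> carrier M ==> \<one>\<^bsub>A\<^esub> \<odot>\<^bsub>M\<^esub> x = x"
 using right_module by (simp_all add: right_module_def)

lemma smult_r_null [simp]: assumes "a \<in> carrier A" shows "a \<odot>\<^bsub>M\<^esub> \<zero>\<^bsub>M\<^esub> = \<zero>\<^bsub>M\<^esub>"
proof -
 have "a \<odot>\<^bsub>M\<^esub> \<zero>\<^bsub>M\<^esub> \<oplus>\<^bsub>M\<^esub> a \<odot>\<^bsub>M\<^esub> \<zero>\<^bsub>M\<^esub> = a \<odot>\<^bsub>M\<^esub> \<zero>\<^bsub>M\<^esub>"
  using smult_r_distr[OF assms M.zero_closed M.zero_closed] by simp
 then show ?thesis using assms M.add.l_cancel_one[of "a \<odot>\<^bsub>M\<^esub> \<zero>\<^bsub>M\<^esub>" "a \<odot>\<^bsub>M\<^esub> \<zero>\<^bsub>M\<^esub>"] by simp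
qed

lemma smult_l_null [simp]: assumes "x \<in> carrier M" shows "\<zero>\<^bsub>A\<^esub> \<odot>\<^bsub>M\<^esub> x = \<zero>\<^bsub>M\<^esub>"
proof -
 have "\<zero>\<^bsub>A\<^esub> \<odot>\<^bsub>M\<^esub> x \<oplus>\<^bsub>M\<^esub> \<zero>\<^bsub>A\<^esub> \<odot>\<^bsub>M\<^esub> x = \<zero>\<^bsub>A\<^esub> \<odot>\<^bsub>M\<^esub> x"
  using smult_l_distr[OF R.zero_closed R.zero_closed assms] by simp
 then show ?thesis using assms M.add.l_cancel_one[of "\<zero>\<^bsub>A\<^esub> \<odot>\<^bsub>M\<^esub> x" "\<zero>\<^bsub>A\<^esub> \<odot>\<^bsub>M\<^esub> x"] by simp
qed

lemma smult_r_minus: assumes "a \<in> carrier A" "x \<in> carrier M"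
 shows "a \<odot>\<^bsub>M\<^esub> (\<ominus>\<^bsub>M\<^esub> x) = \<ominus>\<^bsub>M\<^esub> (a \<odot>\<^bsub>M\<^esub> x)"
proof -
 have "a \<odot>\<^bsub>M\<^esub> (\<ominus>\<^bsub>M\<^esub> x) \<oplus>\<^bsub>M\<^esub> a \<odot>\<^bsub>M\<^esub> x = \<zero>\<^bsub>M\<^esub>"
  using assms smult_r_distr[of a "\<ominus>\<^bsub>M\<^esub> x" x] by (simp add: M.l_neg)
 then show ?thesis using assms by (metis M.a_inv_closed M.minus_equality smult_closed)
qed

lemma smult_r_diff: "a \<in> carrier A ==> x \<in> carrier M ==> y \<in> carrier M ==>
  a \<odot>\<^bsub>M\<^esub> (x \<ominus>\<^bsub>M\<^esub> y) = a \<odot>\<^bsub>M\<^esub> x \<ominus>\<^bsub>M\<^esub> a \<odot>\<^bsub>M\<^esub> y"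
 by (simp add: a_minus_def smult_r_distr smult_r_minus)

lemma eq_diff_zero: "x \<in> carrier M ==> y \<in> carrier M ==> x \<ominus>\<^bsub>M\<^esub> y = \<zero>\<^bsub>M\<^esub> \<longleftrightarrow> x = y"
 by (metis M.a_inv_closed M.add.inv_equality M.minus_minus M.r_neg a_minus_def)

end

lemma right_homD:
 assumes "f \<in> right_hom A M N"
 shows "x \<in> carrier M ==> f x \<in> carrier N"
  "x \<in> carrier M ==> y \<in> carrier M ==> f (x \<oplus>\<^bsub>M\<^esub> y) = f x \<oplus>\<^bsub>N\<^esub> f y"
  "a \<in> carrier A ==> x \<in> carrier M ==> f (a \<odot>\<^bsub>M\<^esub> x) = a \<odot>\<^bsub>N\<^esub> f x"
  "f \<in> extensional (carrier M)"
 using assms by (auto simp: right_hom_def PiE_def)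

lemma right_homI:
 assumes "right_module A M" "!!x. x \<in> carrier M ==> f x \<in> carrier N"
  "!!x y. x \<in> carrier M ==> y \<in> carrier M ==> f (x \<oplus>\<^bsub>M\<^esub> y) = f x \<oplus>\<^bsub>N\<^esub> f y"
  "!!a x. a \<in> carrier A ==> x \<in> carrier M ==> f (a \<odot>\<^bsub>M\<^esub> x) = a \<odot>\<^bsub>N\<^esub> f x"
 shows "(\<lambda>x\<in>carrier M. f x) \<in> right_hom A M N"
proof -
 interpret rmod A M by standard fact
 show ?thesis using assms(2-) by (auto simp: right_hom_def)
qed

lemma right_hom_zero: assumes "right_module A M" "right_module A N" "f \<in> right_hom A M N"
 shows "f \<zero>\<^bsub>M\<^esub> = \<zero>\<^bsub>N\<^esub>"
proof -
 interpret M: rmod A M by standard fact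
 interpret N: rmod A N by standard fact
 have "f \<zero>\<^bsub>M\<^esub> \<oplus>\<^bsub>N\<^esub> f \<zero>\<^bsub>M\<^esub> = f \<zero>\<^bsub>M\<^esub>" using right_homD(2)[OF assms(3), of "\<zero>\<^bsub>M\<^esub>" "\<zero>\<^bsub>M\<^esub>"] by simp
 then show ?thesis
  using right_homD(1)[OF assms(3), of "\<zero>\<^bsub>M\<^esub>"] N.M.add.l_cancel_one[of "f \<zero>\<^bsub>M\<^esub>" "f \<zero>\<^bsub>M\<^esub>"] by simp
qed

lemma right_hom_minus: assumes "right_module A M" "right_module A N" "f \<in> right_hom A M N" "x \<in> carrier M"
 shows "f (\<ominus>\<^bsub>M\<^esub> x) = \<ominus>\<^bsub>N\<^esub> f x"
proof -
 interpret M: rmod A M by standard fact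
 interpret N: rmod A N by standard fact
 have "f (\<ominus>\<^bsub>M\<^esub> x) \<oplus>\<^bsub>N\<^esub> f x = \<zero>\<^bsub>N\<^esub>"
  using right_homD(2)[OF assms(3), of "\<ominus>\<^bsub>M\<^esub> x" x] right_hom_zero[OF assms(1-3)] assms(4) by (simp add: M.M.l_neg)
 then show ?thesis
  using N.M.minus_equality[of "f (\<ominus>\<^bsub>M\<^esub> x)" "f x"] right_homD(1)[OF assms(3)] assms(4) by simp
qed

lemma right_hom_diff: assumes "right_module A M" "right_module A N" "f \<in> right_hom A M N" "x \<in> carrier M" "y \<in> carrier M"
 shows "f (x \<ominus>\<^bsub>M\<^esub> y) = f x \<ominus>\<^bsub>N\<^esub> f y"
proof -
 interpret M: rmod A M by standard fact
 show ?thesis using assms right_hom_minus[OF assms(1-3)] right_homD(2)[OF assms(3), of x "\<ominus>\<^bsub>M\<^esub> y"]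
  by (simp add: a_minus_def)
qed

lemma right_hom_comp:
 assumes "right_module A M" "f \<in> right_hom A M N" "g \<in> right_hom A N L"
 shows "(\<lambda>x\<in>carrier M. g (f x)) \<in> right_hom A M L"
 by (rule right_homI[OF assms(1)]) (use assms in \<open>auto simp: right_homD[OF assms(2)] right_homD[OF assms(3)]\<close>)

lemma right_hom_sub:
 assumes "right_module A M" "right_module A N" "f \<in> right_hom A M N" "g \<in> right_hom A M N"
 shows "(\<lambda>x\<in>carrier M. f x \<ominus>\<^bsub>N\<^esub> g x) \<in> right_hom A M N"
proof -
 interpret N: rmod A N by standard fact
 note h = right_homD[OF assms(3)] right_homD[OF assms(4)]
 show ?thesis
  by (rule right_homI[OF assms(1)])
   (use h in \<open>auto simp: N.smult_r_distr N.smult_r_minus a_minus_def N.M.minus_add N.M.a_ac\<close>)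
qed

lemma right_hom_add:
 assumes "right_module A M" "right_module A N" "f \<in> right_hom A M N" "g \<in> right_hom A M N"
 shows "(\<lambda>x\<in>carrier M. f x \<oplus>\<^bsub>N\<^esub> g x) \<in> right_hom A M N"
proof -
 interpret N: rmod A N by standard fact
 note h = right_homD[OF assms(3)] right_homD[OF assms(4)]
 show ?thesis
  by (rule right_homI[OF assms(1)]) (use h in \<open>auto simp: N.smult_r_distr N.M.a_ac\<close>)
qed

lemma right_hom_ext: "f \<in> right_hom A M N ==> g \<in> right_hom A M N ==>
 (!!x. x \<in> carrier M ==> f x = g x) ==> f = g"
 by (rule extensionalityI[OF right_homD(4) right_homD(4)])

subsection \<open>Projective modules\<close>

lemma free_right_module_simps [simp]:
 "carrier (free_right_module A U) = {f. (\<forall>x\<in>U. f x \<in> carrier A) & (\<forall>x. x \<notin> U --> f x = \<zero>\<^bsub>A\<^esub>) &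
          finite {x. f x ~= \<zero>\<^bsub>A\<^esub>}}"
 "\<zero>\<^bsub>free_right_module A U\<^esub> = (%_. \<zero>\<^bsub>A\<^esub>)"
 "f \<oplus>\<^bsub>free_right_module A U\<^esub> g = (%x. f x \<oplus>\<^bsub>A\<^esub> g x)"
 "a \<odot>\<^bsub>free_right_module A U\<^esub> f = (%x. f x \<otimes>\<^bsub>A\<^esub> a)"
 by (simp_all add: free_right_module_def)

lemma free_right_module_hom_eqI:
 fixes A :: "('a, 'r) ring_scheme" and U :: "'u set"
 defines "Fr \<equiv> free_right_module A U" and "e \<equiv> %u x. if x = u then \<one>\<^bsub>A\<^esub> else \<zero>\<^bsub>A\<^esub>"
 assumes N: "right_module A N"
  and f: "f \<in> right_hom A Fr N" and g: "g \<in> right_hom A Fr N"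
  and eq: "!!u. u \<in> U ==> f (e u) = g (e u)" and phi: "\<phi> \<in> carrier Fr"
 shows "f \<phi> = g \<phi>"
proof -
 interpret N: rmod A N by standard fact
 have e: "e u \<in> carrier Fr" if "u \<in> U" for u using that by (auto simp: Fr_def e_def)
 have "finite V ==> \<forall>\<phi>\<in>carrier Fr. {x. \<phi> x ~= \<zero>\<^bsub>A\<^esub>} \<subseteq> V --> f \<phi> = g \<phi>" for V
 proof (induction V rule: finite_induct)
  case empty
  show ?case
  proof (intro ballI impI)
   fix \<phi> assume h: "\<phi> \<in> carrier Fr" "{x. \<phi> x ~= \<zero>\<^bsub>A\<^esub>} \<subseteq> {}"
   then have "\<phi> = (%x. \<phi> x \<otimes>\<^bsub>A\<^esub> \<zero>\<^bsub>A\<^esub>)" by auto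
   then have "\<phi> = \<zero>\<^bsub>A\<^esub> \<odot>\<^bsub>Fr\<^esub> \<phi>" by (simp add: Fr_def)
   then show "f \<phi> = g \<phi>"
    using right_homD(1,3)[OF f] right_homD(1,3)[OF g] h(1) N.R.zero_closed N.smult_l_null by metis
  qed
 next
  case (insert u V)
  show ?case
  proof (intro ballI impI)
   fix \<phi> assume h: "\<phi> \<in> carrier Fr" "{x. \<phi> x ~= \<zero>\<^bsub>A\<^esub>} \<subseteq> insert u V"
   show "f \<phi> = g \<phi>"
   proof (cases "u \<in> U")
    case False
    then have "\<phi> u = \<zero>\<^bsub>A\<^esub>" using h(1) by (simp add: Fr_def)
    then have "{x. \<phi> x ~= \<zero>\<^bsub>A\<^esub>} \<subseteq> V" using h(2) by auto
    then show ?thesis using insert.IH h(1) by blast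
   next
    case True
    define \<psi> where "\<psi> = (%x. if x = u then \<zero>\<^bsub>A\<^esub> else \<phi> x)"
    have pu: "\<phi> u \<in> carrier A" using h(1) True by (simp add: Fr_def)
    have "{x. \<psi> x ~= \<zero>\<^bsub>A\<^esub>} \<subseteq> {x. \<phi> x ~= \<zero>\<^bsub>A\<^esub>}" by (auto simp: \<psi>_def)
    then have "finite {x. \<psi> x ~= \<zero>\<^bsub>A\<^esub>}" by (rule finite_subset) (use h(1) in \<open>simp add: Fr_def\<close>)
    moreover have "\<forall>x\<in>U. \<psi> x \<in> carrier A" "\<forall>x. x \<notin> U --> \<psi> x = \<zero>\<^bsub>A\<^esub>"
     using h(1) by (auto simp: Fr_def \<psi>_def)
    ultimately have psi: "\<psi> \<in> carrier Fr" by (simp add: Fr_def)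
    have "{x. \<psi> x ~= \<zero>\<^bsub>A\<^esub>} \<subseteq> V" using h(2) by (auto simp: \<psi>_def)
    then have "f \<psi> = g \<psi>" using insert.IH psi by blast
    moreover have "\<phi> = \<psi> \<oplus>\<^bsub>Fr\<^esub> \<phi> u \<odot>\<^bsub>Fr\<^esub> e u"
    proof
     fix x
     have "\<phi> x \<in> carrier A" using h(1) by (cases "x \<in> U") (simp_all add: Fr_def)
     then show "\<phi> x = (\<psi> \<oplus>\<^bsub>Fr\<^esub> \<phi> u \<odot>\<^bsub>Fr\<^esub> e u) x"
      using pu by (simp add: Fr_def \<psi>_def e_def)
    qed
    moreover have "\<phi> u \<odot>\<^bsub>Fr\<^esub> e u \<in> carrier Fr"
     using pu True by (auto simp: Fr_def e_def elim: rev_finite_subset[of "{u}"])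
    ultimately show ?thesis
     using right_homD(2)[OF f psi] right_homD(2)[OF g psi] right_homD(3)[OF f pu e[OF True]]
      right_homD(3)[OF g pu e[OF True]] eq[OF True] by metis
   qed
  qed
 qed
 moreover have "finite {x. \<phi> x ~= \<zero>\<^bsub>A\<^esub>}" using phi by (simp add: Fr_def)
 ultimately show ?thesis using phi by blast
qed

lemma free_right_module_extend:
 fixes A :: "('a, 'r) ring_scheme" and U :: "'u set"
 defines "Fr \<equiv> free_right_module A U" and "e \<equiv> %u x. if x = u then \<one>\<^bsub>A\<^esub> else \<zero>\<^bsub>A\<^esub>"
 assumes N: "right_module A N" and m: "!!u. u \<in> U ==> m u \<in> carrier N"
 shows "\<exists>h\<in>right_hom A Fr N. \<forall>u\<in>U. h (e u) = m u"
proof -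
 interpret N: rmod A N by standard fact
 define H where "H \<phi> = (\<Oplus>\<^bsub>N\<^esub>u\<in>{u. \<phi> u ~= \<zero>\<^bsub>A\<^esub>}. \<phi> u \<odot>\<^bsub>N\<^esub> m u)" for \<phi>
 have supp: "u \<in> U" "\<phi> u \<in> carrier A" if "\<phi> \<in> carrier Fr" "\<phi> u ~= \<zero>\<^bsub>A\<^esub>" for \<phi> u
  using that by (auto simp: Fr_def)
 have H: "H \<phi> = (\<Oplus>\<^bsub>N\<^esub>u\<in>V. \<phi> u \<odot>\<^bsub>N\<^esub> m u)"
  if "\<phi> \<in> carrier Fr" "finite V" "V \<subseteq> U" "{u. \<phi> u ~= \<zero>\<^bsub>A\<^esub>} \<subseteq> V" for \<phi> V
  unfolding H_def using that m supp[OF that(1)]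
  by (intro N.M.add.finprod_mono_neutral_cong_left) (auto simp: Fr_def)
 have fin: "finite {u. \<phi> u ~= \<zero>\<^bsub>A\<^esub>}" "{u. \<phi> u ~= \<zero>\<^bsub>A\<^esub>} \<subseteq> U" if "\<phi> \<in> carrier Fr" for \<phi>
  using that supp[OF that] by (auto simp: Fr_def)
 have val: "\<phi> u \<in> carrier A" if "\<phi> \<in> carrier Fr" "u \<in> U" for \<phi> u using that by (simp add: Fr_def)
 have hom: "(\<lambda>\<phi>\<in>carrier Fr. H \<phi>) \<in> right_hom A Fr N"
 proof -
  have "H \<phi> \<in> carrier N" if "\<phi> \<in> carrier Fr" for \<phi>
   unfolding H_def using supp[OF that] m by (intro N.M.finsum_closed) auto
  moreover have "\<phi> \<oplus>\<^bsub>Fr\<^esub> \<psi> \<in> carrier Fr & H (\<phi> \<oplus>\<^bsub>Fr\<^esub> \<psi>) = H \<phi> \<oplus>\<^bsub>N\<^esub> H \<psi>"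
   if p: "\<phi> \<in> carrier Fr" "\<psi> \<in> carrier Fr" for \<phi> \<psi>
  proof -
   define V where "V = {u. \<phi> u ~= \<zero>\<^bsub>A\<^esub>} \<union> {u. \<psi> u ~= \<zero>\<^bsub>A\<^esub>}"
   have V: "finite V" "V \<subseteq> U" "{u. \<phi> u ~= \<zero>\<^bsub>A\<^esub>} \<subseteq> V" "{u. \<psi> u ~= \<zero>\<^bsub>A\<^esub>} \<subseteq> V"
    "{u. \<phi> u \<oplus>\<^bsub>A\<^esub> \<psi> u ~= \<zero>\<^bsub>A\<^esub>} \<subseteq> V"
    using fin[OF p(1)] fin[OF p(2)] by (auto simp: V_def)
   have s: "\<phi> \<oplus>\<^bsub>Fr\<^esub> \<psi> \<in> carrier Fr"
    using p V finite_subset[OF V(5) V(1)] by (auto simp: Fr_def)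
   have "H (\<phi> \<oplus>\<^bsub>Fr\<^esub> \<psi>) = (\<Oplus>\<^bsub>N\<^esub>u\<in>V. (\<phi> u \<oplus>\<^bsub>A\<^esub> \<psi> u) \<odot>\<^bsub>N\<^esub> m u)"
    using H[OF s V(1,2)] V(5) by (simp add: Fr_def)
   also have "\<dots> = (\<Oplus>\<^bsub>N\<^esub>u\<in>V. \<phi> u \<odot>\<^bsub>N\<^esub> m u \<oplus>\<^bsub>N\<^esub> \<psi> u \<odot>\<^bsub>N\<^esub> m u)"
    using V(2) m val[OF p(1)] val[OF p(2)]
    by (intro N.M.add.finprod_cong') (auto simp: N.smult_l_distr subset_eq)
   also have "\<dots> = H \<phi> \<oplus>\<^bsub>N\<^esub> H \<psi>"
    using V m val[OF p(1)] val[OF p(2)] H[OF p(1) V(1,2,3)] H[OF p(2) V(1,2,4)]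
    by (simp, intro N.M.finsum_addf) (auto simp: subset_eq)
   finally show ?thesis using s by simp
  qed
  moreover have "a \<odot>\<^bsub>Fr\<^esub> \<phi> \<in> carrier Fr & H (a \<odot>\<^bsub>Fr\<^esub> \<phi>) = a \<odot>\<^bsub>N\<^esub> H \<phi>"
   if p: "a \<in> carrier A" "\<phi> \<in> carrier Fr" for a \<phi>
  proof -
   define V where "V = {u. \<phi> u ~= \<zero>\<^bsub>A\<^esub>}"
   have V: "finite V" "V \<subseteq> U" "{u. \<phi> u \<otimes>\<^bsub>A\<^esub> a ~= \<zero>\<^bsub>A\<^esub>} \<subseteq> V"
    using fin[OF p(2)] p(1) by (auto simp: V_def)
   have s: "a \<odot>\<^bsub>Fr\<^esub> \<phi> \<in> carrier Fr"
    using p V finite_subset[OF V(3) V(1)] by (auto simp: Fr_def)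
   have "H (a \<odot>\<^bsub>Fr\<^esub> \<phi>) = (\<Oplus>\<^bsub>N\<^esub>u\<in>V. (\<phi> u \<otimes>\<^bsub>A\<^esub> a) \<odot>\<^bsub>N\<^esub> m u)"
    using H[OF s V(1,2)] V(3) by (simp add: Fr_def)
   also have "\<dots> = (\<Oplus>\<^bsub>N\<^esub>u\<in>V. a \<odot>\<^bsub>N\<^esub> (\<phi> u \<odot>\<^bsub>N\<^esub> m u))"
    using V(2) m val[OF p(2)] p(1)
    by (intro N.M.add.finprod_cong') (auto simp: N.smult_assoc subset_eq)
   also have "\<dots> = a \<odot>\<^bsub>N\<^esub> (\<Oplus>\<^bsub>N\<^esub>u\<in>V. \<phi> u \<odot>\<^bsub>N\<^esub> m u)"
    using V(1,2)
   proof (induction V rule: finite_induct)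
    case (insert u V)
    have "\<phi> v \<odot>\<^bsub>N\<^esub> m v \<in> carrier N" if "v \<in> insert u V" for v
     using that insert.prems m val[OF p(2)] by auto
    then show ?case using insert p(1) by (simp add: N.M.finsum_insert N.smult_r_distr Pi_def)
   qed (simp add: p(1))
   finally show ?thesis using s by (simp add: H_def V_def)
  qed
  ultimately show ?thesis by (auto simp: right_hom_def)
 qed
 moreover have "H (e u) = m u" if u: "u \<in> U" for u
 proof -
  have eu: "e u \<in> carrier Fr" using u by (auto simp: Fr_def e_def)
  have "H (e u) = (\<Oplus>\<^bsub>N\<^esub>v\<in>{u}. e u v \<odot>\<^bsub>N\<^esub> m v)" by (rule H[OF eu]) (use u in \<open>auto simp: e_def\<close>)
  also have "\<dots> = m u" using m[OF u] by (simp add: e_def)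
  finally show ?thesis .
 qed
 moreover have "e u \<in> carrier Fr" if "u \<in> U" for u using that by (auto simp: Fr_def e_def)
 ultimately show ?thesis by (intro bexI[of _ "\<lambda>\<phi>\<in>carrier Fr. H \<phi>"]) auto
qed

text \<open>The lift is chosen on the basis of a free module having P as a direct summand and then
  restricted to P. The two maps to compare agree on basis elements, hence on the whole free
  module.\<close>

lemma projective_lift:
 fixes P :: "('a, 'm) module"
 assumes P: "projective_module A P" and N: "right_module A N" and Y: "right_module A Y"
  and f: "f \<in> right_hom A P Y" and g: "g \<in> right_hom A N Y"
  and fg: "!!x. x \<in> carrier P ==> f x \<in> g ` carrier N"
 shows "\<exists>h\<in>right_hom A P N. \<forall>x\<in>carrier P. g (h x) = f x"
proof -
 interpret N: rmod A N by standard fact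
 obtain U :: "'m set" and i r where i: "i \<in> right_hom A P (free_right_module A U)"
  and r: "r \<in> right_hom A (free_right_module A U) P" and ri: "\<forall>x\<in>carrier P. r (i x) = x"
  using P unfolding projective_module_def by blast
 have rP: "right_module A P" using P by (simp add: projective_module_def)
 define e where "e = (%(u::'m) x. if x = u then \<one>\<^bsub>A\<^esub> else \<zero>\<^bsub>A\<^esub>)"
 have e: "e u \<in> carrier (free_right_module A U)" if "u \<in> U" for u using that by (auto simp: e_def)
 have "\<exists>x. x \<in> carrier N & g x = f (r (e u))" if "u \<in> U" for u
  using fg[OF right_homD(1)[OF r e[OF that]]] by (metis imageE)
 then obtain m where m: "!!u. u \<in> U ==> m u \<in> carrier N & g (m u) = f (r (e u))" by metis
 obtain H where H: "H \<in> right_hom A (free_right_module A U) N" "!!u. u \<in> U ==> H (e u) = m u"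
  using free_right_module_extend[OF N, of U m] m unfolding e_def by blast
 have homs: "(\<lambda>\<phi>\<in>carrier (free_right_module A U). g (H \<phi>)) \<in> right_hom A (free_right_module A U) Y"
  "(\<lambda>\<phi>\<in>carrier (free_right_module A U). f (r \<phi>)) \<in> right_hom A (free_right_module A U) Y"
 proof -
  have cl: "x \<oplus>\<^bsub>free_right_module A U\<^esub> y \<in> carrier (free_right_module A U)"
   if "x \<in> carrier (free_right_module A U)" "y \<in> carrier (free_right_module A U)" for x y
  proof -
   have "{u. x u \<oplus>\<^bsub>A\<^esub> y u ~= \<zero>\<^bsub>A\<^esub>} \<subseteq> {u. x u ~= \<zero>\<^bsub>A\<^esub>} \<union> {u. y u ~= \<zero>\<^bsub>A\<^esub>}" by auto
   then show ?thesis using that by (auto intro: finite_subset)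
  qed
  have cs: "a \<odot>\<^bsub>free_right_module A U\<^esub> x \<in> carrier (free_right_module A U)"
   if "x \<in> carrier (free_right_module A U)" "a \<in> carrier A" for a x
  proof -
   have "{u. x u \<otimes>\<^bsub>A\<^esub> a ~= \<zero>\<^bsub>A\<^esub>} \<subseteq> {u. x u ~= \<zero>\<^bsub>A\<^esub>}" using that by auto
   then show ?thesis using that by (auto intro: finite_subset)
  qed
  show "(\<lambda>\<phi>\<in>carrier (free_right_module A U). g (H \<phi>)) \<in> right_hom A (free_right_module A U) Y"
   unfolding right_hom_def
   using cl cs right_homD[OF H(1)] right_homD[OF g]
   by (auto simp del: free_right_module_simps)
  show "(\<lambda>\<phi>\<in>carrier (free_right_module A U). f (r \<phi>)) \<in> right_hom A (free_right_module A U) Y"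
   unfolding right_hom_def
   using cl cs right_homD[OF r] right_homD[OF f]
   by (auto simp del: free_right_module_simps)
 qed
 have "g (H \<phi>) = f (r \<phi>)" if "\<phi> \<in> carrier (free_right_module A U)" for \<phi>
 proof -
  have "(\<lambda>\<phi>\<in>carrier (free_right_module A U). g (H \<phi>)) \<phi> = (\<lambda>\<phi>\<in>carrier (free_right_module A U). f (r \<phi>)) \<phi>"
   by (rule free_right_module_hom_eqI[OF Y homs _ that])
    (use e[unfolded e_def] m[unfolded e_def] H(2)[unfolded e_def] in
     \<open>simp del: free_right_module_simps\<close>)
  then show ?thesis using that by (simp del: free_right_module_simps)
 qed
 moreover have "i x \<in> carrier (free_right_module A U)" if "x \<in> carrier P" for x
  using right_homD(1)[OF i that] .
 ultimately show ?thesis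
  using right_hom_comp[OF rP i H(1)] ri by (intro bexI[of _ "\<lambda>x\<in>carrier P. H (i x)"]) auto
qed

subsection \<open>Comparison of resolutions\<close>

text \<open>Only exactness is recorded. In the comparison lemmas projectivity is a condition on the
  complex that is mapped in, so they apply both with the given resolution and with the periodic one
  as target.\<close>

locale resolution =
 fixes A :: "('a, 'r) ring_scheme" and M :: "('a, 'k, 'y) module_scheme"
  and R :: "nat => ('a, 'm, 'x) module_scheme" and D :: "nat => 'm => 'm" and aug :: "'m => 'k"
 assumes M: "right_module A M" and R: "right_module A (R n)"
  and D: "D n \<in> right_hom A (R (Suc n)) (R n)" and aug: "aug \<in> right_hom A (R 0) M"
  and aug_surj: "aug ` carrier (R 0) = carrier M"
  and exact_0: "D 0 ` carrier (R 1) = {x \<in> carrier (R 0). aug x = \<zero>\<^bsub>M\<^esub>}"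
  and exact: "D (Suc n) ` carrier (R (Suc (Suc n))) = {x \<in> carrier (R (Suc n)). D n x = \<zero>\<^bsub>R n\<^esub>}"
begin

lemma rmod_R: "rmod A (R n)" and rmod_M: "rmod A M"
 using R M by (simp_all add: rmod_def)

sublocale M: rmod A M by (rule rmod_M)

lemma D_closed [simp]: "x \<in> carrier (R (Suc n)) ==> D n x \<in> carrier (R n)"
 and D_add: "x \<in> carrier (R (Suc n)) ==> y \<in> carrier (R (Suc n)) ==> D n (x \<oplus>\<^bsub>R (Suc n)\<^esub> y) = D n x \<oplus>\<^bsub>R n\<^esub> D n y"
 and D_smult: "a \<in> carrier A ==> x \<in> carrier (R (Suc n)) ==> D n (a \<odot>\<^bsub>R (Suc n)\<^esub> x) = a \<odot>\<^bsub>R n\<^esub> D n x"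
 using right_homD[OF D] by auto

lemma D_diff: "x \<in> carrier (R (Suc n)) ==> y \<in> carrier (R (Suc n)) ==> D n (x \<ominus>\<^bsub>R (Suc n)\<^esub> y) = D n x \<ominus>\<^bsub>R n\<^esub> D n y"
 by (rule right_hom_diff[OF R R D])

lemma aug_D: "x \<in> carrier (R 1) ==> aug (D 0 x) = \<zero>\<^bsub>M\<^esub>"
 and D_D: "x \<in> carrier (R (Suc (Suc n))) ==> D n (D (Suc n) x) = \<zero>\<^bsub>R n\<^esub>"
 using exact_0 exact[of n] by blast+

lemma aug_preimage: "x \<in> carrier M ==> \<exists>y\<in>carrier (R 0). aug y = x"
 using aug_surj by (metis imageE)

lemma D0_preimage: "x \<in> carrier (R 0) ==> aug x = \<zero>\<^bsub>M\<^esub> ==> \<exists>y\<in>carrier (R 1). D 0 y = x"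
proof -
 assume "x \<in> carrier (R 0)" "aug x = \<zero>\<^bsub>M\<^esub>"
 then have "x \<in> D 0 ` carrier (R 1)" unfolding exact_0 by simp
 then show ?thesis by auto
qed

lemma D_preimage: "x \<in> carrier (R (Suc n)) ==> D n x = \<zero>\<^bsub>R n\<^esub> ==> \<exists>y\<in>carrier (R (Suc (Suc n))). D (Suc n) y = x"
proof -
 assume "x \<in> carrier (R (Suc n))" "D n x = \<zero>\<^bsub>R n\<^esub>"
 then have "x \<in> D (Suc n) ` carrier (R (Suc (Suc n)))" unfolding exact by simp
 then show ?thesis by auto
qed

text \<open>A chain map from the complex of free modules of rank one with differentials \<open>e\<close> is given by
 the images \<open>a k\<close> of the generators.\<close>

lemma element_chain:
 assumes e: "!!k. e k \<in> carrier A" "!!k. e k \<otimes>\<^bsub>A\<^esub> e (Suc k) = \<zero>\<^bsub>A\<^esub>"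
  and m: "m \<in> carrier M" "e 1 \<odot>\<^bsub>M\<^esub> m = \<zero>\<^bsub>M\<^esub>"
 shows "\<exists>q. (\<forall>k. q k \<in> carrier (R k)) & aug (q 0) = m & (\<forall>k. D k (q (Suc k)) = e (Suc k) \<odot>\<^bsub>R k\<^esub> q k)"
proof -
 obtain q0 where q0: "q0 \<in> carrier (R 0)" "aug q0 = m" using aug_preimage[OF m(1)] by blast
 \<comment> \<open>For dependent choice the invariant must guarantee the next step:
   \<open>e (Suc k)\<close> applied to the chosen element is a cycle, directly for k > 0 and through
   the augmentation for k = 0.\<close>
 define Good where "Good k x \<longleftrightarrow> x \<in> carrier (R k) & (k = 0 --> aug x = m) &
  (\<forall>j. k = Suc j --> D j (e (Suc k) \<odot>\<^bsub>R k\<^esub> x) = \<zero>\<^bsub>R j\<^esub>)" for k x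
 have "\<exists>q. \<forall>k. Good k (q k) & D k (q (Suc k)) = e (Suc k) \<odot>\<^bsub>R k\<^esub> q k"
 proof (rule dependent_nat_choice)
  show "\<exists>x. Good 0 x" using q0 by (auto simp: Good_def)
 next
  fix x k assume g: "Good k x"
  interpret Rk: rmod A "R k" by (rule rmod_R)
  have x: "x \<in> carrier (R k)" "e (Suc k) \<odot>\<^bsub>R k\<^esub> x \<in> carrier (R k)" using g e(1) by (auto simp: Good_def)
  have "\<exists>y\<in>carrier (R (Suc k)). D k y = e (Suc k) \<odot>\<^bsub>R k\<^esub> x"
  proof (cases k)
   case 0
   then have "aug (e 1 \<odot>\<^bsub>R 0\<^esub> x) = \<zero>\<^bsub>M\<^esub>" using right_homD(3)[OF aug e(1)] g m(2) by (simp add: Good_def)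
   then show ?thesis using D0_preimage x 0 by simp
  next
   case (Suc j)
   then show ?thesis using D_preimage[of "e (Suc k) \<odot>\<^bsub>R k\<^esub> x" j] x g by (auto simp: Good_def)
  qed
  then obtain y where y: "y \<in> carrier (R (Suc k))" "D k y = e (Suc k) \<odot>\<^bsub>R k\<^esub> x" by blast
  have 1: "e (Suc k') \<odot>\<^bsub>R k\<^esub> (e k' \<odot>\<^bsub>R k\<^esub> x) = \<zero>\<^bsub>R k\<^esub>" for k'
   using Rk.smult_assoc[OF e(1) e(1) x(1), of k' "Suc k'"] e(2)[of k'] x(1) by simp
  have "D k (e (Suc (Suc k)) \<odot>\<^bsub>R (Suc k)\<^esub> y) = \<zero>\<^bsub>R k\<^esub>"
   using D_smult[OF e(1) y(1)] y(2) 1[of "Suc k"] by simp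
  then show "\<exists>y. Good (Suc k) y & D k y = e (Suc k) \<odot>\<^bsub>R k\<^esub> x"
   using y by (auto simp: Good_def)
 qed
 then show ?thesis by (auto simp: Good_def)
qed

text \<open>Uniqueness up to homotopy for chain maps given by the images of generators; it is meant
  for the difference of two such maps, whose augmentation vanishes.\<close>

lemma element_homotopy:
 assumes e: "!!k. e k \<in> carrier A" "!!k. e k \<otimes>\<^bsub>A\<^esub> e (Suc k) = \<zero>\<^bsub>A\<^esub>"
  and a: "!!k. a k \<in> carrier (R k)" "aug (a 0) = \<zero>\<^bsub>M\<^esub>" "!!k. D k (a (Suc k)) = e (Suc k) \<odot>\<^bsub>R k\<^esub> a k"
 shows "\<exists>r. (\<forall>k. r k \<in> carrier (R (Suc k))) & a 0 = D 0 (r 0) &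
  (\<forall>k. a (Suc k) = D (Suc k) (r (Suc k)) \<oplus>\<^bsub>R (Suc k)\<^esub> e (Suc k) \<odot>\<^bsub>R (Suc k)\<^esub> r k)"
proof -
 obtain r0 where r0: "r0 \<in> carrier (R (Suc 0))" "D 0 r0 = a 0" using D0_preimage[OF a(1,2)] by auto
 \<comment> \<open>The last condition says that \<open>e (Suc k)\<close> does not distinguish
   \<open>D k x\<close> from \<open>a k\<close>; this makes the remainder in the next degree a
   cycle.\<close>
 define Good where "Good k x \<longleftrightarrow> x \<in> carrier (R (Suc k)) & (k = 0 --> a 0 = D 0 x) &
  e (Suc k) \<odot>\<^bsub>R k\<^esub> D k x = e (Suc k) \<odot>\<^bsub>R k\<^esub> a k" for k x
 have "\<exists>r. \<forall>k. Good k (r k) & a (Suc k) = D (Suc k) (r (Suc k)) \<oplus>\<^bsub>R (Suc k)\<^esub> e (Suc k) \<odot>\<^bsub>R (Suc k)\<^esub> r k"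
 proof (rule dependent_nat_choice)
  show "\<exists>x. Good 0 x" using r0 by (auto simp: Good_def)
 next
  fix x k assume g: "Good k x"
  interpret Rk: rmod A "R k" by (rule rmod_R)
  interpret Rk1: rmod A "R (Suc k)" by (rule rmod_R)
  have x: "x \<in> carrier (R (Suc k))" "e (Suc k) \<odot>\<^bsub>R (Suc k)\<^esub> x \<in> carrier (R (Suc k))"
   using g e(1) by (auto simp: Good_def)
  define z where "z = a (Suc k) \<ominus>\<^bsub>R (Suc k)\<^esub> e (Suc k) \<odot>\<^bsub>R (Suc k)\<^esub> x"
  have z: "z \<in> carrier (R (Suc k))" using x a(1) by (simp add: z_def)
  have "D k z = e (Suc k) \<odot>\<^bsub>R k\<^esub> a k \<ominus>\<^bsub>R k\<^esub> e (Suc k) \<odot>\<^bsub>R k\<^esub> D k x"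
   using D_diff[OF a(1) x(2)] a(3) D_smult[OF e(1) x(1)] by (simp add: z_def)
  also have "\<dots> = \<zero>\<^bsub>R k\<^esub>" using g a(1) e(1) by (simp add: Good_def a_minus_def Rk.M.r_neg)
  finally obtain y where y: "y \<in> carrier (R (Suc (Suc k)))" "D (Suc k) y = z"
   using D_preimage[OF z] by blast
  have az: "a (Suc k) = z \<oplus>\<^bsub>R (Suc k)\<^esub> e (Suc k) \<odot>\<^bsub>R (Suc k)\<^esub> x"
   using x a(1)[of "Suc k"] by (simp add: z_def a_minus_def Rk1.M.a_assoc Rk1.M.l_neg)
  have "e (Suc (Suc k)) \<odot>\<^bsub>R (Suc k)\<^esub> (e (Suc k) \<odot>\<^bsub>R (Suc k)\<^esub> x) = \<zero>\<^bsub>R (Suc k)\<^esub>"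
   using Rk1.smult_assoc[OF e(1) e(1) x(1), of "Suc k" "Suc (Suc k)"] e(2)[of "Suc k"] x(1) by simp
  then have "e (Suc (Suc k)) \<odot>\<^bsub>R (Suc k)\<^esub> a (Suc k) = e (Suc (Suc k)) \<odot>\<^bsub>R (Suc k)\<^esub> z"
   unfolding az using Rk1.smult_r_distr[OF e(1) z x(2)] z e(1) by simp
  then show "\<exists>y. Good (Suc k) y & a (Suc k) = D (Suc k) y \<oplus>\<^bsub>R (Suc k)\<^esub> e (Suc k) \<odot>\<^bsub>R (Suc k)\<^esub> x"
   using y az by (auto simp: Good_def)
 qed
 then show ?thesis by (auto simp: Good_def)
qed

text \<open>The comparison theorem with a shift by i. As f is a cocycle, each map composed with the
  differential lands in the cycles of the target, and projectivity lifts it one degree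
  further.\<close>

lemma chain_lift_exists:
 fixes P :: "nat => ('a, 'q) module"
 assumes P: "!!k. projective_module A (P k)" and d: "!!k. d k \<in> right_hom A (P (Suc k)) (P k)"
  and dd: "!!k x. x \<in> carrier (P (Suc (Suc k))) ==> d k (d (Suc k) x) = \<zero>\<^bsub>P k\<^esub>"
  and f: "f \<in> right_hom A (P i) M" and fd: "!!x. x \<in> carrier (P (Suc i)) ==> f (d i x) = \<zero>\<^bsub>M\<^esub>"
 shows "\<exists>F. (\<forall>k. F k \<in> right_hom A (P (i + k)) (R k)) & (\<forall>x\<in>carrier (P i). aug (F 0 x) = f x) &
  (\<forall>k. \<forall>x\<in>carrier (P (i + Suc k)). D k (F (Suc k) x) = F k (d (i + k) x))"
proof -
 have rP: "right_module A (P k)" for k using P by (simp add: projective_module_def)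
 have dcl: "x \<in> carrier (P (Suc k)) ==> d k x \<in> carrier (P k)" for k x using right_homD(1)[OF d] .
 obtain F0 where F0: "F0 \<in> right_hom A (P i) (R 0)" "\<forall>x\<in>carrier (P i). aug (F0 x) = f x"
  using projective_lift[OF P R M f aug] right_homD(1)[OF f] aug_surj by auto
 define Good where "Good k F \<longleftrightarrow> F \<in> right_hom A (P (i + k)) (R k) &
  (k = 0 --> (\<forall>x\<in>carrier (P i). aug (F x) = f x)) &
  (\<forall>j. k = Suc j --> (\<forall>x\<in>carrier (P (Suc (i + k))). D j (F (d (i + k) x)) = \<zero>\<^bsub>R j\<^esub>))" for k F
 have "\<exists>F. \<forall>k. Good k (F k) & (\<forall>x\<in>carrier (P (i + Suc k)). D k (F (Suc k) x) = F k (d (i + k) x))"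
 proof (rule dependent_nat_choice)
  show "\<exists>F. Good 0 F" using F0 by (auto simp: Good_def)
 next
  fix F k assume g: "Good k F"
  then have F: "F \<in> right_hom A (P (i + k)) (R k)" by (simp add: Good_def)
  have comp: "(\<lambda>x\<in>carrier (P (Suc (i + k))). F (d (i + k) x)) \<in> right_hom A (P (Suc (i + k))) (R k)"
   by (rule right_hom_comp[OF rP d F])
  have "F (d (i + k) x) \<in> D k ` carrier (R (Suc k))" if x: "x \<in> carrier (P (Suc (i + k)))" for x
  proof (cases k)
   case 0
   then have "aug (F (d (i + k) x)) = \<zero>\<^bsub>M\<^esub>" using g fd[of x] dcl[OF x] x by (simp add: Good_def)
   then have "F (d (i + k) x) \<in> D 0 ` carrier (R 1)"
    unfolding exact_0 using right_homD(1)[OF F dcl[OF x]] 0 by simp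
   then show ?thesis using 0 by simp
  next
   case (Suc j)
   then have "D j (F (d (i + k) x)) = \<zero>\<^bsub>R j\<^esub>" using g x by (simp add: Good_def)
   then have "F (d (i + k) x) \<in> D (Suc j) ` carrier (R (Suc (Suc j)))"
    unfolding exact using right_homD(1)[OF F dcl[OF x]] Suc by simp
   then show ?thesis using Suc by simp
  qed
  then obtain H where H: "H \<in> right_hom A (P (Suc (i + k))) (R (Suc k))"
   "\<forall>x\<in>carrier (P (Suc (i + k))). D k (H x) = F (d (i + k) x)"
   using projective_lift[OF P R R comp D] by auto
  have "D k (H (d (Suc (i + k)) x)) = \<zero>\<^bsub>R k\<^esub>" if x: "x \<in> carrier (P (Suc (Suc (i + k))))" for x
   using H(2) dcl[OF x] dd[OF x] right_hom_zero[OF rP R F] by simp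
  then have "Good (Suc k) H" using H(1) by (simp add: Good_def)
  then show "\<exists>H. Good (Suc k) H & (\<forall>x\<in>carrier (P (i + Suc k)). D k (H x) = F (d (i + k) x))"
   using H(2) by auto
 qed
 then show ?thesis by (auto simp: Good_def)
qed

text \<open>The part of \<theta> not yet accounted for by the homotopy is killed by the
  differential, by the construction in the previous degree; exactness and projectivity lift
  it.\<close>

lemma null_homotopy:
 fixes P :: "nat => ('a, 'q) module"
 assumes P: "!!k. projective_module A (P k)" and d: "!!k. d k \<in> right_hom A (P (Suc k)) (P k)"
  and dd: "!!k x. x \<in> carrier (P (Suc (Suc k))) ==> d k (d (Suc k) x) = \<zero>\<^bsub>P k\<^esub>"
  and th: "!!k. \<theta> k \<in> right_hom A (P k) (R k)" and th0: "!!x. x \<in> carrier (P 0) ==> aug (\<theta> 0 x) = \<zero>\<^bsub>M\<^esub>"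
  and thd: "!!k x. x \<in> carrier (P (Suc k)) ==> D k (\<theta> (Suc k) x) = \<theta> k (d k x)"
 shows "\<exists>h. (\<forall>k. h k \<in> right_hom A (P k) (R (Suc k))) & (\<forall>x\<in>carrier (P 0). \<theta> 0 x = D 0 (h 0 x)) &
  (\<forall>k. \<forall>x\<in>carrier (P (Suc k)). \<theta> (Suc k) x = D (Suc k) (h (Suc k) x) \<oplus>\<^bsub>R (Suc k)\<^esub> h k (d k x))"
proof -
 have rP: "right_module A (P k)" for k using P by (simp add: projective_module_def)
 have dcl: "x \<in> carrier (P (Suc k)) ==> d k x \<in> carrier (P k)" for k x using right_homD(1)[OF d] .
 have "\<theta> 0 x \<in> D 0 ` carrier (R 1)" if "x \<in> carrier (P 0)" for x
  unfolding exact_0 using th0[OF that] right_homD(1)[OF th that] by simp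
 then obtain h0 where h0: "h0 \<in> right_hom A (P 0) (R (Suc 0))" "\<forall>x\<in>carrier (P 0). D 0 (h0 x) = \<theta> 0 x"
  using projective_lift[OF P[of 0] R R th[of 0] D[of 0]] by auto
 define Good where "Good k h \<longleftrightarrow> h \<in> right_hom A (P k) (R (Suc k)) &
  (k = 0 --> (\<forall>x\<in>carrier (P 0). \<theta> 0 x = D 0 (h x))) &
  (\<forall>x\<in>carrier (P (Suc k)). D k (h (d k x)) = \<theta> k (d k x))" for k h
 have "\<exists>h. \<forall>k. Good k (h k) &
  (\<forall>x\<in>carrier (P (Suc k)). \<theta> (Suc k) x = D (Suc k) (h (Suc k) x) \<oplus>\<^bsub>R (Suc k)\<^esub> h k (d k x))"
 proof (rule dependent_nat_choice)
  show "\<exists>h. Good 0 h" using h0 dcl by (auto simp: Good_def)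
 next
  fix h k assume g: "Good k h"
  then have h: "h \<in> right_hom A (P k) (R (Suc k))" by (simp add: Good_def)
  interpret R1: rmod A "R (Suc k)" by (rule rmod_R)
  interpret R0: rmod A "R k" by (rule rmod_R)
  define Y where "Y = (\<lambda>x\<in>carrier (P (Suc k)). \<theta> (Suc k) x \<ominus>\<^bsub>R (Suc k)\<^esub> (\<lambda>x\<in>carrier (P (Suc k)). h (d k x)) x)"
  have hd: "(\<lambda>x\<in>carrier (P (Suc k)). h (d k x)) \<in> right_hom A (P (Suc k)) (R (Suc k))"
   by (rule right_hom_comp[OF rP d h])
  have Y: "Y \<in> right_hom A (P (Suc k)) (R (Suc k))"
   unfolding Y_def by (rule right_hom_sub[OF rP R th hd])
  have Yx: "Y x = \<theta> (Suc k) x \<ominus>\<^bsub>R (Suc k)\<^esub> h (d k x)" if "x \<in> carrier (P (Suc k))" for x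
   using that by (simp add: Y_def)
  have cl: "\<theta> (Suc k) x \<in> carrier (R (Suc k))" "h (d k x) \<in> carrier (R (Suc k))" if "x \<in> carrier (P (Suc k))" for x
   using right_homD(1)[OF th that] right_homD(1)[OF h dcl[OF that]] by auto
  have "Y x \<in> D (Suc k) ` carrier (R (Suc (Suc k)))" if x: "x \<in> carrier (P (Suc k))" for x
  proof -
   have "D k (Y x) = \<theta> k (d k x) \<ominus>\<^bsub>R k\<^esub> \<theta> k (d k x)"
    using Yx[OF x] D_diff[OF cl[OF x]] thd[OF x] g x by (simp add: Good_def)
   also have "\<dots> = \<zero>\<^bsub>R k\<^esub>" using right_homD(1)[OF th dcl[OF x]] by (simp add: a_minus_def R0.M.r_neg)
   finally show ?thesis unfolding exact using right_homD(1)[OF Y x] by simp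
  qed
  then obtain h' where h': "h' \<in> right_hom A (P (Suc k)) (R (Suc (Suc k)))"
   "\<forall>x\<in>carrier (P (Suc k)). D (Suc k) (h' x) = Y x" using projective_lift[OF P R R Y D] by auto
  have eq: "\<theta> (Suc k) x = D (Suc k) (h' x) \<oplus>\<^bsub>R (Suc k)\<^esub> h (d k x)" if "x \<in> carrier (P (Suc k))" for x
   using h'(2) Yx[OF that] that cl[OF that] by (simp add: a_minus_def R1.M.a_assoc R1.M.l_neg)
  have "D (Suc k) (h' (d (Suc k) x)) = \<theta> (Suc k) (d (Suc k) x)" if x: "x \<in> carrier (P (Suc (Suc k)))" for x
   using eq[OF dcl[OF x]] dd[OF x] right_hom_zero[OF rP R h] h'(1) right_homD(1)[OF h'(1) dcl[OF x]] by simp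
  then have "Good (Suc k) h'" using h'(1) by (simp add: Good_def)
  then show "\<exists>h'. Good (Suc k) h' &
   (\<forall>x\<in>carrier (P (Suc k)). \<theta> (Suc k) x = D (Suc k) (h' x) \<oplus>\<^bsub>R (Suc k)\<^esub> h (d k x))"
   using eq by auto
 qed
 then show ?thesis by (auto simp: Good_def)
qed

end

lemma resolution_of_projective:
 assumes "projective_resolution A M P d \<epsilon>" "right_module A M"
 shows "resolution A M P d \<epsilon>"
 using assms by unfold_locales (auto simp: projective_resolution_def projective_module_def a_kernel_def')

section \<open>The periodic resolution over the twisted group ring\<close>

lemma twisted_group_ring_simps [simp]:
 "carrier (twisted_group_ring G T) = {y. (\<forall>\<rho>\<in>G. y \<rho> \<in> T) & (\<forall>\<rho>. \<rho> \<notin> G --> y \<rho> = 0)}"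
 "\<one>\<^bsub>twisted_group_ring G T\<^esub> = (%\<kappa>. if \<kappa> = id then 1 else 0)"
 "\<zero>\<^bsub>twisted_group_ring G T\<^esub> = (%_. 0)"
 "y \<oplus>\<^bsub>twisted_group_ring G T\<^esub> z = (%\<kappa>. y \<kappa> + z \<kappa>)"
 "s \<odot>\<^bsub>twisted_group_ring G T\<^esub> y = (%\<kappa>. s * y \<kappa>)"
 by (simp_all add: twisted_group_ring_def)

lemma galois_module_simps [simp]:
 "carrier (galois_module G T) = T" "\<zero>\<^bsub>galois_module G T\<^esub> = 0" "x \<oplus>\<^bsub>galois_module G T\<^esub> y = x + y"
 "a \<odot>\<^bsub>galois_module G T\<^esub> x = (\<Sum>\<rho>\<in>G. \<rho> x * a \<rho>)"
 by (simp_all add: galois_module_def)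

definition regular_module :: "('a, 'r) ring_scheme => ('a, 'a) module" where
 "regular_module A = \<lparr>carrier = carrier A, monoid.mult = undefined, one = undefined,
   ring.zero = \<zero>\<^bsub>A\<^esub>, add = (%x y. x \<oplus>\<^bsub>A\<^esub> y), module.smult = (%a x. x \<otimes>\<^bsub>A\<^esub> a)\<rparr>"

lemma regular_module_simps [simp]:
 "carrier (regular_module A) = carrier A" "\<zero>\<^bsub>regular_module A\<^esub> = \<zero>\<^bsub>A\<^esub>"
 "x \<oplus>\<^bsub>regular_module A\<^esub> y = x \<oplus>\<^bsub>A\<^esub> y" "a \<odot>\<^bsub>regular_module A\<^esub> x = x \<otimes>\<^bsub>A\<^esub> a"
 by (simp_all add: regular_module_def)

lemma right_module_regular: assumes "ring A" shows "right_module A (regular_module A)"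
proof -
 interpret ring A by fact
 have "abelian_group (regular_module A)"
 proof (rule abelian_groupI)
  fix x assume "x \<in> carrier (regular_module A)"
  then show "\<exists>y\<in>carrier (regular_module A). y \<oplus>\<^bsub>regular_module A\<^esub> x = \<zero>\<^bsub>regular_module A\<^esub>"
   by (intro bexI[of _ "\<ominus>\<^bsub>A\<^esub> x"]) (simp_all add: l_neg)
 qed (simp_all add: a_ac)
 then show ?thesis using assms by (auto simp: right_module_def l_distr r_distr m_assoc)
qed

context cyclic_action
begin

abbreviation A :: "('l, ('l => 'l) => 'l) module" where "A \<equiv> twisted_group_ring G T"

abbreviation Tm :: "(('l => 'l) => 'l, 'l) module" where "Tm \<equiv> galois_module G T"

abbreviation act :: "'l => (('l => 'l) => 'l) => 'l" where "act x a \<equiv> a \<odot>\<^bsub>Tm\<^esub> x"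

text \<open>Among the pairs with \<open>\<tau> \<circ> \<rho> = \<kappa>\<close> the component
  \<tau> determines \<rho>, so a single sum over \<open>G\<close> suffices.\<close>

lemma tmult: "(y \<otimes>\<^bsub>A\<^esub> z) \<kappa> = (if \<kappa> \<in> G then \<Sum>\<tau>\<in>G. \<tau> (y (ginv \<tau> \<circ> \<kappa>)) * z \<tau> else 0)"
proof (cases "\<kappa> \<in> G")
 case True
 have "(y \<otimes>\<^bsub>A\<^esub> z) \<kappa> = (\<Sum>(\<rho>, \<tau>)\<in>{(\<rho>, \<tau>) \<in> G \<times> G. \<tau> \<circ> \<rho> = \<kappa>}. \<tau> (y \<rho>) * z \<tau>)"
  by (simp add: twisted_group_ring_def)
 also have "\<dots> = (\<Sum>\<tau>\<in>G. \<tau> (y (ginv \<tau> \<circ> \<kappa>)) * z \<tau>)"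
  using True by (intro sum.reindex_bij_witness[of _ "%\<tau>. (ginv \<tau> \<circ> \<kappa>, \<tau>)" snd]) (auto simp del: o_apply)
 finally show ?thesis using True by simp
next
 case False
 then have "{(\<rho>, \<tau>) \<in> G \<times> G. \<tau> \<circ> \<rho> = \<kappa>} = {}" by auto
 then show ?thesis using False unfolding twisted_group_ring_def
  by (simp only: monoid.select_convs sum.empty if_False)
qed

lemma tmult_closed: "y \<in> carrier A ==> z \<in> carrier A ==> y \<otimes>\<^bsub>A\<^esub> z \<in> carrier A"
 by (auto simp: tmult intro!: sum_T)

text \<open>The augmentation \<open>x \<mapsto> 1 \<cdot> x\<close> and the differentials of the periodic resolution are given by
 \<open>\<sigma> - 1\<close> and the norm element.\<close>

definition pe :: "nat => ('l => 'l) => 'l" where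
 "pe n = (if odd n then (%\<kappa>. if \<kappa> = \<sigma> then 1 else if \<kappa> = id then -1 else 0)
      else (%\<kappa>. if \<kappa> \<in> G then 1 else 0))"

definition scal :: "'l => ('l => 'l) => 'l" where "scal y = (%\<kappa>. if \<kappa> = id then y else 0)"

lemma pe_carrier [simp, intro]: "pe n \<in> carrier A"
 by (auto simp: pe_def)

lemma scal_carrier [simp, intro]: "y \<in> T ==> scal y \<in> carrier A"
 by (auto simp: scal_def)

lemma pe_fixed: "\<tau> \<in> G ==> \<tau> (pe n \<kappa>) = pe n \<kappa>"
 by (auto simp: pe_def G_uminus)

lemma pe_odd_sum: assumes "odd n" shows "(\<Sum>\<tau>\<in>G. f \<tau> * pe n \<tau>) = f \<sigma> - f id"
proof -
 have "(\<Sum>\<tau>\<in>G. f \<tau> * pe n \<tau>) = (\<Sum>\<tau>\<in>G. (if \<tau> = \<sigma> then f \<tau> else 0) - (if \<tau> = id then f \<tau> else 0))"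
  using assms by (intro sum.cong) (auto simp: pe_def)
 also have "\<dots> = f \<sigma> - f id" by (simp add: sum_subtractf)
 finally show ?thesis .
qed

lemma act_pe: "act x (pe n) = (if odd n then \<delta> x else Tr x)"
proof (cases "odd n")
 case True
 then show ?thesis using pe_odd_sum[OF True, of "%\<rho>. \<rho> x"] by (simp add: \<delta>_def)
qed (simp add: pe_def Tr_def)

lemma act_scal: "act x (scal y) = x * y"
proof -
 have "act x (scal y) = (\<Sum>\<rho>\<in>G. if \<rho> = id then x * y else 0)"
  unfolding galois_module_simps scal_def by (rule sum.cong) auto
 then show ?thesis by simp
qed

lemma act_T: "x \<in> T ==> a \<in> carrier A ==> act x a \<in> T"
 by (auto intro!: sum_T)

lemma mult_pe_even: assumes "\<not> odd n" "\<kappa> \<in> G"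
 shows "(a \<otimes>\<^bsub>A\<^esub> pe n) \<kappa> = (\<Sum>\<tau>\<in>G. \<tau> (a (ginv \<tau> \<circ> \<kappa>)))"
  and "(pe n \<otimes>\<^bsub>A\<^esub> a) \<kappa> = (\<Sum>\<tau>\<in>G. a \<tau>)"
proof -
 show "(a \<otimes>\<^bsub>A\<^esub> pe n) \<kappa> = (\<Sum>\<tau>\<in>G. \<tau> (a (ginv \<tau> \<circ> \<kappa>)))"
  using assms by (simp add: tmult pe_def)
 show "(pe n \<otimes>\<^bsub>A\<^esub> a) \<kappa> = (\<Sum>\<tau>\<in>G. a \<tau>)"
  using assms by (auto simp: tmult pe_def intro!: sum.cong)
qed

lemma mult_pe_odd: assumes n: "odd n" and k: "\<kappa> \<in> G"
 shows "(a \<otimes>\<^bsub>A\<^esub> pe n) \<kappa> = \<sigma> (a (ginv \<sigma> \<circ> \<kappa>)) - a \<kappa>"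
  and "(pe n \<otimes>\<^bsub>A\<^esub> a) \<kappa> = a (\<kappa> \<circ> ginv \<sigma>) - a \<kappa>"
proof -
 show "(a \<otimes>\<^bsub>A\<^esub> pe n) \<kappa> = \<sigma> (a (ginv \<sigma> \<circ> \<kappa>)) - a \<kappa>"
  using pe_odd_sum[OF n, of "%\<tau>. \<tau> (a (ginv \<tau> \<circ> \<kappa>))"] k by (simp add: tmult inv_into_id[simplified])
 have "(\<Sum>\<tau>\<in>G. \<tau> (pe n (ginv \<tau> \<circ> \<kappa>)) * a \<tau>) = (\<Sum>\<tau>\<in>G. a (\<kappa> \<circ> ginv \<tau>) * pe n \<tau>)"
 proof (rule sum.reindex_bij_witness[of _ "%\<tau>. \<kappa> \<circ> ginv \<tau>" "%\<tau>. ginv \<tau> \<circ> \<kappa>"])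
  fix \<tau> assume t: "\<tau> \<in> G"
  have "ginv (ginv \<tau> \<circ> \<kappa>) = \<tau> \<circ> ginv \<kappa>" using t k by (simp add: inv_distrib)
  then have "\<kappa> \<circ> ginv (ginv \<tau> \<circ> \<kappa>) = \<kappa> \<circ> (ginv \<kappa> \<circ> \<tau>)" using t k G_commute[of \<tau> "ginv \<kappa>"] by simp
  then show 1: "\<kappa> \<circ> ginv (ginv \<tau> \<circ> \<kappa>) = \<tau>" using k by simp
  show "ginv \<tau> \<circ> \<kappa> \<in> G" using t k by blast
  show "a (\<kappa> \<circ> ginv (ginv \<tau> \<circ> \<kappa>)) * pe n (ginv \<tau> \<circ> \<kappa>) = \<tau> (pe n (ginv \<tau> \<circ> \<kappa>)) * a \<tau>"
   using 1 t by (simp add: pe_fixed mult.commute)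
 next
  fix \<tau> assume t: "\<tau> \<in> G"
  have "ginv (\<kappa> \<circ> ginv \<tau>) = \<tau> \<circ> ginv \<kappa>" using t k G_commute[of \<tau> "ginv \<kappa>"] by (simp add: inv_distrib)
  then show "ginv (\<kappa> \<circ> ginv \<tau>) \<circ> \<kappa> = \<tau>" using k by simp
  show "\<kappa> \<circ> ginv \<tau> \<in> G" using t k by blast
 qed
 then show "(pe n \<otimes>\<^bsub>A\<^esub> a) \<kappa> = a (\<kappa> \<circ> ginv \<sigma>) - a \<kappa>"
  using pe_odd_sum[OF n, of "%\<tau>. a (\<kappa> \<circ> ginv \<tau>)"] k by (simp add: tmult inv_into_id[simplified])
qed

lemma tmult_outside: "\<kappa> \<notin> G ==> (a \<otimes>\<^bsub>A\<^esub> c) \<kappa> = 0"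
 by (simp add: tmult)

lemma pe_pe: "pe n \<otimes>\<^bsub>A\<^esub> pe (Suc n) = \<zero>\<^bsub>A\<^esub>"
proof
 fix \<kappa>
 show "(pe n \<otimes>\<^bsub>A\<^esub> pe (Suc n)) \<kappa> = \<zero>\<^bsub>A\<^esub> \<kappa>"
 proof (cases "\<kappa> \<in> G")
  case True
  show ?thesis
  proof (cases "odd n")
   case odd: True
   have "\<kappa> \<circ> ginv \<sigma> \<in> G" using True by blast
   then show ?thesis using mult_pe_odd(2)[OF odd True, of "pe (Suc n)"] odd True by (simp add: pe_def)
  next
   case even: False
   then have "(\<Sum>\<tau>\<in>G. pe (Suc n) \<tau>) = 0" using pe_odd_sum[of "Suc n" "%_. 1"] by simp
   then show ?thesis using mult_pe_even(2)[OF even True] by simp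
  qed
 qed (simp add: tmult_outside)
qed

lemma comp_sigma_inv_power: "\<sigma> ^^ Suc k \<circ> ginv \<sigma> = \<sigma> ^^ k"
 by (simp only: funpow_Suc_right comp_inv_cancel sigma_G)

text \<open>Left multiplication by \<sigma> - 1 takes differences of neighbouring coefficients along
  the powers of \<sigma>, so negative partial sums solve the equation. At exponent 0 the neighbour
  is \<sigma>^(p-1), where the partial sum is the total sum, that is, zero.\<close>

lemma pe_odd_exact: assumes a: "a \<in> carrier A" "(\<Sum>\<tau>\<in>G. a \<tau>) = 0"
 shows "\<exists>r\<in>carrier A. pe 1 \<otimes>\<^bsub>A\<^esub> r = a"
proof -
 define idx where "idx = the_inv_into {..<p} (%k. \<sigma> ^^ k)"
 have idx: "idx (\<sigma> ^^ k) = k" if "k < p" for k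
  using the_inv_into_f_f[of "%k. \<sigma> ^^ k" "{..<p}" k] G_bij that by (simp add: idx_def bij_betw_def)
 have pw: "\<sigma> ^^ k \<in> G" for k unfolding G_eq by blast
 define r where "r \<kappa> = (if \<kappa> \<in> G then - (\<Sum>i\<le>idx \<kappa>. a (\<sigma> ^^ i)) else 0)" for \<kappa>
 have "r \<in> carrier A" using a(1) pw by (auto simp: r_def intro!: sum_T)
 moreover have "pe 1 \<otimes>\<^bsub>A\<^esub> r = a"
 proof
  fix \<kappa>
  show "(pe 1 \<otimes>\<^bsub>A\<^esub> r) \<kappa> = a \<kappa>"
  proof (cases "\<kappa> \<in> G")
   case True
   then obtain k where k: "k < p" "\<kappa> = \<sigma> ^^ k" using G_bij by (auto simp: bij_betw_def)
   have "(pe 1 \<otimes>\<^bsub>A\<^esub> r) \<kappa> = r (\<kappa> \<circ> ginv \<sigma>) - r \<kappa>" using mult_pe_odd(2)[of 1 \<kappa> r] True by simp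
   also have "\<dots> = a \<kappa>"
   proof (cases k)
    case 0
    have "\<kappa> \<circ> ginv \<sigma> = \<sigma> ^^ (p - 1)"
     using comp_sigma_inv_power[of "p - 1"] sigma_order p_ge_2 0 k(2) by (simp add: id_def)
    moreover have "{..p - 1} = {..<p}" using p_ge_2 by auto
    ultimately have "r (\<kappa> \<circ> ginv \<sigma>) = 0"
     using idx[of "p - 1"] p_ge_2 pw[of "p - 1"] a(2) by (simp add: r_def sum_G)
    moreover have "r \<kappa> = - a \<kappa>" using idx[of 0] k 0 True p_ge_2 by (simp add: r_def)
    ultimately show ?thesis by simp
   next
    case (Suc j)
    then have "\<kappa> \<circ> ginv \<sigma> = \<sigma> ^^ j" using comp_sigma_inv_power k(2) by simp
    then have "r (\<kappa> \<circ> ginv \<sigma>) = - (\<Sum>i\<le>j. a (\<sigma> ^^ i))" using idx[of j] k(1) Suc pw[of j] by (simp add: r_def)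
    moreover have "r \<kappa> = - (\<Sum>i\<le>Suc j. a (\<sigma> ^^ i))" unfolding r_def using idx[of k] k True Suc by simp
    ultimately show ?thesis using k(2) Suc by (simp del: funpow.simps)
   qed
   finally show ?thesis .
  qed (use a(1) in \<open>simp add: tmult_outside\<close>)
 qed
 ultimately show ?thesis by blast
qed

text \<open>For odd n, being killed by \<sigma> - 1 means constant coefficients, and such an element
  is the norm element times a scalar. For even n, being killed by the norm element means coefficient
  sum zero.\<close>

lemma pe_exact: assumes a: "a \<in> carrier A" and z: "pe n \<otimes>\<^bsub>A\<^esub> a = \<zero>\<^bsub>A\<^esub>"
 shows "\<exists>r\<in>carrier A. pe (Suc n) \<otimes>\<^bsub>A\<^esub> r = a"
proof (cases "odd n")
 case True
 have s: "a (\<kappa> \<circ> ginv \<sigma>) = a \<kappa>" if "\<kappa> \<in> G" for \<kappa>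
  using mult_pe_odd(2)[OF True that, of a] z by simp
 have "a \<kappa> = a id" if "\<kappa> \<in> G" for \<kappa>
  using that
 proof (induction rule: G_induct)
  case (sigma \<rho>)
  have "(\<sigma> \<circ> \<rho>) \<circ> ginv \<sigma> = \<rho>" using sigma.hyps G_commute[of \<sigma> \<rho>] by simp
  moreover have "\<sigma> \<circ> \<rho> \<in> G" using sigma.hyps by blast
  ultimately have "a (\<sigma> \<circ> \<rho>) = a \<rho>" using s by metis
  then show ?case using sigma.IH by (simp only:)
 qed simp
 note const = this
 have "(pe (Suc n) \<otimes>\<^bsub>A\<^esub> scal (a id)) \<kappa> = a \<kappa>" for \<kappa>
 proof (cases "\<kappa> \<in> G")
  case k: True
  have "(pe (Suc n) \<otimes>\<^bsub>A\<^esub> scal (a id)) \<kappa> = (\<Sum>\<tau>\<in>G. scal (a id) \<tau>)"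
   using True k by (intro mult_pe_even(2)) simp_all
  also have "\<dots> = a id" unfolding scal_def by simp
  finally show ?thesis using const[OF k] by (simp only:)
 next
  case False
  then have "a \<kappa> = 0" using a by simp
  then show ?thesis using False tmult_outside by metis
 qed
 moreover have "scal (a id) \<in> carrier A" by (rule scal_carrier) (use a id_G in auto)
 ultimately show ?thesis by blast
next
 case False
 have "(\<Sum>\<tau>\<in>G. a \<tau>) = 0" using mult_pe_even(2)[OF False id_G, of a] z by simp
 then obtain r where "r \<in> carrier A" "pe 1 \<otimes>\<^bsub>A\<^esub> r = a" using pe_odd_exact[OF a] by blast
 moreover have "pe (Suc n) = pe 1" using False by (simp add: pe_def)
 ultimately show ?thesis by auto
qed

lemma act_one: "act 1 a = (\<Sum>\<tau>\<in>G. a \<tau>)"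
 by simp

text \<open>That the twisted group ring is a ring is carried along as an assumption; it is finally
  supplied by the given resolution, as \<open>right_module\<close> includes it.\<close>

lemma right_module_Tm: assumes "ring A" shows "right_module A Tm"
proof -
 have "abelian_group Tm"
  by (rule abelian_groupI) (auto intro: exI[of _ "- _"] bexI[of _ "- _"])
 moreover have "act x (a \<otimes>\<^bsub>A\<^esub> c) = act (act x a) c" if "x \<in> T" "a \<in> carrier A" "c \<in> carrier A" for x a c
 proof -
  have "act x (a \<otimes>\<^bsub>A\<^esub> c) = (\<Sum>\<kappa>\<in>G. \<Sum>\<tau>\<in>G. \<kappa> x * (\<tau> (a (ginv \<tau> \<circ> \<kappa>)) * c \<tau>))"
   by (auto simp: tmult sum_distrib_left intro!: sum.cong)
  also have "\<dots> = (\<Sum>\<tau>\<in>G. \<Sum>\<kappa>\<in>G. \<kappa> x * (\<tau> (a (ginv \<tau> \<circ> \<kappa>)) * c \<tau>))" by (rule sum.swap)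
  also have "\<dots> = (\<Sum>\<tau>\<in>G. \<Sum>\<rho>\<in>G. (\<tau> \<circ> \<rho>) x * (\<tau> (a (ginv \<tau> \<circ> (\<tau> \<circ> \<rho>))) * c \<tau>))"
   by (rule sum.cong[OF refl], rule sum_shift[symmetric, where f = "%\<kappa>. \<kappa> x * _ \<kappa>"])
  also have "\<dots> = act (act x a) c"
   by (auto simp: G_sum G_mult sum_distrib_right mult.assoc simp del: o_apply intro!: sum.cong) (simp_all add: o_apply)
  finally show ?thesis .
 qed
 moreover have "\<one>\<^bsub>A\<^esub> = scal 1" by (simp add: scal_def)
 then have "act x \<one>\<^bsub>A\<^esub> = x" for x by (simp only: act_scal mult_1_right)
 ultimately show ?thesis using assms
  by (auto simp: right_module_def act_T G_add ring_distribs sum.distrib simp del: galois_module_simps(4))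
   (auto simp: G_add ring_distribs sum.distrib)
qed

lemma left_mult_hom: assumes "ring A" "c \<in> carrier A"
 shows "(\<lambda>x\<in>carrier A. c \<otimes>\<^bsub>A\<^esub> x) \<in> right_hom A (regular_module A) (regular_module A)"
proof -
 interpret ring A by fact
 have "(\<lambda>x\<in>carrier (regular_module A). c \<otimes>\<^bsub>A\<^esub> x) \<in> right_hom A (regular_module A) (regular_module A)"
  by (rule right_homI[OF right_module_regular[OF assms(1)]])
   (use assms(2) in \<open>simp_all add: r_distr m_assoc del: twisted_group_ring_simps\<close>)
 then show ?thesis by (simp del: twisted_group_ring_simps)
qed

lemma orbit_hom: assumes "ring A" "y \<in> T"
 shows "(\<lambda>a\<in>carrier A. act y a) \<in> right_hom A (regular_module A) Tm"
proof -
 interpret Tm: rmod A Tm by (rule rmod.intro[OF right_module_Tm[OF assms(1)]])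
 have "(\<lambda>a\<in>carrier (regular_module A). act y a) \<in> right_hom A (regular_module A) Tm"
  by (rule right_homI[OF right_module_regular[OF assms(1)]])
   (use assms(2) Tm.smult_l_distr Tm.smult_assoc Tm.smult_closed in
    \<open>simp_all del: twisted_group_ring_simps galois_module_simps(3,4)\<close>)
 then show ?thesis by (simp del: twisted_group_ring_simps galois_module_simps(4))
qed

lemma periodic_resolution: assumes "ring A"
 shows "resolution A Tm (%_. regular_module A) (%n. \<lambda>x\<in>carrier A. pe (Suc n) \<otimes>\<^bsub>A\<^esub> x) (\<lambda>a\<in>carrier A. act 1 a)"
proof
 interpret ring A by fact
 show "right_module A Tm" by (rule right_module_Tm[OF assms])
 show "right_module A (regular_module A)" by (rule right_module_regular[OF assms])
 show "(\<lambda>x\<in>carrier A. pe (Suc n) \<otimes>\<^bsub>A\<^esub> x) \<in> right_hom A (regular_module A) (regular_module A)" for n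
  by (rule left_mult_hom[OF assms pe_carrier])
 show "(\<lambda>a\<in>carrier A. act 1 a) \<in> right_hom A (regular_module A) Tm" by (rule orbit_hom[OF assms one_T])
 show "(\<lambda>a\<in>carrier A. act 1 a) ` carrier (regular_module A) = carrier Tm"
 proof
  show "carrier Tm \<subseteq> (\<lambda>a\<in>carrier A. act 1 a) ` carrier (regular_module A)"
  proof
   fix x assume "x \<in> carrier Tm"
   then have "scal x \<in> carrier A" using scal_carrier[of x] by simp
   moreover have "act 1 (scal x) = x" by (simp only: act_scal mult_1)
   ultimately
   show "x \<in> (\<lambda>a\<in>carrier A. act 1 a) ` carrier (regular_module A)"
    by (intro image_eqI[of _ _ "scal x"]) (simp_all del: twisted_group_ring_simps galois_module_simps(4))
  qed
 qed (use act_T[of 1] in \<open>auto simp del: twisted_group_ring_simps galois_module_simps(4)\<close>)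
 show "(\<lambda>x\<in>carrier A. pe (Suc 0) \<otimes>\<^bsub>A\<^esub> x) ` carrier (regular_module A)
  = {x \<in> carrier (regular_module A). (\<lambda>a\<in>carrier A. act 1 a) x = \<zero>\<^bsub>Tm\<^esub>}"
 proof -
  have "act 1 (pe 1 \<otimes>\<^bsub>A\<^esub> x) = 0" if "x \<in> carrier A" for x
  proof -
   interpret Tm: rmod A Tm by (rule rmod.intro[OF right_module_Tm[OF assms]])
   have "act 1 (pe 1 \<otimes>\<^bsub>A\<^esub> x) = act (act 1 (pe 1)) x" by (rule Tm.smult_assoc[OF pe_carrier that]) simp
   also have "\<dots> = 0" unfolding act_pe by (simp add: \<delta>_def)
   finally show ?thesis .
  qed
  moreover have "\<exists>r\<in>carrier A. pe 1 \<otimes>\<^bsub>A\<^esub> r = x" if "x \<in> carrier A" "act 1 x = 0" for x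
   using pe_odd_exact[OF that(1)] that(2) unfolding act_one by blast
  moreover have "pe 1 \<otimes>\<^bsub>A\<^esub> x \<in> carrier A" if "x \<in> carrier A" for x
   by (rule tmult_closed[OF pe_carrier that])
  ultimately have "(%x. pe 1 \<otimes>\<^bsub>A\<^esub> x) ` carrier A = {x \<in> carrier A. act 1 x = 0}" by blast
  then show ?thesis
   by (simp del: twisted_group_ring_simps galois_module_simps(4) cong: image_cong_simp conj_cong)
 qed
 show "(\<lambda>x\<in>carrier A. pe (Suc (Suc n)) \<otimes>\<^bsub>A\<^esub> x) ` carrier (regular_module A)
  = {x \<in> carrier (regular_module A). (\<lambda>x\<in>carrier A. pe (Suc n) \<otimes>\<^bsub>A\<^esub> x) x = \<zero>\<^bsub>regular_module A\<^esub>}" for n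
 proof -
  have "pe (Suc n) \<otimes>\<^bsub>A\<^esub> (pe (Suc (Suc n)) \<otimes>\<^bsub>A\<^esub> x) = \<zero>\<^bsub>A\<^esub>" if "x \<in> carrier A" for x
   using m_assoc[OF pe_carrier pe_carrier that, of "Suc n" "Suc (Suc n)"] l_null[OF that] by (simp only: pe_pe)
  moreover have "pe (Suc (Suc n)) \<otimes>\<^bsub>A\<^esub> x \<in> carrier A" if "x \<in> carrier A" for x
   by (rule tmult_closed[OF pe_carrier that])
  ultimately have "(%x. pe (Suc (Suc n)) \<otimes>\<^bsub>A\<^esub> x) ` carrier A = {x \<in> carrier A. pe (Suc n) \<otimes>\<^bsub>A\<^esub> x = \<zero>\<^bsub>A\<^esub>}"
   using pe_exact[of _ "Suc n"] by blast
  then show ?thesis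
   by (simp del: twisted_group_ring_simps galois_module_simps(4) cong: image_cong_simp conj_cong)
 qed
qed

end

section \<open>The Ext algebra\<close>

context cyclic_action
begin

text \<open>Cocycles and coboundaries of the complex obtained from the periodic resolution.\<close>

definition Zc :: "nat => 'l set" where "Zc n = (if even n then S else {y \<in> T. Tr y = 0})"

definition Bc :: "nat => 'l set" where
 "Bc n = (if n = 0 then {0} else if even n then Tr ` T else \<delta> ` T)"

lemma Zc_T: "y \<in> Zc n ==> y \<in> T"
 by (auto simp: Zc_def S_T split: if_splits)

lemma Zc_iff: "y \<in> Zc n \<longleftrightarrow> y \<in> T & act y (pe (Suc n)) = 0"
 unfolding act_pe by (cases "even n") (auto simp: Zc_def \<delta>_def S_T S_sigma, simp add: S_eq)

lemma Bc_Suc: "Bc (Suc n) = (%x. act x (pe (Suc n))) ` T"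
 unfolding act_pe by (simp add: Bc_def)

lemma Bc_zero [simp]: "0 \<in> Bc n"
 by (auto simp: Bc_def intro: image_eqI[of _ _ 0])

lemma Bc_add: "x \<in> Bc n ==> y \<in> Bc n ==> x + y \<in> Bc n"
 by (auto simp: Bc_def simp flip: Tr_add delta_add split: if_splits)

lemma Bc_uminus: "x \<in> Bc n ==> - x \<in> Bc n"
 by (auto simp: Bc_def simp flip: Tr_uminus delta_uminus split: if_splits)

lemma Bc_diff: "x \<in> Bc n ==> y \<in> Bc n ==> x - y \<in> Bc n"
 using Bc_add[of x n "- y"] Bc_uminus[of y n] by simp

lemma Bc_smult: assumes "a \<in> S" "x \<in> Bc n" shows "a * x \<in> Bc n"
proof -
 have "a * Tr z = Tr (a * z)" "a * \<delta> z = \<delta> (a * z)" for z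
  using assms(1) by (simp_all add: Tr_fixed_mult delta_fixed_mult S_sigma)
 then show ?thesis using assms S_T[OF assms(1)] by (auto simp: Bc_def split: if_splits)
qed

lemma Bc_cong_sym: "x - y \<in> Bc n ==> y - x \<in> Bc n"
 using Bc_uminus[of "x - y"] by simp

lemma Bc_cong_trans: "x - y \<in> Bc n ==> y - z \<in> Bc n ==> x - z \<in> Bc n"
 using Bc_add[of "x - y" n "y - z"] by simp

lemma Zc_add: "x \<in> Zc n ==> y \<in> Zc n ==> x + y \<in> Zc n"
 by (auto simp: Zc_def Tr_add)

lemma Zc_zero [simp]: "0 \<in> Zc n"
 by (auto simp: Zc_def)

lemma Zc_smult: "a \<in> S ==> x \<in> Zc n ==> a * x \<in> Zc n"
 by (auto simp: Zc_def Tr_fixed_mult S_sigma S_T)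

lemma Bc_Zc: "x \<in> Bc n ==> x \<in> Zc n"
 by (auto simp: Zc_def Bc_def split: if_splits)

lemma G_diff_T: assumes "\<delta> u \<in> T" "\<kappa> \<in> G" shows "\<kappa> u - u \<in> T"
 using assms(2)
proof (induction rule: G_induct)
 case (sigma \<rho>)
 have "(\<sigma> \<circ> \<rho>) u - u = \<sigma> (\<rho> u - u) + \<delta> u" by (simp add: \<delta>_def G_diff)
 then show ?case using sigma.IH assms(1) by (simp only:) (simp add: sigma_T)
qed simp

text \<open>As Tr v = 0, u may be subtracted from its conjugates under the sum; what remains are
  integral differences.\<close>

lemma Tr_mult_sigma_T: assumes "\<delta> u \<in> T" "v \<in> Zc n" "odd n" shows "Tr (v * \<sigma> u) \<in> S"
proof -
 have v: "v \<in> T" "Tr v = 0" using assms(2,3) by (auto simp: Zc_def)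
 have "Tr (v * \<sigma> u) = (\<Sum>\<kappa>\<in>G. \<kappa> v * ((\<kappa> \<circ> \<sigma>) u - u))"
  using v(2) by (simp add: Tr_def G_mult right_diff_distrib sum_subtractf flip: sum_distrib_right)
 also have "\<dots> \<in> T" using v(1) G_diff_T[OF assms(1)] by (intro sum_T mult_T) (auto simp del: o_apply)
 finally show ?thesis using G_Tr[of \<sigma>] by (simp add: S_eq)
qed

text \<open>The witness is \<open>Tr z * u - Tr (z * u)\<close>: the second term is invisible to
  \<delta>, and it makes the whole a combination of differences of conjugates of u, hence
  integral.\<close>

lemma Tr_smult_kernel: assumes "z \<in> T" "\<delta> u \<in> T" shows "Tr z * \<delta> u \<in> \<delta> ` T"
proof -
 define w where "w = Tr z * u - Tr (z * u)"
 have "w = (\<Sum>\<kappa>\<in>G. \<kappa> z * (- (\<kappa> u - u)))"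
  by (simp add: w_def Tr_def G_mult right_diff_distrib sum_subtractf flip: sum_distrib_right)
 also have "\<dots> \<in> T" using assms(1) G_diff_T[OF assms(2)] by (intro sum_T mult_T uminus_T) auto
 finally have "w \<in> T" .
 moreover have "\<delta> w = Tr z * \<delta> u"
  using G_Tr[of \<sigma>] by (simp add: w_def delta_diff delta_fixed_mult) (simp add: \<delta>_def)
 ultimately show ?thesis by (metis image_eqI)
qed

text \<open>Summation by parts, from the invariance of the trace.\<close>

lemma Tr_delta_mult_sigma: "Tr (\<delta> w * \<sigma> u) = - Tr (w * \<delta> u)"
proof -
 have "Tr (\<sigma> w * \<sigma> u) = Tr (w * u)" using Tr_sigma[of "w * u"] by (simp add: sigma_mult)
 then show ?thesis by (simp add: \<delta>_def Tr_diff algebra_simps)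
qed

text \<open>The preimages u and u' differ by an integral z and a fixed k. The term with k dies
  against Tr v' = 0, the change \<open>\<delta> w\<close> of v is moved onto u by summation by
  parts, and what is left is the trace of an integral element.\<close>

lemma odd_product_cong:
 assumes u: "\<delta> u \<in> T" "\<delta> u' - \<delta> u \<in> \<delta> ` T" and v: "v \<in> Zc n" "odd n" "v' - v \<in> Bc n"
 shows "Tr (v' * \<sigma> u') - Tr (v * \<sigma> u) \<in> Tr ` T"
proof -
 obtain z where z: "z \<in> T" "\<delta> u' - \<delta> u = \<delta> z" using u(2) by auto
 obtain w where w: "w \<in> T" "v' - v = \<delta> w" using v(2,3) by (auto simp: Bc_def split: if_splits)
 define k where "k = u' - u - z"
 have "\<delta> k = 0" using z(2) by (simp add: k_def delta_diff)
 then have k: "\<sigma> k = k" by (simp add: \<delta>_def)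
 have v': "v' = v + \<delta> w" "v' \<in> T" "Tr v' = 0" using w v Zc_T[OF v(1)] by (auto simp: Zc_def Tr_add algebra_simps)
 have u': "u' = u + z + k" by (simp add: k_def)
 have "v' * \<sigma> u' = v * \<sigma> u + \<delta> w * \<sigma> u + v' * \<sigma> z + k * v'"
  unfolding u' sigma_add k by (simp add: v'(1) algebra_simps)
 then have "Tr (v' * \<sigma> u') = Tr (v * \<sigma> u) - Tr (w * \<delta> u) + Tr (v' * \<sigma> z)"
  using k v'(3) by (simp add: Tr_add Tr_delta_mult_sigma Tr_fixed_mult)
 then have "Tr (v' * \<sigma> u') - Tr (v * \<sigma> u) = Tr (v' * \<sigma> z - w * \<delta> u)" by (simp add: Tr_diff)
 moreover have "v' * \<sigma> z - w * \<delta> u \<in> T" using v' w z(1) u(1) by (auto simp: sigma_T)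
 ultimately show ?thesis by blast
qed

end

locale cyclic_action_h90 = cyclic_action T S \<sigma> p G
 for T :: "'l::field set" and S \<sigma> p G +
 assumes h90: "y \<in> T ==> Tr y = 0 ==> \<exists>u. \<delta> u = y"
begin

text \<open>The one case that is not \<open>S\<close>-linearity is a trace times a cocycle of odd
  degree: write the cocycle as \<delta> u by \<open>h90\<close> and apply
  \<open>Tr_smult_kernel\<close>.\<close>

lemma even_product_cong:
 assumes y: "y \<in> Zc i" "y' - y \<in> Bc i" and v: "v \<in> Zc j" "v' - v \<in> Bc j" and ev: "even i \<or> even j"
 shows "y' * v' - y * v \<in> Bc (i + j)"
proof -
 have key: "x * w \<in> Bc (m + n)" if "x \<in> Bc m" "w \<in> Zc n" "even m \<or> even n" for x w m n
 proof (cases "m = 0")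
  case True
  then have "x = 0" using that by (simp add: Bc_def)
  then show ?thesis by simp
 next
  case False
  show ?thesis
  proof (cases "odd m \<or> even n")
   case True
   then have "w \<in> S" "even n" using that by (auto simp: Zc_def)
   moreover have "Bc (m + n) = Bc m" using False \<open>even n\<close> by (simp add: Bc_def)
   ultimately show ?thesis using Bc_smult[of w x m] that(1) by (simp add: mult.commute)
  next
   case False
   then have "x \<in> Tr ` T" using that(1) \<open>m ~= 0\<close> by (simp add: Bc_def)
   then obtain z where z: "z \<in> T" "x = Tr z" by blast
   have "w \<in> T" "Tr w = 0" using that(2) False by (auto simp: Zc_def)
   then obtain u where "\<delta> u = w" using h90 by blast
   then show ?thesis using Tr_smult_kernel[OF z(1), of u] z(2) \<open>w \<in> T\<close> False \<open>m ~= 0\<close>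
    by (simp add: Bc_def)
  qed
 qed
 have y': "y' \<in> Zc i" using Zc_add[OF Bc_Zc[OF y(2)] y(1)] by simp
 have "y' * v' - y * v = (v' - v) * y' + (y' - y) * v" by (simp add: algebra_simps)
 moreover have "(v' - v) * y' \<in> Bc (j + i)" by (rule key) (use v(2) y' ev in auto)
 moreover have "(y' - y) * v \<in> Bc (i + j)" by (rule key) (use y(2) v(1) ev in auto)
 ultimately show ?thesis using Bc_add by (simp add: add.commute)
qed

text \<open>\<open>cl n\<close> identifies the subquotient \<open>Zc n / Bc n\<close> of \<open>T\<close> with the degree \<open>n\<close> part of a graded
 algebra, in such a way that products are the expected ones; the sign \<open>\<chi>\<close> distinguishes the Yoneda
 product from the cup product.\<close>

definition cohomology_model ::
 "(nat => ('l, 'c) module) => (nat => nat => 'c => 'c => 'c) => 'c => (nat => 'l => 'c) => 'l => bool"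
 where "cohomology_model E pr e cl \<chi> \<longleftrightarrow>
  (\<chi> = 1 \<or> \<chi> = -1) & e = cl 0 1 &
  (\<forall>n. carrier (E n) = cl n ` Zc n & \<zero>\<^bsub>E n\<^esub> = cl n 0) &
  (\<forall>n. \<forall>y\<in>Zc n. \<forall>y'\<in>Zc n. cl n y = cl n y' \<longleftrightarrow> y - y' \<in> Bc n) &
  (\<forall>n. \<forall>y\<in>Zc n. \<forall>y'\<in>Zc n. cl n y \<oplus>\<^bsub>E n\<^esub> cl n y' = cl n (y + y')) &
  (\<forall>n. \<forall>a\<in>S. \<forall>y\<in>Zc n. a \<odot>\<^bsub>E n\<^esub> cl n y = cl n (a * y)) &
  (\<forall>i j. \<forall>y\<in>Zc i. \<forall>v\<in>Zc j. even i \<or> even j --> pr i j (cl i y) (cl j v) = cl (i + j) (y * v)) &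
  (\<forall>i j u. \<forall>v\<in>Zc j. odd i --> odd j --> \<delta> u \<in> T -->
    pr i j (cl i (\<delta> u)) (cl j v) = cl (i + j) (\<chi> * Tr (v * \<sigma> u)))"

end

section \<open>Homotopy equivalence of an arbitrary projective resolution with the periodic
  one\<close>

locale ext_setup = cyclic_action_h90 T S \<sigma> p G
 for T :: "'l::field set" and S \<sigma> p G +
 fixes P :: "nat => (('l => 'l) => 'l, 'm) module" and d :: "nat => 'm => 'm" and \<epsilon> :: "'m => 'l"
 assumes P_res: "projective_resolution A Tm P d \<epsilon>"
begin

lemma projective_P: "projective_module A (P n)"
 using P_res by (simp add: projective_resolution_def)

lemma right_P: "right_module A (P n)"
 using projective_P by (simp add: projective_module_def)

lemma ring_A: "ring A"
 using right_P by (simp add: right_module_def)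

lemma right_Tm: "right_module A Tm"
 by (rule right_module_Tm[OF ring_A])

sublocale P: resolution A Tm P d \<epsilon>
 by (rule resolution_of_projective[OF P_res right_Tm])

sublocale Q: resolution A Tm "%_. regular_module A" "%n. \<lambda>x\<in>carrier A. pe (Suc n) \<otimes>\<^bsub>A\<^esub> x" "\<lambda>a\<in>carrier A. act 1 a"
 by (rule periodic_resolution[OF ring_A])

lemma Tm_minus: "x \<in> T ==> y \<in> T ==> x \<ominus>\<^bsub>Tm\<^esub> y = x - y"
 using P.M.M.minus_equality[of "- y" y] by (simp add: a_minus_def)

text \<open>The chain map from the periodic resolution to P over the identity of \<open>T\<close>,
  recorded by the images of the generators.\<close>

lemma q_ex: "\<exists>q. (\<forall>k. q k \<in> carrier (P k)) & \<epsilon> (q 0) = 1 & (\<forall>k. d k (q (Suc k)) = pe (Suc k) \<odot>\<^bsub>P k\<^esub> q k)"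
proof (rule P.element_chain)
 show "pe 1 \<odot>\<^bsub>Tm\<^esub> 1 = \<zero>\<^bsub>Tm\<^esub>" unfolding act_pe by (simp add: \<delta>_def)
qed (rule pe_carrier, rule pe_pe, simp)

definition q :: "nat => 'm" where
 "q = (SOME q. (\<forall>k. q k \<in> carrier (P k)) & \<epsilon> (q 0) = 1 & (\<forall>k. d k (q (Suc k)) = pe (Suc k) \<odot>\<^bsub>P k\<^esub> q k))"

lemma q: "q k \<in> carrier (P k)" "\<epsilon> (q 0) = 1" "d k (q (Suc k)) = pe (Suc k) \<odot>\<^bsub>P k\<^esub> q k"
 using someI_ex[OF q_ex] unfolding q_def[symmetric] by blast+

abbreviation coc :: "nat => ('m => 'l) set" where "coc n \<equiv> ext_cocycles A P d Tm n"

abbreviation cob :: "nat => ('m => 'l) set" where "cob n \<equiv> ext_coboundaries A P d Tm n"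

lemma hom_module_simps [simp]:
 "carrier (hom_module A (P n) Tm) = right_hom A (P n) Tm"
 "\<zero>\<^bsub>hom_module A (P n) Tm\<^esub> = (\<lambda>x\<in>carrier (P n). 0)"
 "f \<oplus>\<^bsub>hom_module A (P n) Tm\<^esub> g = (\<lambda>x\<in>carrier (P n). f x + g x)"
 "s \<odot>\<^bsub>hom_module A (P n) Tm\<^esub> f = (\<lambda>x\<in>carrier (P n). f x * s)"
proof -
 have 1: "s \<odot>\<^bsub>A\<^esub> \<one>\<^bsub>A\<^esub> = scal s" by (simp add: scal_def fun_eq_iff)
 show "s \<odot>\<^bsub>hom_module A (P n) Tm\<^esub> f = (\<lambda>x\<in>carrier (P n). f x * s)"
  unfolding hom_module_def module.select_convs 1 act_scal ..
qed (simp_all add: hom_module_def)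

lemma homD:
 assumes "f \<in> right_hom A (P n) Tm"
 shows "x \<in> carrier (P n) ==> f x \<in> T"
  "x \<in> carrier (P n) ==> y \<in> carrier (P n) ==> f (x \<oplus>\<^bsub>P n\<^esub> y) = f x + f y"
  "a \<in> carrier A ==> x \<in> carrier (P n) ==> f (a \<odot>\<^bsub>P n\<^esub> x) = act (f x) a"
 using right_homD[OF assms] by simp_all

lemma coc_iff: "f \<in> coc n \<longleftrightarrow> f \<in> right_hom A (P n) Tm & (\<forall>x\<in>carrier (P (Suc n)). f (d n x) = 0)"
proof -
 have "ext_coboundary P d n f = \<zero>\<^bsub>hom_module A (P (Suc n)) Tm\<^esub> \<longleftrightarrow> (\<forall>x\<in>carrier (P (Suc n)). f (d n x) = 0)"
  by (auto simp: ext_coboundary_def fun_eq_iff restrict_def)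
 then show ?thesis by (simp add: ext_cocycles_def)
qed

lemma cob_0: "cob 0 = {\<lambda>x\<in>carrier (P 0). 0}"
 by (simp add: ext_coboundaries_def)

lemma cob_Suc: "cob (Suc n) = (%f. \<lambda>x\<in>carrier (P (Suc n)). f (d n x)) ` right_hom A (P n) Tm"
 by (simp add: ext_coboundaries_def ext_coboundary_def)

lemma zero_hom: "(\<lambda>x\<in>carrier (P n). 0) \<in> right_hom A (P n) Tm"
proof -
 have "(\<lambda>x\<in>carrier (P n). 0) \<in> right_hom A (P n) Tm"
  by (rule right_homI[OF right_P]) simp_all
 then show ?thesis .
qed

lemma cob_coc: "f \<in> cob n ==> f \<in> coc n"
proof (cases n)
 case 0
 assume "f \<in> cob n"
 then show ?thesis using zero_hom[of 0] 0 by (auto simp: cob_0 coc_iff)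
next
 case (Suc m)
 assume "f \<in> cob n"
 then obtain g where g: "g \<in> right_hom A (P m) Tm" "f = (\<lambda>x\<in>carrier (P n). g (d m x))" using Suc by (auto simp: cob_Suc)
 have "f \<in> right_hom A (P n) Tm" unfolding g(2) using right_hom_comp[OF right_P P.D g(1)] Suc by simp
 moreover have "f (d n x) = 0" if "x \<in> carrier (P (Suc n))" for x
  using that Suc g P.D_D[of x m] right_hom_zero[OF right_P right_Tm g(1)] by simp
 ultimately show ?thesis by (simp add: coc_iff)
qed

text \<open>Evaluation at \<open>q n\<close> is composition with the chain map from the periodic
  resolution, so the cocycle condition becomes that of the periodic complex.\<close>

lemma coc_value: assumes "f \<in> coc n" shows "f (q n) \<in> Zc n"
proof -
 have f: "f \<in> right_hom A (P n) Tm" "\<forall>x\<in>carrier (P (Suc n)). f (d n x) = 0" using assms by (auto simp: coc_iff)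
 have "act (f (q n)) (pe (Suc n)) = f (d n (q (Suc n)))" using homD(3)[OF f(1) pe_carrier q(1)] q(3) by simp
 also have "\<dots> = 0" using f(2) q(1) by blast
 finally show ?thesis using homD(1)[OF f(1) q(1)] unfolding Zc_iff by blast
qed

lemma cob_value: assumes "f \<in> cob n" shows "f (q n) \<in> Bc n"
proof (cases n)
 case 0
 then show ?thesis using assms q(1)[of 0] by (auto simp: cob_0 Bc_def)
next
 case (Suc m)
 then obtain g where g: "g \<in> right_hom A (P m) Tm" "f = (\<lambda>x\<in>carrier (P n). g (d m x))" using assms by (auto simp: cob_Suc)
 have "f (q n) = g (pe (Suc m) \<odot>\<^bsub>P m\<^esub> q m)" using q(1)[of n] q(3)[of m] Suc by (simp add: g(2))
 also have "\<dots> = act (g (q m)) (pe (Suc m))" by (rule homD(3)[OF g(1) pe_carrier q(1)])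
 finally show ?thesis unfolding Suc Bc_Suc using homD(1)[OF g(1) q(1)] by blast
qed

text \<open>The chain map in the opposite direction; it exists because P is projective and the
  periodic complex is exact.\<close>

lemma G_ex: "\<exists>Gm. (\<forall>k. Gm k \<in> right_hom A (P k) (regular_module A)) &
  (\<forall>x\<in>carrier (P 0). act 1 (Gm 0 x) = \<epsilon> x) &
  (\<forall>k. \<forall>x\<in>carrier (P (Suc k)). pe (Suc k) \<otimes>\<^bsub>A\<^esub> Gm (Suc k) x = Gm k (d k x))"
proof -
 obtain Gm where Gm: "\<forall>k. Gm k \<in> right_hom A (P (0 + k)) (regular_module A)"
  "\<forall>x\<in>carrier (P 0). (\<lambda>a\<in>carrier A. act 1 a) (Gm 0 x) = \<epsilon> x"
  "\<forall>k. \<forall>x\<in>carrier (P (0 + Suc k)). (\<lambda>x\<in>carrier A. pe (Suc k) \<otimes>\<^bsub>A\<^esub> x) (Gm (Suc k) x) = Gm k (d (0 + k) x)"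
  using Q.chain_lift_exists[OF projective_P P.D P.D_D P.aug] P.aug_D by auto
 have "Gm k x \<in> carrier A" if "x \<in> carrier (P k)" for k x
  using Gm(1) that right_homD(1)[of "Gm k" A "P k" "regular_module A" x] by simp
 then show ?thesis using Gm
  by (intro exI[of _ Gm]) (simp del: twisted_group_ring_simps galois_module_simps(4))
qed

definition Gm :: "nat => 'm => ('l => 'l) => 'l" where
 "Gm = (SOME Gm. (\<forall>k. Gm k \<in> right_hom A (P k) (regular_module A)) &
  (\<forall>x\<in>carrier (P 0). act 1 (Gm 0 x) = \<epsilon> x) &
  (\<forall>k. \<forall>x\<in>carrier (P (Suc k)). pe (Suc k) \<otimes>\<^bsub>A\<^esub> Gm (Suc k) x = Gm k (d k x)))"

lemma Gm: "Gm k \<in> right_hom A (P k) (regular_module A)"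
  "x \<in> carrier (P 0) ==> act 1 (Gm 0 x) = \<epsilon> x"
  "x \<in> carrier (P (Suc k)) ==> pe (Suc k) \<otimes>\<^bsub>A\<^esub> Gm (Suc k) x = Gm k (d k x)"
 using someI_ex[OF G_ex] unfolding Gm_def[symmetric] by blast+

lemma Gm_A: "x \<in> carrier (P k) ==> Gm k x \<in> carrier A"
 using right_homD(1)[OF Gm(1)] by simp

lemma act_Gm_hom: assumes "y \<in> T" shows "(\<lambda>x\<in>carrier (P n). act y (Gm n x)) \<in> right_hom A (P n) Tm"
proof -
 have "(\<lambda>x\<in>carrier (P n). (\<lambda>a\<in>carrier A. act y a) (Gm n x)) \<in> right_hom A (P n) Tm"
  by (rule right_hom_comp[OF right_P Gm(1) orbit_hom[OF ring_A assms]])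
 moreover have "(\<lambda>x\<in>carrier (P n). (\<lambda>a\<in>carrier A. act y a) (Gm n x)) = (\<lambda>x\<in>carrier (P n). act y (Gm n x))"
  using Gm_A by (intro restrict_ext) (simp del: twisted_group_ring_simps galois_module_simps(4))
 ultimately show ?thesis by simp
qed

text \<open>Composing with \<open>Gm\<close> turns y into a cocycle on P. Its value at
  \<open>q n\<close> is y acted upon by \<open>Gm n (q n)\<close>, and \<open>Gm\<close> after q is
  homotopic to the identity of the periodic resolution.\<close>

lemma coc_surj: assumes y: "y \<in> Zc n" shows "\<exists>f\<in>coc n. f (q n) - y \<in> Bc n"
proof -
 have yT: "y \<in> T" "act y (pe (Suc n)) = 0" using y Zc_iff by blast+
 define f where "f = (\<lambda>x\<in>carrier (P n). act y (Gm n x))"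
 have "f \<in> right_hom A (P n) Tm" unfolding f_def by (rule act_Gm_hom[OF yT(1)])
 moreover have "f (d n x) = 0" if x: "x \<in> carrier (P (Suc n))" for x
 proof -
  have "f (d n x) = act y (pe (Suc n) \<otimes>\<^bsub>A\<^esub> Gm (Suc n) x)"
   using P.D_closed[OF x] by (simp only: f_def restrict_apply' Gm(3)[OF x])
  also have "\<dots> = act (act y (pe (Suc n))) (Gm (Suc n) x)"
   by (rule P.M.smult_assoc[OF pe_carrier Gm_A[OF x]]) (use yT in simp)
  finally show ?thesis using yT(2) P.M.smult_r_null[OF Gm_A[OF x]] by simp
 qed
 ultimately have "f \<in> coc n" by (simp add: coc_iff)
 moreover have "f (q n) - y \<in> Bc n"
 proof -
  interpret Rr: rmod A "regular_module A" by (rule Q.rmod_R)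
  \<comment> \<open>The difference between that composite and the identity, on generators. In the
    homotopy formula y kills the term starting with \<open>pe (Suc n)\<close>; the other term acts
    as a coboundary.\<close>
  define a where "a k = Gm k (q k) \<ominus>\<^bsub>regular_module A\<^esub> \<one>\<^bsub>A\<^esub>" for k
  have g: "Gm k (q k) \<in> carrier A" for k using Gm_A[OF q(1)] .
  have one: "\<one>\<^bsub>A\<^esub> \<in> carrier A" by (rule P.M.R.one_closed)
  have greg: "Gm k (q k) \<in> carrier (regular_module A)" "\<one>\<^bsub>A\<^esub> \<in> carrier (regular_module A)" for k
   unfolding regular_module_simps(1) by (rule g, rule one)
  have ac: "a k \<in> carrier A" for k
   using Rr.M.minus_closed[OF greg, of k] unfolding a_def regular_module_simps(1) .
  have orb: "act z (a k) = act z (Gm k (q k)) - z" if "z \<in> T" for z k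
  proof -
   have "(\<lambda>a\<in>carrier A. act z a) (a k) = (\<lambda>a\<in>carrier A. act z a) (Gm k (q k)) \<ominus>\<^bsub>Tm\<^esub> (\<lambda>a\<in>carrier A. act z a) \<one>\<^bsub>A\<^esub>"
    unfolding a_def by (rule right_hom_diff[OF Q.R right_Tm orbit_hom[OF ring_A that] greg])
   then have "act z (a k) = act z (Gm k (q k)) \<ominus>\<^bsub>Tm\<^esub> act z \<one>\<^bsub>A\<^esub>"
    by (simp only: restrict_apply' ac g one)
   also have "act z \<one>\<^bsub>A\<^esub> = z" by (rule P.M.smult_one) (use that in simp)
   finally show ?thesis using act_T[OF that g] that by (simp only: Tm_minus)
  qed
  have "\<exists>r. (\<forall>k. r k \<in> carrier (regular_module A)) & a 0 = (\<lambda>x\<in>carrier A. pe (Suc 0) \<otimes>\<^bsub>A\<^esub> x) (r 0) &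
   (\<forall>k. a (Suc k) = (\<lambda>x\<in>carrier A. pe (Suc (Suc k)) \<otimes>\<^bsub>A\<^esub> x) (r (Suc k)) \<oplus>\<^bsub>regular_module A\<^esub> pe (Suc k) \<odot>\<^bsub>regular_module A\<^esub> r k)"
  proof (rule Q.element_homotopy)
   show "a k \<in> carrier (regular_module A)" for k unfolding regular_module_simps(1) by (rule ac)
   have "act 1 (a 0) = 0" unfolding orb[OF one_T] Gm(2)[OF q(1)] q(2) by simp
   then show "(\<lambda>a\<in>carrier A. act 1 a) (a 0) = \<zero>\<^bsub>Tm\<^esub>" by (simp only: restrict_apply' ac galois_module_simps(2))
   fix k
   have "(\<lambda>x\<in>carrier A. pe (Suc k) \<otimes>\<^bsub>A\<^esub> x) (a (Suc k))
    = (\<lambda>x\<in>carrier A. pe (Suc k) \<otimes>\<^bsub>A\<^esub> x) (Gm (Suc k) (q (Suc k))) \<ominus>\<^bsub>regular_module A\<^esub> (\<lambda>x\<in>carrier A. pe (Suc k) \<otimes>\<^bsub>A\<^esub> x) \<one>\<^bsub>A\<^esub>"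
    unfolding a_def by (rule Q.D_diff[OF greg])
   also have "\<dots> = Gm k (d k (q (Suc k))) \<ominus>\<^bsub>regular_module A\<^esub> pe (Suc k)"
    by (simp only: restrict_apply' g one Gm(3)[OF q(1)] P.M.R.r_one[OF pe_carrier])
   also have "Gm k (d k (q (Suc k))) = pe (Suc k) \<odot>\<^bsub>regular_module A\<^esub> Gm k (q k)"
    unfolding q(3) by (rule right_homD(3)[OF Gm(1) pe_carrier q(1)])
   also have "pe (Suc k) \<odot>\<^bsub>regular_module A\<^esub> Gm k (q k) \<ominus>\<^bsub>regular_module A\<^esub> pe (Suc k) = pe (Suc k) \<odot>\<^bsub>regular_module A\<^esub> a k"
   proof -
    have "pe (Suc k) \<odot>\<^bsub>regular_module A\<^esub> \<one>\<^bsub>A\<^esub> = pe (Suc k)"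
     by (simp only: regular_module_simps(4) P.M.R.l_one[OF pe_carrier])
    then show ?thesis unfolding a_def Rr.smult_r_diff[OF pe_carrier greg] by (simp only:)
   qed
   finally show "(\<lambda>x\<in>carrier A. pe (Suc k) \<otimes>\<^bsub>A\<^esub> x) (a (Suc k)) = pe (Suc k) \<odot>\<^bsub>regular_module A\<^esub> a k" .
  qed (rule pe_carrier, rule pe_pe)
  then obtain r where r: "!!k. r k \<in> carrier A" "a 0 = pe (Suc 0) \<otimes>\<^bsub>A\<^esub> r 0"
   "!!k. a (Suc k) = pe (Suc (Suc k)) \<otimes>\<^bsub>A\<^esub> r (Suc k) \<oplus>\<^bsub>A\<^esub> r k \<otimes>\<^bsub>A\<^esub> pe (Suc k)"
   unfolding regular_module_simps by (metis restrict_apply')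
  have yc: "y \<in> carrier Tm" using yT by simp
  have kill: "act y (pe (Suc n) \<otimes>\<^bsub>A\<^esub> r n) = 0"
   using P.M.smult_assoc[OF pe_carrier r(1) yc, of "Suc n" n] P.M.smult_r_null[OF r(1), of n] yT(2) by simp
  have "f (q n) - y = act y (a n)" unfolding orb[OF yT(1)] by (simp only: f_def restrict_apply' q(1))
  also have "\<dots> \<in> Bc n"
  proof (cases n)
   case 0
   then show ?thesis using kill r(2) by (simp only: Bc_zero)
  next
   case (Suc m)
   have "act y (a n) = act y (pe (Suc n) \<otimes>\<^bsub>A\<^esub> r n) \<oplus>\<^bsub>Tm\<^esub> act y (r m \<otimes>\<^bsub>A\<^esub> pe n)"
    unfolding Suc r(3) by (rule P.M.smult_l_distr) (rule tmult_closed pe_carrier r(1) yc)+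
   also have "\<dots> = act (act y (r m)) (pe n)"
    unfolding kill using P.M.smult_assoc[OF r(1) pe_carrier yc, of m n] by (simp only: galois_module_simps(3) add_0)
   finally show ?thesis unfolding Suc Bc_Suc using act_T[OF yT(1) r(1)[of m]] by blast
  qed
  finally show ?thesis .
 qed
 ultimately show ?thesis by blast
qed

text \<open>The endomorphism q after \<open>Gm\<close> of P is homotopic to the identity. Applying f
  to a homotopy writes f as a coboundary plus a term that depends only on the value
  \<open>f (q n)\<close>.\<close>

lemma coc_inj: assumes f: "f \<in> coc n" and v: "f (q n) \<in> Bc n" shows "f \<in> cob n"
proof -
 have fh: "f \<in> right_hom A (P n) Tm" "\<forall>x\<in>carrier (P (Suc n)). f (d n x) = 0" using f by (auto simp: coc_iff)
 define qg where "qg k = (\<lambda>x\<in>carrier (P k). Gm k x \<odot>\<^bsub>P k\<^esub> q k)" for k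
 define \<theta> where "\<theta> k = (\<lambda>x\<in>carrier (P k). (\<lambda>x\<in>carrier (P k). x) x \<ominus>\<^bsub>P k\<^esub> qg k x)" for k
 have qg: "qg k \<in> right_hom A (P k) (P k)" for k
 proof -
  interpret Pk: rmod A "P k" by (rule P.rmod_R)
  show ?thesis unfolding qg_def
  proof (rule right_homI[OF right_P])
   fix x assume x: "x \<in> carrier (P k)"
   show "Gm k x \<odot>\<^bsub>P k\<^esub> q k \<in> carrier (P k)" by (rule Pk.smult_closed[OF Gm_A[OF x] q(1)])
   fix y assume y: "y \<in> carrier (P k)"
   show "Gm k (x \<oplus>\<^bsub>P k\<^esub> y) \<odot>\<^bsub>P k\<^esub> q k = Gm k x \<odot>\<^bsub>P k\<^esub> q k \<oplus>\<^bsub>P k\<^esub> Gm k y \<odot>\<^bsub>P k\<^esub> q k"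
    unfolding right_homD(2)[OF Gm(1) x y] regular_module_simps by (rule Pk.smult_l_distr[OF Gm_A[OF x] Gm_A[OF y] q(1)])
  next
   fix a x assume a: "a \<in> carrier A" and x: "x \<in> carrier (P k)"
   show "Gm k (a \<odot>\<^bsub>P k\<^esub> x) \<odot>\<^bsub>P k\<^esub> q k = a \<odot>\<^bsub>P k\<^esub> (Gm k x \<odot>\<^bsub>P k\<^esub> q k)"
    unfolding right_homD(3)[OF Gm(1) a x] regular_module_simps by (rule Pk.smult_assoc[OF Gm_A[OF x] a q(1)])
  qed
 qed
 have idh: "(\<lambda>x\<in>carrier (P k). x) \<in> right_hom A (P k) (P k)" for k
  by (rule right_homI[OF right_P]) simp_all
 have th: "\<theta> k \<in> right_hom A (P k) (P k)" for k
  unfolding \<theta>_def by (rule right_hom_sub[OF right_P right_P idh qg])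
 have thx: "\<theta> k x = x \<ominus>\<^bsub>P k\<^esub> Gm k x \<odot>\<^bsub>P k\<^esub> q k" if "x \<in> carrier (P k)" for k x
  using that by (simp add: \<theta>_def qg_def)
 have cl: "Gm k x \<odot>\<^bsub>P k\<^esub> q k \<in> carrier (P k)" if "x \<in> carrier (P k)" for k x
  using right_homD(1)[OF qg that] that by (simp add: qg_def)
 have "\<exists>h. (\<forall>k. h k \<in> right_hom A (P k) (P (Suc k))) & (\<forall>x\<in>carrier (P 0). \<theta> 0 x = d 0 (h 0 x)) &
  (\<forall>k. \<forall>x\<in>carrier (P (Suc k)). \<theta> (Suc k) x = d (Suc k) (h (Suc k) x) \<oplus>\<^bsub>P (Suc k)\<^esub> h k (d k x))"
 proof (rule P.null_homotopy[OF projective_P P.D P.D_D th])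
  fix x assume x: "x \<in> carrier (P 0)"
  have "\<epsilon> (\<theta> 0 x) = \<epsilon> x \<ominus>\<^bsub>Tm\<^esub> \<epsilon> (Gm 0 x \<odot>\<^bsub>P 0\<^esub> q 0)"
   unfolding thx[OF x] by (rule right_hom_diff[OF right_P right_Tm P.aug x cl[OF x]])
  also have "\<epsilon> (Gm 0 x \<odot>\<^bsub>P 0\<^esub> q 0) = \<epsilon> x"
   unfolding right_homD(3)[OF P.aug Gm_A[OF x] q(1)] q(2) by (rule Gm(2)[OF x])
  also have "\<epsilon> x \<ominus>\<^bsub>Tm\<^esub> \<epsilon> x = \<zero>\<^bsub>Tm\<^esub>"
   using right_homD(1)[OF P.aug x] P.M.eq_diff_zero by blast
  finally show "\<epsilon> (\<theta> 0 x) = \<zero>\<^bsub>Tm\<^esub>" .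
 next
  fix k x assume x: "x \<in> carrier (P (Suc k))"
  have "d k (\<theta> (Suc k) x) = d k x \<ominus>\<^bsub>P k\<^esub> d k (Gm (Suc k) x \<odot>\<^bsub>P (Suc k)\<^esub> q (Suc k))"
   unfolding thx[OF x] by (rule P.D_diff[OF x cl[OF x]])
  also have "d k (Gm (Suc k) x \<odot>\<^bsub>P (Suc k)\<^esub> q (Suc k)) = Gm (Suc k) x \<odot>\<^bsub>P k\<^esub> (pe (Suc k) \<odot>\<^bsub>P k\<^esub> q k)"
   unfolding P.D_smult[OF Gm_A[OF x] q(1)] q(3) ..
  also have "\<dots> = Gm k (d k x) \<odot>\<^bsub>P k\<^esub> q k"
   unfolding Gm(3)[OF x, symmetric] by (rule rmod.smult_assoc[OF P.rmod_R pe_carrier Gm_A[OF x] q(1), symmetric])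
  finally show "d k (\<theta> (Suc k) x) = \<theta> k (d k x)" unfolding thx[OF P.D_closed[OF x]] .
 qed
 then obtain h where h: "!!k. h k \<in> right_hom A (P k) (P (Suc k))" "!!x. x \<in> carrier (P 0) ==> \<theta> 0 x = d 0 (h 0 x)"
  "!!k x. x \<in> carrier (P (Suc k)) ==> \<theta> (Suc k) x = d (Suc k) (h (Suc k) x) \<oplus>\<^bsub>P (Suc k)\<^esub> h k (d k x)" by blast
 have fth: "f (\<theta> n x) = f x - act (f (q n)) (Gm n x)" if x: "x \<in> carrier (P n)" for x
 proof -
  have "f (\<theta> n x) = f x \<ominus>\<^bsub>Tm\<^esub> f (Gm n x \<odot>\<^bsub>P n\<^esub> q n)"
   unfolding thx[OF x] by (rule right_hom_diff[OF right_P right_Tm fh(1) x cl[OF x]])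
  also have "\<dots> = f x - f (Gm n x \<odot>\<^bsub>P n\<^esub> q n)"
   by (rule Tm_minus[OF homD(1)[OF fh(1) x] homD(1)[OF fh(1) cl[OF x]]])
  finally show ?thesis unfolding homD(3)[OF fh(1) Gm_A[OF x] q(1)] .
 qed
 show ?thesis
 proof (cases n)
  case 0
  have "f x = 0" if x: "x \<in> carrier (P n)" for x
  proof -
   have x0: "x \<in> carrier (P 0)" using x 0 by simp
   have "f (\<theta> n x) = 0" unfolding 0 h(2)[OF x0] using fh(2) right_homD(1)[OF h(1) x0] 0 by blast
   moreover have "f (q n) = 0" using v 0 by (simp add: Bc_def)
   ultimately show ?thesis using fth[OF x] rmod.smult_r_null[OF P.rmod_M Gm_A[OF x]] by simp
  qed
  then have "f = (\<lambda>x\<in>carrier (P n). 0)" using right_hom_ext[OF fh(1) zero_hom] by simp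
  then show ?thesis using 0 by (simp add: cob_0)
 next
  case (Suc m)
  obtain w where w: "w \<in> T" "f (q n) = act w (pe n)" using v unfolding Suc Bc_Suc by blast
  have wc: "w \<in> carrier Tm" using w by simp
  \<comment> \<open>The first summand accounts for the value at \<open>q n\<close>, through a
    preimage w of it; the second is f applied to the homotopy.\<close>
  define g where "g = (\<lambda>x\<in>carrier (P m). (\<lambda>x\<in>carrier (P m). act w (Gm m x)) x \<oplus>\<^bsub>Tm\<^esub> (\<lambda>x\<in>carrier (P m). f (h m x)) x)"
  have fm: "f \<in> right_hom A (P (Suc m)) Tm" using fh(1) Suc by simp
  have g: "g \<in> right_hom A (P m) Tm" unfolding g_def
   by (rule right_hom_add[OF right_P right_Tm act_Gm_hom[OF w(1)] right_hom_comp[OF right_P h(1) fm]])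
  have gx: "g x = act w (Gm m x) + f (h m x)" if "x \<in> carrier (P m)" for x
   using that by (simp add: g_def)
  have "f x = g (d m x)" if x: "x \<in> carrier (P n)" for x
  proof -
   have x': "x \<in> carrier (P (Suc m))" using x Suc by simp
   have hx: "h n x \<in> carrier (P (Suc n))" "h m (d m x) \<in> carrier (P n)"
    using right_homD(1)[OF h(1) x] right_homD(1)[OF h(1) P.D_closed[OF x']] Suc by simp_all
   have "f (\<theta> n x) = f (d n (h n x)) + f (h m (d m x))"
    using homD(2)[OF fh(1) P.D_closed[OF hx(1)] hx(2)] h(3)[OF x'] Suc by simp
   then have 1: "f (\<theta> n x) = f (h m (d m x))" using fh(2) hx(1) by simp
   have "act (f (q n)) (Gm n x) = act w (pe n \<otimes>\<^bsub>A\<^esub> Gm n x)"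
    unfolding w(2) by (rule P.M.smult_assoc[OF pe_carrier Gm_A[OF x] wc, symmetric])
   also have "pe n \<otimes>\<^bsub>A\<^esub> Gm n x = Gm m (d m x)" using Gm(3)[OF x'] Suc by simp
   finally show ?thesis using fth[OF x] 1 gx[OF P.D_closed[OF x']] by simp
  qed
  then have "f = (\<lambda>x\<in>carrier (P n). g (d m x))"
   using right_homD(4)[OF fh(1)] by (auto simp: extensional_def fun_eq_iff restrict_def)
  then show ?thesis using g Suc by (auto simp: cob_Suc)
 qed
qed

end

section \<open>Ext and the Yoneda product in terms of subquotients of \<open>T\<close>\<close>

context ext_setup
begin

text \<open>An Ext class as the set of all its cocycles, which is the coset form produced by
  \<open>ext_class\<close>.\<close>

definition cl :: "nat => 'l => ('m => 'l) set" where "cl n y = {f \<in> coc n. f (q n) - y \<in> Bc n}"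

lemma coc_add: assumes "f \<in> coc n" "g \<in> coc n" shows "(\<lambda>x\<in>carrier (P n). f x + g x) \<in> coc n"
 using right_hom_add[OF right_P right_Tm, of f n g] assms P.D_closed by (simp add: coc_iff)

lemma coc_sub: assumes "f \<in> coc n" "g \<in> coc n" shows "(\<lambda>x\<in>carrier (P n). f x - g x) \<in> coc n"
proof -
 have h: "f \<in> right_hom A (P n) Tm" "g \<in> right_hom A (P n) Tm" using assms by (simp_all add: coc_iff)
 have "(\<lambda>x\<in>carrier (P n). f x \<ominus>\<^bsub>Tm\<^esub> g x) \<in> right_hom A (P n) Tm"
  by (rule right_hom_sub[OF right_P right_Tm h])
 moreover have "(\<lambda>x\<in>carrier (P n). f x \<ominus>\<^bsub>Tm\<^esub> g x) = (\<lambda>x\<in>carrier (P n). f x - g x)"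
  using homD(1)[OF h(1)] homD(1)[OF h(2)] by (intro restrict_ext) (rule Tm_minus)
 ultimately show ?thesis using assms P.D_closed by (simp add: coc_iff)
qed

lemma coc_smult: assumes "s \<in> S" "f \<in> coc n" shows "(\<lambda>x\<in>carrier (P n). f x * s) \<in> coc n"
proof -
 have f: "f \<in> right_hom A (P n) Tm" using assms by (simp add: coc_iff)
 have "(\<lambda>x\<in>carrier (P n). f x * s) \<in> right_hom A (P n) Tm"
 proof (rule right_homI[OF right_P])
  fix x assume x: "x \<in> carrier (P n)"
  show "f x * s \<in> carrier Tm" using homD(1)[OF f x] S_T[OF assms(1)] by simp
  fix y assume y: "y \<in> carrier (P n)"
  show "f (x \<oplus>\<^bsub>P n\<^esub> y) * s = f x * s \<oplus>\<^bsub>Tm\<^esub> f y * s" using homD(2)[OF f x y] by (simp add: distrib_right)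
 next
  fix a x assume a: "a \<in> carrier A" and x: "x \<in> carrier (P n)"
  have "act (f x * s) a = act (f x) a * s"
   by (simp add: G_mult S_G[OF assms(1)] sum_distrib_left mult_ac)
  then show "f (a \<odot>\<^bsub>P n\<^esub> x) * s = a \<odot>\<^bsub>Tm\<^esub> (f x * s)" using homD(3)[OF f a x] by simp
 qed
 then show ?thesis using assms P.D_closed by (simp add: coc_iff)
qed

lemma coc_ext: "f \<in> coc n ==> g \<in> coc n ==> (!!x. x \<in> carrier (P n) ==> f x = g x) ==> f = g"
 using right_hom_ext[of f A "P n" Tm g] by (simp add: coc_iff)

text \<open>Cocycles with congruent values differ by a coboundary: this is \<open>coc_inj\<close>
  for their difference.\<close>

lemma ext_class_eq: assumes f: "f \<in> coc n" shows "ext_class A P d Tm n f = cl n (f (q n))"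
proof -
 have "ext_class A P d Tm n f = (\<Union>h\<in>cob n. {\<lambda>x\<in>carrier (P n). h x + f x})"
  by (simp add: ext_class_def a_r_coset_def')
 also have "\<dots> = cl n (f (q n))"
 proof (intro equalityI subsetI)
  fix g assume "g \<in> (\<Union>h\<in>cob n. {\<lambda>x\<in>carrier (P n). h x + f x})"
  then obtain h where h: "h \<in> cob n" "g = (\<lambda>x\<in>carrier (P n). h x + f x)" by auto
  then show "g \<in> cl n (f (q n))"
   using coc_add[OF cob_coc[OF h(1)] f] cob_value[OF h(1)] q(1)[of n] by (simp add: cl_def)
 next
  fix g assume g: "g \<in> cl n (f (q n))"
  define h where "h = (\<lambda>x\<in>carrier (P n). g x - f x)"
  have gc: "g \<in> coc n" using g by (simp add: cl_def)
  have hc: "h \<in> coc n" unfolding h_def by (rule coc_sub[OF gc f])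
  have "h (q n) \<in> Bc n" using g q(1)[of n] by (simp add: h_def cl_def)
  then have "h \<in> cob n" using coc_inj[OF hc] by blast
  moreover have "g = (\<lambda>x\<in>carrier (P n). h x + f x)"
   by (rule coc_ext[OF gc coc_add[OF hc f]]) (simp add: h_def)
  ultimately show "g \<in> (\<Union>h\<in>cob n. {\<lambda>x\<in>carrier (P n). h x + f x})" by blast
 qed
 finally show ?thesis .
qed

lemma cl_nonempty: "y \<in> Zc n ==> \<exists>f. f \<in> cl n y"
 using coc_surj[of y n] by (auto simp: cl_def)

lemma cl_eqI: assumes "y - y' \<in> Bc n" shows "cl n y = cl n y'"
proof -
 have "cl n y \<subseteq> cl n y'" if "y - y' \<in> Bc n" for y y'
  using Bc_cong_trans[OF _ that] by (auto simp: cl_def)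
 from this[OF assms] this[OF Bc_cong_sym[OF assms]] show ?thesis by blast
qed

lemma cl_eq_iff: assumes "y \<in> Zc n" "y' \<in> Zc n" shows "cl n y = cl n y' \<longleftrightarrow> y - y' \<in> Bc n"
proof
 assume h: "cl n y = cl n y'"
 obtain f where "f \<in> cl n y" using cl_nonempty[OF assms(1)] by blast
 then have "f (q n) - y \<in> Bc n" "f (q n) - y' \<in> Bc n" using h by (auto simp: cl_def)
 then show "y - y' \<in> Bc n" using Bc_cong_trans[OF Bc_cong_sym] by blast
qed (rule cl_eqI)

lemma ext_class_rep: "f \<in> cl n y ==> ext_class A P d Tm n f = cl n y"
 using ext_class_eq[of f n] cl_eqI[of "f (q n)" y n] by (simp add: cl_def)

lemma carrier_ext: "carrier (ext_module A P d Tm n) = cl n ` Zc n"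
proof -
 have "ext_class A P d Tm n ` coc n = cl n ` Zc n"
 proof (intro equalityI subsetI)
  fix U assume "U \<in> cl n ` Zc n"
  then obtain y where y: "y \<in> Zc n" "U = cl n y" by blast
  obtain f where "f \<in> cl n y" using cl_nonempty[OF y(1)] by blast
  then show "U \<in> ext_class A P d Tm n ` coc n" using ext_class_rep[of f n y] y(2) by (auto simp: cl_def)
 qed (use ext_class_eq coc_value in auto)
 then show ?thesis by (simp add: ext_module_def)
qed

lemma zero_ext: "\<zero>\<^bsub>ext_module A P d Tm n\<^esub> = cl n 0"
proof -
 have "cob n = cl n 0" using cob_coc cob_value coc_inj by (auto simp: cl_def)
 then show ?thesis by (simp add: ext_module_def)
qed

lemma add_ext: assumes "y \<in> Zc n" "y' \<in> Zc n"
 shows "cl n y \<oplus>\<^bsub>ext_module A P d Tm n\<^esub> cl n y' = cl n (y + y')"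
proof -
 have "cl n y \<oplus>\<^bsub>ext_module A P d Tm n\<^esub> cl n y' = (\<Union>f\<in>cl n y. \<Union>g\<in>cl n y'. {\<lambda>x\<in>carrier (P n). f x + g x})"
  by (simp add: ext_module_def set_add_def')
 also have "\<dots> = cl n (y + y')"
 proof (intro equalityI subsetI)
  fix k assume "k \<in> (\<Union>f\<in>cl n y. \<Union>g\<in>cl n y'. {\<lambda>x\<in>carrier (P n). f x + g x})"
  then obtain f g where h: "f \<in> coc n" "f (q n) - y \<in> Bc n" "g \<in> coc n" "g (q n) - y' \<in> Bc n"
   "k = (\<lambda>x\<in>carrier (P n). f x + g x)" by (auto simp: cl_def)
  have "k (q n) = f (q n) + g (q n)" using q(1)[of n] h(5) by simp
  then have "k (q n) - (y + y') = (f (q n) - y) + (g (q n) - y')" by simp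
  then have "k (q n) - (y + y') \<in> Bc n" using Bc_add[OF h(2,4)] by (simp only:)
  moreover have "k \<in> coc n" unfolding h(5) by (rule coc_add[OF h(1,3)])
  ultimately show "k \<in> cl n (y + y')" by (simp add: cl_def)
 next
  fix k assume k: "k \<in> cl n (y + y')"
  obtain f where f: "f \<in> cl n y" using cl_nonempty[OF assms(1)] by blast
  then have fc: "f \<in> coc n" "f (q n) - y \<in> Bc n" and kc: "k \<in> coc n" "k (q n) - (y + y') \<in> Bc n"
   using k by (auto simp: cl_def)
  define g where "g = (\<lambda>x\<in>carrier (P n). k x - f x)"
  have gc: "g \<in> coc n" unfolding g_def by (rule coc_sub[OF kc(1) fc(1)])
  have "g (q n) - y' = (k (q n) - (y + y')) - (f (q n) - y)" using q(1)[of n] by (simp add: g_def)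
  then have "g (q n) - y' \<in> Bc n" using Bc_diff[OF kc(2) fc(2)] by (simp only:)
  then have "g \<in> cl n y'" using gc by (simp add: cl_def)
  moreover have "k = (\<lambda>x\<in>carrier (P n). f x + g x)"
   by (rule coc_ext[OF kc(1) coc_add[OF fc(1) gc]]) (simp add: g_def)
  ultimately show "k \<in> (\<Union>f\<in>cl n y. \<Union>g\<in>cl n y'. {\<lambda>x\<in>carrier (P n). f x + g x})" using f by blast
 qed
 finally show ?thesis .
qed

lemma smult_ext: assumes "a \<in> S" "y \<in> Zc n"
 shows "a \<odot>\<^bsub>ext_module A P d Tm n\<^esub> cl n y = cl n (a * y)"
proof -
 have "a \<odot>\<^bsub>ext_module A P d Tm n\<^esub> cl n y = (\<Union>f\<in>cl n y. ext_class A P d Tm n (\<lambda>x\<in>carrier (P n). f x * a))"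
  by (simp add: ext_module_def)
 moreover have "ext_class A P d Tm n (\<lambda>x\<in>carrier (P n). f x * a) = cl n (a * y)" if "f \<in> cl n y" for f
 proof (rule ext_class_rep)
  have f: "f \<in> coc n" "f (q n) - y \<in> Bc n" using that by (auto simp: cl_def)
  show "(\<lambda>x\<in>carrier (P n). f x * a) \<in> cl n (a * y)"
   using coc_smult[OF assms(1) f(1)] Bc_smult[OF assms(1) f(2)] q(1)[of n]
   by (simp add: cl_def algebra_simps)
 qed
 ultimately show ?thesis using cl_nonempty[OF assms(2)] by blast
qed

lemma unit_ext: "ext_class A P d Tm 0 \<epsilon> = cl 0 1"
proof -
 have "\<epsilon> \<in> coc 0" using P.aug P.aug_D by (simp add: coc_iff)
 then show ?thesis using ext_class_eq[of \<epsilon> 0] q(2) by simp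
qed

text \<open>The coefficients of the chain map over the periodic resolution which lifts the cocycle
 with value \<open>y = \<delta> u\<close> (in odd degree) or \<open>y \<in> S\<close> (in even degree).\<close>

definition codd :: "'l => ('l => 'l) => 'l" where "codd u = (%\<kappa>. if \<kappa> \<in> G then u - \<sigma> (\<kappa> u) else 0)"

definition cc :: "nat => 'l => 'l => nat => ('l => 'l) => 'l" where
 "cc i y u k = (if even i \<or> even k then scal y else codd u)"

lemma codd_carrier: assumes "\<delta> u \<in> T" shows "codd u \<in> carrier A"
proof -
 have "u - \<sigma> (\<kappa> u) \<in> T" if "\<kappa> \<in> G" for \<kappa>
  using uminus_T[OF G_diff_T[OF assms G_comp[OF sigma_G that]]] by simp
 then show ?thesis by (simp add: codd_def)
qed

text \<open>The origin of the odd product formula and of the sign -1 of the Yoneda model: for a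
  cocycle v of odd degree the first term vanishes.\<close>

lemma act_codd: "act v (codd u) = u * Tr v - Tr (v * \<sigma> u)"
proof -
 have "act v (codd u) = (\<Sum>\<kappa>\<in>G. u * \<kappa> v - \<kappa> (v * \<sigma> u))"
  unfolding galois_module_simps codd_def
  by (rule sum.cong) (simp_all add: G_mult G_commute'[of _ \<sigma>] algebra_simps)
 then show ?thesis by (simp add: sum_subtractf Tr_def sum_distrib_left)
qed

lemma cc_carrier: assumes "y \<in> T" "odd i ==> \<delta> u \<in> T" shows "cc i y u k \<in> carrier A"
 unfolding cc_def using codd_carrier[of u] scal_carrier[OF assms(1)] assms(2)
 by (simp del: twisted_group_ring_simps)

lemma scal_mult_pe: assumes "\<kappa> \<in> G" shows "(scal y \<otimes>\<^bsub>A\<^esub> pe n) \<kappa> = \<kappa> y * pe n \<kappa>" "(pe n \<otimes>\<^bsub>A\<^esub> scal y) \<kappa> = pe n \<kappa> * y"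
proof -
 have "(\<Sum>\<tau>\<in>G. \<tau> (scal y (ginv \<tau> \<circ> \<kappa>)) * pe n \<tau>) = (\<Sum>\<tau>\<in>G. if \<tau> = \<kappa> then \<kappa> y * pe n \<kappa> else 0)"
 proof (rule sum.cong[OF refl])
  fix \<tau> assume t: "\<tau> \<in> G"
  have "ginv \<tau> \<circ> \<kappa> = id \<longleftrightarrow> \<tau> = \<kappa>"
  proof
   assume "ginv \<tau> \<circ> \<kappa> = id"
   then have "\<tau> \<circ> (ginv \<tau> \<circ> \<kappa>) = \<tau>" by (simp only: comp_id)
   then show "\<tau> = \<kappa>" using t by simp
  qed (use t in \<open>simp only: inv_comp\<close>)
  then show "\<tau> (scal y (ginv \<tau> \<circ> \<kappa>)) * pe n \<tau> = (if \<tau> = \<kappa> then \<kappa> y * pe n \<kappa> else 0)"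
   using t by (simp add: scal_def)
 qed
 then show "(scal y \<otimes>\<^bsub>A\<^esub> pe n) \<kappa> = \<kappa> y * pe n \<kappa>" using assms by (simp add: tmult)
 have "(\<Sum>\<tau>\<in>G. \<tau> (pe n (ginv \<tau> \<circ> \<kappa>)) * scal y \<tau>) = (\<Sum>\<tau>\<in>G. if \<tau> = id then pe n \<kappa> * y else 0)"
  by (rule sum.cong) (auto simp: scal_def inv_into_id[simplified])
 then show "(pe n \<otimes>\<^bsub>A\<^esub> scal y) \<kappa> = pe n \<kappa> * y" using assms by (simp add: tmult)
qed

text \<open>For odd i the shift exchanges \<sigma> - 1 and the norm element N. The squares to check
  are y N = (\<sigma> - 1) c for even k and c (\<sigma> - 1) = N y for odd k, and
  \<open>c = codd u\<close> solves both because \<delta> u = y.\<close>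

lemma cc_chain: assumes "even i ==> y \<in> S" "odd i ==> \<delta> u = y"
 shows "cc i y u k \<otimes>\<^bsub>A\<^esub> pe (i + Suc k) = pe (Suc k) \<otimes>\<^bsub>A\<^esub> cc i y u (Suc k)"
proof
 fix \<kappa>
 show "(cc i y u k \<otimes>\<^bsub>A\<^esub> pe (i + Suc k)) \<kappa> = (pe (Suc k) \<otimes>\<^bsub>A\<^esub> cc i y u (Suc k)) \<kappa>"
 proof (cases "\<kappa> \<in> G")
  case K: True
  show ?thesis
  proof (cases "even i")
   case True
   then have "pe (i + Suc k) = pe (Suc k)" by (simp add: pe_def)
   then show ?thesis using True assms(1) scal_mult_pe[OF K] S_G[of y] K by (simp add: cc_def mult.commute)
  next
   case False
   then have du: "\<delta> u = y" using assms(2) by blast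
   show ?thesis
   proof (cases "even k")
    case True
    have "(scal y \<otimes>\<^bsub>A\<^esub> pe (i + Suc k)) \<kappa> = \<kappa> y"
    proof -
     have "pe (i + Suc k) \<kappa> = 1" using K True False by (simp add: pe_def)
     then show ?thesis using scal_mult_pe(1)[OF K] by (simp only: mult_1_right)
    qed
    moreover have "(pe (Suc k) \<otimes>\<^bsub>A\<^esub> codd u) \<kappa> = codd u (\<kappa> \<circ> ginv \<sigma>) - codd u \<kappa>"
     by (rule mult_pe_odd(2)[OF _ K]) (use True in simp)
    moreover have "codd u (\<kappa> \<circ> ginv \<sigma>) - codd u \<kappa> = \<kappa> y"
    proof -
     have "\<kappa> \<circ> ginv \<sigma> \<in> G" using K by blast
     moreover have "\<sigma> ((\<kappa> \<circ> ginv \<sigma>) u) = \<kappa> u"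
      using K by (simp add: G_commute'[of \<sigma> \<kappa>])
     ultimately show ?thesis
      using K du by (simp add: codd_def \<delta>_def G_diff G_commute'[of \<kappa> \<sigma>] del: o_apply flip: du)
    qed
    ultimately show ?thesis using True False by (simp add: cc_def)
   next
    case odd: False
    have "(codd u \<otimes>\<^bsub>A\<^esub> pe (i + Suc k)) \<kappa> = \<sigma> (codd u (ginv \<sigma> \<circ> \<kappa>)) - codd u \<kappa>"
     by (rule mult_pe_odd(1)[OF _ K]) (use False odd in simp)
    moreover have "\<sigma> (codd u (ginv \<sigma> \<circ> \<kappa>)) - codd u \<kappa> = y"
    proof -
     have "ginv \<sigma> \<circ> \<kappa> \<in> G" using K by blast
     moreover have "\<sigma> ((ginv \<sigma> \<circ> \<kappa>) u) = \<kappa> u" by simp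
     ultimately show ?thesis
      using K by (simp add: codd_def \<delta>_def G_diff del: o_apply flip: du)
    qed
    moreover have "(pe (Suc k) \<otimes>\<^bsub>A\<^esub> scal y) \<kappa> = y"
    proof -
     have "pe (Suc k) \<kappa> = 1" using K odd by (simp add: pe_def)
     then show ?thesis using scal_mult_pe(2)[OF K] by (simp only: mult_1)
    qed
    ultimately show ?thesis using odd False by (simp add: cc_def)
   qed
  qed
 qed (simp add: tmult_outside)
qed

text \<open>On the generators q, any lift F and the map with coefficients \<open>cc\<close> are two
  chain maps over the same cocycle, hence homotopic. The cocycle g sends the homotopy to a
  coboundary.\<close>

lemma chain_lift_value:
 assumes f: "f \<in> coc i" and g: "g \<in> coc j" and F: "F \<in> chain_lifts A P d \<epsilon> i f"
  and u: "odd i ==> \<delta> u = f (q i)"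
 shows "(\<lambda>x\<in>carrier (P (i + j)). g (F j x)) \<in> coc (i + j)"
  and "g (F j (q (i + j))) - act (g (q j)) (cc i (f (q i)) u j) \<in> Bc (i + j)"
proof -
 have Fh: "F k \<in> right_hom A (P (i + k)) (P k)" and F0: "x \<in> carrier (P i) ==> \<epsilon> (F 0 x) = f x"
  and Fd: "x \<in> carrier (P (i + Suc k)) ==> d k (F (Suc k) x) = F k (d (i + k) x)" for k x
  using F by (simp_all add: chain_lifts_def)
 have fh: "f \<in> right_hom A (P i) Tm" and gh: "g \<in> right_hom A (P j) Tm" and gd: "!!x. x \<in> carrier (P (Suc j)) ==> g (d j x) = 0"
  using f g by (simp_all add: coc_iff)
 have "(\<lambda>x\<in>carrier (P (i + j)). g (F j x)) \<in> right_hom A (P (i + j)) Tm" by (rule right_hom_comp[OF right_P Fh gh])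
 moreover have "g (F j (d (i + j) x)) = 0" if x: "x \<in> carrier (P (Suc (i + j)))" for x
  using Fd[of x j] gd[of "F (Suc j) x"] right_homD(1)[OF Fh[of "Suc j"]] x by simp
 ultimately show "(\<lambda>x\<in>carrier (P (i + j)). g (F j x)) \<in> coc (i + j)" using P.D_closed by (simp add: coc_iff)
 define y where "y = f (q i)"
 have yZ: "y \<in> Zc i" unfolding y_def by (rule coc_value[OF f])
 have yT: "y \<in> T" by (rule Zc_T[OF yZ])
 define c where "c k = cc i y u k" for k
 have c: "c k \<in> carrier A" for k unfolding c_def by (rule cc_carrier[OF yT]) (use u yT y_def in simp)
 have cch: "c k \<otimes>\<^bsub>A\<^esub> pe (i + Suc k) = pe (Suc k) \<otimes>\<^bsub>A\<^esub> c (Suc k)" for k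
  unfolding c_def by (rule cc_chain) (use yZ u y_def in \<open>simp_all add: Zc_def\<close>)
 define a where "a k = F k (q (i + k)) \<ominus>\<^bsub>P k\<^esub> c k \<odot>\<^bsub>P k\<^esub> q k" for k
 have Fq: "F k (q (i + k)) \<in> carrier (P k)" for k by (rule right_homD(1)[OF Fh q(1)])
 have cq: "c k \<odot>\<^bsub>P k\<^esub> q k \<in> carrier (P k)" for k by (rule rmod.smult_closed[OF P.rmod_R c q(1)])
 have ac: "a k \<in> carrier (P k)" for k
 proof -
  interpret Pk: rmod A "P k" by (rule P.rmod_R)
  show ?thesis unfolding a_def by (rule Pk.M.minus_closed[OF Fq cq])
 qed
 have "\<exists>r. (\<forall>k. r k \<in> carrier (P (Suc k))) & a 0 = d 0 (r 0) &
  (\<forall>k. a (Suc k) = d (Suc k) (r (Suc k)) \<oplus>\<^bsub>P (Suc k)\<^esub> pe (i + Suc k) \<odot>\<^bsub>P (Suc k)\<^esub> r k)"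
 proof (rule P.element_homotopy[of "%k. pe (i + k)"])
  show "pe (i + k) \<in> carrier A" for k by (rule pe_carrier)
  show "pe (i + k) \<otimes>\<^bsub>A\<^esub> pe (i + Suc k) = \<zero>\<^bsub>A\<^esub>" for k using pe_pe[of "i + k"] by simp
  have "\<epsilon> (a 0) = \<epsilon> (F 0 (q (i + 0))) \<ominus>\<^bsub>Tm\<^esub> \<epsilon> (c 0 \<odot>\<^bsub>P 0\<^esub> q 0)"
   unfolding a_def by (rule right_hom_diff[OF right_P right_Tm P.aug Fq cq])
  also have "\<epsilon> (F 0 (q (i + 0))) = y" using F0[OF q(1)] by (simp add: y_def)
  also have "\<epsilon> (c 0 \<odot>\<^bsub>P 0\<^esub> q 0) = act 1 (c 0)"
   unfolding right_homD(3)[OF P.aug c q(1)] q(2) ..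
  also have "c 0 = scal y" by (simp add: c_def cc_def)
  also have "act 1 (scal y) = y" by (simp only: act_scal mult_1)
  also have "y \<ominus>\<^bsub>Tm\<^esub> y = \<zero>\<^bsub>Tm\<^esub>" using yT P.M.eq_diff_zero[of y y] by simp
  finally show "\<epsilon> (a 0) = \<zero>\<^bsub>Tm\<^esub>" .
  fix k
  interpret Pk: rmod A "P k" by (rule P.rmod_R)
  have "d k (a (Suc k)) = d k (F (Suc k) (q (i + Suc k))) \<ominus>\<^bsub>P k\<^esub> d k (c (Suc k) \<odot>\<^bsub>P (Suc k)\<^esub> q (Suc k))"
   unfolding a_def by (rule P.D_diff[OF Fq cq])
  also have "d k (F (Suc k) (q (i + Suc k))) = pe (i + Suc k) \<odot>\<^bsub>P k\<^esub> F k (q (i + k))"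
   using Fd[OF q(1)] q(3)[of "i + k"] right_homD(3)[OF Fh pe_carrier q(1)] by simp
  also have "d k (c (Suc k) \<odot>\<^bsub>P (Suc k)\<^esub> q (Suc k)) = (pe (Suc k) \<otimes>\<^bsub>A\<^esub> c (Suc k)) \<odot>\<^bsub>P k\<^esub> q k"
   unfolding P.D_smult[OF c q(1)] q(3) by (rule Pk.smult_assoc[OF pe_carrier c q(1), symmetric])
  also have "\<dots> = pe (i + Suc k) \<odot>\<^bsub>P k\<^esub> (c k \<odot>\<^bsub>P k\<^esub> q k)"
   unfolding cch[symmetric] by (rule Pk.smult_assoc[OF c pe_carrier q(1)])
  finally show "d k (a (Suc k)) = pe (i + Suc k) \<odot>\<^bsub>P k\<^esub> a k"
   unfolding a_def Pk.smult_r_diff[OF pe_carrier Fq cq] .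
 qed (rule ac)
 then obtain r where r: "!!k. r k \<in> carrier (P (Suc k))" "a 0 = d 0 (r 0)"
  "!!k. a (Suc k) = d (Suc k) (r (Suc k)) \<oplus>\<^bsub>P (Suc k)\<^esub> pe (i + Suc k) \<odot>\<^bsub>P (Suc k)\<^esub> r k" by blast
 have "g (a j) = g (F j (q (i + j))) \<ominus>\<^bsub>Tm\<^esub> g (c j \<odot>\<^bsub>P j\<^esub> q j)"
  unfolding a_def by (rule right_hom_diff[OF right_P right_Tm gh Fq cq])
 also have "\<dots> = g (F j (q (i + j))) - g (c j \<odot>\<^bsub>P j\<^esub> q j)" by (rule Tm_minus[OF homD(1)[OF gh Fq] homD(1)[OF gh cq]])
 also have "g (c j \<odot>\<^bsub>P j\<^esub> q j) = act (g (q j)) (c j)" by (rule homD(3)[OF gh c q(1)])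
 finally have ga: "g (a j) = g (F j (q (i + j))) - act (g (q j)) (c j)" .
 have "g (a j) \<in> Bc (i + j)"
 proof (cases j)
  case 0
  then have "g (a j) = 0" using gd[of "r 0"] r(1)[of 0] r(2) by simp
  then show ?thesis by simp
 next
  case (Suc m)
  interpret Pj: rmod A "P j" by (rule P.rmod_R)
  have rm: "r m \<in> carrier (P j)" using r(1)[of m] Suc by simp
  have "g (a j) = g (d j (r j)) + g (pe (i + j) \<odot>\<^bsub>P j\<^esub> r m)"
   using homD(2)[OF gh P.D_closed[OF r(1)] Pj.smult_closed[OF pe_carrier rm]] r(3)[of m] Suc by simp
  also have "\<dots> = act (g (r m)) (pe (i + j))" using gd[OF r(1)] homD(3)[OF gh pe_carrier rm] by simp
  also have "\<dots> \<in> Bc (i + j)" using Bc_Suc[of "i + m"] homD(1)[OF gh rm] Suc by auto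
  finally show ?thesis .
 qed
 then show "g (F j (q (i + j))) - act (g (q j)) (cc i (f (q i)) u j) \<in> Bc (i + j)"
  unfolding ga c_def y_def .
qed

lemma chain_lifts_nonempty: assumes "f \<in> coc i" shows "\<exists>F. F \<in> chain_lifts A P d \<epsilon> i f"
proof -
 have "\<exists>F. (\<forall>k. F k \<in> right_hom A (P (i + k)) (P k)) & (\<forall>x\<in>carrier (P i). \<epsilon> (F 0 x) = f x) &
  (\<forall>k. \<forall>x\<in>carrier (P (i + Suc k)). d k (F (Suc k) x) = F k (d (i + k) x))"
  using assms projective_P P.D P.D_D
  by (intro P.chain_lift_exists[where P = P and d = d]) (simp_all add: coc_iff)
 then show ?thesis by (auto simp: chain_lifts_def)
qed

text \<open>The product is defined as a union over representatives and lifts. It is a single class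
  once all members of the union agree and at least one exists.\<close>

lemma yoneda_aux:
 assumes U: "y \<in> Zc i" and V: "v \<in> Zc j" and w: "!!f g u. f \<in> cl i y ==> g \<in> cl j v ==> (odd i ==> \<delta> u = f (q i)) ==>
   act (g (q j)) (cc i (f (q i)) u j) - w \<in> Bc (i + j)"
 shows "yoneda_product A Tm P d \<epsilon> i j (cl i y) (cl j v) = cl (i + j) w"
proof -
 have eq: "ext_class A P d Tm (i + j) (\<lambda>x\<in>carrier (P (i + j)). g (F j x)) = cl (i + j) w"
  if f: "f \<in> cl i y" and g: "g \<in> cl j v" and F: "F \<in> chain_lifts A P d \<epsilon> i f" for f g F
 proof -
  have fc: "f \<in> coc i" "g \<in> coc j" using f g by (simp_all add: cl_def)
  obtain u where u: "odd i ==> \<delta> u = f (q i)"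
   using h90[of "f (q i)"] coc_value[OF fc(1)] by (cases "odd i") (auto simp: Zc_def)
  note cv = chain_lift_value[OF fc F u]
  have "(\<lambda>x\<in>carrier (P (i + j)). g (F j x)) \<in> cl (i + j) w"
   using cv(1) Bc_cong_trans[OF cv(2) w[OF f g u]] q(1)[of "i + j"] by (simp add: cl_def)
  then show ?thesis by (rule ext_class_rep)
 qed
 obtain f where f: "f \<in> cl i y" using cl_nonempty[OF U] by blast
 obtain g where g: "g \<in> cl j v" using cl_nonempty[OF V] by blast
 have "f \<in> coc i" using f by (simp add: cl_def)
 then obtain F where F: "F \<in> chain_lifts A P d \<epsilon> i f" using chain_lifts_nonempty by blast
 show ?thesis unfolding yoneda_product_def
 proof (intro equalityI subsetI)
  fix h assume "h \<in> cl (i + j) w"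
  then show "h \<in> (\<Union>f\<in>cl i y. \<Union>g\<in>cl j v. \<Union>F\<in>chain_lifts A P d \<epsilon> i f.
    ext_class A P d Tm (i + j) (\<lambda>x\<in>carrier (P (i + j)). g (F j x)))"
   using f g F eq[OF f g F] by blast
 qed (use eq in blast)
qed

theorem ext_model:
 "cohomology_model (ext_module A P d Tm) (yoneda_product A Tm P d \<epsilon>) (ext_class A P d Tm 0 \<epsilon>) cl (-1)"
proof -
 have 1: "yoneda_product A Tm P d \<epsilon> i j (cl i y) (cl j v) = cl (i + j) (y * v)"
  if yv: "y \<in> Zc i" "v \<in> Zc j" "even i \<or> even j" for i j y v
 proof (rule yoneda_aux[OF yv(1,2)])
  fix f g u assume fg: "f \<in> cl i y" "g \<in> cl j v"
  have "act (g (q j)) (cc i (f (q i)) u j) = f (q i) * g (q j)"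
   using yv(3) act_scal by (simp add: cc_def mult.commute del: galois_module_simps(4))
  moreover have "f (q i) * g (q j) - y * v \<in> Bc (i + j)"
   by (rule even_product_cong[OF yv(1) _ yv(2) _ yv(3)]) (use fg in \<open>simp_all add: cl_def\<close>)
  ultimately show "act (g (q j)) (cc i (f (q i)) u j) - y * v \<in> Bc (i + j)" by simp
 qed
 have 2: "yoneda_product A Tm P d \<epsilon> i j (cl i (\<delta> u)) (cl j v) = cl (i + j) (- 1 * Tr (v * \<sigma> u))"
  if v: "v \<in> Zc j" and ij: "odd i" "odd j" and u: "\<delta> u \<in> T" for i j u v
 proof (rule yoneda_aux[OF _ v])
  show "\<delta> u \<in> Zc i" using ij u by (simp add: Zc_def)
  fix f g u' assume f: "f \<in> cl i (\<delta> u)" and g: "g \<in> cl j v" and u': "odd i ==> \<delta> u' = f (q i)"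
  have "Tr (g (q j)) = 0" using coc_value[of g j] g ij by (simp add: cl_def Zc_def)
  then have "act (g (q j)) (cc i (f (q i)) u' j) = - Tr (g (q j) * \<sigma> u')"
   using ij act_codd[where v = "g (q j)" and u = u'] by (simp add: cc_def del: galois_module_simps(4))
  moreover have "Tr (g (q j) * \<sigma> u') - Tr (v * \<sigma> u) \<in> Tr ` T"
  proof (rule odd_product_cong[OF u _ v ij(2)])
   show "\<delta> u' - \<delta> u \<in> \<delta> ` T" using f u' ij odd_pos[OF ij(1)] by (simp add: cl_def Bc_def)
   show "g (q j) - v \<in> Bc j" using g by (simp add: cl_def)
  qed
  then have "- (Tr (g (q j) * \<sigma> u') - Tr (v * \<sigma> u)) \<in> Bc (i + j)"
   using ij odd_pos[OF ij(1)] by (intro Bc_uminus) (simp add: Bc_def)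
  ultimately show "act (g (q j)) (cc i (f (q i)) u' j) - - 1 * Tr (v * \<sigma> u) \<in> Bc (i + j)"
   by (simp del: galois_module_simps(4))
 qed
 show ?thesis unfolding cohomology_model_def
  using unit_ext carrier_ext zero_ext cl_eq_iff add_ext smult_ext 1 2
  by (simp del: galois_module_simps(4))
qed

end

section \<open>The bar resolution with coefficients in T\<close>

text \<open>The simplicial coboundary of a function on tuples, with deletion of an entry as face
  map. It is defined on lists of all lengths at once, which permits induction on the list.\<close>

definition Dl :: "('g list => 'l::field) => 'g list => 'l" where
 "Dl \<phi> v = (\<Sum>i<length v. (-1) ^ i * \<phi> (take i v @ drop (Suc i) v))"

definition ind :: "'g list => 'g list => 'l::field" where "ind w = (%v. if v = w then 1 else 0)"

lemma Dl_Nil [simp]: "Dl \<phi> [] = 0"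
 by (simp add: Dl_def)

lemma Dl_Cons: "Dl \<phi> (g # v) = \<phi> v - Dl (%u. \<phi> (g # u)) v"
 by (simp add: Dl_def sum.lessThan_Suc_shift sum_negf[symmetric] del: sum.lessThan_Suc)

lemma Dl_diff: "Dl (%w. \<phi> w - \<psi> w) v = Dl \<phi> v - Dl \<psi> v"
 by (simp add: Dl_def sum_subtractf right_diff_distrib)

lemma Dl_smult: "Dl (%w. c * \<phi> w) v = c * Dl \<phi> v"
 by (simp add: Dl_def sum_distrib_left mult_ac)

lemma Dl_Dl: "Dl (Dl \<phi>) v = 0"
proof (induction v arbitrary: \<phi>)
 case (Cons g v)
 have "Dl (Dl \<phi>) (g # v) = Dl \<phi> v - Dl (%u. \<phi> u - Dl (%w. \<phi> (g # w)) u) v"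
  by (simp add: Dl_Cons)
 also have "\<dots> = 0" by (simp add: Dl_diff Cons.IH)
 finally show ?case .
qed simp

lemma Dl_map: "Dl \<phi> (map f v) = Dl (%u. \<phi> (map f u)) v"
 by (simp add: Dl_def take_map drop_map)

text \<open>The Leibniz rule for cochains. Splitting off the first entry of the tuple lowers the
  degree of \<alpha> by one and gives the induction on i.\<close>

lemma Dl_cup:
 assumes "length v = Suc (Suc (i + k))"
 shows "Dl (%w. \<alpha> (take (Suc i) w) * \<phi> (drop i w)) v
  = Dl \<alpha> (take (Suc (Suc i)) v) * \<phi> (drop (Suc i) v) + (-1) ^ i * \<alpha> (take (Suc i) v) * Dl \<phi> (drop i v)"
 using assms
proof (induction i arbitrary: v \<alpha>)
 case 0
 then obtain g h u where v: "v = g # h # u" by (metis Suc_length_conv)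
 have "Dl (%w. \<alpha> (take (Suc 0) w) * \<phi> (drop 0 w)) v = \<alpha> [h] * \<phi> (h # u) - \<alpha> [g] * Dl (%w. \<phi> (g # w)) (h # u)"
  unfolding v by (subst Dl_Cons) (simp add: Dl_smult)
 then show ?case unfolding v by (simp add: Dl_Cons[of _ g] Dl_Cons[of _ h "[]"] algebra_simps)
next
 case (Suc i)
 then obtain g u where v: "v = g # u" and u: "length u = Suc (Suc (i + k))" by (metis add_Suc length_Suc_conv)
 have "Dl (%w. \<alpha> (take (Suc (Suc i)) w) * \<phi> (drop (Suc i) w)) v
  = \<alpha> (take (Suc (Suc i)) u) * \<phi> (drop (Suc i) u) - Dl (%w. \<alpha> (g # take (Suc i) w) * \<phi> (drop i w)) u"
  unfolding v by (subst Dl_Cons) simp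
 then show ?case unfolding v using Suc.IH[OF u, of "%w. \<alpha> (g # w)"]
  by (simp add: Dl_Cons[of \<alpha> g] algebra_simps)
qed

lemma finite_bar_tuples [simp]: "finite G ==> finite (bar_tuples G n)"
 unfolding bar_tuples_def by (rule finite_lists_length_eq)

lemma bar_module_simps [simp]:
 "carrier (bar_module G R n) = {f. (\<forall>w\<in>bar_tuples G n. f w \<in> R) & (\<forall>w. w \<notin> bar_tuples G n --> f w = 0)}"
 "\<zero>\<^bsub>bar_module G R n\<^esub> = (%_. 0)" "f \<oplus>\<^bsub>bar_module G R n\<^esub> g = (%w. f w + g w)"
 by (simp_all add: bar_module_def)

lemma delete_bar_tuples: "v \<in> bar_tuples G (Suc n) ==> i < Suc (Suc n) ==> take i v @ drop (Suc i) v \<in> bar_tuples G n"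
 using set_take_subset[of i v] set_drop_subset[of "Suc i" v] by (auto simp: bar_tuples_def)

lemma bar_diff_eq: assumes G: "finite G" and f: "f \<in> carrier (bar_module G R (Suc n))"
 shows "bar_diff G R n f w = (\<Sum>v\<in>bar_tuples G (Suc n). f v * Dl (ind w) v)"
proof -
 let ?A = "bar_tuples G (Suc n) \<times> {..Suc n}"
 have "bar_diff G R n f w = (\<Sum>(v, i)\<in>{(v, i) \<in> ?A. take i v @ drop (Suc i) v = w}. (-1) ^ i * f v)"
  using f by (simp add: bar_diff_def)
 also have "{(v, i) \<in> ?A. take i v @ drop (Suc i) v = w} = {x \<in> ?A. take (snd x) (fst x) @ drop (Suc (snd x)) (fst x) = w}"
  by auto
 also have "(\<Sum>(v, i)\<in>\<dots>. (-1) ^ i * f v)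
  = (\<Sum>x\<in>?A. if take (snd x) (fst x) @ drop (Suc (snd x)) (fst x) = w then (-1) ^ snd x * f (fst x) else 0)"
  using G by (subst sum.inter_filter) (auto intro!: sum.cong split: prod.splits)
 also have "\<dots> = (\<Sum>v\<in>bar_tuples G (Suc n). \<Sum>i\<le>Suc n. if take i v @ drop (Suc i) v = w then (-1) ^ i * f v else 0)"
  unfolding sum.cartesian_product by (simp only: case_prod_unfold)
 also have "\<dots> = (\<Sum>v\<in>bar_tuples G (Suc n). f v * Dl (ind w) v)"
 proof (rule sum.cong[OF refl])
  fix v assume "v \<in> bar_tuples G (Suc n)"
  then have "{..<length v} = {..Suc n}" by (auto simp: bar_tuples_def)
  then show "(\<Sum>i\<le>Suc n. if take i v @ drop (Suc i) v = w then (-1) ^ i * f v else 0) = f v * Dl (ind w) v"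
   unfolding Dl_def sum_distrib_left by (intro sum.cong) (auto simp: ind_def)
 qed
 finally show ?thesis .
qed

lemma bar_diff_outside:
 fixes f :: "('l::field => 'l) list => 'l"
 assumes "finite G" "f \<in> carrier (bar_module G R (Suc n))" "w \<notin> bar_tuples G n"
 shows "bar_diff G R n f w = 0"
proof -
 have "Dl (ind w) v = (0::'l)" if "v \<in> bar_tuples G (Suc n)" for v
  unfolding Dl_def
 proof (rule sum.neutral, intro ballI)
  fix i assume "i \<in> {..<length v}"
  then have "take i v @ drop (Suc i) v \<in> bar_tuples G n"
   using delete_bar_tuples[OF that, of i] that by (simp add: bar_tuples_def)
  then show "(-1) ^ i * ind w (take i v @ drop (Suc i) v) = (0::'l)" using assms(3) by (auto simp: ind_def)
 qed
 then show ?thesis using bar_diff_eq[OF assms(1,2)] by simp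
qed

text \<open>Boundary and coboundary are adjoint. Computations with the boundary thereby become
  computations with \<open>Dl\<close>, where recursion on lists is available.\<close>

lemma bar_diff_pairing: assumes G: "finite G" and f: "f \<in> carrier (bar_module G R (Suc n))"
 shows "(\<Sum>w\<in>bar_tuples G n. \<phi> w * bar_diff G R n f w) = (\<Sum>v\<in>bar_tuples G (Suc n). f v * Dl \<phi> v)"
proof -
 have "(\<Sum>w\<in>bar_tuples G n. \<phi> w * bar_diff G R n f w)
  = (\<Sum>w\<in>bar_tuples G n. \<Sum>v\<in>bar_tuples G (Suc n). f v * (\<phi> w * Dl (ind w) v))"
  by (simp add: bar_diff_eq[OF G f] sum_distrib_left mult_ac)
 also have "\<dots> = (\<Sum>v\<in>bar_tuples G (Suc n). f v * (\<Sum>w\<in>bar_tuples G n. \<phi> w * Dl (ind w) v))"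
  by (subst sum.swap) (simp add: sum_distrib_left)
 also have "\<dots> = (\<Sum>v\<in>bar_tuples G (Suc n). f v * Dl \<phi> v)"
 proof (rule sum.cong[OF refl])
  fix v assume v: "v \<in> bar_tuples G (Suc n)"
  have "(\<Sum>w\<in>bar_tuples G n. \<phi> w * Dl (ind w) v)
   = (\<Sum>i<length v. \<Sum>w\<in>bar_tuples G n. (-1) ^ i * (\<phi> w * ind w (take i v @ drop (Suc i) v)))"
   unfolding Dl_def sum_distrib_left by (subst sum.swap) (simp add: mult_ac)
  also have "\<dots> = (\<Sum>i<length v. (-1) ^ i * \<phi> (take i v @ drop (Suc i) v))"
  proof (rule sum.cong[OF refl])
   fix i assume "i \<in> {..<length v}"
   then have "take i v @ drop (Suc i) v \<in> bar_tuples G n"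
    using delete_bar_tuples[OF v, of i] v by (simp add: bar_tuples_def)
   then show "(\<Sum>w\<in>bar_tuples G n. (-1) ^ i * (\<phi> w * ind w (take i v @ drop (Suc i) v)))
    = (-1) ^ i * \<phi> (take i v @ drop (Suc i) v)"
    using G by (simp add: ind_def if_distrib[of "%x. _ * x"] cong: if_cong)
  qed
  finally show "f v * (\<Sum>w\<in>bar_tuples G n. \<phi> w * Dl (ind w) v) = f v * Dl \<phi> v" by (simp add: Dl_def)
 qed
 finally show ?thesis .
qed

lemma Dl_closed:
 assumes "0 \<in> R" "!!x y. x \<in> R ==> y \<in> R ==> x + y \<in> R" "!!x. x \<in> R ==> - x \<in> R" "!!v. \<phi> v \<in> R"
 shows "Dl \<phi> v \<in> R"
proof -
 have 1: "(-1) ^ i * x \<in> R" if "x \<in> R" for i x using that assms(3) by (cases "even i") auto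
 have "finite I ==> (\<Sum>i\<in>I. (-1) ^ i * \<phi> (take i v @ drop (Suc i) v)) \<in> R" for I
  by (induction I rule: finite_induct) (use assms 1 in auto)
 then show ?thesis by (simp add: Dl_def)
qed

section \<open>The bar complex with coefficients in \<open>T\<close>, over the twisted group
  ring\<close>

context cyclic_action
begin

abbreviation tup :: "nat => ('l => 'l) list set" where "tup n \<equiv> bar_tuples G n"

definition Lm :: "('l => 'l) => ('l => 'l) list => ('l => 'l) list" where "Lm \<rho> w = map (%g. \<rho> \<circ> g) w"

lemma Lm_tup [simp, intro]: "\<rho> \<in> G ==> w \<in> tup n ==> Lm \<rho> w \<in> tup n"
 by (auto simp: Lm_def bar_tuples_def subset_eq simp del: o_apply)

lemma Lm_Lm: "Lm \<rho> (Lm \<tau> w) = Lm (\<rho> \<circ> \<tau>) w"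
 by (simp add: Lm_def comp_assoc)

lemma Lm_id [simp]: "Lm id w = w"
 unfolding Lm_def by (rule map_idI) (rule id_comp)

lemma Lm_inv [simp]: "\<rho> \<in> G ==> Lm \<rho> (Lm (ginv \<rho>) w) = w" "\<rho> \<in> G ==> Lm (ginv \<rho>) (Lm \<rho> w) = w"
 unfolding Lm_Lm by (simp_all only: inv_comp Lm_id)

lemma Lm_bij: "\<rho> \<in> G ==> bij_betw (Lm \<rho>) (tup n) (tup n)"
 by (rule bij_betw_byWitness[of _ "Lm (ginv \<rho>)"]) auto

lemma Lm_eq_iff: "\<rho> \<in> G ==> Lm \<rho> v = w \<longleftrightarrow> v = Lm (ginv \<rho>) w"
 by (metis Lm_inv)

lemma sum_Lm: "\<rho> \<in> G ==> (\<Sum>w\<in>tup n. F (Lm \<rho> w)) = (\<Sum>w\<in>tup n. F w)"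
 using sum.reindex_bij_betw[OF Lm_bij, of \<rho> F n] by simp

lemma finite_tup [simp]: "finite (tup n)"
 by simp

text \<open>The tensor product of \<open>T\<close> with the bar module over \<open>S\<close>, where
  \<rho> acts on coefficients as well as on tuples. Homomorphisms from it to \<open>T\<close> over
  the twisted group ring correspond to homomorphisms from the bar module to \<open>T\<close> over SG
  (see \<open>res\<close>), so group cohomology becomes another Ext over the twisted group
  ring.\<close>

definition tbar :: "nat => (('l => 'l) => 'l, ('l => 'l) list => 'l) module" where
 "tbar n = (bar_module G T n)\<lparr>module.smult := (%a f w.
   if w \<in> tup n then \<Sum>\<rho>\<in>G. \<rho> (f (Lm (ginv \<rho>) w)) * a \<rho> else 0)\<rparr>"

lemma tbar_simps [simp]:
 "carrier (tbar n) = {f. (\<forall>w\<in>tup n. f w \<in> T) & (\<forall>w. w \<notin> tup n --> f w = 0)}"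
 "\<zero>\<^bsub>tbar n\<^esub> = (%_. 0)" "f \<oplus>\<^bsub>tbar n\<^esub> g = (%w. f w + g w)"
 by (simp_all add: tbar_def bar_module_def)

lemma tbar_smult: "(a \<odot>\<^bsub>tbar n\<^esub> f) w = (if w \<in> tup n then \<Sum>\<rho>\<in>G. \<rho> (f (Lm (ginv \<rho>) w)) * a \<rho> else 0)"
 by (simp add: tbar_def)

lemma tbar_T: "f \<in> carrier (tbar n) ==> f w \<in> T"
 by (cases "w \<in> tup n") auto

lemma right_module_tbar: assumes "ring A" shows "right_module A (tbar n)"
proof -
 have h1: "abelian_group (tbar n)"
 proof (rule abelian_groupI)
  fix f assume "f \<in> carrier (tbar n)"
  then show "\<exists>g\<in>carrier (tbar n). g \<oplus>\<^bsub>tbar n\<^esub> f = \<zero>\<^bsub>tbar n\<^esub>"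
   by (intro bexI[of _ "%w. - f w"]) auto
 qed (auto simp: add_ac)
 have h2: "a \<odot>\<^bsub>tbar n\<^esub> f \<in> carrier (tbar n)" if "a \<in> carrier A" "f \<in> carrier (tbar n)" for a f
  using that(1) tbar_T[OF that(2)] by (auto simp: tbar_smult intro!: sum_T)
 have h3: "(a \<oplus>\<^bsub>A\<^esub> c) \<odot>\<^bsub>tbar n\<^esub> f = a \<odot>\<^bsub>tbar n\<^esub> f \<oplus>\<^bsub>tbar n\<^esub> c \<odot>\<^bsub>tbar n\<^esub> f" for a c f
  by (rule ext) (simp add: tbar_smult sum.distrib distrib_left)
 have h4: "a \<odot>\<^bsub>tbar n\<^esub> (f \<oplus>\<^bsub>tbar n\<^esub> g) = a \<odot>\<^bsub>tbar n\<^esub> f \<oplus>\<^bsub>tbar n\<^esub> a \<odot>\<^bsub>tbar n\<^esub> g" for a f g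
  by (rule ext) (simp add: tbar_smult sum.distrib distrib_right G_add)
 have h5: "(a \<otimes>\<^bsub>A\<^esub> c) \<odot>\<^bsub>tbar n\<^esub> f = c \<odot>\<^bsub>tbar n\<^esub> (a \<odot>\<^bsub>tbar n\<^esub> f)" for a c f
 proof
  fix w
  show "((a \<otimes>\<^bsub>A\<^esub> c) \<odot>\<^bsub>tbar n\<^esub> f) w = (c \<odot>\<^bsub>tbar n\<^esub> (a \<odot>\<^bsub>tbar n\<^esub> f)) w"
  proof (cases "w \<in> tup n")
   case True
   have "((a \<otimes>\<^bsub>A\<^esub> c) \<odot>\<^bsub>tbar n\<^esub> f) w = (\<Sum>\<kappa>\<in>G. \<Sum>\<tau>\<in>G. \<kappa> (f (Lm (ginv \<kappa>) w)) * (\<tau> (a (ginv \<tau> \<circ> \<kappa>)) * c \<tau>))"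
    using True by (auto simp: tbar_smult tmult sum_distrib_left intro!: sum.cong)
   also have "\<dots> = (\<Sum>\<tau>\<in>G. \<Sum>\<kappa>\<in>G. \<kappa> (f (Lm (ginv \<kappa>) w)) * (\<tau> (a (ginv \<tau> \<circ> \<kappa>)) * c \<tau>))" by (rule sum.swap)
   also have "\<dots> = (\<Sum>\<tau>\<in>G. \<Sum>\<rho>\<in>G. (\<tau> \<circ> \<rho>) (f (Lm (ginv (\<tau> \<circ> \<rho>)) w)) * (\<tau> (a (ginv \<tau> \<circ> (\<tau> \<circ> \<rho>))) * c \<tau>))"
    by (rule sum.cong[OF refl], rule sum_shift[symmetric, where f = "%\<kappa>. \<kappa> (f (Lm (ginv \<kappa>) w)) * _ \<kappa>"])
   also have "\<dots> = (\<Sum>\<tau>\<in>G. \<tau> (\<Sum>\<rho>\<in>G. \<rho> (f (Lm (ginv \<rho>) (Lm (ginv \<tau>) w))) * a \<rho>) * c \<tau>)"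
   proof (rule sum.cong[OF refl])
    fix \<tau> assume t: "\<tau> \<in> G"
    have e: "ginv (\<tau> \<circ> \<rho>) = ginv \<rho> \<circ> ginv \<tau>" if "\<rho> \<in> G" for \<rho>
     using inv_distrib[OF t that] G_commute[of "ginv \<tau>" "ginv \<rho>"] t that by simp
    show "(\<Sum>\<rho>\<in>G. (\<tau> \<circ> \<rho>) (f (Lm (ginv (\<tau> \<circ> \<rho>)) w)) * (\<tau> (a (ginv \<tau> \<circ> (\<tau> \<circ> \<rho>))) * c \<tau>))
     = \<tau> (\<Sum>\<rho>\<in>G. \<rho> (f (Lm (ginv \<rho>) (Lm (ginv \<tau>) w))) * a \<rho>) * c \<tau>"
     unfolding G_sum[OF t] sum_distrib_right
     by (rule sum.cong[OF refl]) (use t e in \<open>simp add: G_mult Lm_Lm mult.assoc\<close>)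
   qed
   also have "\<dots> = (c \<odot>\<^bsub>tbar n\<^esub> (a \<odot>\<^bsub>tbar n\<^esub> f)) w" using True by (simp add: tbar_smult)
   finally show ?thesis .
  qed (simp add: tbar_smult)
 qed
 have h6: "\<one>\<^bsub>A\<^esub> \<odot>\<^bsub>tbar n\<^esub> f = f" if f: "f \<in> carrier (tbar n)" for f
 proof
  fix w
  have "(\<Sum>\<rho>\<in>G. \<rho> (f (Lm (ginv \<rho>) w)) * \<one>\<^bsub>A\<^esub> \<rho>) = (\<Sum>\<rho>\<in>G. if \<rho> = id then f w else 0)"
   by (rule sum.cong) (auto simp: inv_into_id[simplified] simp flip: id_def)
  then show "(\<one>\<^bsub>A\<^esub> \<odot>\<^bsub>tbar n\<^esub> f) w = f w" using f by (simp add: tbar_smult)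
 qed
 show ?thesis unfolding right_module_def
  by (intro conjI ballI assms h1 h2 h3 h4 h5 h6)
qed

lemma Dl_ind_fixed: assumes "\<rho> \<in> G" shows "\<rho> (Dl (ind w) v) = Dl (ind w) v"
proof -
 have "\<rho> ((-1) ^ i) = (-1) ^ i" for i using assms by (simp add: G_power G_uminus)
 moreover have "\<rho> (ind w u) = ind w u" for u using assms by (simp add: ind_def)
 ultimately show ?thesis using assms by (simp add: Dl_def G_sum G_mult)
qed

lemma Dl_ind_Lm: assumes "\<rho> \<in> G" shows "(Dl (ind w) (Lm \<rho> v) :: 'l) = Dl (ind (Lm (ginv \<rho>) w)) v"
proof -
 have "Dl (ind w) (Lm \<rho> v) = Dl (%u. ind w (Lm \<rho> u) :: 'l) v" by (simp only: Lm_def Dl_map)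
 also have "(%u. ind w (Lm \<rho> u) :: 'l) = ind (Lm (ginv \<rho>) w)"
  using Lm_eq_iff[OF assms] by (simp add: ind_def fun_eq_iff)
 finally show ?thesis .
qed

lemma bar_diff_T: assumes "f \<in> carrier (tbar (Suc n))" shows "bar_diff G T n f \<in> carrier (tbar n)"
proof -
 have f: "f \<in> carrier (bar_module G T (Suc n))" using assms by simp
 have "Dl (ind w) v \<in> T" for w v by (rule Dl_closed) (auto simp: ind_def)
 then have "bar_diff G T n f w \<in> T" for w
  unfolding bar_diff_eq[OF finite_G f] using tbar_T[OF assms] by (intro sum_T) auto
 then show ?thesis using bar_diff_outside[OF finite_G f] by simp
qed

lemma bar_diff_hom: assumes "ring A" shows "bar_diff G T n \<in> right_hom A (tbar (Suc n)) (tbar n)"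
proof -
 interpret rmod A "tbar (Suc n)" by (rule rmod.intro[OF right_module_tbar[OF assms]])
 have "(\<lambda>f\<in>carrier (tbar (Suc n)). bar_diff G T n f) \<in> right_hom A (tbar (Suc n)) (tbar n)"
 proof (rule right_homI[OF right_module_tbar[OF assms]])
  fix f assume f: "f \<in> carrier (tbar (Suc n))"
  have fb: "f \<in> carrier (bar_module G T (Suc n))" using f by simp
  show "bar_diff G T n f \<in> carrier (tbar n)" by (rule bar_diff_T[OF f])
  fix g assume g: "g \<in> carrier (tbar (Suc n))"
  have gb: "g \<in> carrier (bar_module G T (Suc n))" using g by simp
  have sb: "(%w. f w + g w) \<in> carrier (bar_module G T (Suc n))" using f g by auto
  show "bar_diff G T n (f \<oplus>\<^bsub>tbar (Suc n)\<^esub> g) = bar_diff G T n f \<oplus>\<^bsub>tbar n\<^esub> bar_diff G T n g"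
   by (rule ext) (simp add: bar_diff_eq[OF finite_G fb] bar_diff_eq[OF finite_G gb]
    bar_diff_eq[OF finite_G sb] sum.distrib distrib_right del: bar_module_simps(1))
 next
  fix a f assume a: "a \<in> carrier A" and f: "f \<in> carrier (tbar (Suc n))"
  have fb: "f \<in> carrier (bar_module G T (Suc n))" using f by simp
  have sb: "a \<odot>\<^bsub>tbar (Suc n)\<^esub> f \<in> carrier (bar_module G T (Suc n))"
   using smult_closed[OF a f] by simp
  show "bar_diff G T n (a \<odot>\<^bsub>tbar (Suc n)\<^esub> f) = a \<odot>\<^bsub>tbar n\<^esub> bar_diff G T n f"
  proof
   fix w
   show "bar_diff G T n (a \<odot>\<^bsub>tbar (Suc n)\<^esub> f) w = (a \<odot>\<^bsub>tbar n\<^esub> bar_diff G T n f) w"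
   proof (cases "w \<in> tup n")
    case True
    have "bar_diff G T n (a \<odot>\<^bsub>tbar (Suc n)\<^esub> f) w
     = (\<Sum>v\<in>tup (Suc n). \<Sum>\<rho>\<in>G. \<rho> (f (Lm (ginv \<rho>) v)) * Dl (ind w) v * a \<rho>)"
     by (simp add: bar_diff_eq[OF finite_G sb] tbar_smult sum_distrib_left mult_ac)
    also have "\<dots> = (\<Sum>\<rho>\<in>G. \<Sum>v\<in>tup (Suc n). \<rho> (f (Lm (ginv \<rho>) v)) * Dl (ind w) v * a \<rho>)" by (rule sum.swap)
    also have "\<dots> = (\<Sum>\<rho>\<in>G. \<rho> (bar_diff G T n f (Lm (ginv \<rho>) w)) * a \<rho>)"
    proof (rule sum.cong[OF refl])
     fix \<rho> assume r: "\<rho> \<in> G"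
     have "(\<Sum>v\<in>tup (Suc n). \<rho> (f (Lm (ginv \<rho>) v)) * Dl (ind w) v * a \<rho>)
      = (\<Sum>v\<in>tup (Suc n). \<rho> (f (Lm (ginv \<rho>) (Lm \<rho> v))) * Dl (ind w) (Lm \<rho> v) * a \<rho>)"
      by (rule sum_Lm[OF r, symmetric])
     also have "\<dots> = \<rho> (bar_diff G T n f (Lm (ginv \<rho>) w)) * a \<rho>"
      using r by (simp add: bar_diff_eq[OF finite_G fb] Dl_ind_Lm G_sum G_mult Dl_ind_fixed sum_distrib_right)
     finally show "(\<Sum>v\<in>tup (Suc n). \<rho> (f (Lm (ginv \<rho>) v)) * Dl (ind w) v * a \<rho>)
      = \<rho> (bar_diff G T n f (Lm (ginv \<rho>) w)) * a \<rho>" .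
    qed
    finally show ?thesis using True by (simp add: tbar_smult)
   next
    case False
    then show ?thesis using bar_diff_outside[OF finite_G sb] by (simp add: tbar_smult)
   qed
  qed
 qed
 moreover have "(\<lambda>f\<in>carrier (tbar (Suc n)). bar_diff G T n f) = bar_diff G T n"
  by (rule ext) (simp add: bar_diff_def)
 ultimately show ?thesis by simp
qed

definition taug :: "(('l => 'l) list => 'l) => 'l" where
 "taug = (\<lambda>f\<in>carrier (tbar 0). \<Sum>w\<in>tup 0. f w)"

lemma taug_hom: assumes "ring A" shows "taug \<in> right_hom A (tbar 0) Tm"
 unfolding taug_def
proof (rule right_homI[OF right_module_tbar[OF assms]])
 fix f assume f: "f \<in> carrier (tbar 0)"
 show "(\<Sum>w\<in>tup 0. f w) \<in> carrier Tm" using tbar_T[OF f] by (auto intro: sum_T)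
 fix a assume a: "a \<in> carrier A"
 have "(\<Sum>w\<in>tup 0. (a \<odot>\<^bsub>tbar 0\<^esub> f) w) = (\<Sum>\<rho>\<in>G. \<Sum>w\<in>tup 0. \<rho> (f (Lm (ginv \<rho>) w)) * a \<rho>)"
  by (simp add: tbar_smult) (rule sum.swap)
 also have "\<dots> = (\<Sum>\<rho>\<in>G. \<rho> (\<Sum>w\<in>tup 0. f w) * a \<rho>)"
 proof (rule sum.cong[OF refl])
  fix \<rho> assume r: "\<rho> \<in> G"
  show "(\<Sum>w\<in>tup 0. \<rho> (f (Lm (ginv \<rho>) w)) * a \<rho>) = \<rho> (\<Sum>w\<in>tup 0. f w) * a \<rho>"
   using sum_Lm[OF r, of "%w. \<rho> (f (Lm (ginv \<rho>) w)) * a \<rho>" 0] r by (simp add: G_sum sum_distrib_right)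
 qed
 finally show "(\<Sum>w\<in>tup 0. (a \<odot>\<^bsub>tbar 0\<^esub> f) w) = a \<odot>\<^bsub>Tm\<^esub> (\<Sum>w\<in>tup 0. f w)" by simp
qed (simp add: sum.distrib)

text \<open>The standard contraction of the bar complex: the identity of \<open>G\<close> is put in
  front of each tuple.\<close>

definition sh :: "(('l => 'l) list => 'l) => ('l => 'l) list => 'l" where
 "sh f w = (case w of [] => 0 | g # v => if g = id then f v else 0)"

lemma sh_carrier: "f \<in> carrier (tbar n) ==> sh f \<in> carrier (tbar (Suc n))"
 using id_G by (auto simp: sh_def bar_tuples_def split: list.splits)

lemma sum_tup_sh: "(\<Sum>v\<in>tup (Suc n). sh f v * F v) = (\<Sum>v\<in>tup n. f v * F (id # v))"
proof -
 have "(\<Sum>v\<in>tup n. f v * F (id # v)) = (\<Sum>v\<in>Cons id ` tup n. sh f v * F v)"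
  by (subst sum.reindex) (auto simp: sh_def)
 also have "\<dots> = (\<Sum>v\<in>tup (Suc n). sh f v * F v)"
 proof (rule sum.mono_neutral_left)
  show "Cons id ` tup n \<subseteq> tup (Suc n)" using id_G by (auto simp: bar_tuples_def)
  show "\<forall>v\<in>tup (Suc n) - Cons id ` tup n. sh f v * F v = 0"
   by (auto simp: sh_def bar_tuples_def split: list.splits)
 qed simp
 finally show ?thesis by simp
qed

lemma sum_ind: "w \<in> tup n ==> (\<Sum>v\<in>tup n. f v * ind w v) = f w"
 by (simp add: ind_def if_distrib[of "%x. _ * x"] cong: if_cong)

lemma bar_diff_sh: assumes f: "f \<in> carrier (tbar n)" and w: "w \<in> tup n"
 shows "bar_diff G T n (sh f) w = f w - (\<Sum>v\<in>tup n. f v * Dl (%u. ind w (id # u)) v)"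
proof -
 have "sh f \<in> carrier (bar_module G T (Suc n))" using sh_carrier[OF f] by simp
 then have "bar_diff G T n (sh f) w = (\<Sum>v\<in>tup n. f v * Dl (ind w) (id # v))"
  by (simp only: bar_diff_eq[OF finite_G] sum_tup_sh)
 also have "\<dots> = (\<Sum>v\<in>tup n. f v * ind w v) - (\<Sum>v\<in>tup n. f v * Dl (%u. ind w (id # u)) v)"
  by (simp add: Dl_Cons right_diff_distrib sum_subtractf)
 finally show ?thesis using sum_ind[OF w] by simp
qed

text \<open>The boundary of \<open>sh f\<close> is f minus a term pairing f with a coboundary; by
  adjointness that term depends only on the boundary of f, which is zero.\<close>

lemma bar_exact: assumes f: "f \<in> carrier (tbar (Suc n))" and z: "bar_diff G T n f = (%_. 0)"
 shows "bar_diff G T (Suc n) (sh f) = f"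
proof
 fix w
 have sf: "sh f \<in> carrier (bar_module G T (Suc (Suc n)))" using sh_carrier[OF f] by simp
 show "bar_diff G T (Suc n) (sh f) w = f w"
 proof (cases "w \<in> tup (Suc n)")
  case True
  have "(\<Sum>v\<in>tup (Suc n). f v * Dl (%u. ind w (id # u)) v) = 0"
   using bar_diff_pairing[OF finite_G, of f T n "%u. ind w (id # u)"] f z by simp
  then show ?thesis using bar_diff_sh[OF f True] by simp
 next
  case False
  then show ?thesis using bar_diff_outside[OF finite_G sf False] f by simp
 qed
qed

lemma bar_exact_0: assumes f: "f \<in> carrier (tbar 0)" and z: "(\<Sum>w\<in>tup 0. f w) = 0"
 shows "bar_diff G T 0 (sh f) = f"
proof
 fix w
 have sf: "sh f \<in> carrier (bar_module G T (Suc 0))" using sh_carrier[OF f] by simp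
 show "bar_diff G T 0 (sh f) w = f w"
 proof (cases "w \<in> tup 0")
  case True
  have "(\<Sum>v\<in>tup 0. f v * Dl (%u. ind w (id # u)) v) = (\<Sum>v\<in>tup 0. f v * ind w [id])"
   by (rule sum.cong[OF refl]) (auto simp: bar_tuples_def length_Suc_conv Dl_Cons)
  also have "\<dots> = 0" using z by (simp flip: sum_distrib_right)
  finally show ?thesis using bar_diff_sh[OF f True] by simp
 next
  case False
  then show ?thesis using bar_diff_outside[OF finite_G sf False] f by simp
 qed
qed

lemma bar_diff_bar_diff: assumes f: "f \<in> carrier (tbar (Suc (Suc n)))"
 shows "bar_diff G T n (bar_diff G T (Suc n) f) = (%_. 0)"
proof
 fix w
 have d: "bar_diff G T (Suc n) f \<in> carrier (bar_module G T (Suc n))" using bar_diff_T[OF f] by simp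
 have "bar_diff G T n (bar_diff G T (Suc n) f) w = (\<Sum>v\<in>tup (Suc n). Dl (ind w) v * bar_diff G T (Suc n) f v)"
  by (simp only: bar_diff_eq[OF finite_G d] mult.commute)
 also have "\<dots> = 0"
  using bar_diff_pairing[OF finite_G, of f T "Suc n" "Dl (ind w)"] f by (simp add: Dl_Dl)
 finally show "bar_diff G T n (bar_diff G T (Suc n) f) w = 0" .
qed

lemma taug_bar_diff: assumes f: "f \<in> carrier (tbar 1)" shows "(\<Sum>w\<in>tup 0. bar_diff G T 0 f w) = 0"
proof -
 have "(\<Sum>w\<in>tup 0. 1 * bar_diff G T 0 f w) = (\<Sum>v\<in>tup (Suc 0). f v * Dl (%_. 1) v)"
  by (rule bar_diff_pairing) (use f in auto)
 also have "\<dots> = 0"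
  by (rule sum.neutral) (auto simp: bar_tuples_def length_Suc_conv Dl_Cons)
 finally show ?thesis by simp
qed

end

lemma basis_elem_inject: "basis_elem v = (basis_elem w :: _ => 'l::field) \<longleftrightarrow> v = w"
 by (metis basis_elem_def zero_neq_one)

section \<open>Freeness of these modules over the twisted group ring\<close>

context cyclic_action
begin

text \<open>Representatives of the orbits of \<open>G\<close> on tuples; the action is free, as is
  seen on the first entry.\<close>

definition W0 :: "nat => ('l => 'l) list set" where "W0 n = {w \<in> tup n. hd w = id}"

definition base :: "('l => 'l) list => ('l => 'l) list" where "base w = Lm (ginv (hd w)) w"

lemma hd_tup: "w \<in> tup n ==> hd w \<in> G"
 by (cases w) (auto simp: bar_tuples_def)

lemma hd_Lm: "w \<in> tup n ==> hd (Lm \<rho> w) = \<rho> \<circ> hd w"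
 by (cases w) (auto simp: bar_tuples_def Lm_def)

lemma base_W0: assumes "w \<in> tup n" shows "base w \<in> W0 n"
proof -
 have "hd (base w) = id" unfolding base_def hd_Lm[OF assms] by (rule inv_comp(1)[OF hd_tup[OF assms]])
 then show ?thesis using assms hd_tup[OF assms] by (simp add: W0_def base_def)
qed

lemma base_Lm: assumes "w \<in> tup n" "\<rho> \<in> G" shows "base (Lm \<rho> w) = base w"
proof -
 have h: "hd w \<in> G" by (rule hd_tup[OF assms(1)])
 have "ginv (\<rho> \<circ> hd w) \<circ> \<rho> = ginv (hd w)"
  using h assms(2) inv_distrib[OF assms(2) h] G_commute[of "ginv \<rho>" "ginv (hd w)"] by simp
 then show ?thesis unfolding base_def hd_Lm[OF assms(1)] Lm_Lm by (simp only:)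
qed

lemma Lm_base: "w \<in> tup n ==> Lm (hd w) (base w) = w"
 using hd_tup[of w n] by (simp add: base_def)

text \<open>Each orbit of tuples contributes one free summand: for w in \<open>W0 n\<close> the
  values of a chain at the tuples \<open>Lm \<kappa> w\<close> are the coefficients of an element of
  the twisted group ring. The basis consists of the functions \<open>basis_elem w\<close>, since
  \<open>projective_module\<close> asks for a basis within the type of the module.\<close>

lemma projective_tbar: assumes "ring A" shows "projective_module A (tbar n)"
proof -
 interpret A: ring A by fact
 interpret Tb: rmod A "tbar n" by (rule rmod.intro[OF right_module_tbar[OF assms]])
 define U where "U = (basis_elem ` W0 n :: (('l => 'l) list => 'l) set)"
 define Fr where "Fr = free_right_module A U"
 have finU: "finite U" by (simp add: U_def W0_def)
 define co where "co f w = (%\<kappa>. if \<kappa> \<in> G then f (Lm \<kappa> w) else 0)" for f :: "('l => 'l) list => 'l" and w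
 define ii where "ii f = (%u. if u \<in> U then co f (the_inv_into (W0 n) basis_elem u) else (%_. 0))" for f :: "('l => 'l) list => 'l"
 have inj: "inj_on (basis_elem :: _ => ('l => 'l) list => 'l) (W0 n)"
  by (simp add: inj_on_def basis_elem_inject)
 have ii: "ii f (basis_elem w) = co f w" if "w \<in> W0 n" for f w
  using that the_inv_into_f_f[OF inj that] by (simp add: ii_def U_def)
 have ii0: "ii f u = (%_. 0)" if "u \<notin> U" for f u using that by (simp add: ii_def)
 have co: "co f w \<in> carrier A" if "f \<in> carrier (tbar n)" for f w
  using tbar_T[OF that] by (simp add: co_def)
 have FrD: "\<phi> u \<in> carrier A" if "\<phi> \<in> carrier Fr" for \<phi> u
  using that A.zero_closed unfolding Fr_def free_right_module_simps by (cases "u \<in> U") auto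
 have FrI: "\<phi> \<in> carrier Fr" if "!!u. u \<in> U ==> \<phi> u \<in> carrier A" "!!u. u \<notin> U ==> \<phi> u = (%_. 0)" for \<phi>
 proof -
  have "{x. \<phi> x ~= \<zero>\<^bsub>A\<^esub>} \<subseteq> U" using that(2) by auto
  then have "finite {x. \<phi> x ~= \<zero>\<^bsub>A\<^esub>}" using finU finite_subset by blast
  then show ?thesis using that unfolding Fr_def free_right_module_simps by simp
 qed
 have iic: "ii f \<in> carrier Fr" if f: "f \<in> carrier (tbar n)" for f
 proof (rule FrI)
  fix u assume "u \<in> U"
  then obtain w where "w \<in> W0 n" "u = basis_elem w" by (auto simp: U_def)
  then show "ii f u \<in> carrier A" using ii co[OF f] by metis
 qed (rule ii0)
 have i: "(\<lambda>f\<in>carrier (tbar n). ii f) \<in> right_hom A (tbar n) Fr"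
 proof (rule right_homI[OF right_module_tbar[OF assms]])
  fix f assume f: "f \<in> carrier (tbar n)"
  show "ii f \<in> carrier Fr" by (rule iic[OF f])
  fix g
  have "co (f \<oplus>\<^bsub>tbar n\<^esub> g) w = co f w \<oplus>\<^bsub>A\<^esub> co g w" for w by (rule ext) (simp add: co_def)
  then show "ii (f \<oplus>\<^bsub>tbar n\<^esub> g) = ii f \<oplus>\<^bsub>Fr\<^esub> ii g"
   by (simp add: Fr_def ii_def fun_eq_iff)
 next
  fix a f assume a: "a \<in> carrier A" and f: "f \<in> carrier (tbar n)"
  have "co (a \<odot>\<^bsub>tbar n\<^esub> f) w = co f w \<otimes>\<^bsub>A\<^esub> a" if w: "w \<in> W0 n" for w
  proof
   fix \<kappa>
   show "co (a \<odot>\<^bsub>tbar n\<^esub> f) w \<kappa> = (co f w \<otimes>\<^bsub>A\<^esub> a) \<kappa>"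
   proof (cases "\<kappa> \<in> G")
    case True
    have "ginv \<rho> \<circ> \<kappa> \<in> G" if "\<rho> \<in> G" for \<rho> using that True by blast
    then have "(\<Sum>\<rho>\<in>G. \<rho> (f (Lm (ginv \<rho>) (Lm \<kappa> w))) * a \<rho>) = (\<Sum>\<tau>\<in>G. \<tau> (co f w (ginv \<tau> \<circ> \<kappa>)) * a \<tau>)"
     by (intro sum.cong) (simp_all add: co_def Lm_Lm)
    then show ?thesis using True w by (simp add: tmult) (simp add: co_def tbar_smult W0_def)
   qed (simp add: tmult co_def)
  qed
  moreover have "\<zero>\<^bsub>A\<^esub> \<otimes>\<^bsub>A\<^esub> a = \<zero>\<^bsub>A\<^esub>" by (rule A.l_null[OF a])
  ultimately show "ii (a \<odot>\<^bsub>tbar n\<^esub> f) = a \<odot>\<^bsub>Fr\<^esub> ii f"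
  proof -
   assume 1: "!!w. w \<in> W0 n ==> co (a \<odot>\<^bsub>tbar n\<^esub> f) w = co f w \<otimes>\<^bsub>A\<^esub> a" and 2: "\<zero>\<^bsub>A\<^esub> \<otimes>\<^bsub>A\<^esub> a = \<zero>\<^bsub>A\<^esub>"
   have "ii (a \<odot>\<^bsub>tbar n\<^esub> f) u = ii f u \<otimes>\<^bsub>A\<^esub> a" for u
   proof (cases "u \<in> U")
    case True
    then obtain w where "w \<in> W0 n" "u = basis_elem w" by (auto simp: U_def)
    then show ?thesis using 1 ii by simp
   next
    case False
    then show ?thesis using 2 by (simp add: ii0)
   qed
   then show ?thesis by (simp add: Fr_def fun_eq_iff)
  qed
 qed
 define rr where "rr \<phi> = (%w. if w \<in> tup n then \<phi> (basis_elem (base w)) (hd w) else 0)"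
  for \<phi> :: "(('l => 'l) list => 'l) => ('l => 'l) => 'l"
 have rrc: "rr \<phi> \<in> carrier (tbar n)" if "\<phi> \<in> carrier Fr" for \<phi>
  using FrD[OF that] hd_tup by (simp add: rr_def)
 have r: "(\<lambda>\<phi>\<in>carrier Fr. rr \<phi>) \<in> right_hom A Fr (tbar n)"
 proof -
  have cl: "\<phi> \<oplus>\<^bsub>Fr\<^esub> \<psi> \<in> carrier Fr" if "\<phi> \<in> carrier Fr" "\<psi> \<in> carrier Fr" for \<phi> \<psi>
  proof (rule FrI)
   show "(\<phi> \<oplus>\<^bsub>Fr\<^esub> \<psi>) u \<in> carrier A" for u
    using A.a_closed[OF FrD[OF that(1)] FrD[OF that(2)]] by (simp add: Fr_def)
   show "(\<phi> \<oplus>\<^bsub>Fr\<^esub> \<psi>) u = (%_. 0)" if "u \<notin> U" for u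
    using \<open>\<phi> \<in> carrier Fr\<close> \<open>\<psi> \<in> carrier Fr\<close> that by (simp add: Fr_def)
  qed
  have cs: "a \<odot>\<^bsub>Fr\<^esub> \<phi> \<in> carrier Fr" if "a \<in> carrier A" "\<phi> \<in> carrier Fr" for a \<phi>
  proof (rule FrI)
   show "(a \<odot>\<^bsub>Fr\<^esub> \<phi>) u \<in> carrier A" for u
    using A.m_closed[OF FrD[OF that(2)] that(1)] by (simp add: Fr_def)
   show "(a \<odot>\<^bsub>Fr\<^esub> \<phi>) u = (%_. 0)" if "u \<notin> U" for u
   proof -
    have "\<phi> u = \<zero>\<^bsub>A\<^esub>" using \<open>\<phi> \<in> carrier Fr\<close> that by (simp add: Fr_def)
    then show ?thesis using A.l_null[OF \<open>a \<in> carrier A\<close>] by (simp add: Fr_def)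
   qed
  qed
  have add: "rr (\<phi> \<oplus>\<^bsub>Fr\<^esub> \<psi>) = rr \<phi> \<oplus>\<^bsub>tbar n\<^esub> rr \<psi>" for \<phi> \<psi>
   by (rule ext) (simp add: rr_def Fr_def)
  have smu: "rr (a \<odot>\<^bsub>Fr\<^esub> \<phi>) = a \<odot>\<^bsub>tbar n\<^esub> rr \<phi>" for a \<phi>
  proof
   fix w
   show "rr (a \<odot>\<^bsub>Fr\<^esub> \<phi>) w = (a \<odot>\<^bsub>tbar n\<^esub> rr \<phi>) w"
   proof (cases "w \<in> tup n")
    case True
    have "(\<phi> (basis_elem (base w)) \<otimes>\<^bsub>A\<^esub> a) (hd w) = (\<Sum>\<tau>\<in>G. \<tau> (\<phi> (basis_elem (base w)) (ginv \<tau> \<circ> hd w)) * a \<tau>)"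
     using hd_tup[OF True] by (simp add: tmult)
    also have "\<dots> = (\<Sum>\<tau>\<in>G. \<tau> (rr \<phi> (Lm (ginv \<tau>) w)) * a \<tau>)"
     using True by (intro sum.cong) (simp_all add: rr_def base_Lm[OF True] hd_Lm[OF True])
    finally have "(\<phi> (basis_elem (base w)) \<otimes>\<^bsub>A\<^esub> a) (hd w) = (a \<odot>\<^bsub>tbar n\<^esub> rr \<phi>) w"
     using True by (simp add: tbar_smult)
    then show ?thesis using True unfolding rr_def[of "a \<odot>\<^bsub>Fr\<^esub> \<phi>"] by (simp add: Fr_def)
   qed (simp add: rr_def tbar_smult)
  qed
  show ?thesis unfolding right_hom_def using rrc cl cs add smu by auto
 qed
 have "rr (ii f) = f" if f: "f \<in> carrier (tbar n)" for f
 proof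
  fix w
  show "rr (ii f) w = f w"
  proof (cases "w \<in> tup n")
   case True
   then show ?thesis using ii[OF base_W0[OF True]] hd_tup[OF True] Lm_base[OF True] by (simp add: rr_def co_def)
  qed (use f in \<open>simp add: rr_def\<close>)
 qed
 then have "\<forall>f\<in>carrier (tbar n). (\<lambda>\<phi>\<in>carrier Fr. rr \<phi>) ((\<lambda>f\<in>carrier (tbar n). ii f) f) = f"
  using iic by (simp del: tbar_simps)
 note rri = this
 show ?thesis unfolding projective_module_def
  by (intro conjI exI[of _ U] bexI[of _ "\<lambda>f\<in>carrier (tbar n). ii f"] bexI[of _ "\<lambda>\<phi>\<in>carrier (free_right_module A U). rr \<phi>"]
   right_module_tbar[OF assms] i[unfolded Fr_def] r[unfolded Fr_def] rri[unfolded Fr_def])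
qed

lemma tbar_resolution: assumes "ring A" shows "projective_resolution A Tm tbar (bar_diff G T) taug"
 unfolding projective_resolution_def
proof (intro conjI allI)
 show "projective_module A (tbar n)" for n by (rule projective_tbar[OF assms])
 show "bar_diff G T n \<in> right_hom A (tbar (Suc n)) (tbar n)" for n by (rule bar_diff_hom[OF assms])
 show "taug \<in> right_hom A (tbar 0) Tm" by (rule taug_hom[OF assms])
 show "taug ` carrier (tbar 0) = carrier Tm"
 proof
  show "taug ` carrier (tbar 0) \<subseteq> carrier Tm" using right_homD(1)[OF taug_hom[OF assms]] by blast
  show "carrier Tm \<subseteq> taug ` carrier (tbar 0)"
  proof
   fix x assume "x \<in> carrier Tm"
   then have x: "x \<in> T" by simp
   define f :: "('l => 'l) list => 'l" where "f = (%w. if w = [id] then x else 0)"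
   have w: "[id] \<in> tup 0" using id_G by (simp add: bar_tuples_def)
   have f: "f \<in> carrier (tbar 0)" using x w by (auto simp: f_def)
   have "taug f = x" using f w by (simp add: taug_def) (simp add: f_def)
   then show "x \<in> taug ` carrier (tbar 0)" using f by blast
  qed
 qed
 show "bar_diff G T 0 ` carrier (tbar 1) = a_kernel (tbar 0) Tm taug"
 proof (intro equalityI subsetI)
  fix f assume "f \<in> bar_diff G T 0 ` carrier (tbar 1)"
  then obtain g where g: "g \<in> carrier (tbar 1)" "f = bar_diff G T 0 g" by blast
  then show "f \<in> a_kernel (tbar 0) Tm taug"
   using bar_diff_T[of g 0] taug_bar_diff[OF g(1)] by (simp add: a_kernel_def' taug_def)
 next
  fix f assume "f \<in> a_kernel (tbar 0) Tm taug"
  then have f: "f \<in> carrier (tbar 0)" "taug f = 0" by (simp_all add: a_kernel_def')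
  then have f: "f \<in> carrier (tbar 0)" "(\<Sum>w\<in>tup 0. f w) = 0"
   unfolding taug_def by (simp_all only: restrict_apply')
  from bar_exact_0[OF f] sh_carrier[OF f(1)] show "f \<in> bar_diff G T 0 ` carrier (tbar 1)"
   by (intro image_eqI[of _ _ "sh f"]) simp_all
 qed
 fix n
 show "bar_diff G T (Suc n) ` carrier (tbar (Suc (Suc n))) = a_kernel (tbar (Suc n)) (tbar n) (bar_diff G T n)"
 proof (intro equalityI subsetI)
  fix f assume "f \<in> bar_diff G T (Suc n) ` carrier (tbar (Suc (Suc n)))"
  then obtain g where g: "g \<in> carrier (tbar (Suc (Suc n)))" "f = bar_diff G T (Suc n) g" by blast
  then show "f \<in> a_kernel (tbar (Suc n)) (tbar n) (bar_diff G T n)"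
   using bar_diff_T[OF g(1)] bar_diff_bar_diff[OF g(1)] by (simp add: a_kernel_def')
 next
  fix f assume "f \<in> a_kernel (tbar (Suc n)) (tbar n) (bar_diff G T n)"
  then have f: "f \<in> carrier (tbar (Suc n))" "bar_diff G T n f = (%_. 0)" by (simp_all add: a_kernel_def')
  from bar_exact[OF f] sh_carrier[OF f(1)]
  show "f \<in> bar_diff G T (Suc n) ` carrier (tbar (Suc (Suc n)))"
   by (intro image_eqI[of _ _ "sh f"]) simp_all
 qed
qed

end

section \<open>Group cohomology\<close>

lemma group_ring_simps [simp]:
 "carrier (group_ring G S) = {y. (\<forall>\<rho>\<in>G. y \<rho> \<in> S) & (\<forall>\<rho>. \<rho> \<notin> G --> y \<rho> = 0)}"
 "\<one>\<^bsub>group_ring G S\<^esub> = (%\<kappa>. if \<kappa> = id then 1 else 0)"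
 "s \<odot>\<^bsub>group_ring G S\<^esub> y = (%\<kappa>. s * y \<kappa>)"
 by (simp_all add: group_ring_def)

lemma sum_expansion:
 assumes W: "finite W" and R0: "0 \<in> R"
  and add: "!!c c'. range c \<subseteq> R ==> range c' \<subseteq> R ==> {v. c v ~= 0} \<subseteq> W ==> {v. c' v ~= 0} \<subseteq> W ==>
   f (%v. c v + c' v) = f c + f c'"
  and single: "!!w y. w \<in> W ==> y \<in> R ==> f (%v. if v = w then y else 0) = f (basis_elem w) * (y :: 'l::field)"
  and c: "range c \<subseteq> R" "{v. c v ~= 0} \<subseteq> W"
 shows "f c = (\<Sum>w\<in>W. f (basis_elem w) * c w)"
proof -
 have "f (%_. 0 + 0) = f (%_. 0) + f (%_. 0)" by (rule add) (use R0 in auto)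
 then have f0: "f (%_. 0) = 0" by (metis add_cancel_right_right add_0)
 have "finite V ==> V \<subseteq> W ==> f (%v. if v \<in> V then c v else 0) = (\<Sum>w\<in>V. f (basis_elem w) * c w)" for V
 proof (induction V rule: finite_induct)
  case (insert u V)
  have "(%v. if v \<in> insert u V then c v else 0) = (%v. (if v = u then c u else 0) + (if v \<in> V then c v else 0))"
   using insert.hyps(2) by auto
  then have "f (%v. if v \<in> insert u V then c v else 0) = f (%v. if v = u then c u else 0) + f (%v. if v \<in> V then c v else 0)"
   using c(1) R0 insert.prems by (simp only:) (rule add, auto)
  then show ?case using insert single[of u "c u"] c(1) by auto
 qed (simp add: f0)
 from this[OF W order_refl] have "f (%v. if v \<in> W then c v else 0) = (\<Sum>w\<in>W. f (basis_elem w) * c w)" .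
 moreover have "(%v. if v \<in> W then c v else 0) = c" using c(2) by (auto simp: fun_eq_iff)
 ultimately show ?thesis by simp
qed

context cyclic_action_h90
begin

lemma cohomology_modelD:
 assumes "cohomology_model E pr e cl \<chi>"
 shows "\<chi> = 1 \<or> \<chi> = -1" "e = cl 0 1" "carrier (E n) = cl n ` Zc n" "\<zero>\<^bsub>E n\<^esub> = cl n 0"
  "y \<in> Zc n ==> y' \<in> Zc n ==> cl n y = cl n y' \<longleftrightarrow> y - y' \<in> Bc n"
  "y \<in> Zc n ==> y' \<in> Zc n ==> cl n y \<oplus>\<^bsub>E n\<^esub> cl n y' = cl n (y + y')"
  "a \<in> S ==> y \<in> Zc n ==> a \<odot>\<^bsub>E n\<^esub> cl n y = cl n (a * y)"
  "y \<in> Zc i ==> v \<in> Zc j ==> even i \<or> even j ==> pr i j (cl i y) (cl j v) = cl (i + j) (y * v)"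
  "v \<in> Zc j ==> odd i ==> odd j ==> \<delta> u \<in> T ==> pr i j (cl i (\<delta> u)) (cl j v) = cl (i + j) (\<chi> * Tr (v * \<sigma> u))"
proof -
 note m = assms[unfolded cohomology_model_def]
 note m3 = m[THEN conjunct2, THEN conjunct2]
 note m4 = m3[THEN conjunct2]
 note m7 = m4[THEN conjunct2, THEN conjunct2, THEN conjunct2]
 show "\<chi> = 1 \<or> \<chi> = -1" "e = cl 0 1" using m by simp_all
 show "carrier (E n) = cl n ` Zc n" "\<zero>\<^bsub>E n\<^esub> = cl n 0" using m3 by simp_all
 show "y \<in> Zc n ==> y' \<in> Zc n ==> cl n y = cl n y' \<longleftrightarrow> y - y' \<in> Bc n"
  by (rule m4[THEN conjunct1, rule_format])
 show "y \<in> Zc n ==> y' \<in> Zc n ==> cl n y \<oplus>\<^bsub>E n\<^esub> cl n y' = cl n (y + y')"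
  by (rule m4[THEN conjunct2, THEN conjunct1, rule_format])
 show "a \<in> S ==> y \<in> Zc n ==> a \<odot>\<^bsub>E n\<^esub> cl n y = cl n (a * y)"
  by (rule m4[THEN conjunct2, THEN conjunct2, THEN conjunct1, rule_format])
 show "y \<in> Zc i ==> v \<in> Zc j ==> even i \<or> even j ==> pr i j (cl i y) (cl j v) = cl (i + j) (y * v)"
  by (rule m7[THEN conjunct1, rule_format])
 show "v \<in> Zc j ==> odd i ==> odd j ==> \<delta> u \<in> T ==> pr i j (cl i (\<delta> u)) (cl j v) = cl (i + j) (\<chi> * Tr (v * \<sigma> u))"
  by (rule m7[THEN conjunct2, rule_format])
qed

end

section \<open>Cochains over SG as cochains over the twisted group ring; cup and Yoneda
  product\<close>

locale bar_setup = cyclic_action_h90 T S \<sigma> p G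
 for T :: "'l::field set" and S \<sigma> p G +
 assumes ring_A0: "ring (twisted_group_ring G T)"
begin

sublocale B: ext_setup T S \<sigma> p G tbar "bar_diff G T" taug
 by unfold_locales (rule tbar_resolution[OF ring_A0])

abbreviation gA :: "('l, ('l => 'l) => 'l) module" where "gA \<equiv> group_ring G S"

abbreviation bS :: "nat => (('l => 'l) => 'l, ('l => 'l) list => 'l) module" where "bS \<equiv> bar_module G S"

abbreviation be :: "('l => 'l) list => ('l => 'l) list => 'l" where "be \<equiv> basis_elem"

lemma bS_tbar: "c \<in> carrier (bS n) ==> c \<in> carrier (tbar n)"
 using S_T by auto

lemma be_carrier: "w \<in> tup n ==> be w \<in> carrier (bS n)" "w \<in> tup n ==> be w \<in> carrier (tbar n)"
 by (auto simp: basis_elem_def)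

lemma bS_smult: assumes "c \<in> carrier (bS n)" shows "a \<odot>\<^bsub>bS n\<^esub> c = a \<odot>\<^bsub>tbar n\<^esub> c"
proof
 fix w
 have "(a \<odot>\<^bsub>bS n\<^esub> c) w = (\<Sum>(v, \<rho>)\<in>{(v, \<rho>) \<in> tup n \<times> G. Lm \<rho> v = w}. c v * a \<rho>)"
  by (simp add: bar_module_def Lm_def)
 also have "\<dots> = (a \<odot>\<^bsub>tbar n\<^esub> c) w"
 proof (cases "w \<in> tup n")
  case True
  have "(\<Sum>(v, \<rho>)\<in>{(v, \<rho>) \<in> tup n \<times> G. Lm \<rho> v = w}. c v * a \<rho>) = (\<Sum>\<rho>\<in>G. c (Lm (ginv \<rho>) w) * a \<rho>)"
   using True by (intro sum.reindex_bij_witness[of _ "%\<rho>. (Lm (ginv \<rho>) w, \<rho>)" snd]) auto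
  also have "\<dots> = (\<Sum>\<rho>\<in>G. \<rho> (c (Lm (ginv \<rho>) w)) * a \<rho>)"
  proof (rule sum.cong[OF refl])
   fix \<rho> assume r: "\<rho> \<in> G"
   then have "c (Lm (ginv \<rho>) w) \<in> S" using assms True by simp
   then show "c (Lm (ginv \<rho>) w) * a \<rho> = \<rho> (c (Lm (ginv \<rho>) w)) * a \<rho>" using S_G[OF _ r] by simp
  qed
  finally show ?thesis using True by (simp add: tbar_smult)
 next
  case False
  then have e: "{(v, \<rho>) \<in> tup n \<times> G. Lm \<rho> v = w} = {}" by auto
  show ?thesis unfolding e using False by (simp add: tbar_smult)
 qed
 finally show "(a \<odot>\<^bsub>bS n\<^esub> c) w = (a \<odot>\<^bsub>tbar n\<^esub> c) w" .
qed

lemma bS_smult_closed: assumes "c \<in> carrier (bS n)" "a \<in> carrier gA" shows "a \<odot>\<^bsub>bS n\<^esub> c \<in> carrier (bS n)"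
proof -
 have S: "c w \<in> S" for w using assms(1) by (cases "w \<in> tup n") auto
 have "(\<Sum>\<rho>\<in>G. \<rho> (c (Lm (ginv \<rho>) w)) * a \<rho>) \<in> S" for w
  using assms(2) by (intro S_sum S_closed(4)) (simp_all add: S_G[OF S] S)
 then show ?thesis unfolding bS_smult[OF assms(1)] by (simp add: tbar_smult)
qed

lemma gA_A: "a \<in> carrier gA ==> a \<in> carrier A"
 using S_T by auto

lemma single_S: "w \<in> tup n ==> y \<in> S ==> (%v. if v = w then y else 0) = scal y \<odot>\<^bsub>bS n\<^esub> be w"
 and single_T: "w \<in> tup n ==> (%v. if v = w then y else 0) = scal y \<odot>\<^bsub>tbar n\<^esub> be w"
proof -
 show 1: "(%v. if v = w then y else 0) = scal y \<odot>\<^bsub>tbar n\<^esub> be w" if w: "w \<in> tup n" for y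
 proof
  fix v
  have "(\<Sum>\<rho>\<in>G. \<rho> (be w (Lm (ginv \<rho>) v)) * scal y \<rho>) = (\<Sum>\<rho>\<in>G. if \<rho> = id then be w v * y else 0)"
   by (rule sum.cong) (auto simp: scal_def inv_into_id[simplified] simp flip: id_def)
  then show "(if v = w then y else 0) = (scal y \<odot>\<^bsub>tbar n\<^esub> be w) v"
   using w by (simp add: tbar_smult basis_elem_def)
 qed
 show "(%v. if v = w then y else 0) = scal y \<odot>\<^bsub>bS n\<^esub> be w" if "w \<in> tup n" "y \<in> S"
  unfolding bS_smult[OF be_carrier(1)[OF that(1)]] by (rule 1[OF that(1)])
qed

lemma hom_S_expand: assumes f: "f \<in> right_hom gA (bS n) Tm" and c: "c \<in> carrier (bS n)"
 shows "f c = (\<Sum>w\<in>tup n. f (be w) * c w)"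
proof (rule sum_expansion[of "tup n" S])
 show "f (%v. c v + c' v) = f c + f c'" if "range c \<subseteq> S" "range c' \<subseteq> S" "{v. c v ~= 0} \<subseteq> tup n" "{v. c' v ~= 0} \<subseteq> tup n" for c c'
  using right_homD(2)[OF f, of c c'] that by auto
 show "f (%v. if v = w then y else 0) = f (be w) * y" if w: "w \<in> tup n" and y: "y \<in> S" for w y
 proof -
  have "scal y \<in> carrier gA" using y by (simp add: scal_def)
  from right_homD(3)[OF f this be_carrier(1)[OF w]] show ?thesis
   unfolding single_S[OF w y] act_scal .
 qed
 show "range c \<subseteq> S" "{v. c v ~= 0} \<subseteq> tup n" using c by auto
qed auto

lemma hom_T_expand: assumes f: "f \<in> right_hom A (tbar n) Tm" and c: "c \<in> carrier (tbar n)"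
 shows "f c = (\<Sum>w\<in>tup n. f (be w) * c w)"
proof (rule sum_expansion[of "tup n" T])
 show "f (%v. c v + c' v) = f c + f c'" if "range c \<subseteq> T" "range c' \<subseteq> T" "{v. c v ~= 0} \<subseteq> tup n" "{v. c' v ~= 0} \<subseteq> tup n" for c c'
  using right_homD(2)[OF f, of c c'] that by auto
 show "f (%v. if v = w then y else 0) = f (be w) * y" if w: "w \<in> tup n" and y: "y \<in> T" for w y
  using right_homD(3)[OF f scal_carrier[OF y] be_carrier(2)[OF w]]
  unfolding single_T[OF w] act_scal .
 show "range c \<subseteq> T" "{v. c v ~= 0} \<subseteq> tup n" using c tbar_T[OF c] by auto
qed auto

lemma be_Lm: assumes "\<rho> \<in> G" "v \<in> tup n" shows "be (Lm \<rho> v) = (%\<kappa>. if \<kappa> = \<rho> then 1 else 0) \<odot>\<^bsub>tbar n\<^esub> be v"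
proof
 fix w
 have "(\<Sum>\<kappa>\<in>G. \<kappa> (be v (Lm (ginv \<kappa>) w)) * (if \<kappa> = \<rho> then 1 else 0)) = (\<Sum>\<kappa>\<in>G. if \<kappa> = \<rho> then \<rho> (be v (Lm (ginv \<rho>) w)) else 0)"
  by (rule sum.cong) auto
 also have "\<dots> = be (Lm \<rho> v) w" using assms Lm_eq_iff[OF assms(1), of v w] by (auto simp: basis_elem_def)
 finally show "be (Lm \<rho> v) w = ((%\<kappa>. if \<kappa> = \<rho> then 1 else 0) \<odot>\<^bsub>tbar n\<^esub> be v) w"
  using Lm_tup[OF assms] by (auto simp: tbar_smult basis_elem_def)
qed

lemma act_single: "\<rho> \<in> G ==> act x (%\<kappa>. if \<kappa> = \<rho> then 1 else 0) = \<rho> x"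
proof -
 assume r: "\<rho> \<in> G"
 have "act x (%\<kappa>. if \<kappa> = \<rho> then 1 else 0) = (\<Sum>\<kappa>\<in>G. if \<kappa> = \<rho> then \<rho> x else 0)"
  unfolding galois_module_simps by (rule sum.cong) auto
 then show ?thesis using r by simp
qed

lemma hom_S_Lm: assumes f: "f \<in> right_hom gA (bS n) Tm" and "\<rho> \<in> G" "v \<in> tup n" shows "f (be (Lm \<rho> v)) = \<rho> (f (be v))"
proof -
 have a: "(%\<kappa>. if \<kappa> = \<rho> then 1 else 0) \<in> carrier gA" using assms(2) by simp
 show ?thesis
  using right_homD(3)[OF f a be_carrier(1)[OF assms(3)]]
  unfolding be_Lm[OF assms(2,3)] bS_smult[OF be_carrier(1)[OF assms(3)]] act_single[OF assms(2)] .
qed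

text \<open>Restriction to chains with coefficients in \<open>S\<close>; by \<open>res_inj\<close>
  and \<open>res_surj\<close> it identifies the cochains over the two rings.\<close>

definition res :: "nat => ((('l => 'l) list => 'l) => 'l) => (('l => 'l) list => 'l) => 'l" where
 "res n g = (\<lambda>c\<in>carrier (bS n). g c)"

lemma res_hom: assumes g: "g \<in> right_hom A (tbar n) Tm" shows "res n g \<in> right_hom gA (bS n) Tm"
proof -
 have 1: "c \<oplus>\<^bsub>bS n\<^esub> c' \<in> carrier (bS n)" if "c \<in> carrier (bS n)" "c' \<in> carrier (bS n)" for c c'
  using that by auto
 have 2: "g (c \<oplus>\<^bsub>bS n\<^esub> c') = g c \<oplus>\<^bsub>Tm\<^esub> g c'" if "c \<in> carrier (bS n)" "c' \<in> carrier (bS n)" for c c'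
  using right_homD(2)[OF g bS_tbar[OF that(1)] bS_tbar[OF that(2)]] by simp
 have 3: "g (a \<odot>\<^bsub>bS n\<^esub> c) = a \<odot>\<^bsub>Tm\<^esub> g c" if "a \<in> carrier gA" "c \<in> carrier (bS n)" for a c
  unfolding bS_smult[OF that(2)] by (rule right_homD(3)[OF g gA_A[OF that(1)] bS_tbar[OF that(2)]])
 have 4: "g c \<in> carrier Tm" if "c \<in> carrier (bS n)" for c
  by (rule right_homD(1)[OF g bS_tbar[OF that]])
 show ?thesis unfolding right_hom_def res_def
  using 1 2 3 4 bS_smult_closed by (auto simp del: bar_module_simps group_ring_simps galois_module_simps)
qed

lemma res_inj: assumes "f \<in> right_hom A (tbar n) Tm" "g \<in> right_hom A (tbar n) Tm" "res n f = res n g" shows "f = g"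
proof (rule right_hom_ext[OF assms(1,2)])
 fix c assume c: "c \<in> carrier (tbar n)"
 have "f (be w) = g (be w)" if "w \<in> tup n" for w
  using fun_cong[OF assms(3), of "be w"] be_carrier(1)[OF that] by (simp add: res_def del: bar_module_simps)
 then show "f c = g c" unfolding hom_T_expand[OF assms(1) c] hom_T_expand[OF assms(2) c] by simp
qed

text \<open>Extension by linearity over \<open>T\<close>. Compatibility with the twisted action
  reduces to equivariance of f on basis tuples, \<open>hom_S_Lm\<close>.\<close>

lemma res_surj: assumes f: "f \<in> right_hom gA (bS n) Tm" shows "\<exists>g\<in>right_hom A (tbar n) Tm. res n g = f"
proof -
 define g where "g = (\<lambda>c\<in>carrier (tbar n). \<Sum>w\<in>tup n. f (be w) * c w)"
 have fT: "f (be w) \<in> T" if "w \<in> tup n" for w using right_homD(1)[OF f be_carrier(1)[OF that]] by simp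
 have "g \<in> right_hom A (tbar n) Tm" unfolding g_def
 proof (rule right_homI[OF right_module_tbar[OF ring_A0]])
  fix c assume c: "c \<in> carrier (tbar n)"
  show "(\<Sum>w\<in>tup n. f (be w) * c w) \<in> carrier Tm" using fT tbar_T[OF c] by (auto intro!: sum_T)
  fix a assume a: "a \<in> carrier A"
  have "(\<Sum>w\<in>tup n. f (be w) * (a \<odot>\<^bsub>tbar n\<^esub> c) w)
   = (\<Sum>w\<in>tup n. \<Sum>\<rho>\<in>G. f (be w) * \<rho> (c (Lm (ginv \<rho>) w)) * a \<rho>)"
   by (simp add: tbar_smult sum_distrib_left mult.assoc)
  also have "\<dots> = (\<Sum>\<rho>\<in>G. \<Sum>w\<in>tup n. f (be w) * \<rho> (c (Lm (ginv \<rho>) w)) * a \<rho>)" by (rule sum.swap)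
  also have "\<dots> = (\<Sum>\<rho>\<in>G. \<rho> (\<Sum>w\<in>tup n. f (be w) * c w) * a \<rho>)"
  proof (rule sum.cong[OF refl])
   fix \<rho> assume r: "\<rho> \<in> G"
   have "(\<Sum>w\<in>tup n. f (be w) * \<rho> (c (Lm (ginv \<rho>) w)) * a \<rho>)
    = (\<Sum>w\<in>tup n. f (be (Lm \<rho> w)) * \<rho> (c (Lm (ginv \<rho>) (Lm \<rho> w))) * a \<rho>)"
    by (rule sum_Lm[OF r, symmetric])
   also have "\<dots> = \<rho> (\<Sum>w\<in>tup n. f (be w) * c w) * a \<rho>"
    using r by (simp add: hom_S_Lm[OF f r] G_sum G_mult sum_distrib_right)
   finally show "(\<Sum>w\<in>tup n. f (be w) * \<rho> (c (Lm (ginv \<rho>) w)) * a \<rho>) = \<rho> (\<Sum>w\<in>tup n. f (be w) * c w) * a \<rho>" .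
  qed
  finally show "(\<Sum>w\<in>tup n. f (be w) * (a \<odot>\<^bsub>tbar n\<^esub> c) w) = a \<odot>\<^bsub>Tm\<^esub> (\<Sum>w\<in>tup n. f (be w) * c w)" by simp
 qed (simp add: distrib_left sum.distrib)
 moreover have "res n g = f"
 proof (rule extensionalityI[OF _ right_homD(4)[OF f]])
  show "res n g \<in> extensional (carrier (bS n))" by (simp add: res_def)
  fix c assume c: "c \<in> carrier (bS n)"
  then show "res n g c = f c" using hom_S_expand[OF f c] bS_tbar[OF c]
   by (simp add: res_def g_def del: bar_module_simps tbar_simps)
 qed
 ultimately show ?thesis by blast
qed

lemma bar_diff_S: assumes c: "c \<in> carrier (bS (Suc n))"
 shows "bar_diff G S n c = bar_diff G T n c" "bar_diff G S n c \<in> carrier (bS n)"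
proof -
 have cT: "c \<in> carrier (bar_module G T (Suc n))" using bS_tbar[OF c] by simp
 show "bar_diff G S n c = bar_diff G T n c"
  by (rule ext) (simp only: bar_diff_eq[OF finite_G c] bar_diff_eq[OF finite_G cT])
 have S: "c w \<in> S" for w using c by (cases "w \<in> tup (Suc n)") auto
 have "Dl (ind w) v \<in> S" for w v by (rule Dl_closed) (auto simp: ind_def)
 then have "bar_diff G S n c w \<in> S" for w unfolding bar_diff_eq[OF finite_G c] using S by (intro S_sum S_closed(4))
 then show "bar_diff G S n c \<in> carrier (bS n)" using bar_diff_outside[OF finite_G c] by simp
qed

lemma hom_module_S [simp]:
 "\<zero>\<^bsub>hom_module gA (bS n) Tm\<^esub> = (\<lambda>x\<in>carrier (bS n). 0)"
 "f \<oplus>\<^bsub>hom_module gA (bS n) Tm\<^esub> g = (\<lambda>x\<in>carrier (bS n). f x + g x)"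
 "s \<odot>\<^bsub>hom_module gA (bS n) Tm\<^esub> f = (\<lambda>x\<in>carrier (bS n). f x * s)"
proof -
 have 1: "s \<odot>\<^bsub>gA\<^esub> \<one>\<^bsub>gA\<^esub> = scal s" by (simp add: scal_def fun_eq_iff)
 show "s \<odot>\<^bsub>hom_module gA (bS n) Tm\<^esub> f = (\<lambda>x\<in>carrier (bS n). f x * s)"
  unfolding hom_module_def module.select_convs 1 act_scal ..
qed (simp_all add: hom_module_def)

lemma res_coboundary: assumes "g \<in> right_hom A (tbar n) Tm"
 shows "ext_coboundary bS (bar_diff G S) n (res n g) = res (Suc n) (ext_coboundary tbar (bar_diff G T) n g)"
 unfolding ext_coboundary_def res_def
 by (rule restrict_ext)
  (use bar_diff_S bS_tbar in \<open>simp del: bar_module_simps tbar_simps\<close>)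

lemma cob_S: "ext_coboundaries gA bS (bar_diff G S) Tm n = res n ` B.cob n"
proof (cases n)
 case 0
 have "(\<lambda>x\<in>carrier (bS 0). 0) = res 0 (\<lambda>x\<in>carrier (tbar 0). 0)"
  unfolding res_def by (rule restrict_ext) (use bS_tbar in \<open>simp del: bar_module_simps tbar_simps\<close>)
 then show ?thesis using 0 by (simp add: ext_coboundaries_def B.hom_module_simps)
next
 case (Suc m)
 have "right_hom gA (bS m) Tm = res m ` right_hom A (tbar m) Tm"
  using res_hom res_surj by blast
 then have "ext_coboundary bS (bar_diff G S) m ` right_hom gA (bS m) Tm
  = (%g. res (Suc m) (ext_coboundary tbar (bar_diff G T) m g)) ` right_hom A (tbar m) Tm"
  using res_coboundary by (simp add: image_image cong: image_cong)
 then show ?thesis using Suc by (simp add: ext_coboundaries_def image_image)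
qed

lemma coc_S: "ext_cocycles gA bS (bar_diff G S) Tm n = res n ` B.coc n"
proof -
 have hom: "right_hom gA (bS n) Tm = res n ` right_hom A (tbar n) Tm" using res_hom res_surj by blast
 have iff: "ext_coboundary bS (bar_diff G S) n (res n g) = \<zero>\<^bsub>hom_module gA (bS (Suc n)) Tm\<^esub> \<longleftrightarrow>
   ext_coboundary tbar (bar_diff G T) n g = \<zero>\<^bsub>hom_module A (tbar (Suc n)) Tm\<^esub>"
  if g: "g \<in> right_hom A (tbar n) Tm" for g
 proof -
  have z: "(\<lambda>x\<in>carrier (bS (Suc n)). 0) = res (Suc n) (\<lambda>x\<in>carrier (tbar (Suc n)). 0)"
   unfolding res_def by (rule restrict_ext) (use bS_tbar in \<open>simp del: bar_module_simps tbar_simps\<close>)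
  have h: "ext_coboundary tbar (bar_diff G T) n g \<in> right_hom A (tbar (Suc n)) Tm"
   unfolding ext_coboundary_def by (rule right_hom_comp[OF B.right_P B.P.D g])
  show ?thesis unfolding res_coboundary[OF g] hom_module_S B.hom_module_simps z
   by (rule iffI, erule res_inj[OF h B.zero_hom], simp only:)
 qed
 show ?thesis unfolding ext_cocycles_def hom using iff by blast
qed

definition clS :: "nat => 'l => ((('l => 'l) list => 'l) => 'l) set" where "clS n y = res n ` B.cl n y"

lemma cl_hom: "B.cl n y \<subseteq> right_hom A (tbar n) Tm"
 by (auto simp: B.cl_def B.coc_iff)

lemma res_add: "(\<lambda>x\<in>carrier (bS n). res n f x + res n g x) = res n (\<lambda>x\<in>carrier (tbar n). f x + g x)"
 and res_smult: "(\<lambda>x\<in>carrier (bS n). res n f x * s) = res n (\<lambda>x\<in>carrier (tbar n). f x * s)"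
proof -
 have *: "x \<in> carrier (tbar n)" if "x \<in> carrier (bS n)" for x using bS_tbar that .
 show "(\<lambda>x\<in>carrier (bS n). res n f x + res n g x) = res n (\<lambda>x\<in>carrier (tbar n). f x + g x)"
  unfolding res_def by (rule restrict_ext) (use * in \<open>simp del: bar_module_simps tbar_simps\<close>)
 show "(\<lambda>x\<in>carrier (bS n). res n f x * s) = res n (\<lambda>x\<in>carrier (tbar n). f x * s)"
  unfolding res_def by (rule restrict_ext) (use * in \<open>simp del: bar_module_simps tbar_simps\<close>)
qed

lemma ext_class_S: "ext_class gA bS (bar_diff G S) Tm n (res n f) = res n ` ext_class A tbar (bar_diff G T) Tm n f"
proof -
 have "ext_class gA bS (bar_diff G S) Tm n (res n f)
  = (\<Union>h\<in>B.cob n. {res n (\<lambda>x\<in>carrier (tbar n). h x + f x)})"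
  by (simp add: ext_class_def a_r_coset_def' cob_S res_add del: bar_module_simps tbar_simps)
 also have "\<dots> = res n ` ext_class A tbar (bar_diff G T) Tm n f"
  by (auto simp: ext_class_def a_r_coset_def' B.hom_module_simps simp del: bar_module_simps tbar_simps)
 finally show ?thesis .
qed

lemma ext_class_S_rep: "f \<in> B.cl n y ==> ext_class gA bS (bar_diff G S) Tm n (res n f) = clS n y"
 unfolding ext_class_S clS_def by (simp only: B.ext_class_rep)

lemma Lm_take: "take k (Lm \<rho> w) = Lm \<rho> (take k w)" "drop k (Lm \<rho> w) = Lm \<rho> (drop k w)"
 by (simp_all add: Lm_def take_map drop_map)

lemma take_tup: "w \<in> tup (i + k) ==> take (Suc i) w \<in> tup i"
 and drop_tup: "w \<in> tup (i + k) ==> drop i w \<in> tup k"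
 using set_take_subset[of "Suc i" w] set_drop_subset[of i w] by (auto simp: bar_tuples_def)

lemma sum_drop:
 "(\<Sum>u\<in>tup k. \<phi> u * (\<Sum>w\<in>tup (i + k). if drop i w = u then h w else 0)) = (\<Sum>w\<in>tup (i + k). \<phi> (drop i w) * (h w :: 'l))"
proof -
 have "(\<Sum>u\<in>tup k. \<phi> u * (\<Sum>w\<in>tup (i + k). if drop i w = u then h w else 0))
  = (\<Sum>w\<in>tup (i + k). \<Sum>u\<in>tup k. if drop i w = u then \<phi> (drop i w) * h w else 0)"
  unfolding sum_distrib_left by (subst sum.swap) (intro sum.cong refl, auto)
 also have "\<dots> = (\<Sum>w\<in>tup (i + k). \<phi> (drop i w) * h w)"
  by (rule sum.cong) (simp_all add: drop_tup)
 finally show ?thesis .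
qed

text \<open>Cap product with a cocycle; up to sign it lifts the cocycle to a chain map, which compares the
 cup product with the Yoneda product.\<close>

definition capm :: "nat => ((('l => 'l) list => 'l) => 'l) => nat => (('l => 'l) list => 'l) => ('l => 'l) list => 'l" where
 "capm i \<alpha> k = (\<lambda>c\<in>carrier (tbar (i + k)). %u. if u \<in> tup k then
   (-1) ^ (i * k) * (\<Sum>w\<in>tup (i + k). if drop i w = u then \<alpha> (be (take (Suc i) w)) * c w else 0) else 0)"

lemma hom_T_Lm: assumes f: "f \<in> right_hom A (tbar n) Tm" and "\<rho> \<in> G" "v \<in> tup n" shows "f (be (Lm \<rho> v)) = \<rho> (f (be v))"
proof -
 have a: "(%\<kappa>. if \<kappa> = \<rho> then 1 else 0) \<in> carrier A" using assms(2) by auto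
 show ?thesis
  using right_homD(3)[OF f a be_carrier(2)[OF assms(3)]] unfolding be_Lm[OF assms(2,3)] act_single[OF assms(2)] .
qed

lemma capm_hom: assumes al: "\<alpha> \<in> right_hom A (tbar i) Tm" shows "capm i \<alpha> k \<in> right_hom A (tbar (i + k)) (tbar k)"
 unfolding capm_def
proof (rule right_homI[OF right_module_tbar[OF ring_A0]])
 have alT: "\<alpha> (be (take (Suc i) w)) \<in> T" if "w \<in> tup (i + k)" for w
  using right_homD(1)[OF al be_carrier(2)[OF take_tup[OF that]]] by simp
 have sg: "(-1) ^ (i * k) \<in> T" "\<rho> ((-1) ^ (i * k)) = (-1) ^ (i * k)" if "\<rho> \<in> G" for \<rho>
  using that by (auto simp: G_power G_uminus)
 fix c assume c: "c \<in> carrier (tbar (i + k))"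
 show "(%u. if u \<in> tup k then (-1) ^ (i * k) * (\<Sum>w\<in>tup (i + k). if drop i w = u then \<alpha> (be (take (Suc i) w)) * c w else 0) else 0) \<in> carrier (tbar k)"
  using alT tbar_T[OF c] sg(1)[OF id_G] by (auto intro!: mult_T sum_T)
 fix a assume a: "a \<in> carrier A"
 show "(%u. if u \<in> tup k then (-1) ^ (i * k) * (\<Sum>w\<in>tup (i + k). if drop i w = u then \<alpha> (be (take (Suc i) w)) * (a \<odot>\<^bsub>tbar (i + k)\<^esub> c) w else 0) else 0)
  = a \<odot>\<^bsub>tbar k\<^esub> (%u. if u \<in> tup k then (-1) ^ (i * k) * (\<Sum>w\<in>tup (i + k). if drop i w = u then \<alpha> (be (take (Suc i) w)) * c w else 0) else 0)"
  (is "?L = a \<odot>\<^bsub>tbar k\<^esub> ?H")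
 proof
  fix u
  show "?L u = (a \<odot>\<^bsub>tbar k\<^esub> ?H) u"
  proof (cases "u \<in> tup k")
   case True
   have "(\<Sum>w\<in>tup (i + k). if drop i w = u then \<alpha> (be (take (Suc i) w)) * (a \<odot>\<^bsub>tbar (i + k)\<^esub> c) w else 0)
    = (\<Sum>w\<in>tup (i + k). \<Sum>\<rho>\<in>G. if drop i w = u then \<alpha> (be (take (Suc i) w)) * \<rho> (c (Lm (ginv \<rho>) w)) * a \<rho> else 0)"
    by (rule sum.cong) (auto simp: tbar_smult sum_distrib_left mult.assoc)
   also have "\<dots> = (\<Sum>\<rho>\<in>G. \<Sum>w\<in>tup (i + k). if drop i w = u then \<alpha> (be (take (Suc i) w)) * \<rho> (c (Lm (ginv \<rho>) w)) * a \<rho> else 0)"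
    by (rule sum.swap)
   also have "\<dots> = (\<Sum>\<rho>\<in>G. \<rho> (\<Sum>w\<in>tup (i + k). if drop i w = Lm (ginv \<rho>) u then \<alpha> (be (take (Suc i) w)) * c w else 0) * a \<rho>)"
   proof (rule sum.cong[OF refl])
    fix \<rho> assume r: "\<rho> \<in> G"
    have "(\<Sum>w\<in>tup (i + k). if drop i w = u then \<alpha> (be (take (Suc i) w)) * \<rho> (c (Lm (ginv \<rho>) w)) * a \<rho> else 0)
     = (\<Sum>w\<in>tup (i + k). if drop i (Lm \<rho> w) = u then \<alpha> (be (take (Suc i) (Lm \<rho> w))) * \<rho> (c (Lm (ginv \<rho>) (Lm \<rho> w))) * a \<rho> else 0)"
     by (rule sum_Lm[OF r, symmetric])
    also have "\<dots> = (\<Sum>w\<in>tup (i + k). \<rho> (if drop i w = Lm (ginv \<rho>) u then \<alpha> (be (take (Suc i) w)) * c w else 0) * a \<rho>)"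
    proof (rule sum.cong[OF refl])
     fix w assume w: "w \<in> tup (i + k)"
     show "(if drop i (Lm \<rho> w) = u then \<alpha> (be (take (Suc i) (Lm \<rho> w))) * \<rho> (c (Lm (ginv \<rho>) (Lm \<rho> w))) * a \<rho> else 0)
      = \<rho> (if drop i w = Lm (ginv \<rho>) u then \<alpha> (be (take (Suc i) w)) * c w else 0) * a \<rho>"
      using r by (simp add: Lm_take Lm_eq_iff hom_T_Lm[OF al r take_tup[OF w]] G_mult)
    qed
    finally show "(\<Sum>w\<in>tup (i + k). if drop i w = u then \<alpha> (be (take (Suc i) w)) * \<rho> (c (Lm (ginv \<rho>) w)) * a \<rho> else 0)
     = \<rho> (\<Sum>w\<in>tup (i + k). if drop i w = Lm (ginv \<rho>) u then \<alpha> (be (take (Suc i) w)) * c w else 0) * a \<rho>"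
     using r by (simp add: G_sum sum_distrib_right)
   qed
   finally have eq: "(\<Sum>w\<in>tup (i + k). if drop i w = u then \<alpha> (be (take (Suc i) w)) * (a \<odot>\<^bsub>tbar (i + k)\<^esub> c) w else 0)
    = (\<Sum>\<rho>\<in>G. \<rho> (\<Sum>w\<in>tup (i + k). if drop i w = Lm (ginv \<rho>) u then \<alpha> (be (take (Suc i) w)) * c w else 0) * a \<rho>)" .
   have "(-1) ^ (i * k) * (\<Sum>\<rho>\<in>G. \<rho> (Y \<rho>) * a \<rho>) = (\<Sum>\<rho>\<in>G. \<rho> ((-1) ^ (i * k) * Y \<rho>) * a \<rho>)" for Y
    unfolding sum_distrib_left by (rule sum.cong) (simp_all add: G_mult sg(2) mult.assoc)
   then show ?thesis using True eq by (simp add: tbar_smult)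
  qed (simp add: tbar_smult)
 qed
next
 fix c c'
 show "(%u. if u \<in> tup k then (-1) ^ (i * k) * (\<Sum>w\<in>tup (i + k). if drop i w = u then \<alpha> (be (take (Suc i) w)) * (c \<oplus>\<^bsub>tbar (i + k)\<^esub> c') w else 0) else 0)
  = (%u. if u \<in> tup k then (-1) ^ (i * k) * (\<Sum>w\<in>tup (i + k). if drop i w = u then \<alpha> (be (take (Suc i) w)) * c w else 0) else 0)
   \<oplus>\<^bsub>tbar k\<^esub> (%u. if u \<in> tup k then (-1) ^ (i * k) * (\<Sum>w\<in>tup (i + k). if drop i w = u then \<alpha> (be (take (Suc i) w)) * c' w else 0) else 0)"
 proof -
  have "(\<Sum>w\<in>tup (i + k). if drop i w = u then \<alpha> (be (take (Suc i) w)) * (c \<oplus>\<^bsub>tbar (i + k)\<^esub> c') w else 0)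
   = (\<Sum>w\<in>tup (i + k). if drop i w = u then \<alpha> (be (take (Suc i) w)) * c w else 0)
    + (\<Sum>w\<in>tup (i + k). if drop i w = u then \<alpha> (be (take (Suc i) w)) * c' w else 0)" for u
   unfolding sum.distrib[symmetric] by (rule sum.cong) (auto simp: distrib_left)
  then show ?thesis by (auto simp: distrib_left)
 qed
qed

lemma capm_pairing: assumes "c \<in> carrier (tbar (i + k))"
 shows "(\<Sum>u\<in>tup k. \<phi> u * capm i \<alpha> k c u) = (-1) ^ (i * k) * (\<Sum>w\<in>tup (i + k). \<alpha> (be (take (Suc i) w)) * \<phi> (drop i w) * c w)"
proof -
 have "(\<Sum>u\<in>tup k. \<phi> u * capm i \<alpha> k c u) = (-1) ^ (i * k) *
  (\<Sum>u\<in>tup k. \<phi> u * (\<Sum>w\<in>tup (i + k). if drop i w = u then \<alpha> (be (take (Suc i) w)) * c w else 0))"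
  unfolding sum_distrib_left[of "(-1) ^ (i * k)" "%u. \<phi> u * Y u" for Y]
  by (rule sum.cong) (use assms in \<open>simp_all add: capm_def mult.left_commute del: tbar_simps\<close>)
 then show ?thesis unfolding sum_drop by (simp add: mult_ac)
qed

text \<open>By adjointness and \<open>Dl_cup\<close> the boundary of a cap product has two terms,
  and that with the coboundary of \<alpha> vanishes. The other carries the factor (-1)^i, which is
  what the sign in \<open>capm\<close> compensates from one degree to the next.\<close>

lemma capm_lift: assumes al: "\<alpha> \<in> B.coc i" shows "capm i \<alpha> \<in> chain_lifts A tbar (bar_diff G T) taug i \<alpha>"
proof -
 have ah: "\<alpha> \<in> right_hom A (tbar i) Tm" "!!x. x \<in> carrier (tbar (Suc i)) ==> \<alpha> (bar_diff G T i x) = 0"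
  using al by (simp_all add: B.coc_iff del: tbar_simps)
 have aD: "Dl (%w. \<alpha> (be w)) v = 0" if v: "v \<in> tup (Suc i)" for v
 proof -
  have bc: "be v \<in> carrier (tbar (Suc i))" "be v \<in> carrier (bar_module G T (Suc i))"
   using be_carrier(2)[OF v] by simp_all
  have "0 = (\<Sum>w\<in>tup i. \<alpha> (be w) * bar_diff G T i (be v) w)"
   using ah(2)[OF bc(1)] hom_T_expand[OF ah(1) bar_diff_T[OF bc(1)]] by simp
  also have "\<dots> = (\<Sum>u\<in>tup (Suc i). be v u * Dl (%w. \<alpha> (be w)) u)"
   by (rule bar_diff_pairing[OF finite_G bc(2)])
  also have "\<dots> = (\<Sum>u\<in>tup (Suc i). if u = v then Dl (%w. \<alpha> (be w)) v else 0)"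
   by (rule sum.cong) (auto simp: basis_elem_def)
  finally show ?thesis using v by simp
 qed
 have 1: "taug (capm i \<alpha> 0 x) = \<alpha> x" if x: "x \<in> carrier (tbar i)" for x
 proof -
  have x0: "x \<in> carrier (tbar (i + 0))" using x by simp
  have "taug (capm i \<alpha> 0 x) = (\<Sum>u\<in>tup 0. 1 * capm i \<alpha> 0 x u)"
   using right_homD(1)[OF capm_hom[OF ah(1)] x0] by (simp add: taug_def del: tbar_simps)
  also have "\<dots> = (\<Sum>w\<in>tup i. \<alpha> (be w) * x w)"
   unfolding capm_pairing[OF x0] by (simp add: bar_tuples_def)
  also have "\<dots> = \<alpha> x" by (rule hom_T_expand[OF ah(1) x, symmetric])
  finally show ?thesis .
 qed
 have 2: "bar_diff G T k (capm i \<alpha> (Suc k) x) = capm i \<alpha> k (bar_diff G T (i + k) x)"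
  if x: "x \<in> carrier (tbar (i + Suc k))" for k x
 proof
  fix u
  have x': "x \<in> carrier (tbar (Suc (i + k)))" "x \<in> carrier (bar_module G T (Suc (i + k)))" using x by simp_all
  have cx: "capm i \<alpha> (Suc k) x \<in> carrier (tbar (Suc k))" by (rule right_homD(1)[OF capm_hom[OF ah(1)] x])
  then have cx': "capm i \<alpha> (Suc k) x \<in> carrier (bar_module G T (Suc k))" by simp
  have dx: "bar_diff G T (i + k) x \<in> carrier (tbar (i + k))" by (rule bar_diff_T[OF x'(1)])
  show "bar_diff G T k (capm i \<alpha> (Suc k) x) u = capm i \<alpha> k (bar_diff G T (i + k) x) u"
  proof (cases "u \<in> tup k")
   case False
   then show ?thesis using bar_diff_outside[OF finite_G cx'] dx by (simp add: capm_def del: tbar_simps)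
  next
   case True
   have "capm i \<alpha> k (bar_diff G T (i + k) x) u = (\<Sum>v\<in>tup k. ind u v * capm i \<alpha> k (bar_diff G T (i + k) x) v)"
    using sum_ind[OF True, of "capm i \<alpha> k (bar_diff G T (i + k) x)"] by (simp only: mult.commute)
   also have "\<dots> = (-1) ^ (i * k) * (\<Sum>w\<in>tup (i + k). (\<alpha> (be (take (Suc i) w)) * ind u (drop i w)) * bar_diff G T (i + k) x w)"
    by (rule capm_pairing[OF dx])
   also have "\<dots> = (-1) ^ (i * k) * (\<Sum>v\<in>tup (Suc (i + k)). x v * Dl (%w. \<alpha> (be (take (Suc i) w)) * ind u (drop i w)) v)"
    unfolding bar_diff_pairing[OF finite_G x'(2), of "%w. \<alpha> (be (take (Suc i) w)) * ind u (drop i w)"] ..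
   also have "(\<Sum>v\<in>tup (Suc (i + k)). x v * Dl (%w. \<alpha> (be (take (Suc i) w)) * ind u (drop i w)) v)
    = (\<Sum>v\<in>tup (Suc (i + k)). (-1) ^ i * (\<alpha> (be (take (Suc i) v)) * Dl (ind u) (drop i v) * x v))"
   proof (rule sum.cong[OF refl])
    fix v assume v: "v \<in> tup (Suc (i + k))"
    then have l: "length v = Suc (Suc (i + k))" by (simp add: bar_tuples_def)
    have "take (Suc (Suc i)) v \<in> tup (Suc i)" using take_tup[of v "Suc i" k] v by simp
    then show "x v * Dl (%w. \<alpha> (be (take (Suc i) w)) * ind u (drop i w)) v
     = (-1) ^ i * (\<alpha> (be (take (Suc i) v)) * Dl (ind u) (drop i v) * x v)"
     unfolding Dl_cup[OF l, of "%w. \<alpha> (be w)"] by (simp add: aD mult_ac)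
   qed
   also have "(-1) ^ (i * k) * \<dots> = (-1) ^ (i * Suc k) * (\<Sum>w\<in>tup (i + Suc k). \<alpha> (be (take (Suc i) w)) * Dl (ind u) (drop i w) * x w)"
    by (simp add: sum_distrib_left[symmetric] power_add mult.commute)
   also have "\<dots> = (\<Sum>v\<in>tup (Suc k). capm i \<alpha> (Suc k) x v * Dl (ind u) v)"
    unfolding capm_pairing[OF x, symmetric] by (simp add: mult.commute)
   also have "\<dots> = bar_diff G T k (capm i \<alpha> (Suc k) x) u" by (rule bar_diff_eq[OF finite_G cx', symmetric])
   finally show ?thesis by (rule sym)
  qed
 qed
 show ?thesis unfolding chain_lifts_def using capm_hom[OF ah(1)] 1 2 by blast
qed

lemma coc_self: "f \<in> B.coc n ==> f \<in> ext_class A tbar (bar_diff G T) Tm n f"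
 unfolding B.ext_class_eq by (simp add: B.cl_def)

text \<open>\<open>capm i \<alpha>\<close> is a lift of \<alpha>, so \<beta> after it represents the
  Yoneda product; evaluated on chains it is the cup product up to the sign (-1)^(i*j).\<close>

lemma cup_rep:
 assumes al: "\<alpha> \<in> B.cl i y" and be: "\<beta> \<in> B.cl j v"
  and prod: "yoneda_product A Tm tbar (bar_diff G T) taug i j (B.cl i y) (B.cl j v) = B.cl (i + j) w"
 shows "ext_class gA bS (bar_diff G S) Tm (i + j) (bar_cup G S i j (res i \<alpha>) (res j \<beta>)) = clS (i + j) ((-1) ^ (i * j) * w)"
proof -
 have ac: "\<alpha> \<in> B.coc i" and bc: "\<beta> \<in> B.coc j" using al be by (simp_all add: B.cl_def)
 have bh: "\<beta> \<in> right_hom A (tbar j) Tm" and ah: "\<alpha> \<in> right_hom A (tbar i) Tm" using ac bc by (simp_all add: B.coc_iff)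
 define h where "h = (\<lambda>x\<in>carrier (tbar (i + j)). \<beta> (capm i \<alpha> j x))"
 have lift: "capm i \<alpha> \<in> chain_lifts A tbar (bar_diff G T) taug i \<alpha>" by (rule capm_lift[OF ac])
 obtain u where u: "odd i ==> \<delta> u = \<alpha> (B.q i)"
  using h90[of "\<alpha> (B.q i)"] B.coc_value[OF ac] by (cases "odd i") (auto simp: Zc_def)
 have hc: "h \<in> B.coc (i + j)" unfolding h_def by (rule B.chain_lift_value(1)[OF ac bc lift u])
 have "ext_class A tbar (bar_diff G T) Tm (i + j) h \<subseteq> B.cl (i + j) w"
  unfolding prod[symmetric] yoneda_product_def h_def using al be lift by blast
 then have hw: "h \<in> B.cl (i + j) w" using coc_self[OF hc] by blast
 define s where "s = ((-1) ^ (i * j) :: 'l)"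
 have s: "s \<in> S" "s * s = 1" by (simp_all add: s_def flip: power_mult_distrib)
 define h' where "h' = (\<lambda>x\<in>carrier (tbar (i + j)). h x * s)"
 have "h' \<in> B.cl (i + j) (s * w)"
 proof -
  have "h' \<in> B.coc (i + j)" unfolding h'_def by (rule B.coc_smult[OF s(1) hc])
  moreover have "h' (B.q (i + j)) - s * w = s * (h (B.q (i + j)) - w)"
   using B.q(1)[of "i + j"] by (simp add: h'_def algebra_simps del: tbar_simps)
  moreover have "s * (h (B.q (i + j)) - w) \<in> Bc (i + j)"
   by (rule Bc_smult[OF s(1)]) (use hw in \<open>simp add: B.cl_def\<close>)
  ultimately show ?thesis by (simp add: B.cl_def)
 qed
 moreover have "bar_cup G S i j (res i \<alpha>) (res j \<beta>) = res (i + j) h'"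
  unfolding bar_cup_def res_def[of "i + j"]
 proof (rule restrict_ext)
  fix c assume c: "c \<in> carrier (bS (i + j))"
  note ct = bS_tbar[OF c]
  have r: "res i \<alpha> (be (take (Suc i) w)) = \<alpha> (be (take (Suc i) w))" "res j \<beta> (be (drop i w)) = \<beta> (be (drop i w))"
   if "w \<in> tup (i + j)" for w
   using be_carrier(1)[OF take_tup[OF that]] be_carrier(1)[OF drop_tup[OF that]]
   by (simp_all add: res_def del: bar_module_simps)
  have "\<beta> (capm i \<alpha> j c) = (\<Sum>u\<in>tup j. \<beta> (be u) * capm i \<alpha> j c u)"
   by (rule hom_T_expand[OF bh right_homD(1)[OF capm_hom[OF ah] ct]])
  also have "\<dots> = s * (\<Sum>w\<in>tup (i + j). \<alpha> (be (take (Suc i) w)) * \<beta> (be (drop i w)) * c w)"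
   unfolding s_def by (rule capm_pairing[OF ct])
  finally have "h' c = (s * s) * (\<Sum>w\<in>tup (i + j). \<alpha> (be (take (Suc i) w)) * \<beta> (be (drop i w)) * c w)"
   using ct by (simp add: h'_def h_def mult_ac del: tbar_simps)
  then have "h' c = (\<Sum>w\<in>tup (i + j). \<alpha> (be (take (Suc i) w)) * \<beta> (be (drop i w)) * c w)"
   unfolding s(2) by simp
  also have "\<dots> = (\<Sum>w\<in>tup (i + j). res i \<alpha> (be (take (Suc i) w)) * res j \<beta> (be (drop i w)) * c w)"
   by (rule sum.cong) (simp_all add: r)
  finally show "(\<Sum>w\<in>tup (i + j). res i \<alpha> (be (take (Suc i) w)) * res j \<beta> (be (drop i w)) * c w) = h' c" by simp
 qed
 ultimately show ?thesis using ext_class_S_rep by (simp add: s_def)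
qed

lemma cup_product_eq:
 assumes y: "y \<in> Zc i" and v: "v \<in> Zc j"
  and prod: "yoneda_product A Tm tbar (bar_diff G T) taug i j (B.cl i y) (B.cl j v) = B.cl (i + j) w"
 shows "cup_product G T S i j (clS i y) (clS j v) = clS (i + j) ((-1) ^ (i * j) * w)"
proof -
 have "cup_product G T S i j (clS i y) (clS j v)
  = (\<Union>\<alpha>\<in>B.cl i y. \<Union>\<beta>\<in>B.cl j v. ext_class gA bS (bar_diff G S) Tm (i + j) (bar_cup G S i j (res i \<alpha>) (res j \<beta>)))"
  by (simp add: cup_product_def clS_def)
 then show ?thesis using cup_rep[OF _ _ prod] B.cl_nonempty[OF y] B.cl_nonempty[OF v] by auto
qed

theorem group_cohomology_model:
 "cohomology_model (ext_module gA bS (bar_diff G S) Tm) (cup_product G T S)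
  (ext_class gA bS (bar_diff G S) Tm 0 (\<lambda>f\<in>carrier (bS 0). \<Sum>w\<in>tup 0. f w)) clS 1"
proof -
 note m = cohomology_modelD(8,9)[OF B.ext_model]
 have unit: "ext_class gA bS (bar_diff G S) Tm 0 (\<lambda>f\<in>carrier (bS 0). \<Sum>w\<in>tup 0. f w) = clS 0 1"
 proof -
  have "(\<lambda>f\<in>carrier (bS 0). \<Sum>w\<in>tup 0. f w) = res 0 taug"
   unfolding res_def by (rule restrict_ext) (use bS_tbar in \<open>simp add: taug_def del: tbar_simps bar_module_simps\<close>)
  then show ?thesis using B.unit_ext by (simp only: ext_class_S clS_def)
 qed
 have carrier: "carrier (ext_module gA bS (bar_diff G S) Tm n) = clS n ` Zc n" for n
 proof -
  have "carrier (ext_module gA bS (bar_diff G S) Tm n) = (%f. res n ` ext_class A tbar (bar_diff G T) Tm n f) ` B.coc n"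
   by (simp add: ext_module_def coc_S image_image ext_class_S)
  also have "\<dots> = (`) (res n) ` carrier (ext_module A tbar (bar_diff G T) Tm n)"
   by (simp add: ext_module_def image_image)
  also have "\<dots> = clS n ` Zc n" unfolding B.carrier_ext by (simp add: image_image clS_def)
  finally show ?thesis .
 qed
 have zero: "\<zero>\<^bsub>ext_module gA bS (bar_diff G S) Tm n\<^esub> = clS n 0" for n
  using B.zero_ext[of n] by (simp add: ext_module_def cob_S clS_def)
 have eq: "clS n y = clS n y' \<longleftrightarrow> y - y' \<in> Bc n" if "y \<in> Zc n" "y' \<in> Zc n" for n y y'
 proof -
  have "inj_on (res n) (right_hom A (tbar n) Tm)" using res_inj by (auto intro: inj_onI)
  then have "clS n y = clS n y' \<longleftrightarrow> B.cl n y = B.cl n y'"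
   unfolding clS_def by (rule inj_on_image_eq_iff[OF _ cl_hom cl_hom])
  then show ?thesis using B.cl_eq_iff[OF that] by simp
 qed
 have add: "clS n y \<oplus>\<^bsub>ext_module gA bS (bar_diff G S) Tm n\<^esub> clS n y' = clS n (y + y')"
  if "y \<in> Zc n" "y' \<in> Zc n" for n y y'
 proof -
  have "clS n y \<oplus>\<^bsub>ext_module gA bS (bar_diff G S) Tm n\<^esub> clS n y'
   = (\<Union>f\<in>B.cl n y. \<Union>g\<in>B.cl n y'. {res n (\<lambda>x\<in>carrier (tbar n). f x + g x)})"
   by (simp add: ext_module_def set_add_def' clS_def res_add del: bar_module_simps tbar_simps)
  also have "\<dots> = res n ` (B.cl n y \<oplus>\<^bsub>ext_module A tbar (bar_diff G T) Tm n\<^esub> B.cl n y')"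
   by (simp add: ext_module_def set_add_def' B.hom_module_simps image_UN del: bar_module_simps tbar_simps)
  finally show ?thesis unfolding B.add_ext[OF that] clS_def .
 qed
 have smult: "a \<odot>\<^bsub>ext_module gA bS (bar_diff G S) Tm n\<^esub> clS n y = clS n (a * y)"
  if "a \<in> S" "y \<in> Zc n" for n a y
 proof -
  have "a \<odot>\<^bsub>ext_module gA bS (bar_diff G S) Tm n\<^esub> clS n y
   = (\<Union>f\<in>B.cl n y. res n ` ext_class A tbar (bar_diff G T) Tm n (\<lambda>x\<in>carrier (tbar n). f x * a))"
   by (simp add: ext_module_def clS_def res_smult ext_class_S del: bar_module_simps tbar_simps)
  also have "\<dots> = res n ` (a \<odot>\<^bsub>ext_module A tbar (bar_diff G T) Tm n\<^esub> B.cl n y)"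
   by (simp add: ext_module_def B.hom_module_simps image_UN del: bar_module_simps tbar_simps)
  finally show ?thesis unfolding B.smult_ext[OF that] clS_def .
 qed
 have even: "cup_product G T S i j (clS i y) (clS j v) = clS (i + j) (y * v)"
  if "y \<in> Zc i" "v \<in> Zc j" "even i \<or> even j" for i j y v
 proof -
  have "yoneda_product A Tm tbar (bar_diff G T) taug i j (B.cl i y) (B.cl j v) = B.cl (i + j) (y * v)"
   by (rule m(1)[OF that])
  from cup_product_eq[OF that(1,2) this] show ?thesis using that(3) by auto
 qed
 \<comment> \<open>In odd degrees the comparison sign (-1)^(i*j) cancels the sign -1 of the Yoneda
   model, which gives \<chi> = 1.\<close>
 have odd: "cup_product G T S i j (clS i (\<delta> u)) (clS j v) = clS (i + j) (1 * Tr (v * \<sigma> u))"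
  if "v \<in> Zc j" "odd i" "odd j" "\<delta> u \<in> T" for i j u v
 proof -
  have "yoneda_product A Tm tbar (bar_diff G T) taug i j (B.cl i (\<delta> u)) (B.cl j v) = B.cl (i + j) (-1 * Tr (v * \<sigma> u))"
   by (rule m(2)[OF that])
  moreover have "\<delta> u \<in> Zc i" using that by (simp add: Zc_def)
  ultimately have "cup_product G T S i j (clS i (\<delta> u)) (clS j v) = clS (i + j) ((-1) ^ (i * j) * (-1 * Tr (v * \<sigma> u)))"
   using that(1) by (intro cup_product_eq)
  then show ?thesis using that(2,3) by simp
 qed
 show ?thesis unfolding cohomology_model_def
  using unit carrier zero eq add smult even odd by simp
qed

end

section \<open>Presentations of graded algebras\<close>

text \<open>What the passage to a quotient uses: a ring in which scalars act as left multiplication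
  by elements of the ring.\<close>

definition graded_alg :: "'s set => ('s, 'a) graded_algebra => bool" where
 "graded_alg S A \<longleftrightarrow> ring A & (\<forall>s\<in>S. s \<odot>\<^bsub>A\<^esub> \<one>\<^bsub>A\<^esub> \<in> carrier A &
   (\<forall>x\<in>carrier A. s \<odot>\<^bsub>A\<^esub> x = (s \<odot>\<^bsub>A\<^esub> \<one>\<^bsub>A\<^esub>) \<otimes>\<^bsub>A\<^esub> x))"

lemma graded_quotient_simps [simp]:
 "carrier (graded_quotient A I) = (%x. I +>\<^bsub>A\<^esub> x) ` carrier A"
 "monoid.mult (graded_quotient A I) = monoid.mult (A Quot I)"
 "one (graded_quotient A I) = I +>\<^bsub>A\<^esub> \<one>\<^bsub>A\<^esub>"
 "zero (graded_quotient A I) = I"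
 "add (graded_quotient A I) = add (A Quot I)"
 "homog (graded_quotient A I) n = (%x. I +>\<^bsub>A\<^esub> x) ` homog A n"
 by (auto simp: graded_quotient_def FactRing_def A_RCOSETS_def')

lemma ring_graded_quotient: assumes "ideal I A" shows "ring (graded_quotient A I)"
proof -
 interpret Q: ring "A Quot I" by (rule ideal.quotient_is_ring[OF assms])
 have sel: "carrier (graded_quotient A I) = carrier (A Quot I)" "monoid.mult (graded_quotient A I) = monoid.mult (A Quot I)"
  "one (graded_quotient A I) = one (A Quot I)" "zero (graded_quotient A I) = zero (A Quot I)"
  "add (graded_quotient A I) = add (A Quot I)"
  by (simp_all add: graded_quotient_def)
 show ?thesis
 proof (rule ringI)
  show "abelian_group (graded_quotient A I)"
  proof (rule abelian_groupI; unfold sel)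
   fix x assume x: "x \<in> carrier (A Quot I)"
   show "\<exists>y\<in>carrier (A Quot I). y \<oplus>\<^bsub>A Quot I\<^esub> x = \<zero>\<^bsub>A Quot I\<^esub>"
    using Q.a_inv_closed[OF x] Q.l_neg[OF x] by blast
  qed (rule Q.a_closed Q.zero_closed Q.a_assoc Q.a_comm Q.l_zero | assumption)+
  show "Group.monoid (graded_quotient A I)"
   by (rule Group.monoidI; unfold sel) (rule Q.m_closed Q.one_closed Q.m_assoc Q.l_one Q.r_one | assumption)+
 qed (unfold sel, (rule Q.l_distr Q.r_distr | assumption)+)
qed

locale graded_presentation =
 fixes S :: "'s set" and A :: "('s, 'a) graded_algebra" and \<Gamma> :: "'a set"
 assumes alg: "graded_alg S A" and rels: "\<Gamma> \<subseteq> carrier A"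
begin

sublocale A: ring A using alg by (simp add: graded_alg_def)

abbreviation Q where "Q \<equiv> graded_quotient A (Idl\<^bsub>A\<^esub> \<Gamma>)"

definition \<pi> :: "'a => 'a set" where "\<pi> x = Idl\<^bsub>A\<^esub> \<Gamma> +>\<^bsub>A\<^esub> x"

lemma idl: "ideal (Idl\<^bsub>A\<^esub> \<Gamma>) A"
 by (rule A.genideal_ideal[OF rels])

sublocale Q: ring Q by (rule ring_graded_quotient[OF idl])

lemma pi_hom: "\<pi> \<in> ring_hom A (A Quot Idl\<^bsub>A\<^esub> \<Gamma>)"
 using ideal.rcos_ring_hom[OF idl] by (simp add: \<pi>_def[abs_def])

lemma carrier_Q: "carrier Q = \<pi> ` carrier A"
 and homog_Q: "homog Q n = \<pi> ` homog A n"
 and pi_one: "\<pi> \<one>\<^bsub>A\<^esub> = \<one>\<^bsub>Q\<^esub>"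
 by (simp_all add: \<pi>_def)

lemma pi_mult: "x \<in> carrier A ==> y \<in> carrier A ==> \<pi> (x \<otimes>\<^bsub>A\<^esub> y) = \<pi> x \<otimes>\<^bsub>Q\<^esub> \<pi> y"
 and pi_add: "x \<in> carrier A ==> y \<in> carrier A ==> \<pi> (x \<oplus>\<^bsub>A\<^esub> y) = \<pi> x \<oplus>\<^bsub>Q\<^esub> \<pi> y"
 using ring_hom_mult[OF pi_hom] ring_hom_add[OF pi_hom] by simp_all

lemma pi_closed: "x \<in> carrier A ==> \<pi> x \<in> carrier Q"
 by (simp add: \<pi>_def)

lemma pi_zero: "\<pi> \<zero>\<^bsub>A\<^esub> = \<zero>\<^bsub>Q\<^esub>"
 using ring_hom_zero[OF pi_hom A.ring_axioms ideal.quotient_is_ring[OF idl]] by (simp add: FactRing_def)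

lemma pi_uminus: assumes "x \<in> carrier A" shows "\<pi> (\<ominus>\<^bsub>A\<^esub> x) = \<ominus>\<^bsub>Q\<^esub> \<pi> x"
proof (rule Q.minus_equality[symmetric])
 show "\<pi> (\<ominus>\<^bsub>A\<^esub> x) \<oplus>\<^bsub>Q\<^esub> \<pi> x = \<zero>\<^bsub>Q\<^esub>"
  using assms pi_zero by (simp only: pi_add[symmetric] A.a_inv_closed A.l_neg)
qed (use assms pi_closed in \<open>simp_all del: graded_quotient_simps\<close>)

lemma pi_minus: "x \<in> carrier A ==> y \<in> carrier A ==> \<pi> (x \<ominus>\<^bsub>A\<^esub> y) = \<pi> x \<ominus>\<^bsub>Q\<^esub> \<pi> y"
 by (simp only: a_minus_def pi_add pi_uminus A.a_inv_closed)

lemma subg: "abelian_subgroup (Idl\<^bsub>A\<^esub> \<Gamma>) A"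
 by (rule abelian_subgroupI3[OF ideal.axioms(1)[OF idl] A.is_abelian_group])

lemma pi_eq_iff: assumes "x \<in> carrier A" "y \<in> carrier A" shows "\<pi> x = \<pi> y \<longleftrightarrow> x \<ominus>\<^bsub>A\<^esub> y \<in> Idl\<^bsub>A\<^esub> \<Gamma>"
proof -
 have "x \<in> \<pi> y \<longleftrightarrow> x \<ominus>\<^bsub>A\<^esub> y \<in> Idl\<^bsub>A\<^esub> \<Gamma>"
  using abelian_subgroup.a_rcos_module[OF subg assms(2,1)] by (simp add: \<pi>_def a_minus_def)
 moreover have "\<pi> x = \<pi> y" if "x \<in> \<pi> y"
  using abelian_subgroup.a_repr_independence'[OF subg _ assms(2), of x] that by (simp add: \<pi>_def)
 moreover have "x \<in> \<pi> x" using abelian_subgroup.a_rcos_self[OF subg assms(1)] by (simp add: \<pi>_def)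
 ultimately show ?thesis by metis
qed

lemma smult_eq: "s \<in> S ==> x \<in> carrier A ==> s \<odot>\<^bsub>A\<^esub> x = (s \<odot>\<^bsub>A\<^esub> \<one>\<^bsub>A\<^esub>) \<otimes>\<^bsub>A\<^esub> x"
 and smult_one: "s \<in> S ==> s \<odot>\<^bsub>A\<^esub> \<one>\<^bsub>A\<^esub> \<in> carrier A"
 using alg unfolding graded_alg_def by blast+

lemma smult_closed: "s \<in> S ==> x \<in> carrier A ==> s \<odot>\<^bsub>A\<^esub> x \<in> carrier A"
 by (simp only: smult_eq smult_one A.m_closed)

lemma pi_smult: assumes s: "s \<in> S" and x: "x \<in> carrier A" shows "\<pi> (s \<odot>\<^bsub>A\<^esub> x) = s \<odot>\<^bsub>Q\<^esub> \<pi> x"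
proof -
 have "Idl\<^bsub>A\<^esub> \<Gamma> +>\<^bsub>A\<^esub> (s \<odot>\<^bsub>A\<^esub> y) = \<pi> (s \<odot>\<^bsub>A\<^esub> x)" if y: "y \<in> \<pi> x" for y
 proof -
  have yA: "y \<in> carrier A" using y x ideal.Icarr[OF idl] by (auto simp: \<pi>_def a_r_coset_def')
  have "\<pi> y = \<pi> x"
   using abelian_subgroup.a_repr_independence'[OF subg, of y x] x y by (simp add: \<pi>_def)
  then have "\<pi> (s \<odot>\<^bsub>A\<^esub> y) = \<pi> (s \<odot>\<^bsub>A\<^esub> x)"
   using s x yA by (simp only: smult_eq pi_mult smult_one)
  then show ?thesis by (simp add: \<pi>_def)
 qed
 moreover have "x \<in> \<pi> x"
  using abelian_subgroup.a_rcos_self[OF subg x]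
  by (simp add: \<pi>_def)
 ultimately show ?thesis by (auto simp: graded_quotient_def)
qed

lemma graded_alg_Q: "graded_alg S Q"
 unfolding graded_alg_def
proof (intro conjI ballI)
 show "ring Q" by (rule Q.ring_axioms)
 fix s assume s: "s \<in> S"
 show "s \<odot>\<^bsub>Q\<^esub> \<one>\<^bsub>Q\<^esub> \<in> carrier Q" unfolding pi_one[symmetric] pi_smult[OF s A.one_closed, symmetric]
  by (rule pi_closed[OF smult_one[OF s]])
 fix U assume "U \<in> carrier Q"
 then obtain x where x: "x \<in> carrier A" "U = \<pi> x" unfolding carrier_Q by blast
 show "s \<odot>\<^bsub>Q\<^esub> U = (s \<odot>\<^bsub>Q\<^esub> \<one>\<^bsub>Q\<^esub>) \<otimes>\<^bsub>Q\<^esub> U"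
  unfolding x(2) pi_one[symmetric] pi_smult[OF s A.one_closed, symmetric] pi_smult[OF s x(1), symmetric]
   pi_mult[OF smult_one[OF s] x(1), symmetric] by (simp only: smult_eq[OF s x(1)])
qed

lemma pi_rel: assumes "x \<in> \<Gamma>" shows "\<pi> x = \<pi> \<zero>\<^bsub>A\<^esub>"
proof -
 have x: "x \<in> carrier A" "x \<in> Idl\<^bsub>A\<^esub> \<Gamma>" using assms rels A.genideal_self[OF rels] by blast+
 then have "x \<ominus>\<^bsub>A\<^esub> \<zero>\<^bsub>A\<^esub> = x" by (simp add: a_minus_def)
 then show ?thesis using x by (simp only: pi_eq_iff A.zero_closed)
qed

text \<open>The target operations f and g are arbitrary functions, since ring axioms are not
  established for the cohomology algebra. Nevertheless the elements with the same image as zero form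
  an ideal, and it contains the relations.\<close>

lemma pi_universal:
 assumes add: "!!x y. x \<in> carrier A ==> y \<in> carrier A ==> \<Phi> (x \<oplus>\<^bsub>A\<^esub> y) = f (\<Phi> x) (\<Phi> y)"
  and mult: "!!x y. x \<in> carrier A ==> y \<in> carrier A ==> \<Phi> (x \<otimes>\<^bsub>A\<^esub> y) = g (\<Phi> x) (\<Phi> y)"
  and rel: "!!x. x \<in> \<Gamma> ==> \<Phi> x = \<Phi> \<zero>\<^bsub>A\<^esub>"
  and x: "x \<in> carrier A" and y: "y \<in> carrier A" and eq: "\<pi> x = \<pi> y"
 shows "\<Phi> x = \<Phi> y"
proof -
 define K where "K = {x \<in> carrier A. \<Phi> x = \<Phi> \<zero>\<^bsub>A\<^esub>}"
 have K_add: "u \<oplus>\<^bsub>A\<^esub> v \<in> K" if "u \<in> K" "v \<in> K" for u v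
 proof -
  have "\<Phi> (u \<oplus>\<^bsub>A\<^esub> v) = \<Phi> (\<zero>\<^bsub>A\<^esub> \<oplus>\<^bsub>A\<^esub> \<zero>\<^bsub>A\<^esub>)" using that by (simp only: add K_def mem_Collect_eq A.zero_closed)
  then show ?thesis using that by (simp add: K_def)
 qed
 have K_inv: "\<ominus>\<^bsub>A\<^esub> u \<in> K" if "u \<in> K" for u
 proof -
  have u: "u \<in> carrier A" "\<Phi> u = \<Phi> \<zero>\<^bsub>A\<^esub>" using that by (simp_all add: K_def)
  have "\<Phi> (\<ominus>\<^bsub>A\<^esub> u \<oplus>\<^bsub>A\<^esub> \<zero>\<^bsub>A\<^esub>) = \<Phi> (\<ominus>\<^bsub>A\<^esub> u \<oplus>\<^bsub>A\<^esub> u)" using u by (simp only: add A.a_inv_closed A.zero_closed)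
  then show ?thesis using u by (simp add: K_def A.l_neg)
 qed
 have K_mult: "v \<otimes>\<^bsub>A\<^esub> u \<in> K" "u \<otimes>\<^bsub>A\<^esub> v \<in> K" if "u \<in> K" "v \<in> carrier A" for u v
 proof -
  have u: "u \<in> carrier A" "\<Phi> u = \<Phi> \<zero>\<^bsub>A\<^esub>" using that by (simp_all add: K_def)
  have "\<Phi> (v \<otimes>\<^bsub>A\<^esub> u) = \<Phi> (v \<otimes>\<^bsub>A\<^esub> \<zero>\<^bsub>A\<^esub>)" "\<Phi> (u \<otimes>\<^bsub>A\<^esub> v) = \<Phi> (\<zero>\<^bsub>A\<^esub> \<otimes>\<^bsub>A\<^esub> v)"
   using u that by (simp_all only: mult A.zero_closed)
  then show "v \<otimes>\<^bsub>A\<^esub> u \<in> K" "u \<otimes>\<^bsub>A\<^esub> v \<in> K" using u that by (simp_all add: K_def)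
 qed
 have "subgroup K (add_monoid A)"
 proof (rule A.add.subgroupI)
  show "K \<subseteq> carrier A" "K ~= {}" using A.zero_closed by (auto simp: K_def)
 qed (use K_add K_inv in \<open>auto simp: a_inv_def\<close>)
 then have "ideal K A" using K_mult by (intro idealI A.ring_axioms)
 moreover have "\<Gamma> \<subseteq> K" using rel rels by (auto simp: K_def)
 ultimately have "x \<ominus>\<^bsub>A\<^esub> y \<in> K" using pi_eq_iff[OF x y] eq A.genideal_minimal by blast
 then have d: "\<Phi> (x \<ominus>\<^bsub>A\<^esub> y) = \<Phi> \<zero>\<^bsub>A\<^esub>" by (simp add: K_def)
 have "x = (x \<ominus>\<^bsub>A\<^esub> y) \<oplus>\<^bsub>A\<^esub> y" "y = \<zero>\<^bsub>A\<^esub> \<oplus>\<^bsub>A\<^esub> y"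
  using x y by (simp_all add: a_minus_def A.a_assoc A.l_neg)
 then show ?thesis using d x y by (metis add A.minus_closed A.zero_closed)
qed

end

text \<open>Both algebras are images of one set C under maps with the same fibres, and all
  operations come from C.\<close>

lemma graded_algebra_isoI:
 assumes carrier: "carrier A = q ` C" "carrier B = \<Phi> ` C"
  and eq: "!!f g. f \<in> C ==> g \<in> C ==> q f = q g \<longleftrightarrow> \<Phi> f = \<Phi> g"
  and closed: "!!f g. f \<in> C ==> g \<in> C ==> m f g \<in> C" "!!f g. f \<in> C ==> g \<in> C ==> a f g \<in> C"
   "u \<in> C" "!!s f. s \<in> S ==> f \<in> C ==> sm s f \<in> C"
  and q: "!!f g. f \<in> C ==> g \<in> C ==> q (m f g) = q f \<otimes>\<^bsub>A\<^esub> q g" "!!f g. f \<in> C ==> g \<in> C ==> q (a f g) = q f \<oplus>\<^bsub>A\<^esub> q g"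
   "q u = \<one>\<^bsub>A\<^esub>" "!!s f. s \<in> S ==> f \<in> C ==> q (sm s f) = s \<odot>\<^bsub>A\<^esub> q f"
  and \<Phi>: "!!f g. f \<in> C ==> g \<in> C ==> \<Phi> (m f g) = \<Phi> f \<otimes>\<^bsub>B\<^esub> \<Phi> g" "!!f g. f \<in> C ==> g \<in> C ==> \<Phi> (a f g) = \<Phi> f \<oplus>\<^bsub>B\<^esub> \<Phi> g"
   "\<Phi> u = \<one>\<^bsub>B\<^esub>" "!!s f. s \<in> S ==> f \<in> C ==> \<Phi> (sm s f) = s \<odot>\<^bsub>B\<^esub> \<Phi> f"
  and homog: "!!n. homog A n = q ` H n" "!!n. homog B n = \<Phi> ` H n" "!!n. H n \<subseteq> C"
 shows "\<exists>\<phi>. \<phi> \<in> graded_algebra_iso S A B"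
proof -
 define \<phi> where "\<phi> U = \<Phi> (SOME f. f \<in> C & q f = U)" for U
 have \<phi>: "\<phi> (q f) = \<Phi> f" if "f \<in> C" for f
 proof -
  have "(SOME g. g \<in> C & q g = q f) \<in> C & q (SOME g. g \<in> C & q g = q f) = q f"
   by (rule someI[of _ f]) (simp add: that)
  then show ?thesis unfolding \<phi>_def using eq that by blast
 qed
 have "\<phi> \<in> ring_hom A B"
  by (rule ring_hom_memI)
   (auto simp: carrier \<phi> closed simp flip: q \<Phi>)
 moreover have "bij_betw \<phi> (carrier A) (carrier B)"
  unfolding bij_betw_def carrier using eq by (auto simp: inj_on_def \<phi> image_image cong: image_cong)
 moreover have "\<phi> (s \<odot>\<^bsub>A\<^esub> U) = s \<odot>\<^bsub>B\<^esub> \<phi> U" if "s \<in> S" "U \<in> carrier A" for s U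
  using that by (auto simp: carrier \<phi> closed simp flip: q \<Phi>)
 moreover have "\<phi> ` homog A n = homog B n" for n
  unfolding homog(1,2) image_image using homog(3) \<phi> by (intro image_cong refl) blast
 ultimately have "\<phi> \<in> graded_algebra_iso S A B" by (simp add: graded_algebra_iso_def ring_iso_def)
 then show ?thesis by (rule exI[of "%\<phi>. \<phi> \<in> graded_algebra_iso S A B" \<phi>])
qed

section \<open>Free algebras\<close>

locale free_alg =
 fixes S :: "'l::field set" and U :: "'x set" and wt :: "'x => nat"
 assumes S0: "0 \<in> S" and S1: "1 \<in> S" and S_add: "x \<in> S ==> y \<in> S ==> x + y \<in> S"
  and S_mult: "x \<in> S ==> y \<in> S ==> x * y \<in> S" and S_uminus: "x \<in> S ==> - x \<in> S"
begin

abbreviation Fr :: "('l, 'x list => 'l) graded_algebra" where "Fr \<equiv> free_algebra S U wt"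

definition dg :: "'x list => nat" where "dg w = sum_list (map wt w)"

lemma dg_simps [simp]: "dg [] = 0" "dg (x # w) = wt x + dg w" "dg (v @ w) = dg v + dg w"
 by (simp_all add: dg_def)

lemma S_sum: "(!!i. i \<in> I ==> f i \<in> S) ==> sum f I \<in> S"
 by (induction I rule: infinite_finite_induct) (auto intro: S0 S_add)

lemma Fr_simps [simp]:
 "carrier Fr = {f. range f \<subseteq> S & (\<forall>w. w \<notin> lists U --> f w = 0) & finite {w. f w ~= 0}}"
 "f \<otimes>\<^bsub>Fr\<^esub> g = (%w. \<Sum>k\<le>length w. f (take k w) * g (drop k w))"
 "\<one>\<^bsub>Fr\<^esub> = basis_elem []" "\<zero>\<^bsub>Fr\<^esub> = (%_. 0)" "f \<oplus>\<^bsub>Fr\<^esub> g = (%w. f w + g w)"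
 "s \<odot>\<^bsub>Fr\<^esub> f = (%w. s * f w)"
 by (simp_all add: free_algebra_def)

lemma homog_Fr: "homog Fr n = {f \<in> carrier Fr. \<forall>w. f w ~= 0 --> dg w = n}"
 by (auto simp: free_algebra_def dg_def)

lemma Fr_mult_sum:
 assumes "finite A" "finite B" "!!w. w \<notin> A ==> f w = 0" "!!w. w \<notin> B ==> g w = 0"
 shows "(f \<otimes>\<^bsub>Fr\<^esub> g) x = (\<Sum>(v, w)\<in>A \<times> B. if v @ w = x then f v * g w else 0)"
proof -
 have "(f \<otimes>\<^bsub>Fr\<^esub> g) x = (\<Sum>(v, w)\<in>{(v, w). v @ w = x}. f v * g w)"
  unfolding Fr_simps
  by (rule sum.reindex_bij_witness[of _ "%(v, w). length v" "%k. (take k x, drop k x)"]) auto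
 also have "\<dots> = (\<Sum>(v, w)\<in>{(v, w) \<in> A \<times> B. v @ w = x}. f v * g w)"
 proof (rule sum.mono_neutral_right)
  have "{(v, w). v @ w = x} \<subseteq> (%k. (take k x, drop k x)) ` {..length x}"
  proof
   fix z assume "z \<in> {(v, w). v @ w = x}"
   then show "z \<in> (%k. (take k x, drop k x)) ` {..length x}"
    by (intro image_eqI[of _ _ "length (fst z)"]) auto
  qed
  then show "finite {(v, w). v @ w = x}" by (rule finite_subset) simp
  show "\<forall>z\<in>{(v, w). v @ w = x} - {(v, w) \<in> A \<times> B. v @ w = x}. (case z of (v, w) => f v * g w) = 0"
   using assms(3,4) by fastforce
 qed auto
 also have "\<dots> = (\<Sum>(v, w)\<in>A \<times> B. if v @ w = x then f v * g w else 0)"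
  using assms(1,2) by (intro sum.mono_neutral_cong_left) (auto split: if_splits)
 finally show ?thesis .
qed

lemma Fr_closed: assumes f: "f \<in> carrier Fr" and g: "g \<in> carrier Fr"
 shows "f \<otimes>\<^bsub>Fr\<^esub> g \<in> carrier Fr" "f \<oplus>\<^bsub>Fr\<^esub> g \<in> carrier Fr" "(%w. - f w) \<in> carrier Fr" "s \<in> S ==> s \<odot>\<^bsub>Fr\<^esub> f \<in> carrier Fr"
proof -
 have fS: "f w \<in> S" and gS: "g w \<in> S" for w using f g by auto
 have fin: "finite ({w. f w ~= 0} \<union> {w. g w ~= 0})" "finite ((%(v, w). v @ w) ` ({w. f w ~= 0} \<times> {w. g w ~= 0}))"
  using f g by auto
 have nz: "\<exists>k\<le>length w. f (take k w) ~= 0 & g (drop k w) ~= 0" if "(f \<otimes>\<^bsub>Fr\<^esub> g) w ~= 0" for w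
  using that by (auto elim!: sum.not_neutral_contains_not_neutral)
 have "{w. (f \<otimes>\<^bsub>Fr\<^esub> g) w ~= 0} \<subseteq> (%(v, w). v @ w) ` ({w. f w ~= 0} \<times> {w. g w ~= 0})"
 proof
  fix w assume "w \<in> {w. (f \<otimes>\<^bsub>Fr\<^esub> g) w ~= 0}"
  then obtain k where "f (take k w) ~= 0" "g (drop k w) ~= 0" using nz by blast
  then show "w \<in> (%(v, w). v @ w) ` ({w. f w ~= 0} \<times> {w. g w ~= 0})"
   by (auto intro!: image_eqI[of _ _ "(take k w, drop k w)"])
 qed
 then have "finite {w. (f \<otimes>\<^bsub>Fr\<^esub> g) w ~= 0}" using fin(2) by (rule finite_subset)
 moreover have "(f \<otimes>\<^bsub>Fr\<^esub> g) w = 0" if "w \<notin> lists U" for w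
 proof (rule ccontr)
  assume "(f \<otimes>\<^bsub>Fr\<^esub> g) w ~= 0"
  then obtain k where "f (take k w) ~= 0" "g (drop k w) ~= 0" using nz by blast
  then have "take k w \<in> lists U" "drop k w \<in> lists U" using f g by auto
  then have "take k w @ drop k w \<in> lists U" by (simp only: append_in_lists_conv)
  then show False using that by simp
 qed
 moreover have "(f \<otimes>\<^bsub>Fr\<^esub> g) w \<in> S" for w using fS gS by (auto intro!: S_sum S_mult)
 ultimately show "f \<otimes>\<^bsub>Fr\<^esub> g \<in> carrier Fr" unfolding Fr_simps(1) by blast
 have "finite {w. f w + g w ~= 0}" by (rule finite_subset[OF _ fin(1)]) auto
 then show "f \<oplus>\<^bsub>Fr\<^esub> g \<in> carrier Fr" using f g fS gS by (auto intro: S_add)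
 show "(%w. - f w) \<in> carrier Fr" using f fS by (auto intro: S_uminus)
 have "finite {w. s * f w ~= 0}" using f by (auto elim!: finite_subset[rotated])
 then show "s \<odot>\<^bsub>Fr\<^esub> f \<in> carrier Fr" if "s \<in> S" using f fS that by (auto intro: S_mult)
qed

lemma be_Fr: "w \<in> lists U ==> basis_elem w \<in> carrier Fr"
 using S0 S1 by (auto simp: basis_elem_def)

lemma be_mult: "basis_elem v \<otimes>\<^bsub>Fr\<^esub> basis_elem w = (basis_elem (v @ w) :: 'x list => 'l)"
proof
 fix x
 have "(basis_elem v \<otimes>\<^bsub>Fr\<^esub> basis_elem w) x = (\<Sum>(v', w')\<in>{v} \<times> {w}. if v' @ w' = x then basis_elem v v' * basis_elem w w' else 0)"
  by (rule Fr_mult_sum) (auto simp: basis_elem_def)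
 then show "(basis_elem v \<otimes>\<^bsub>Fr\<^esub> basis_elem w) x = (basis_elem (v @ w) :: 'x list => 'l) x"
  by (auto simp: basis_elem_def)
qed

lemma Fr_assoc: "(f \<otimes>\<^bsub>Fr\<^esub> g) \<otimes>\<^bsub>Fr\<^esub> h = f \<otimes>\<^bsub>Fr\<^esub> (g \<otimes>\<^bsub>Fr\<^esub> h)"
proof
 fix w :: "'x list"
 \<comment> \<open>Two orders of summation over the ways to cut a word into three parts.\<close>
 have nested: "(\<Sum>j\<le>k. \<Sum>i\<le>j. c i (j - i) (n - j)) = (\<Sum>j\<le>k. \<Sum>i\<le>k - j. c j i (n - j - i))"
  for c :: "nat => nat => nat => 'l" and n k
  by (induct k) (simp_all add: Suc_diff_le sum.distrib add.assoc)
 let ?c = "%i j l. f (take i w) * g (take j (drop i w)) * h (drop (length w - l) w)"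
 have "((f \<otimes>\<^bsub>Fr\<^esub> g) \<otimes>\<^bsub>Fr\<^esub> h) w = (\<Sum>j\<le>length w. \<Sum>i\<le>j. ?c i (j - i) (length w - j))"
  by (auto simp: sum_distrib_right min_def drop_take intro!: sum.cong)
 also have "\<dots> = (\<Sum>j\<le>length w. \<Sum>i\<le>length w - j. ?c j i (length w - j - i))" by (rule nested)
 also have "\<dots> = (f \<otimes>\<^bsub>Fr\<^esub> (g \<otimes>\<^bsub>Fr\<^esub> h)) w"
  by (auto simp: sum_distrib_left mult.assoc add.commute intro!: sum.cong)
 finally show "((f \<otimes>\<^bsub>Fr\<^esub> g) \<otimes>\<^bsub>Fr\<^esub> h) w = (f \<otimes>\<^bsub>Fr\<^esub> (g \<otimes>\<^bsub>Fr\<^esub> h)) w" .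
qed

lemma Fr_one_mult: "basis_elem [] \<otimes>\<^bsub>Fr\<^esub> f = f" "f \<otimes>\<^bsub>Fr\<^esub> basis_elem [] = (f :: 'x list => 'l)"
proof -
 have "(\<Sum>k\<le>length w. basis_elem [] (take k w) * f (drop k w)) = (\<Sum>k\<le>length w. if k = 0 then f w else 0)" for w :: "'x list"
  by (rule sum.cong) (auto simp: basis_elem_def)
 then show "basis_elem [] \<otimes>\<^bsub>Fr\<^esub> f = f" by auto
 have "(\<Sum>k\<le>length w. f (take k w) * basis_elem [] (drop k w)) = (\<Sum>k\<le>length w. if k = length w then f w else 0)" for w :: "'x list"
  by (rule sum.cong) (auto simp: basis_elem_def)
 then show "f \<otimes>\<^bsub>Fr\<^esub> basis_elem [] = f" by auto
qed

sublocale Fr: ring Fr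
proof (rule ringI)
 show "abelian_group Fr"
 proof (rule abelian_groupI)
  fix f assume f: "f \<in> carrier Fr"
  show "\<exists>g\<in>carrier Fr. g \<oplus>\<^bsub>Fr\<^esub> f = \<zero>\<^bsub>Fr\<^esub>" by (rule bexI[OF _ Fr_closed(3)[OF f f]]) simp
 qed (use Fr_closed(2) S0 in \<open>auto simp: add_ac\<close>)
 show "Group.monoid Fr"
  by (rule Group.monoidI) (simp_all add: Fr_closed(1) Fr_assoc Fr_one_mult be_Fr del: Fr_simps(1,2))
qed (simp_all add: distrib_left distrib_right sum.distrib)

lemma Fr_uminus: assumes "f \<in> carrier Fr" shows "\<ominus>\<^bsub>Fr\<^esub> f = (%w. - f w)"
 using Fr_closed(3)[OF assms assms] assms by (intro Fr.minus_equality) (auto simp del: Fr_simps(1))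

lemma graded_alg_Fr: "graded_alg S Fr"
 unfolding graded_alg_def
proof (intro conjI ballI)
 show "ring Fr" by (rule Fr.ring_axioms)
 fix s assume s: "s \<in> S"
 show "s \<odot>\<^bsub>Fr\<^esub> \<one>\<^bsub>Fr\<^esub> \<in> carrier Fr" using Fr_closed(4)[OF Fr.one_closed Fr.one_closed s] .
 fix f
 have "(s \<odot>\<^bsub>Fr\<^esub> \<one>\<^bsub>Fr\<^esub>) \<otimes>\<^bsub>Fr\<^esub> f = s \<odot>\<^bsub>Fr\<^esub> (\<one>\<^bsub>Fr\<^esub> \<otimes>\<^bsub>Fr\<^esub> f)"
  by (simp add: sum_distrib_left mult.assoc)
 then show "s \<odot>\<^bsub>Fr\<^esub> f = (s \<odot>\<^bsub>Fr\<^esub> \<one>\<^bsub>Fr\<^esub>) \<otimes>\<^bsub>Fr\<^esub> f" unfolding Fr_simps(3) Fr_one_mult ..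
qed

lemma Fr_mult_smult: "f \<otimes>\<^bsub>Fr\<^esub> (s \<odot>\<^bsub>Fr\<^esub> g) = s \<odot>\<^bsub>Fr\<^esub> (f \<otimes>\<^bsub>Fr\<^esub> g)" "(s \<odot>\<^bsub>Fr\<^esub> f) \<otimes>\<^bsub>Fr\<^esub> g = s \<odot>\<^bsub>Fr\<^esub> (f \<otimes>\<^bsub>Fr\<^esub> g)"
 by (simp_all add: sum_distrib_left mult_ac)

lemma Fr_induct [consumes 1, case_names zero add]:
 assumes f: "f \<in> carrier Fr" and zero: "P (%_. 0)"
  and add: "!!w g. w \<in> lists U ==> f w ~= 0 ==> g \<in> carrier Fr ==> P g ==> P ((f w \<odot>\<^bsub>Fr\<^esub> basis_elem w) \<oplus>\<^bsub>Fr\<^esub> g)"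
 shows "P f"
proof -
 have fin: "finite {w. f w ~= 0}" using f by simp
 have "finite V ==> V \<subseteq> {w. f w ~= 0} ==> (%w. if w \<in> V then f w else 0) \<in> carrier Fr & P (%w. if w \<in> V then f w else 0)" for V
 proof (induction V rule: finite_induct)
  case (insert v V)
  have v: "v \<in> lists U" "f v ~= 0" "f v \<in> S" using insert.prems f by auto
  have "(%w. if w \<in> insert v V then f w else 0) = (f v \<odot>\<^bsub>Fr\<^esub> basis_elem v) \<oplus>\<^bsub>Fr\<^esub> (%w. if w \<in> V then f w else 0)"
   using insert.hyps by (auto simp: basis_elem_def)
  then show ?case using add[OF v(1,2)] insert Fr_closed(2)[OF Fr_closed(4)[OF be_Fr[OF v(1)] be_Fr[OF v(1)] v(3)]]
   by (simp del: Fr_simps)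
 qed (use zero S0 in auto)
 from this[OF fin order_refl] have "P (%w. if w \<in> {w. f w ~= 0} then f w else 0)" ..
 moreover have "(%w. if w \<in> {w. f w ~= 0} then f w else 0) = f" by auto
 ultimately show ?thesis by simp
qed

lemma commutators_closed: "graded_commutators Fr \<subseteq> carrier Fr"
 unfolding graded_commutators_def homog_Fr
 by (auto simp del: Fr_simps intro!: Fr.minus_closed Fr.m_closed)

end

section \<open>The presentation of the cohomology algebra\<close>

context wild_extension
begin

sublocale cyclic_action_h90 T S \<sigma> p G
 by unfold_locales (rule hilbert90)

sublocale FA: free_alg S "hgens p b" hdeg
 by unfold_locales auto

end

section \<open>Evaluation of words in an arbitrary cohomology model\<close>

locale cohomology_presentation = wild_extension T S t \<sigma> p G b s
 for T S :: "'l::field set" and t \<sigma> p G b s +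
 fixes E :: "nat => ('l, 'c) module" and pr :: "nat => nat => 'c => 'c => 'c" and e :: 'c
  and cl :: "nat => 'l => 'c" and \<chi> :: 'l
 assumes model: "cohomology_model E pr e cl \<chi>"
begin

lemmas model_facts = cohomology_modelD[OF model]

abbreviation Uw :: "hgen list set" where "Uw \<equiv> lists (hgens p b)"

abbreviation dg :: "hgen list => nat" where "dg \<equiv> FA.dg"

abbreviation be :: "hgen list => hgen list => 'l" where "be \<equiv> basis_elem"

abbreviation Fr :: "('l, hgen list => 'l) graded_algebra" where "Fr \<equiv> FA.Fr"

lemma hgens_iff [simp]: "H1 j \<in> hgens p b \<longleftrightarrow> j \<in> J" "H2 \<in> hgens p b"
 by (auto simp: hgens_def J_def)

lemma chi: "\<chi> \<in> S" "\<chi> * \<chi> = 1" "\<sigma> \<chi> = \<chi>"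
proof -
 show "\<chi> \<in> S" "\<chi> * \<chi> = 1" using model_facts(1) by auto
 then show "\<sigma> \<chi> = \<chi>" by (simp add: S_sigma)
qed

text \<open>Left multiplication by a generator on a representative y of degree n. \<open>H2\<close>
  acts as \<chi>, so that the factor \<chi> in the product of two odd generators occurs on both
  sides of the corresponding relation.\<close>

definition st :: "hgen => nat => 'l => 'l" where
 "st x n y = (case x of H2 => \<chi> * y | H1 j => if even n then gx j * y else \<chi> * Tr (y * \<sigma> (gu j)))"

primrec val :: "hgen list => 'l" where
 "val [] = 1" | "val (x # w) = st x (dg w) (val w)"

lemma Bc_pos: "odd n ==> Bc n = \<delta> ` T" "odd n ==> Bc (Suc n) = Tr ` T"
 by (auto simp: Bc_def)

lemma zero_delta [simp]: "0 \<in> \<delta> ` T"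
 using Bc_zero[of 1] by (simp add: Bc_pos)

text \<open>Coboundaries have period two except in degree 0, where only zero is one.\<close>

lemma Bc_add2: "x \<in> Bc n ==> x \<in> Bc (2 + n)"
 using Bc_zero[of 2] by (auto simp: Bc_def split: if_splits)

lemma Zc_odd: "odd n ==> y \<in> Zc n \<longleftrightarrow> y \<in> T & Tr y = 0" and Zc_even: "even n ==> y \<in> Zc n \<longleftrightarrow> y \<in> S"
 by (simp_all add: Zc_def)

lemma Bc_sum: "(!!i. i \<in> I ==> f i \<in> Bc n) ==> sum f I \<in> Bc n"
 by (induction I rule: infinite_finite_induct) (auto intro: Bc_add)

lemma Zc_sum: "(!!i. i \<in> I ==> f i \<in> Zc n) ==> sum f I \<in> Zc n"
 by (induction I rule: infinite_finite_induct) (auto intro: Zc_add)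

lemma st_Zc: assumes "x \<in> hgens p b" "y \<in> Zc n" shows "st x n y \<in> Zc (hdeg x + n)"
proof (cases x)
 case H2
 have "\<chi> * y \<in> Zc n" using Zc_smult[OF chi(1) assms(2)] .
 then show ?thesis using H2 by (simp add: st_def Zc_def)
next
 case (H1 j)
 then have j: "gx j \<in> T" "Tr (gx j) = 0" "\<delta> (gu j) = gx j" using assms(1) gx[of j] by (simp_all add: gx_def)
 show ?thesis
 proof (cases "even n")
  case True
  then have "y * gx j \<in> Zc 1" using assms(2) j by (intro Zc_smult) (simp_all add: Zc_odd Zc_even)
  then show ?thesis using H1 True by (simp add: st_def Zc_def mult.commute)
 next
  case False
  then have "Tr (y * \<sigma> (gu j)) \<in> S" using Tr_mult_sigma_T[OF _ assms(2)] j by simp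
  then show ?thesis using H1 False chi(1) by (auto simp: st_def Zc_def)
 qed
qed

lemma val_Zc: "w \<in> Uw ==> val w \<in> Zc (dg w)"
 by (induction w) (simp_all add: st_Zc, simp add: Zc_def)

lemma st_cong: assumes "x \<in> hgens p b" "y \<in> Zc n" "y' \<in> Zc n" "y - y' \<in> Bc n"
 shows "st x n y - st x n y' \<in> Bc (hdeg x + n)"
proof (cases x)
 case H2
 have "\<chi> * (y - y') \<in> Bc n" by (rule Bc_smult[OF chi(1) assms(4)])
 from Bc_add2[OF this] show ?thesis using H2 by (simp add: st_def right_diff_distrib)
next
 case (H1 j)
 then have j: "gx j \<in> T" "Tr (gx j) = 0" "\<delta> (gu j) = gx j" using assms(1) gx[of j] by (simp_all add: gx_def)
 show ?thesis
 proof (cases "even n")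
  case True
  have "gx j * y - gx j * y' \<in> Bc (1 + n)"
   by (rule even_product_cong) (use True j assms in \<open>simp_all add: Zc_odd\<close>)
  then show ?thesis using H1 True by (simp add: st_def)
 next
  case False
  have "Tr (y * \<sigma> (gu j)) - Tr (y' * \<sigma> (gu j)) \<in> Tr ` T"
   by (rule odd_product_cong) (use False j assms in simp_all)
  then have "\<chi> * (Tr (y * \<sigma> (gu j)) - Tr (y' * \<sigma> (gu j))) \<in> Bc (Suc n)"
   using False by (intro Bc_smult[OF chi(1)]) (simp add: Bc_pos)
  then show ?thesis using H1 False by (simp add: st_def right_diff_distrib)
 qed
qed

definition pm :: "nat => nat => 'l => 'l => 'l => bool" where
 "pm i j y v z \<longleftrightarrow> (if even i \<or> even j then y * v - z \<in> Bc (i + j)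
   else \<forall>u. \<delta> u = y --> \<chi> * Tr (v * \<sigma> u) - z \<in> Bc (i + j))"

lemma chi_Tr_cong: assumes "v \<in> T" "Tr v = 0" "\<delta> u \<in> T" "\<delta> u' = \<delta> u"
 shows "\<chi> * Tr (v * \<sigma> u') - \<chi> * Tr (v * \<sigma> u) \<in> Tr ` T"
proof -
 have "Tr (v * \<sigma> u') - Tr (v * \<sigma> u) \<in> Tr ` T"
  by (rule odd_product_cong[of _ _ _ 1]) (use assms in \<open>simp_all add: Zc_odd image_iff bexI[of _ 0]\<close>)
 from TrT_smult[OF chi(1) this] show ?thesis by (simp only: right_diff_distrib)
qed

text \<open>Associativity for a generator x and two factors y, v. Unless x, y and v are all odd,
  fixed elements can be pulled out of traces and the congruence for z is carried along. If all three
  are odd, both bracketings are coboundaries by \<open>triple_product\<close>.\<close>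

lemma pm_step:
 assumes pm: "pm d n y v z" and y: "y \<in> Zc d" and v: "v \<in> Zc n" and z: "z \<in> Zc (d + n)" and x: "x \<in> hgens p b"
 shows "pm (hdeg x + d) n (st x d y) v (st x (d + n) z)"
proof (cases x)
 case H2
 show ?thesis
 proof (cases "even d \<or> even n")
  case True
  then have "y * v - z \<in> Bc (d + n)" using pm by (simp add: pm_def)
  from Bc_add2[OF Bc_smult[OF chi(1) this]] have "\<chi> * y * v - \<chi> * z \<in> Bc (2 + d + n)"
   by (simp add: right_diff_distrib mult.assoc)
  then show ?thesis using True H2 by (simp add: pm_def st_def)
 next
  case False
  have "\<chi> * Tr (v * \<sigma> u) - \<chi> * z \<in> Bc (2 + d + n)" if u: "\<delta> u = \<chi> * y" for u
  proof -
   have "\<delta> (\<chi> * u) = (\<chi> * \<chi>) * y" using u by (simp add: delta_fixed_mult chi mult.assoc)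
   then have "\<chi> * Tr (v * \<sigma> (\<chi> * u)) - z \<in> Bc (d + n)" using pm False by (simp add: pm_def chi)
   moreover have "Tr (v * \<sigma> (\<chi> * u)) = \<chi> * Tr (v * \<sigma> u)"
    using Tr_fixed_mult[OF chi(3), of "v * \<sigma> u"] by (simp add: sigma_mult chi mult.left_commute)
   ultimately have "(\<chi> * \<chi>) * Tr (v * \<sigma> u) - z \<in> Bc (d + n)" by (simp add: mult.assoc)
   then have "Tr (v * \<sigma> u) - z \<in> Bc (d + n)" by (simp add: chi)
   from Bc_add2[OF Bc_smult[OF chi(1) this]] show ?thesis by (simp add: right_diff_distrib)
  qed
  then show ?thesis using False H2 by (simp add: pm_def st_def)
 qed
next
 case (H1 j)
 then have j: "gx j \<in> T" "Tr (gx j) = 0" "\<delta> (gu j) = gx j" using x gx[of j] by (simp_all add: gx_def)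
 have yT: "y \<in> T" and vT: "v \<in> T" using y v Zc_T by blast+
 show ?thesis
 proof (cases "even d \<or> even n")
  case ev: True
  then have c: "y * v - z \<in> Bc (d + n)" using pm by (simp add: pm_def)
  have "y * v \<in> Zc (d + n)" using Zc_add[OF Bc_Zc[OF c] z] by simp
  from st_cong[OF x this z c] have c': "st x (d + n) (y * v) - st x (d + n) z \<in> Bc (Suc (d + n))" using H1 by simp
  show ?thesis
  proof (cases "even d")
   case True
   then have yS: "y \<in> S" using y by (simp add: Zc_even)
   show ?thesis
   proof (cases "even n")
    case True
    then show ?thesis using \<open>even d\<close> c' H1 by (simp add: pm_def st_def mult.assoc)
   next
    case False
    have v0: "Tr v = 0" using v False by (simp add: Zc_odd)
    have "\<chi> * Tr (v * \<sigma> u) - st x (d + n) z \<in> Bc (Suc (d + n))" if u: "\<delta> u = gx j * y" for u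
    proof -
     have "\<delta> u = \<delta> (y * gu j)" using u yS j by (simp add: delta_fixed_mult S_sigma mult.commute)
     then have "\<chi> * Tr (v * \<sigma> u) - \<chi> * Tr (v * \<sigma> (y * gu j)) \<in> Tr ` T"
      using vT v0 j yT yS by (intro chi_Tr_cong) (auto simp: delta_fixed_mult S_sigma)
     moreover have "\<chi> * Tr (v * \<sigma> (y * gu j)) = st x (d + n) (y * v)"
      using H1 False \<open>even d\<close> yS by (simp add: st_def sigma_mult S_sigma mult_ac)
     ultimately show ?thesis using c' Bc_cong_trans[of _ "st x (d + n) (y * v)" "Suc (d + n)"] False \<open>even d\<close>
      by (simp add: Bc_pos)
    qed
    then show ?thesis using False \<open>even d\<close> H1 by (simp add: pm_def st_def)
   qed
  next
   case False
   then have n: "even n" and vS: "v \<in> S" using ev v by (auto simp: Zc_even)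
   have "st x (d + n) (y * v) = \<chi> * Tr (y * \<sigma> (gu j)) * v"
    using Tr_fixed_mult[OF S_sigma[OF vS], of "y * \<sigma> (gu j)"] H1 False n by (simp add: st_def mult_ac)
   with c' have "\<chi> * Tr (y * \<sigma> (gu j)) * v - st x (d + n) z \<in> Bc (Suc (d + n))" by (simp only:)
   then show ?thesis using H1 False n by (simp add: pm_def st_def)
  qed
 next
  case False
  then have yv: "Tr y = 0" "Tr v = 0" "odd d" "odd n" using y v by (auto simp: Zc_odd)
  obtain u where u: "\<delta> u = y" using h90[OF yT yv(1)] by blast
  have B: "Bc (Suc (d + n)) = \<delta> ` T" using yv by (simp add: Bc_pos)
  have c: "\<chi> * Tr (v * \<sigma> u) - z \<in> Bc (d + n)" using pm u False by (simp add: pm_def)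
  have m: "\<chi> * Tr (v * \<sigma> u) \<in> Zc (d + n)" using Zc_add[OF Bc_Zc[OF c] z] by simp
  have eq: "st x (d + n) (\<chi> * Tr (v * \<sigma> u)) = \<chi> * (Tr (v * \<sigma> u) * gx j)" using H1 yv by (simp add: st_def mult_ac)
  have 1: "\<chi> * (Tr (v * \<sigma> u) * gx j) - st x (d + n) z \<in> Bc (Suc (d + n))"
   using st_cong[OF x m z c] H1 unfolding eq by simp
  have 2: "\<chi> * (Tr (y * \<sigma> (gu j)) * v) \<in> Bc (Suc (d + n))"
   using triple_product[OF vT yv(2) j(1,2,3) yT yv(1)] unfolding B[symmetric] by (rule Bc_smult[OF chi(1)])
  have 3: "\<chi> * (Tr (v * \<sigma> u) * gx j) \<in> Bc (Suc (d + n))"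
   using triple_product[OF j(1,2) yT yv(1) u vT yv(2)] unfolding B[symmetric] by (rule Bc_smult[OF chi(1)])
  have "\<chi> * (Tr (y * \<sigma> (gu j)) * v) - st x (d + n) z \<in> Bc (Suc (d + n))"
   using Bc_add[OF Bc_diff[OF 2 3] 1] by simp
  then show ?thesis using H1 yv by (simp add: pm_def st_def mult_ac)
 qed
qed

lemma pm_val: "w \<in> Uw ==> w' \<in> Uw ==> pm (dg w) (dg w') (val w) (val w') (val (w @ w'))"
proof (induction w)
 case (Cons x w)
 then have "w \<in> Uw" "x \<in> hgens p b" by auto
 then show ?case using Cons pm_step[of "dg w" "dg w'" "val w" "val w'" "val (w @ w')" x] val_Zc[of w] val_Zc[of w'] val_Zc[of "w @ w'"]
  by simp
qed (simp add: pm_def)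

definition uval :: "hgen list => 'l" where "uval w = (SOME u. \<delta> u = val w)"

lemma uval: "w \<in> Uw ==> odd (dg w) ==> \<delta> (uval w) = val w"
 unfolding uval_def using h90[of "val w"] val_Zc[of w] by (auto intro: someI_ex simp: Zc_odd)

definition \<phi> :: "nat => (hgen list => 'l) => 'l" where
 "\<phi> n f = (\<Sum>w | f w ~= 0. if dg w = n then f w * val w else 0)"

text \<open>For odd n a preimage of \<open>\<phi> n f\<close> under \<delta>, assembled word by
  word; in this form odd products expand over pairs of words.\<close>

definition \<upsilon> :: "nat => (hgen list => 'l) => 'l" where
 "\<upsilon> n f = (\<Sum>w | f w ~= 0. if dg w = n then f w * uval w else 0)"

lemma phi_sup: assumes "finite Va" "!!w. f w ~= 0 ==> w \<in> Va"
 shows "\<phi> n f = (\<Sum>w\<in>Va. if dg w = n then f w * val w else 0)"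
 unfolding \<phi>_def by (rule sum.mono_neutral_left) (use assms in auto)

lemma Fr_D: assumes "f \<in> carrier Fr" shows "f w \<in> S" "f w ~= 0 ==> w \<in> Uw" "finite {w. f w ~= 0}"
 using assms unfolding FA.Fr_simps(1) by blast+

lemma phi_add: assumes "f \<in> carrier Fr" "g \<in> carrier Fr" shows "\<phi> n (f \<oplus>\<^bsub>Fr\<^esub> g) = \<phi> n f + \<phi> n g"
proof -
 let ?Va = "{w. f w ~= 0} \<union> {w. g w ~= 0}"
 have fin: "finite ?Va" using Fr_D(3)[OF assms(1)] Fr_D(3)[OF assms(2)] by (rule finite_UnI)
 have *: "\<phi> n f = (\<Sum>w\<in>?Va. if dg w = n then f w * val w else 0)" "\<phi> n g = (\<Sum>w\<in>?Va. if dg w = n then g w * val w else 0)"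
  "\<phi> n (f \<oplus>\<^bsub>Fr\<^esub> g) = (\<Sum>w\<in>?Va. if dg w = n then (f \<oplus>\<^bsub>Fr\<^esub> g) w * val w else 0)"
  by (rule phi_sup[OF fin], fastforce)+
 show ?thesis unfolding * sum.distrib[symmetric] by (rule sum.cong) (auto simp: distrib_right)
qed

lemma phi_smult: "\<phi> n (a \<odot>\<^bsub>Fr\<^esub> f) = a * \<phi> n f"
 by (cases "a = 0") (auto simp: \<phi>_def sum_distrib_left intro!: sum.cong)

lemma phi_Zc: "f \<in> carrier Fr ==> \<phi> n f \<in> Zc n"
 unfolding \<phi>_def using val_Zc Fr_D by (intro Zc_sum) (auto intro!: Zc_smult simp del: FA.Fr_simps)

lemma phi_zero [simp]: "\<phi> n (%_. 0) = 0"
 by (simp add: \<phi>_def)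

lemma phi_be: "\<phi> n (be w) = (if dg w = n then val w else 0)"
 by (subst phi_sup[of "{w}"]) (auto simp: basis_elem_def split: if_splits)

lemma delta_upsilon: assumes "f \<in> carrier Fr" "odd n" shows "\<delta> (\<upsilon> n f) = \<phi> n f"
 unfolding \<upsilon>_def \<phi>_def delta_sum
proof (rule sum.cong[OF refl])
 fix w assume "w \<in> {w. f w ~= 0}"
 then have "w \<in> Uw" "f w \<in> S" using Fr_D[OF assms(1)] by auto
 then show "\<delta> (if dg w = n then f w * uval w else 0) = (if dg w = n then f w * val w else 0)"
  using assms(2) by (auto simp: delta_fixed_mult S_sigma uval)
qed

text \<open>The representative that the model assigns to the product of the components of f and g in
  degrees i and j.\<close>

definition PV :: "nat => nat => (hgen list => 'l) => (hgen list => 'l) => 'l" where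
 "PV i j f g = (if even i \<or> even j then \<phi> i f * \<phi> j g else \<chi> * Tr (\<phi> j g * \<sigma> (\<upsilon> i f)))"

definition mval :: "hgen list => hgen list => 'l" where
 "mval w w' = (if even (dg w) \<or> even (dg w') then val w * val w' else \<chi> * Tr (val w' * \<sigma> (uval w)))"

lemma mval_cong: "w \<in> Uw ==> w' \<in> Uw ==> mval w w' - val (w @ w') \<in> Bc (dg w + dg w')"
 using pm_val[of w w'] uval[of w] by (auto simp: pm_def mval_def)

lemma pr_cl: assumes "f \<in> carrier Fr" "g \<in> carrier Fr"
 shows "pr i j (cl i (\<phi> i f)) (cl j (\<phi> j g)) = cl (i + j) (PV i j f g)" "PV i j f g \<in> Zc (i + j)"
proof -
 note Z = phi_Zc[OF assms(1), of i] phi_Zc[OF assms(2), of j]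
 show "pr i j (cl i (\<phi> i f)) (cl j (\<phi> j g)) = cl (i + j) (PV i j f g)"
  using model_facts(8)[OF Z] model_facts(9)[OF Z(2), of i "\<upsilon> i f"] delta_upsilon[OF assms(1), of i] Zc_T[OF Z(1)]
  by (auto simp: PV_def)
 show "PV i j f g \<in> Zc (i + j)"
 proof (cases "even i \<or> even j")
  case True
  then show ?thesis using Z Zc_smult[of "\<phi> i f" "\<phi> j g" j] Zc_smult[of "\<phi> j g" "\<phi> i f" i]
   by (auto simp: PV_def Zc_def mult.commute)
 next
  case False
  then have "Tr (\<phi> j g * \<sigma> (\<upsilon> i f)) \<in> S"
   using Tr_mult_sigma_T[of "\<upsilon> i f" "\<phi> j g" j] Z(2) delta_upsilon[OF assms(1), of i] Zc_T[OF Z(1)] by simp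
  then show ?thesis using False chi by (auto simp: PV_def Zc_def)
 qed
qed

lemma PV_expand: assumes f: "f \<in> carrier Fr" and g: "g \<in> carrier Fr"
 shows "PV i j f g = (\<Sum>(w, w')\<in>{w. f w ~= 0} \<times> {w. g w ~= 0}. if dg w = i & dg w' = j then f w * g w' * mval w w' else 0)"
proof (cases "even i \<or> even j")
 case True
 then show ?thesis
  by (auto simp: PV_def \<phi>_def sum_product sum.cartesian_product mval_def intro!: sum.cong)
next
 case False
 have sg: "\<sigma> (\<upsilon> i f) = (\<Sum>w | f w ~= 0. if dg w = i then f w * \<sigma> (uval w) else 0)"
  unfolding \<upsilon>_def G_sum[OF sigma_G]
  by (rule sum.cong) (use Fr_D(1)[OF f] in \<open>auto simp: sigma_mult S_sigma\<close>)
 have "\<chi> * Tr (\<phi> j g * \<sigma> (\<upsilon> i f)) = (\<Sum>(w', w)\<in>{w. g w ~= 0} \<times> {w. f w ~= 0}.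
   \<chi> * Tr ((if dg w' = j then g w' * val w' else 0) * (if dg w = i then f w * \<sigma> (uval w) else 0)))"
  unfolding sg \<phi>_def sum_product unfolding sum.cartesian_product Tr_sum unfolding sum_distrib_left
  by (rule sum.cong) (auto split: if_splits)
 also have "\<dots> = (\<Sum>(w, w')\<in>{w. f w ~= 0} \<times> {w. g w ~= 0}.
   \<chi> * Tr ((if dg w' = j then g w' * val w' else 0) * (if dg w = i then f w * \<sigma> (uval w) else 0)))"
  by (rule sum.reindex_bij_witness[of _ prod.swap prod.swap]) auto
 also have "\<dots> = (\<Sum>(w, w')\<in>{w. f w ~= 0} \<times> {w. g w ~= 0}. if dg w = i & dg w' = j then f w * g w' * mval w w' else 0)"
 proof (rule sum.cong[OF refl], clarify)
  fix w w'
  have "Tr ((g w' * val w') * (f w * \<sigma> (uval w))) = f w * (g w' * Tr (val w' * \<sigma> (uval w)))"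
   using Tr_fixed_mult[OF S_sigma[OF Fr_D(1)[OF f]], of w "g w' * (val w' * \<sigma> (uval w))"]
    Tr_fixed_mult[OF S_sigma[OF Fr_D(1)[OF g]], of w' "val w' * \<sigma> (uval w)"] by (simp add: mult_ac)
  then show "\<chi> * Tr ((if dg w' = j then g w' * val w' else 0) * (if dg w = i then f w * \<sigma> (uval w) else 0))
   = (if dg w = i & dg w' = j then f w * g w' * mval w w' else 0)"
   using False by (auto simp: mval_def)
 qed
 finally show ?thesis using False by (simp add: PV_def)
qed

text \<open>Both sides expand over pairs of words with the same coefficients; the congruence
  \<open>mval_cong\<close> compares them pair by pair.\<close>

lemma mult_phi: assumes f: "f \<in> carrier Fr" and g: "g \<in> carrier Fr"
 shows "(\<Sum>i\<le>n. PV i (n - i) f g) - \<phi> n (f \<otimes>\<^bsub>Fr\<^esub> g) \<in> Bc n"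
proof -
 define Va Vb where "Va = {w. f w ~= 0}" and "Vb = {w. g w ~= 0}"
 have fin: "finite Va" "finite Vb" using Fr_D(3)[OF f] Fr_D(3)[OF g] by (simp_all only: Va_def Vb_def)
 define C where "C = (%(w, w'). w @ w') ` (Va \<times> Vb)"
 have fC: "finite C" unfolding C_def using fin by auto
 have m: "(f \<otimes>\<^bsub>Fr\<^esub> g) x = (\<Sum>(w, w')\<in>Va \<times> Vb. if w @ w' = x then f w * g w' else 0)" for x
  by (rule FA.Fr_mult_sum[OF fin]) (simp_all add: Va_def Vb_def)
 have C: "x \<in> C" if "(f \<otimes>\<^bsub>Fr\<^esub> g) x ~= 0" for x
 proof -
  obtain z where "z \<in> Va \<times> Vb" "(case z of (w, w') => if w @ w' = x then f w * g w' else 0) ~= 0"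
   using \<open>(f \<otimes>\<^bsub>Fr\<^esub> g) x ~= 0\<close> unfolding m by (rule sum.not_neutral_contains_not_neutral)
  then show ?thesis unfolding C_def by (intro image_eqI[of _ _ z]) (auto split: if_splits)
 qed
 have "\<phi> n (f \<otimes>\<^bsub>Fr\<^esub> g) = (\<Sum>x\<in>C. if dg x = n then (f \<otimes>\<^bsub>Fr\<^esub> g) x * val x else 0)"
  by (rule phi_sup[OF fC C])
 also have "\<dots> = (\<Sum>x\<in>C. \<Sum>(w, w')\<in>Va \<times> Vb. if w @ w' = x then (if dg (w @ w') = n then f w * g w' * val (w @ w') else 0) else 0)"
 proof (rule sum.cong[OF refl])
  fix x
  show "(if dg x = n then (f \<otimes>\<^bsub>Fr\<^esub> g) x * val x else 0)
   = (\<Sum>(w, w')\<in>Va \<times> Vb. if w @ w' = x then (if dg (w @ w') = n then f w * g w' * val (w @ w') else 0) else 0)"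
  proof (cases "dg x = n")
   case True
   show ?thesis unfolding m sum_distrib_right if_P[OF True]
    by (rule sum.cong) (use True in \<open>auto simp del: FA.dg_simps\<close>)
  next
   case False
   then have "(case z of (w, w') => if w @ w' = x then (if dg (w @ w') = n then f w * g w' * val (w @ w') else 0) else 0) = 0" for z
    by (auto split: prod.splits)
   then show ?thesis unfolding if_not_P[OF False] by simp
  qed
 qed
 also have "\<dots> = (\<Sum>(w, w')\<in>Va \<times> Vb. \<Sum>x\<in>C. if w @ w' = x then (if dg (w @ w') = n then f w * g w' * val (w @ w') else 0) else 0)"
  by (subst sum.swap) (simp add: case_prod_unfold)
 also have "\<dots> = (\<Sum>(w, w')\<in>Va \<times> Vb. if dg (w @ w') = n then f w * g w' * val (w @ w') else 0)"
  using fC by (intro sum.cong) (auto simp: C_def)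
 finally have 1: "\<phi> n (f \<otimes>\<^bsub>Fr\<^esub> g) = (\<Sum>(w, w')\<in>Va \<times> Vb. if dg (w @ w') = n then f w * g w' * val (w @ w') else 0)" .
 have "(\<Sum>i\<le>n. PV i (n - i) f g) = (\<Sum>(w, w')\<in>Va \<times> Vb. \<Sum>i\<le>n. if dg w = i & dg w' = n - i then f w * g w' * mval w w' else 0)"
  unfolding PV_expand[OF f g] Va_def[symmetric] Vb_def[symmetric] by (subst sum.swap) (simp add: case_prod_unfold)
 also have "\<dots> = (\<Sum>(w, w')\<in>Va \<times> Vb. if dg (w @ w') = n then f w * g w' * mval w w' else 0)"
 proof (rule sum.cong[OF refl], clarify)
  fix w w'
  have "(\<Sum>i\<le>n. if dg w = i & dg w' = n - i then f w * g w' * mval w w' else 0)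
   = (\<Sum>i\<le>n. if i = dg w then (if dg (w @ w') = n then f w * g w' * mval w w' else 0) else 0)"
   by (rule sum.cong) auto
  then show "(\<Sum>i\<le>n. if dg w = i & dg w' = n - i then f w * g w' * mval w w' else 0)
   = (if dg (w @ w') = n then f w * g w' * mval w w' else 0)" by auto
 qed
 finally have 2: "(\<Sum>i\<le>n. PV i (n - i) f g) = (\<Sum>(w, w')\<in>Va \<times> Vb. if dg (w @ w') = n then f w * g w' * mval w w' else 0)" .
 have "(\<Sum>i\<le>n. PV i (n - i) f g) - \<phi> n (f \<otimes>\<^bsub>Fr\<^esub> g)
  = (\<Sum>(w, w')\<in>Va \<times> Vb. if dg (w @ w') = n then (f w * g w') * (mval w w' - val (w @ w')) else 0)"
  unfolding 1 2 sum_subtractf[symmetric] by (rule sum.cong) (auto simp: right_diff_distrib)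
 also have "\<dots> \<in> Bc n"
 proof (rule Bc_sum, clarify)
  fix w w' assume "w \<in> Va" "w' \<in> Vb"
  then have "w \<in> Uw" "w' \<in> Uw" "f w * g w' \<in> S" using Fr_D[OF f] Fr_D[OF g] by (auto simp: Va_def Vb_def)
  then show "(if dg (w @ w') = n then f w * g w' * (mval w w' - val (w @ w')) else 0) \<in> Bc n"
   using Bc_smult[OF _ mval_cong[of w w']] by auto
 qed
 finally show ?thesis .
qed

lemma E_closed: "y \<in> Zc n ==> cl n y \<in> carrier (E n)"
 by (simp add: model_facts(3))

lemma cl_eq: "y \<in> Zc n ==> y' \<in> Zc n ==> y - y' \<in> Bc n ==> cl n y = cl n y'"
 by (simp add: model_facts(5))

lemma abelian_E: "abelian_monoid (E n)"
 by (rule abelian_monoidI) (auto simp: model_facts(3,4,6) Zc_add add_ac)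

lemma finsum_cl: "finite I ==> (!!i. i \<in> I ==> y i \<in> Zc n) ==> (\<Oplus>\<^bsub>E n\<^esub>i\<in>I. cl n (y i)) = cl n (\<Sum>i\<in>I. y i)"
proof (induction I rule: finite_induct)
 case empty
 show ?case using abelian_monoid.finsum_empty[OF abelian_E] by (simp add: model_facts(4))
next
 case (insert i I)
 then have "(\<Oplus>\<^bsub>E n\<^esub>i\<in>insert i I. cl n (y i)) = cl n (y i) \<oplus>\<^bsub>E n\<^esub> (\<Oplus>\<^bsub>E n\<^esub>i\<in>I. cl n (y i))"
  by (intro abelian_monoid.finsum_insert[OF abelian_E]) (auto intro: E_closed)
 then show ?case using insert by (simp add: model_facts(6) Zc_sum)
qed

abbreviation Tot where "Tot \<equiv> total_algebra E pr e"

definition \<Phi> :: "(hgen list => 'l) => nat => 'c" where "\<Phi> f = (%n. cl n (\<phi> n f))"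

lemma Phi_eq_zero: assumes "f \<in> carrier Fr" shows "\<Phi> f = \<Phi> \<zero>\<^bsub>Fr\<^esub> \<longleftrightarrow> (\<forall>n. \<phi> n f \<in> Bc n)"
 using model_facts(5)[OF phi_Zc[OF assms] Zc_zero] by (simp add: \<Phi>_def fun_eq_iff)

lemma Phi_mult: assumes f: "f \<in> carrier Fr" and g: "g \<in> carrier Fr" shows "\<Phi> (f \<otimes>\<^bsub>Fr\<^esub> g) = \<Phi> f \<otimes>\<^bsub>Tot\<^esub> \<Phi> g"
proof
 fix n
 have 1: "pr i (n - i) (cl i (\<phi> i f)) (cl (n - i) (\<phi> (n - i) g)) = cl n (PV i (n - i) f g)" "PV i (n - i) f g \<in> Zc n" if "i \<le> n" for i
  using pr_cl[OF f g, of i "n - i"] that by simp_all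
 have "(\<Phi> f \<otimes>\<^bsub>Tot\<^esub> \<Phi> g) n = (\<Oplus>\<^bsub>E n\<^esub>i\<in>{..n}. pr i (n - i) (cl i (\<phi> i f)) (cl (n - i) (\<phi> (n - i) g)))"
  by (simp add: total_algebra_def \<Phi>_def)
 also have "\<dots> = (\<Oplus>\<^bsub>E n\<^esub>i\<in>{..n}. cl n (PV i (n - i) f g))"
  by (rule abelian_monoid.finsum_cong'[OF abelian_E refl]) (auto simp: 1 E_closed)
 also have "\<dots> = cl n (\<Sum>i\<le>n. PV i (n - i) f g)" by (rule finsum_cl) (auto simp: 1)
 also have "\<dots> = cl n (\<phi> n (f \<otimes>\<^bsub>Fr\<^esub> g))"
  by (rule cl_eq[OF _ phi_Zc[OF FA.Fr_closed(1)[OF f g]] mult_phi[OF f g]]) (auto intro: Zc_sum 1)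
 finally show "\<Phi> (f \<otimes>\<^bsub>Fr\<^esub> g) n = (\<Phi> f \<otimes>\<^bsub>Tot\<^esub> \<Phi> g) n" by (simp add: \<Phi>_def)
qed

lemma Phi_add: assumes "f \<in> carrier Fr" "g \<in> carrier Fr" shows "\<Phi> (f \<oplus>\<^bsub>Fr\<^esub> g) = \<Phi> f \<oplus>\<^bsub>Tot\<^esub> \<Phi> g"
 using model_facts(6)[OF phi_Zc[OF assms(1)] phi_Zc[OF assms(2)]] by (simp add: \<Phi>_def total_algebra_def phi_add[OF assms] del: FA.Fr_simps)

lemma Phi_smult: assumes "a \<in> S" "f \<in> carrier Fr" shows "\<Phi> (a \<odot>\<^bsub>Fr\<^esub> f) = a \<odot>\<^bsub>Tot\<^esub> \<Phi> f"
 using model_facts(7)[OF assms(1) phi_Zc[OF assms(2)]] by (simp add: \<Phi>_def total_algebra_def phi_smult del: FA.Fr_simps)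

lemma Phi_one: "\<Phi> \<one>\<^bsub>Fr\<^esub> = \<one>\<^bsub>Tot\<^esub>"
 by (auto simp: \<Phi>_def total_algebra_def phi_be model_facts(2,4))

end

section \<open>Relations, normal forms and the isomorphism\<close>

context cohomology_presentation
begin

sublocale P1: graded_presentation S Fr "graded_commutators Fr"
 by unfold_locales (rule FA.graded_alg_Fr, rule FA.commutators_closed)

text \<open>The relations lifted to the free algebra, with both families of powers of s merged by
  means of \<open>mu\<close>.\<close>

definition rel_F :: "(hgen list => 'l) set" where
 "rel_F = (%j. s ^ mu j \<odot>\<^bsub>Fr\<^esub> be [H1 j]) ` J \<union> {s ^ (b - b div p) \<odot>\<^bsub>Fr\<^esub> be [H2]} \<union>
   (%(j, k). (be [H1 j] \<otimes>\<^bsub>Fr\<^esub> be [H1 k]) \<ominus>\<^bsub>Fr\<^esub> (gam j k \<odot>\<^bsub>Fr\<^esub> be [H2])) ` (J \<times> J)"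

lemma be_gen: "j \<in> J ==> be [H1 j] \<in> carrier Fr" "be [H2] \<in> carrier Fr"
 by (rule FA.be_Fr, simp)+

lemma s_S: "s \<in> S"
 by (rule s_props(4))

lemma rel_F_closed: "rel_F \<subseteq> carrier Fr"
 unfolding rel_F_def using gam_S s_S be_gen
 by (auto simp del: FA.Fr_simps intro!: FA.Fr.minus_closed FA.Fr.m_closed P1.smult_closed)

lemma hrelations_eq: "hrelations S s p b = P1.\<pi> ` rel_F"
proof -
 have R: "gc_polynomial_ring S (hgens p b) hdeg = P1.Q"
  by (simp add: gc_polynomial_ring_def Let_def)
 have gen: "gc_generator S (hgens p b) hdeg x = P1.\<pi> (be [x])" for x
  by (simp add: gc_generator_def Let_def P1.\<pi>_def)
 have sm: "a \<odot>\<^bsub>P1.Q\<^esub> P1.\<pi> f = P1.\<pi> (a \<odot>\<^bsub>Fr\<^esub> f)" if "a \<in> S" "f \<in> carrier Fr" for a f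
  by (rule P1.pi_smult[OF that, symmetric])
 have 1: "{s ^ (b div p + 1) \<odot>\<^bsub>P1.Q\<^esub> P1.\<pi> (be [H1 j]) | j. j < b mod p} = (%j. P1.\<pi> (s ^ mu j \<odot>\<^bsub>Fr\<^esub> be [H1 j])) ` {j \<in> J. j < b mod p}"
 proof -
  have "j \<in> J" if "j < b mod p" for j
   using that p_ge_3 mod_less_divisor[of p b] by (auto simp: J_def simp del: mod_less_divisor)
  moreover have "P1.\<pi> (s ^ mu j \<odot>\<^bsub>Fr\<^esub> be [H1 j]) = s ^ (b div p + 1) \<odot>\<^bsub>P1.Q\<^esub> P1.\<pi> (be [H1 j])" if "j < b mod p" for j
   unfolding mu_def if_P[OF that] by (rule P1.pi_smult[OF S_power[OF s_S] be_gen(1)[OF calculation[OF that]]])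
  ultimately show ?thesis by (auto simp del: FA.Fr_simps graded_quotient_simps simp: image_iff)
 qed
 have 2: "{s ^ (b div p) \<odot>\<^bsub>P1.Q\<^esub> P1.\<pi> (be [H1 j]) | j. j \<in> {b mod p + 1..p - 1}} = (%j. P1.\<pi> (s ^ mu j \<odot>\<^bsub>Fr\<^esub> be [H1 j])) ` {j \<in> J. \<not> j < b mod p}"
 proof -
  have J: "{j \<in> J. \<not> j < b mod p} = {b mod p + 1..p - 1}" by (auto simp: J_def)
  have "P1.\<pi> (s ^ mu j \<odot>\<^bsub>Fr\<^esub> be [H1 j]) = s ^ (b div p) \<odot>\<^bsub>P1.Q\<^esub> P1.\<pi> (be [H1 j])" if "j \<in> {j \<in> J. \<not> j < b mod p}" for j
   using that P1.pi_smult[OF S_power[OF s_S] be_gen(1)] by (simp add: mu_def del: FA.Fr_simps)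
  then show ?thesis unfolding J by (auto simp del: FA.Fr_simps graded_quotient_simps simp: image_iff)
 qed
 have 3: "{P1.\<pi> (be [H1 j]) \<otimes>\<^bsub>P1.Q\<^esub> P1.\<pi> (be [H1 k]) \<ominus>\<^bsub>P1.Q\<^esub> (gam j k \<odot>\<^bsub>P1.Q\<^esub> P1.\<pi> (be [H2])) | j k. j \<in> J & k \<in> J}
  = (%(j, k). P1.\<pi> ((be [H1 j] \<otimes>\<^bsub>Fr\<^esub> be [H1 k]) \<ominus>\<^bsub>Fr\<^esub> (gam j k \<odot>\<^bsub>Fr\<^esub> be [H2]))) ` (J \<times> J)"
 proof -
  have "P1.\<pi> ((be [H1 j] \<otimes>\<^bsub>Fr\<^esub> be [H1 k]) \<ominus>\<^bsub>Fr\<^esub> (gam j k \<odot>\<^bsub>Fr\<^esub> be [H2]))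
   = P1.\<pi> (be [H1 j]) \<otimes>\<^bsub>P1.Q\<^esub> P1.\<pi> (be [H1 k]) \<ominus>\<^bsub>P1.Q\<^esub> (gam j k \<odot>\<^bsub>P1.Q\<^esub> P1.\<pi> (be [H2]))" if "j \<in> J" "k \<in> J" for j k
   by (simp only: P1.pi_minus P1.pi_mult P1.pi_smult gam_S[OF that(1)] be_gen that FA.Fr.m_closed P1.smult_closed)
  then show ?thesis by (force simp del: FA.Fr_simps graded_quotient_simps simp: image_iff)
 qed
 have 4: "s ^ (b - b div p) \<odot>\<^bsub>P1.Q\<^esub> P1.\<pi> (be [H2]) = P1.\<pi> (s ^ (b - b div p) \<odot>\<^bsub>Fr\<^esub> be [H2])"
  by (rule sm[OF S_power[OF s_S] be_gen(2)])
 have "hrelations S s p b = (%j. P1.\<pi> (s ^ mu j \<odot>\<^bsub>Fr\<^esub> be [H1 j])) ` {j \<in> J. j < b mod p} \<union>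
  (%j. P1.\<pi> (s ^ mu j \<odot>\<^bsub>Fr\<^esub> be [H1 j])) ` {j \<in> J. \<not> j < b mod p} \<union> {P1.\<pi> (s ^ (b - b div p) \<odot>\<^bsub>Fr\<^esub> be [H2])} \<union>
  (%(j, k). P1.\<pi> ((be [H1 j] \<otimes>\<^bsub>Fr\<^esub> be [H1 k]) \<ominus>\<^bsub>Fr\<^esub> (gam j k \<odot>\<^bsub>Fr\<^esub> be [H2]))) ` (J \<times> J)"
  unfolding hrelations_def R gen Let_def J_def[symmetric] gam_def[symmetric] 1 2 3 4 ..
 also have "\<dots> = P1.\<pi> ` rel_F"
 proof -
  have "J = {j \<in> J. j < b mod p} \<union> {j \<in> J. \<not> j < b mod p}" by auto
  then have "(%j. s ^ mu j \<odot>\<^bsub>Fr\<^esub> be [H1 j]) ` J = (%j. s ^ mu j \<odot>\<^bsub>Fr\<^esub> be [H1 j]) ` {j \<in> J. j < b mod p} \<union> (%j. s ^ mu j \<odot>\<^bsub>Fr\<^esub> be [H1 j]) ` {j \<in> J. \<not> j < b mod p}"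
   by (simp only: image_Un[symmetric])
  then show ?thesis unfolding rel_F_def by (simp only: image_Un image_image image_insert image_empty case_prod_unfold)
 qed
 finally show ?thesis .
qed

sublocale P2: graded_presentation S P1.Q "hrelations S s p b"
proof
 show "graded_alg S P1.Q" by (rule P1.graded_alg_Q)
 show "hrelations S s p b \<subseteq> carrier P1.Q"
  unfolding hrelations_eq using rel_F_closed P1.pi_closed by blast
qed

definition q :: "(hgen list => 'l) => (hgen list => 'l) set set" where "q f = P2.\<pi> (P1.\<pi> f)"

lemma h_algebra_eq: "h_algebra S s p b = P2.Q"
 by (simp add: h_algebra_def gc_polynomial_ring_def Let_def)

lemma q_mult: "f \<in> carrier Fr ==> g \<in> carrier Fr ==> q (f \<otimes>\<^bsub>Fr\<^esub> g) = q f \<otimes>\<^bsub>P2.Q\<^esub> q g"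
 and q_add: "f \<in> carrier Fr ==> g \<in> carrier Fr ==> q (f \<oplus>\<^bsub>Fr\<^esub> g) = q f \<oplus>\<^bsub>P2.Q\<^esub> q g"
 and q_smult: "a \<in> S ==> f \<in> carrier Fr ==> q (a \<odot>\<^bsub>Fr\<^esub> f) = a \<odot>\<^bsub>P2.Q\<^esub> q f"
 and q_one: "q \<one>\<^bsub>Fr\<^esub> = \<one>\<^bsub>P2.Q\<^esub>"
 by (simp_all only: q_def P1.pi_mult P2.pi_mult P1.pi_add P2.pi_add P1.pi_smult P2.pi_smult P1.pi_one P2.pi_one P1.pi_closed)

lemma q_minus_zero: assumes "f \<in> carrier Fr" "g \<in> carrier Fr" "q (f \<ominus>\<^bsub>Fr\<^esub> g) = q \<zero>\<^bsub>Fr\<^esub>" shows "q f = q g"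
proof -
 have "q f = q ((f \<ominus>\<^bsub>Fr\<^esub> g) \<oplus>\<^bsub>Fr\<^esub> g)"
  using assms by (simp only: a_minus_def FA.Fr.a_assoc FA.Fr.l_neg FA.Fr.r_zero FA.Fr.a_inv_closed)
 also have "\<dots> = q (\<zero>\<^bsub>Fr\<^esub> \<oplus>\<^bsub>Fr\<^esub> g)" using assms by (simp only: q_add FA.Fr.minus_closed FA.Fr.zero_closed)
 finally show ?thesis using assms by (simp only: FA.Fr.l_zero)
qed

lemma q_rel_F: "f \<in> rel_F ==> q f = q \<zero>\<^bsub>Fr\<^esub>"
 unfolding q_def P1.pi_zero by (rule P2.pi_rel) (simp only: hrelations_eq imageI)

lemma homogD: "f \<in> homog Fr m ==> f \<in> carrier Fr" "f \<in> homog Fr m ==> f w ~= 0 ==> dg w = m"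
 unfolding FA.homog_Fr by blast+

lemma be_homog: "j \<in> J ==> be [H1 j] \<in> homog Fr 1" "be [H2] \<in> homog Fr 2"
 unfolding FA.homog_Fr using be_gen by (auto simp: basis_elem_def simp del: FA.Fr_simps split: if_splits)

lemma q_H1_H2: assumes "j \<in> J" shows "q (be [H1 j, H2]) = q (be [H2, H1 j])"
proof -
 have "(be [H1 j] \<otimes>\<^bsub>Fr\<^esub> be [H2]) \<ominus>\<^bsub>Fr\<^esub> (be [H2] \<otimes>\<^bsub>Fr\<^esub> be [H1 j]) \<in> graded_commutators Fr"
  unfolding graded_commutators_def
  by (rule CollectI, rule exI[of _ "be [H1 j]"], rule exI[of _ "be [H2]"], rule exI[of _ 1], rule exI[of _ 2])
   (simp add: be_homog assms del: FA.Fr_simps One_nat_def)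
 from P1.pi_rel[OF this] have "q ((be [H1 j] \<otimes>\<^bsub>Fr\<^esub> be [H2]) \<ominus>\<^bsub>Fr\<^esub> (be [H2] \<otimes>\<^bsub>Fr\<^esub> be [H1 j])) = q \<zero>\<^bsub>Fr\<^esub>"
  by (simp only: q_def)
 from q_minus_zero[OF _ _ this] have "q (be [H1 j] \<otimes>\<^bsub>Fr\<^esub> be [H2]) = q (be [H2] \<otimes>\<^bsub>Fr\<^esub> be [H1 j])"
  using be_gen assms by (simp only: FA.Fr.m_closed)
 then show ?thesis by (simp add: FA.be_mult del: FA.Fr_simps)
qed

lemma phi_homog: assumes "f \<in> homog Fr m" "n ~= m" shows "\<phi> n f = 0" "\<upsilon> n f = 0"
 using homogD(2)[OF assms(1)] assms(2) by (auto simp: \<phi>_def \<upsilon>_def intro!: sum.neutral)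

lemma PV_zero: assumes "f \<in> homog Fr m" "g \<in> homog Fr n" "i ~= m \<or> j ~= n" shows "PV i j f g = 0"
 using phi_homog[OF assms(1), of i] phi_homog[OF assms(2), of j] assms(3) G_zero[OF sigma_G] by (auto simp: PV_def)

lemma phi_mult_homog: assumes f: "f \<in> homog Fr m" and g: "g \<in> homog Fr n"
 shows "(if k = m + n then PV m n f g else 0) - \<phi> k (f \<otimes>\<^bsub>Fr\<^esub> g) \<in> Bc k"
proof -
 have "(\<Sum>i\<le>k. PV i (k - i) f g) = (\<Sum>i\<le>k. if i = m then (if k = m + n then PV m n f g else 0) else 0)"
  using PV_zero[OF f g] by (intro sum.cong) (auto split: if_splits)
 also have "\<dots> = (if k = m + n then PV m n f g else 0)" by auto
 finally show ?thesis using mult_phi[OF homogD(1)[OF f] homogD(1)[OF g], of k] by simp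
qed

text \<open>In odd degrees, summation by parts turns the sum of the two products into \<chi> times
  the trace of a product of two integral cocycles, which is a coboundary.\<close>

lemma PV_commute: assumes f: "f \<in> carrier Fr" and g: "g \<in> carrier Fr"
 shows "PV m n f g - (if even (m * n) then PV n m g f else - PV n m g f) \<in> Bc (m + n)"
proof (cases "even m \<or> even n")
 case True
 then show ?thesis by (auto simp: PV_def mult.commute)
next
 case False
 have d: "\<delta> (\<upsilon> m f) = \<phi> m f" "\<delta> (\<upsilon> n g) = \<phi> n g" using delta_upsilon f g False by auto
 have T: "\<phi> m f \<in> T" "\<phi> n g \<in> T" using phi_Zc f g Zc_T by blast+
 have "PV m n f g + PV n m g f = \<chi> * Tr (\<phi> m f * \<sigma> (\<upsilon> n g) - \<upsilon> n g * \<phi> m f)"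
  unfolding PV_def using False Tr_delta_mult_sigma[of "\<upsilon> n g" "\<upsilon> m f"] d by (simp add: Tr_diff algebra_simps)
 also have "\<phi> m f * \<sigma> (\<upsilon> n g) - \<upsilon> n g * \<phi> m f = \<phi> m f * \<phi> n g"
  unfolding d(2)[symmetric] by (simp add: \<delta>_def algebra_simps)
 also have "\<chi> * Tr (\<phi> m f * \<phi> n g) \<in> Tr ` T" by (rule TrT_smult[OF chi(1)]) (use T in auto)
 finally show ?thesis using False by (auto simp: Bc_def)
qed

lemma phi_uminus: "f \<in> carrier Fr ==> \<phi> n (\<ominus>\<^bsub>Fr\<^esub> f) = - \<phi> n f"
 by (simp add: FA.Fr_uminus \<phi>_def sum_negf[symmetric] if_distrib cong: if_cong del: FA.Fr_simps)

lemma phi_minus: "f \<in> carrier Fr ==> g \<in> carrier Fr ==> \<phi> n (f \<ominus>\<^bsub>Fr\<^esub> g) = \<phi> n f - \<phi> n g"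
 by (simp only: a_minus_def phi_add phi_uminus FA.Fr.a_inv_closed diff_conv_add_uminus)

lemma Phi_commutator: assumes "c \<in> graded_commutators Fr" shows "\<Phi> c = \<Phi> \<zero>\<^bsub>Fr\<^esub>"
proof -
 obtain f g m n where c: "c = (f \<otimes>\<^bsub>Fr\<^esub> g) \<ominus>\<^bsub>Fr\<^esub> (if even (m * n) then g \<otimes>\<^bsub>Fr\<^esub> f else \<ominus>\<^bsub>Fr\<^esub> (g \<otimes>\<^bsub>Fr\<^esub> f))"
  and fg: "f \<in> homog Fr m" "g \<in> homog Fr n"
  using assms unfolding graded_commutators_def by blast
 note C = homogD(1)[OF fg(1)] homogD(1)[OF fg(2)]
 have cC: "c \<in> carrier Fr" using assms FA.commutators_closed by blast
 have "\<phi> k c \<in> Bc k" for k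
 proof -
  have e: "\<phi> k c = \<phi> k (f \<otimes>\<^bsub>Fr\<^esub> g) - (if even (m * n) then \<phi> k (g \<otimes>\<^bsub>Fr\<^esub> f) else - \<phi> k (g \<otimes>\<^bsub>Fr\<^esub> f))"
   unfolding c using C by (simp add: phi_minus phi_uminus del: FA.Fr_simps even_mult_iff)
  have 1: "(if k = m + n then PV m n f g else 0) - \<phi> k (f \<otimes>\<^bsub>Fr\<^esub> g) \<in> Bc k" by (rule phi_mult_homog[OF fg])
  have 2: "(if k = m + n then PV n m g f else 0) - \<phi> k (g \<otimes>\<^bsub>Fr\<^esub> f) \<in> Bc k"
   using phi_mult_homog[OF fg(2,1), of k] by (simp add: add.commute)
  have 3: "(if k = m + n then PV m n f g else 0) - (if even (m * n) then (if k = m + n then PV n m g f else 0) else - (if k = m + n then PV n m g f else 0)) \<in> Bc k"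
   using PV_commute[OF C, of m n] by auto
  show ?thesis
  proof (cases "even (m * n)")
   case True
   show ?thesis using Bc_add[OF Bc_diff[OF 3 1] 2] unfolding e if_P[OF True] by (simp add: algebra_simps)
  next
   case False
   show ?thesis using Bc_diff[OF Bc_diff[OF 3 1] 2] unfolding e if_not_P[OF False] by (simp add: algebra_simps)
  qed
 qed
 then show ?thesis using Phi_eq_zero[OF cC] by blast
qed

lemma gx_delta: assumes "j \<in> J" shows "s ^ mu j * gx j \<in> \<delta> ` T"
proof -
 have "(\<Sum>k\<in>J. (if k = j then s ^ mu j else 0) * gx k) = (\<Sum>k\<in>J. if k = j then s ^ mu j * gx j else 0)"
  by (rule sum.cong) auto
 then have "(\<Sum>k\<in>J. (if k = j then s ^ mu j else 0) * gx k) = s ^ mu j * gx j" using assms by simp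
 moreover have "(\<Sum>k\<in>J. (if k = j then s ^ mu j else 0) * gx k) \<in> \<delta> ` T"
 proof (rule delta_image_iff[THEN iffD2])
  show "(if k = j then s ^ mu j else 0) \<in> S" for k using s_S by simp
  show "\<forall>k\<in>J. \<exists>c'\<in>S. (if k = j then s ^ mu j else 0) = s ^ mu k * c'"
  proof
   fix k
   show "\<exists>c'\<in>S. (if k = j then s ^ mu j else 0) = s ^ mu k * c'"
    by (cases "k = j") (simp_all add: bexI[of _ 1] bexI[of _ 0])
  qed
 qed
 ultimately show ?thesis by simp
qed

lemma val_gens: "val [H1 j] = gx j" "val [H2] = \<chi>" "val [H1 j, H1 k] = \<chi> * Tr (gx k * \<sigma> (gu j))"
 by (simp_all add: st_def)

text \<open>The three kinds of relation rest on \<open>gx_delta\<close>, \<open>TrT_eq\<close> and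
  \<open>Tr_gx_sigma_gu\<close>, respectively.\<close>

lemma Phi_rel_F: assumes "f \<in> rel_F" shows "\<Phi> f = \<Phi> \<zero>\<^bsub>Fr\<^esub>"
proof -
 have fC: "f \<in> carrier Fr" using assms rel_F_closed by blast
 have "\<forall>f\<in>rel_F. (\<exists>j\<in>J. f = s ^ mu j \<odot>\<^bsub>Fr\<^esub> be [H1 j]) \<or> f = s ^ (b - b div p) \<odot>\<^bsub>Fr\<^esub> be [H2] \<or>
   (\<exists>j\<in>J. \<exists>k\<in>J. f = (be [H1 j] \<otimes>\<^bsub>Fr\<^esub> be [H1 k]) \<ominus>\<^bsub>Fr\<^esub> (gam j k \<odot>\<^bsub>Fr\<^esub> be [H2]))"
  unfolding rel_F_def by (auto simp del: FA.Fr_simps)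
 then consider (1) j where "j \<in> J" "f = s ^ mu j \<odot>\<^bsub>Fr\<^esub> be [H1 j]" | (2) "f = s ^ (b - b div p) \<odot>\<^bsub>Fr\<^esub> be [H2]"
  | (3) j k where "j \<in> J" "k \<in> J" "f = (be [H1 j] \<otimes>\<^bsub>Fr\<^esub> be [H1 k]) \<ominus>\<^bsub>Fr\<^esub> (gam j k \<odot>\<^bsub>Fr\<^esub> be [H2])"
  using assms by meson
 then have "\<phi> n f \<in> Bc n" for n
 proof cases
  case 1
  then show ?thesis using gx_delta[OF 1(1)] by (auto simp: phi_smult phi_be st_def Bc_pos simp del: FA.Fr_simps)
 next
  case 2
  have "\<chi> * s ^ (b - b div p) \<in> Tr ` T" unfolding TrT_eq using chi(1) by (auto simp: mult.commute)
  then show ?thesis unfolding 2 phi_smult phi_be by (auto simp: st_def Bc_def[of 2] mult.commute)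
 next
  case 3
  have "\<phi> n f = (if n = 2 then \<chi> * (Tr (gx k * \<sigma> (gu j)) - gam j k) else 0)"
   unfolding 3(3) using be_gen 3(1,2) gam_S[OF 3(1), of k] FA.be_Fr[of "[H1 j, H1 k]"]
   by (subst phi_minus) (simp_all add: P1.smult_closed FA.Fr.m_closed FA.be_mult phi_smult phi_be val_gens right_diff_distrib mult.commute del: FA.Fr_simps val.simps)
  then show ?thesis using TrT_smult[OF chi(1) Tr_gx_sigma_gu[OF 3(1,2)]] by (auto simp: Bc_def[of 2])
 qed
 then show ?thesis using Phi_eq_zero[OF fC] by blast
qed

text \<open>The evaluation descends through the two quotients in turn; \<Psi> is the map induced on
  the graded commutative ring.\<close>

lemma q_Phi: assumes f: "f \<in> carrier Fr" and g: "g \<in> carrier Fr" and eq: "q f = q g" shows "\<Phi> f = \<Phi> g"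
proof -
 define \<Psi> where "\<Psi> z = \<Phi> (SOME f. f \<in> carrier Fr & P1.\<pi> f = z)" for z
 have \<Psi>: "\<Psi> (P1.\<pi> f) = \<Phi> f" if f: "f \<in> carrier Fr" for f
 proof -
  have "(SOME h. h \<in> carrier Fr & P1.\<pi> h = P1.\<pi> f) \<in> carrier Fr & P1.\<pi> (SOME h. h \<in> carrier Fr & P1.\<pi> h = P1.\<pi> f) = P1.\<pi> f"
   by (rule someI[of _ f]) (simp add: that del: FA.Fr_simps)
  then show ?thesis unfolding \<Psi>_def
   by (intro P1.pi_universal[OF Phi_add Phi_mult Phi_commutator _ f]) (simp_all del: FA.Fr_simps)
 qed
 have 1: "\<Psi> (U \<oplus>\<^bsub>P1.Q\<^esub> V) = \<Psi> U \<oplus>\<^bsub>Tot\<^esub> \<Psi> V" "\<Psi> (U \<otimes>\<^bsub>P1.Q\<^esub> V) = \<Psi> U \<otimes>\<^bsub>Tot\<^esub> \<Psi> V"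
  if "U \<in> carrier P1.Q" "V \<in> carrier P1.Q" for U V
 proof -
  obtain u v where uv: "u \<in> carrier Fr" "v \<in> carrier Fr" "U = P1.\<pi> u" "V = P1.\<pi> v"
   using \<open>U \<in> carrier P1.Q\<close> \<open>V \<in> carrier P1.Q\<close> unfolding P1.carrier_Q by blast
  show "\<Psi> (U \<oplus>\<^bsub>P1.Q\<^esub> V) = \<Psi> U \<oplus>\<^bsub>Tot\<^esub> \<Psi> V" "\<Psi> (U \<otimes>\<^bsub>P1.Q\<^esub> V) = \<Psi> U \<otimes>\<^bsub>Tot\<^esub> \<Psi> V"
   using uv(1,2) unfolding uv(3,4)
   by (simp_all only: P1.pi_add[symmetric] P1.pi_mult[symmetric] \<Psi> FA.Fr.m_closed FA.Fr.a_closed Phi_add Phi_mult)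
 qed
 have 2: "\<Psi> U = \<Psi> \<zero>\<^bsub>P1.Q\<^esub>" if "U \<in> hrelations S s p b" for U
 proof -
  obtain r where r: "r \<in> rel_F" "U = P1.\<pi> r" using \<open>U \<in> hrelations S s p b\<close> unfolding hrelations_eq by (rule imageE)
  then show ?thesis unfolding P1.pi_zero[symmetric] r(2) using rel_F_closed Phi_rel_F[OF r(1)]
   by (subst (1 2) \<Psi>) (auto simp del: FA.Fr_simps)
 qed
 have "\<Psi> (P1.\<pi> f) = \<Psi> (P1.\<pi> g)"
  by (rule P2.pi_universal[OF 1 2 P1.pi_closed[OF f] P1.pi_closed[OF g]]) (use eq in \<open>simp_all add: q_def del: graded_quotient_simps\<close>)
 then show ?thesis using f g by (simp only: \<Psi>)
qed

text \<open>Normal words, with at most one odd generator: a product of two odd generators is a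
  multiple of \<open>H2\<close>, and \<open>H2\<close> commutes with all generators.\<close>

definition NW :: "hgen list set" where
 "NW = range (%m. replicate m H2) \<union> (%(j, m). H1 j # replicate m H2) ` (J \<times> UNIV)"

lemma NW_I: "replicate m H2 \<in> NW" "j \<in> J ==> H1 j # replicate m H2 \<in> NW"
 by (auto simp: NW_def)

lemma NW_cases: assumes "w \<in> NW"
 obtains m where "w = replicate m H2" | j m where "j \<in> J" "w = H1 j # replicate m H2"
 using assms by (auto simp: NW_def)

lemma words [simp]: "replicate m H2 \<in> Uw" "j \<in> J ==> H1 j # replicate m H2 \<in> Uw"
 by (induction m) auto

lemma dg_replicate [simp]: "dg (replicate m H2) = 2 * m"
 by (induction m) auto

lemma val_replicate [simp]: "val (replicate m H2) = \<chi> ^ m"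
 by (induction m) (auto simp: st_def)

lemma val_H1: "val (H1 j # replicate m H2) = \<chi> ^ m * gx j"
 by (simp add: st_def mult.commute)

lemma chi_power: "\<chi> ^ m * \<chi> ^ m = 1" "\<chi> ^ m \<in> S"
 using chi by (simp_all flip: power_mult_distrib)

lemma smult_simps: "1 \<odot>\<^bsub>Fr\<^esub> f = f" "a \<odot>\<^bsub>Fr\<^esub> (c \<odot>\<^bsub>Fr\<^esub> f) = (a * c) \<odot>\<^bsub>Fr\<^esub> f"
 by (simp_all add: mult.assoc)

lemma be_Cons: "be (x # w) = be [x] \<otimes>\<^bsub>Fr\<^esub> be w" "be (x # y # w) = be [x, y] \<otimes>\<^bsub>Fr\<^esub> be w"
 unfolding FA.be_mult by simp_all

lemma q_mult_cong: "f \<in> carrier Fr ==> f' \<in> carrier Fr ==> g \<in> carrier Fr ==> g' \<in> carrier Fr ==> q f = q f' ==> q g = q g' ==>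
  q (f \<otimes>\<^bsub>Fr\<^esub> g) = q (f' \<otimes>\<^bsub>Fr\<^esub> g')"
 by (simp only: q_mult)

lemma q_smult_cong: "a \<in> S ==> f \<in> carrier Fr ==> f' \<in> carrier Fr ==> q f = q f' ==> q (a \<odot>\<^bsub>Fr\<^esub> f) = q (a \<odot>\<^bsub>Fr\<^esub> f')"
 by (simp only: q_smult)

lemma q_H1_H1: assumes "j \<in> J" "k \<in> J" shows "q (be [H1 j, H1 k]) = q (gam j k \<odot>\<^bsub>Fr\<^esub> be [H2])"
proof -
 have "(be [H1 j] \<otimes>\<^bsub>Fr\<^esub> be [H1 k]) \<ominus>\<^bsub>Fr\<^esub> (gam j k \<odot>\<^bsub>Fr\<^esub> be [H2]) \<in> rel_F"
  unfolding rel_F_def using assms by (auto simp del: FA.Fr_simps)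
 from q_minus_zero[OF _ _ q_rel_F[OF this]] have "q (be [H1 j] \<otimes>\<^bsub>Fr\<^esub> be [H1 k]) = q (gam j k \<odot>\<^bsub>Fr\<^esub> be [H2])"
  using be_gen assms gam_S by (simp only: FA.Fr.m_closed P1.smult_closed)
 then show ?thesis unfolding FA.be_mult by simp
qed

text \<open>Prepending a letter to a normal word disturbs only the first two letters:
  \<open>H2\<close> moves past an odd generator, and two odd generators merge into a multiple of
  \<open>H2\<close>.\<close>

lemma reduce: "w \<in> Uw ==> \<exists>\<kappa>\<in>S. \<exists>v\<in>NW. q (be w) = q (\<kappa> \<odot>\<^bsub>Fr\<^esub> be v)"
proof (induction w)
 case Nil
 show ?case by (rule bexI[OF _ S_closed(2)], rule bexI[OF _ NW_I(1)[of 0]], unfold smult_simps) simp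
next
 case (Cons x w)
 then have w: "w \<in> Uw" and x: "x \<in> hgens p b" by auto
 then obtain \<kappa> v where kv: "\<kappa> \<in> S" "v \<in> NW" "q (be w) = q (\<kappa> \<odot>\<^bsub>Fr\<^esub> be v)" using Cons.IH by blast
 have vU: "v \<in> Uw" using kv(2) by (cases rule: NW_cases) auto
 have xF: "be [x] \<in> carrier Fr" using x by (intro FA.be_Fr) auto
 have "q (be (x # w)) = q (be [x] \<otimes>\<^bsub>Fr\<^esub> (\<kappa> \<odot>\<^bsub>Fr\<^esub> be v))"
  unfolding be_Cons(1)[of x w] using xF FA.be_Fr[OF w] P1.smult_closed[OF kv(1) FA.be_Fr[OF vU]] kv(3)
  by (intro q_mult_cong) (simp_all only:)
 also have "\<dots> = q (\<kappa> \<odot>\<^bsub>Fr\<^esub> be (x # v))" unfolding FA.Fr_mult_smult be_Cons(1)[of x v] ..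
 finally have red: "q (be (x # w)) = q (\<kappa> \<odot>\<^bsub>Fr\<^esub> be (x # v))" .
 have triv: "\<exists>a\<in>S. \<exists>u\<in>NW. q (be y) = q (a \<odot>\<^bsub>Fr\<^esub> be u)" if "y \<in> NW" for y
  by (rule bexI[OF _ S_closed(2)], rule bexI[OF _ that], unfold smult_simps) simp
 have "\<exists>a\<in>S. \<exists>u\<in>NW. q (be (x # v)) = q (a \<odot>\<^bsub>Fr\<^esub> be u)"
  using kv(2)
 proof (cases rule: NW_cases)
  case (1 m)
  have "x # v \<in> NW" using NW_I(1)[of "Suc m"] NW_I(2)[of _ m] x by (cases x) (simp_all add: 1)
  then show ?thesis by (rule triv)
 next
  case (2 k m)
  have rF: "be (replicate m H2) \<in> carrier Fr" by (rule FA.be_Fr) simp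
  have c: "be [x, H1 k] \<in> carrier Fr" "be [H1 k, H2] \<in> carrier Fr" by (rule FA.be_Fr, use x 2 in simp)+
  show ?thesis
  proof (cases x)
   case H2
   have "q (be (x # v)) = q (be [H1 k, H2] \<otimes>\<^bsub>Fr\<^esub> be (replicate m H2))"
    unfolding 2(2) be_Cons(2)[of x "H1 k" "replicate m H2"] by (rule q_mult_cong[OF c rF rF _ refl]) (simp only: H2 q_H1_H2[OF 2(1)])
   also have "be [H1 k, H2] \<otimes>\<^bsub>Fr\<^esub> be (replicate m H2) = be (H1 k # replicate (Suc m) H2)"
    unfolding FA.be_mult by simp
   finally show ?thesis using triv[OF NW_I(2)[OF 2(1), of "Suc m"]] by (simp only:)
  next
   case (H1 j)
   then have j: "j \<in> J" using x by simp
   have "q (be (x # v)) = q ((gam j k \<odot>\<^bsub>Fr\<^esub> be [H2]) \<otimes>\<^bsub>Fr\<^esub> be (replicate m H2))"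
    unfolding 2(2) be_Cons(2)[of x "H1 k" "replicate m H2"]
    by (rule q_mult_cong[OF c(1) P1.smult_closed[OF gam_S[OF j] be_gen(2)] rF rF _ refl]) (simp only: H1 q_H1_H1[OF j 2(1)])
   also have "(gam j k \<odot>\<^bsub>Fr\<^esub> be [H2]) \<otimes>\<^bsub>Fr\<^esub> be (replicate m H2) = gam j k \<odot>\<^bsub>Fr\<^esub> be (replicate (Suc m) H2)"
    unfolding FA.Fr_mult_smult FA.be_mult by simp
   finally show ?thesis using gam_S[OF j] NW_I(1) by blast
  qed
 qed
 then obtain a u where u: "a \<in> S" "u \<in> NW" "q (be (x # v)) = q (a \<odot>\<^bsub>Fr\<^esub> be u)" by blast
 have uU: "u \<in> Uw" using u(2) by (cases rule: NW_cases) auto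
 have xv: "be (x # v) \<in> carrier Fr" using x vU by (intro FA.be_Fr) auto
 have "q (be (x # w)) = q ((\<kappa> * a) \<odot>\<^bsub>Fr\<^esub> be u)"
  unfolding red smult_simps(2)[symmetric]
  by (rule q_smult_cong[OF kv(1) xv P1.smult_closed[OF u(1) FA.be_Fr[OF uU]] u(3)])
 then show ?case using kv(1) u(1,2) by blast
qed

lemma normalize: assumes f: "f \<in> carrier Fr" shows "\<exists>g\<in>carrier Fr. (\<forall>w. g w ~= 0 --> w \<in> NW) & q f = q g"
 using f
proof (induction rule: FA.Fr_induct)
 case zero
 show ?case using FA.Fr.zero_closed by (intro bexI[of _ "\<zero>\<^bsub>Fr\<^esub>"]) simp_all
next
 case (add w g)
 obtain \<kappa> v where kv: "\<kappa> \<in> S" "v \<in> NW" "q (be w) = q (\<kappa> \<odot>\<^bsub>Fr\<^esub> be v)" using reduce[OF add(1)] by blast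
 have vU: "v \<in> Uw" using kv(2) by (cases rule: NW_cases) auto
 obtain h where h: "h \<in> carrier Fr" "\<forall>w. h w ~= 0 --> w \<in> NW" "q g = q h" using add(4) by blast
 define c where "c = f w * \<kappa>"
 have fw: "f w \<in> S" by (rule Fr_D(1)[OF f])
 then have c: "c \<in> S" using kv(1) by (auto simp: c_def)
 note v = P1.smult_closed[OF c FA.be_Fr[OF vU]]
 have "q (f w \<odot>\<^bsub>Fr\<^esub> be w) = q (c \<odot>\<^bsub>Fr\<^esub> be v)"
  unfolding c_def smult_simps(2)[symmetric]
  by (rule q_smult_cong[OF fw FA.be_Fr[OF add(1)] P1.smult_closed[OF kv(1) FA.be_Fr[OF vU]] kv(3)])
 then have "q ((f w \<odot>\<^bsub>Fr\<^esub> be w) \<oplus>\<^bsub>Fr\<^esub> g) = q ((c \<odot>\<^bsub>Fr\<^esub> be v) \<oplus>\<^bsub>Fr\<^esub> h)"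
  by (simp only: q_add v h(1,3) add(3) P1.smult_closed[OF fw FA.be_Fr[OF add(1)]])
 moreover have "\<forall>u. ((c \<odot>\<^bsub>Fr\<^esub> be v) \<oplus>\<^bsub>Fr\<^esub> h) u ~= 0 --> u \<in> NW"
  using h(2) kv(2) by (auto simp: basis_elem_def)
 ultimately show ?case using FA.Fr.a_closed[OF v h(1)] by blast
qed

lemma vanish: assumes "g \<in> carrier Fr" "!!w. w \<in> Uw ==> g w ~= 0 ==> q (g w \<odot>\<^bsub>Fr\<^esub> be w) = q \<zero>\<^bsub>Fr\<^esub>"
 shows "q g = q \<zero>\<^bsub>Fr\<^esub>"
 using assms(1)
proof (induction rule: FA.Fr_induct)
 case (add w h)
 have "q ((g w \<odot>\<^bsub>Fr\<^esub> be w) \<oplus>\<^bsub>Fr\<^esub> h) = q (\<zero>\<^bsub>Fr\<^esub> \<oplus>\<^bsub>Fr\<^esub> \<zero>\<^bsub>Fr\<^esub>)"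
  by (simp only: q_add add(3,4)[folded FA.Fr_simps(4)] assms(2)[OF add(1,2)] FA.Fr.zero_closed
    P1.smult_closed[OF Fr_D(1)[OF assms(1)] FA.be_Fr[OF add(1)]])
 then show ?case by (simp only: FA.Fr.l_zero FA.Fr.zero_closed)
qed simp

lemma phi_only:
 assumes g: "g \<in> carrier Fr" and W: "finite W" "!!w. g w ~= 0 ==> dg w = n ==> w \<in> W" "!!w. w \<in> W ==> dg w = n"
 shows "\<phi> n g = (\<Sum>w\<in>W. g w * val w)"
 unfolding \<phi>_def
proof (rule sum.mono_neutral_cong)
 show "finite {w. g w ~= 0}" by (rule Fr_D(3)[OF g])
qed (use W in auto)

lemma q_multiple_zero: assumes "x \<in> hgens p b" "a \<odot>\<^bsub>Fr\<^esub> be [x] \<in> rel_F" "w \<in> Uw" "c \<in> S" "a \<in> S"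
 shows "q ((a * c) \<odot>\<^bsub>Fr\<^esub> be (x # w)) = q \<zero>\<^bsub>Fr\<^esub>"
proof -
 note wF = FA.be_Fr[OF assms(3)]
 have xF: "be [x] \<in> carrier Fr" using assms(1) by (intro FA.be_Fr) auto
 have "q ((a \<odot>\<^bsub>Fr\<^esub> be [x]) \<otimes>\<^bsub>Fr\<^esub> (c \<odot>\<^bsub>Fr\<^esub> be w)) = q (\<zero>\<^bsub>Fr\<^esub> \<otimes>\<^bsub>Fr\<^esub> (c \<odot>\<^bsub>Fr\<^esub> be w))"
  by (rule q_mult_cong) (simp_all only: P1.smult_closed assms wF xF FA.Fr.zero_closed q_rel_F)
 moreover have "(a \<odot>\<^bsub>Fr\<^esub> be [x]) \<otimes>\<^bsub>Fr\<^esub> (c \<odot>\<^bsub>Fr\<^esub> be w) = (c * a) \<odot>\<^bsub>Fr\<^esub> be (x # w)"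
  unfolding FA.Fr_mult_smult be_Cons(1)[of x w, symmetric] smult_simps(2) ..
 ultimately show ?thesis by (simp only: FA.Fr.l_null[OF P1.smult_closed[OF assms(4) wF]] mult.commute[of c])
qed

text \<open>A given degree contains one even normal word, or one odd normal word for each j in
  \<open>J\<close>. A vanishing class thus says that one coefficient is a trace, or that a
  combination of the \<open>gx j\<close> is \<delta> of an integral element. \<open>TrT_eq\<close>
  and \<open>delta_image_iff\<close> translate this into divisibility by the power of s in the
  relations, letter by letter.\<close>

lemma normal_zero: assumes g: "g \<in> carrier Fr" "!!w. g w ~= 0 ==> w \<in> NW" and z: "\<Phi> g = \<Phi> \<zero>\<^bsub>Fr\<^esub>"
 shows "q g = q \<zero>\<^bsub>Fr\<^esub>"
proof (rule vanish[OF g(1)])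
 have B: "\<phi> n g \<in> Bc n" for n using z Phi_eq_zero[OF g(1)] by blast
 fix w assume w: "w \<in> Uw" "g w ~= 0"
 from g(2)[OF w(2)] show "q (g w \<odot>\<^bsub>Fr\<^esub> be w) = q \<zero>\<^bsub>Fr\<^esub>"
 proof (cases rule: NW_cases)
  case (1 m)
  have "\<phi> (2 * m) g = (\<Sum>v\<in>{w}. g v * val v)"
  proof (rule phi_only[OF g(1)])
   fix v assume "g v ~= 0" "dg v = 2 * m"
   from g(2)[OF this(1)] this(2) show "v \<in> {w}" by (cases rule: NW_cases) (auto simp: 1, presburger)
  qed (simp_all add: 1)
  then have "\<chi> ^ m * \<phi> (2 * m) g = (\<chi> ^ m * \<chi> ^ m) * g w" by (simp add: 1 mult_ac)
  then have "g w \<in> Bc (2 * m)" using Bc_smult[OF chi_power(2) B, of m "2 * m"] by (simp add: chi_power)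
  \<comment> \<open>In degree 0 only zero is a coboundary, so a nonzero coefficient belongs to a
    word containing \<open>H2\<close>, to which the relation for \<open>H2\<close> applies.\<close>
  then have m: "m ~= 0" "g w \<in> Tr ` T" using w(2) by (auto simp: Bc_def split: if_splits)
  then obtain c m' where c: "c \<in> S" "g w = s ^ (b - b div p) * c" "m = Suc m'" unfolding TrT_eq by (cases m) auto
  have "s ^ (b - b div p) \<odot>\<^bsub>Fr\<^esub> be [H2] \<in> rel_F" by (simp add: rel_F_def del: FA.Fr_simps)
  from q_multiple_zero[OF _ this _ c(1) S_power[OF s_S], of "replicate m' H2"] show ?thesis
   unfolding c(2) by (simp add: 1 c(3) del: FA.Fr_simps)
 next
  case (2 j m)
  have inj: "inj_on (%k. H1 k # replicate m H2) J" by (auto simp: inj_on_def)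
  have "\<phi> (Suc (2 * m)) g = (\<Sum>v\<in>(%k. H1 k # replicate m H2) ` J. g v * val v)"
  proof (rule phi_only[OF g(1)])
   fix v assume "g v ~= 0" "dg v = Suc (2 * m)"
   from g(2)[OF this(1)] this(2) show "v \<in> (%k. H1 k # replicate m H2) ` J" by (cases rule: NW_cases) (auto, presburger)
  qed auto
  also have "\<dots> = \<chi> ^ m * (\<Sum>k\<in>J. g (H1 k # replicate m H2) * gx k)"
   unfolding sum.reindex[OF inj] by (simp add: val_H1 sum_distrib_left mult_ac del: val.simps)
  finally have "\<chi> ^ m * \<phi> (Suc (2 * m)) g = (\<chi> ^ m * \<chi> ^ m) * (\<Sum>k\<in>J. g (H1 k # replicate m H2) * gx k)"
   by (simp only: mult.assoc)
  then have "(\<Sum>k\<in>J. g (H1 k # replicate m H2) * gx k) \<in> Bc (Suc (2 * m))"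
   using Bc_smult[OF chi_power(2) B, of m "Suc (2 * m)"] by (simp add: chi_power)
  then have "(\<Sum>k\<in>J. g (H1 k # replicate m H2) * gx k) \<in> \<delta> ` T" by (simp add: Bc_pos)
  then obtain c where c: "c \<in> S" "g w = s ^ mu j * c"
   unfolding delta_image_iff[OF Fr_D(1)[OF g(1)]] 2(2) using 2(1) by blast
  have "s ^ mu j \<odot>\<^bsub>Fr\<^esub> be [H1 j] \<in> rel_F" using 2(1) by (simp add: rel_F_def del: FA.Fr_simps)
  from q_multiple_zero[OF _ this _ c(1) S_power[OF s_S], of "replicate m H2"] show ?thesis
   unfolding c(2) using 2(1) by (simp add: 2(2) del: FA.Fr_simps)
 qed
qed

lemma q_iff: assumes f: "f \<in> carrier Fr" and g: "g \<in> carrier Fr" shows "q f = q g \<longleftrightarrow> \<Phi> f = \<Phi> g"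
proof
 show "q f = q g ==> \<Phi> f = \<Phi> g" by (rule q_Phi[OF f g])
 assume eq: "\<Phi> f = \<Phi> g"
 have h: "f \<ominus>\<^bsub>Fr\<^esub> g \<in> carrier Fr" by (rule FA.Fr.minus_closed[OF f g])
 have "\<phi> n f - \<phi> n g \<in> Bc n" for n
  using fun_cong[OF eq, of n] model_facts(5)[OF phi_Zc[OF f] phi_Zc[OF g]] by (simp add: \<Phi>_def)
 then have z: "\<Phi> (f \<ominus>\<^bsub>Fr\<^esub> g) = \<Phi> \<zero>\<^bsub>Fr\<^esub>" using Phi_eq_zero[OF h] by (simp add: phi_minus[OF f g] del: FA.Fr_simps)
 obtain k where k: "k \<in> carrier Fr" "\<forall>w. k w ~= 0 --> w \<in> NW" "q (f \<ominus>\<^bsub>Fr\<^esub> g) = q k" using normalize[OF h] by blast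
 have "q k = q \<zero>\<^bsub>Fr\<^esub>"
  by (rule normal_zero[OF k(1)]) (use k(2) z q_Phi[OF h k(1) k(3)] in auto)
 then show "q f = q g" using q_minus_zero[OF f g] k(3) by simp
qed

text \<open>Even cocycles are scalars from \<open>S\<close>, odd ones are combinations of the
  \<open>gx j\<close> by \<open>kernel_trace\<close>. The factor \<chi>^m in the coefficients
  cancels the one in the value of the word.\<close>

lemma homog_surj: assumes "y \<in> Zc n" shows "\<exists>f\<in>homog Fr n. \<phi> n f = y"
proof (cases "even n")
 case True
 then obtain m where m: "n = 2 * m" by (elim evenE)
 have yS: "\<chi> ^ m * y \<in> S" using assms True chi_power(2) by (auto simp: Zc_even)
 have "(\<chi> ^ m * y) \<odot>\<^bsub>Fr\<^esub> be (replicate m H2) \<in> homog Fr n"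
  unfolding FA.homog_Fr mem_Collect_eq
 proof (intro conjI P1.smult_closed[OF yS FA.be_Fr] words)
  show "\<forall>w. ((\<chi> ^ m * y) \<odot>\<^bsub>Fr\<^esub> be (replicate m H2)) w ~= 0 --> dg w = n" by (auto simp: basis_elem_def m)
 qed
 moreover have "\<phi> n ((\<chi> ^ m * y) \<odot>\<^bsub>Fr\<^esub> be (replicate m H2)) = (\<chi> ^ m * \<chi> ^ m) * y"
  unfolding phi_smult phi_be by (simp add: m)
 ultimately show ?thesis by (auto simp: chi_power simp del: FA.Fr_simps)
next
 case False
 then obtain m where m: "n = Suc (2 * m)" by (elim oddE) simp
 obtain c where c: "\<forall>j\<in>J. c j \<in> S" "y = (\<Sum>j\<in>J. c j * gx j)"
  using kernel_trace[of y] assms False by (auto simp: Zc_odd)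
 define W where "W = (%k. H1 k # replicate m H2) ` J"
 define f where "f w = (if w \<in> W then \<chi> ^ m * c (case hd w of H1 j => j | H2 => 0) else 0)" for w
 have "finite {w. f w ~= 0}" by (rule finite_subset[of _ W]) (auto simp: f_def W_def)
 moreover have "f w \<in> S" for w using c(1) chi_power(2) by (auto simp: f_def W_def)
 moreover have "f w = 0" if "w \<notin> Uw" for w using that by (auto simp: f_def W_def)
 ultimately have fF: "f \<in> carrier Fr" by auto
 have W: "dg w = n" if "w \<in> W" for w using that m by (auto simp: W_def)
 then have "f \<in> homog Fr n" unfolding FA.homog_Fr using fF by (auto simp: f_def simp del: FA.Fr_simps)
 moreover have "\<phi> n f = (\<Sum>w\<in>W. f w * val w)"
  by (rule phi_only[OF fF]) (auto simp: f_def W_def m split: if_splits)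
 moreover have "\<dots> = (\<Sum>k\<in>J. (\<chi> ^ m * \<chi> ^ m) * (c k * gx k))"
  unfolding W_def by (subst sum.reindex) (auto simp: inj_on_def f_def W_def val_H1 mult_ac simp del: val.simps intro!: sum.cong)
 ultimately show ?thesis by (auto simp: chi_power c(2) simp del: FA.Fr_simps)
qed

lemma homog_Tot: "homog Tot n = \<Phi> ` homog Fr n"
proof (intro subset_antisym subsetI)
 fix x assume "x \<in> homog Tot n"
 then have x: "x n \<in> carrier (E n)" "!!m. m ~= n ==> x m = \<zero>\<^bsub>E m\<^esub>" by (auto simp: total_algebra_def)
 obtain y where y: "y \<in> Zc n" "x n = cl n y" using x(1) by (auto simp: model_facts(3))
 obtain f where f: "f \<in> homog Fr n" "\<phi> n f = y" using homog_surj[OF y(1)] by blast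
 have "\<Phi> f m = x m" for m
  using f(2) y(2) x(2)[of m] phi_homog(1)[OF f(1), of m] by (cases "m = n") (simp_all add: \<Phi>_def model_facts(4))
 then show "x \<in> \<Phi> ` homog Fr n" using f(1) by (intro image_eqI[of _ _ f]) auto
next
 fix x assume "x \<in> \<Phi> ` homog Fr n"
 then obtain f where f: "f \<in> homog Fr n" "x = \<Phi> f" by blast
 show "x \<in> homog Tot n"
  using phi_homog(1)[OF f(1)] E_closed[OF phi_Zc[OF homogD(1)[OF f(1)]]] by (auto simp: f(2) total_algebra_def \<Phi>_def model_facts(4))
qed

lemma carrier_Tot: "carrier Tot = \<Phi> ` carrier Fr"
proof (intro subset_antisym subsetI)
 fix x assume "x \<in> carrier Tot"
 then have x: "!!n. x n \<in> carrier (E n)" "finite {n. x n ~= \<zero>\<^bsub>E n\<^esub>}" by (auto simp: total_algebra_def)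
 have "\<exists>f\<in>homog Fr n. cl n (\<phi> n f) = x n & (x n = \<zero>\<^bsub>E n\<^esub> --> f = \<zero>\<^bsub>Fr\<^esub>)" for n
 proof (cases "x n = \<zero>\<^bsub>E n\<^esub>")
  case True
  have "\<zero>\<^bsub>Fr\<^esub> \<in> homog Fr n" unfolding FA.homog_Fr using FA.Fr.zero_closed by simp
  then show ?thesis using True by (intro bexI[of _ "\<zero>\<^bsub>Fr\<^esub>"]) (simp_all add: model_facts(4))
 next
  case False
  obtain y where "y \<in> Zc n" "x n = cl n y" using x(1)[of n] by (auto simp: model_facts(3))
  then show ?thesis using homog_surj[of y n] False by auto
 qed
 then obtain H where H: "!!n. H n \<in> homog Fr n" "!!n. cl n (\<phi> n (H n)) = x n" "!!n. x n = \<zero>\<^bsub>E n\<^esub> ==> H n = \<zero>\<^bsub>Fr\<^esub>"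
  by metis
 \<comment> \<open>Homogeneous preimages of different degrees have disjoint supports and are glued
   by the degree of the word. Zero components were given the preimage zero, which makes the support
   finite.\<close>
 define f where "f w = H (dg w) w" for w
 have HC: "H n \<in> carrier Fr" for n by (rule homogD(1)[OF H(1)])
 have "{w. f w ~= 0} \<subseteq> (\<Union>n\<in>{n. x n ~= \<zero>\<^bsub>E n\<^esub>}. {w. H n w ~= 0})" using H(3) by (force simp: f_def)
 then have "finite {w. f w ~= 0}" by (rule finite_subset) (intro finite_UN_I x(2) Fr_D(3)[OF HC])
 moreover have "range f \<subseteq> S" using Fr_D(1)[OF HC] by (auto simp: f_def)
 moreover have "f w = 0" if "w \<notin> Uw" for w
 proof (rule ccontr)
  assume "f w ~= 0"
  then have "H (dg w) w ~= 0" by (simp add: f_def)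
  from Fr_D(2)[OF HC this] that show False by blast
 qed
 ultimately have fF: "f \<in> carrier Fr" by auto
 have "\<phi> n f = \<phi> n (H n)" for n
 proof -
  have W: "dg w = n" if "w \<in> {w. H n w ~= 0}" for w using homogD(2)[OF H(1)] that by blast
  have "\<phi> n f = (\<Sum>w | H n w ~= 0. f w * val w)"
   by (rule phi_only[OF fF Fr_D(3)[OF HC]]) (use W in \<open>auto simp: f_def\<close>)
  moreover have "\<phi> n (H n) = (\<Sum>w | H n w ~= 0. H n w * val w)"
   by (rule phi_only[OF HC Fr_D(3)[OF HC]]) (use W in auto)
  moreover have "(\<Sum>w | H n w ~= 0. f w * val w) = (\<Sum>w | H n w ~= 0. H n w * val w)"
   by (rule sum.cong) (use W in \<open>auto simp: f_def\<close>)
  ultimately show ?thesis by simp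
 qed
 then have "\<Phi> f = x" using H(2) by (simp add: \<Phi>_def)
 then show "x \<in> \<Phi> ` carrier Fr" using fF by blast
next
 fix x assume "x \<in> \<Phi> ` carrier Fr"
 then obtain f where f: "f \<in> carrier Fr" "x = \<Phi> f" by blast
 have "\<phi> n f = 0" if "n \<notin> dg ` {w. f w ~= 0}" for n using that by (auto simp: \<phi>_def intro!: sum.neutral)
 then have "\<Phi> f n = \<zero>\<^bsub>E n\<^esub>" if "n \<notin> dg ` {w. f w ~= 0}" for n using that by (simp add: \<Phi>_def model_facts(4))
 then have "{n. \<Phi> f n ~= \<zero>\<^bsub>E n\<^esub>} \<subseteq> dg ` {w. f w ~= 0}" by blast
 then have "finite {n. \<Phi> f n ~= \<zero>\<^bsub>E n\<^esub>}" by (rule finite_subset) (intro finite_imageI Fr_D(3)[OF f(1)])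
 then show "x \<in> carrier Tot" using E_closed[OF phi_Zc[OF f(1)]] by (simp add: total_algebra_def f(2)) (simp add: \<Phi>_def)
qed

theorem presentation: "\<exists>\<psi>. \<psi> \<in> graded_algebra_iso S (h_algebra S s p b) Tot"
 unfolding h_algebra_eq
proof (rule graded_algebra_isoI[where q = q and \<Phi> = \<Phi> and C = "carrier Fr" and H = "homog Fr" and m = "monoid.mult Fr"
   and a = "add Fr" and u = "one Fr" and sm = "module.smult Fr"])
 show "carrier P2.Q = q ` carrier Fr" unfolding P2.carrier_Q P1.carrier_Q image_image q_def ..
 show "homog P2.Q n = q ` homog Fr n" for n unfolding P2.homog_Q P1.homog_Q image_image q_def ..
 show "homog Fr n \<subseteq> carrier Fr" for n using homogD(1) by blast
qed (rule carrier_Tot q_iff homog_Tot q_mult q_add q_one q_smult Phi_mult Phi_add Phi_one Phi_smult FA.Fr.m_closed FA.Fr.a_closed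
   FA.Fr.one_closed P1.smult_closed | assumption)+

end

section \<open>Purely ramified Galois extensions of degree p\<close>

lemma ring_of_type_algebra_simps [simp]:
 "carrier ring_of_type_algebra = UNIV" "x \<otimes>\<^bsub>ring_of_type_algebra\<^esub> y = x * y" "x \<oplus>\<^bsub>ring_of_type_algebra\<^esub> y = x + y"
 "\<one>\<^bsub>ring_of_type_algebra\<^esub> = 1" "\<zero>\<^bsub>ring_of_type_algebra\<^esub> = 0"
 by (simp_all add: ring_of_type_algebra_def)

text \<open>Modulo the maximal ideal p becomes zero, so p lies in that ideal, which is generated by
  \<pi>.\<close>

lemma (in dvr_in_field) residue_char_multiple:
 assumes "residue_char R p" shows "\<exists>y\<in>R. of_nat p = y * \<pi>"
proof -
 let ?M = "{x * \<pi> | x. x \<in> R}"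
 have I: "ideal ?M (ring_on R)" using maximal by (rule maximalideal.axioms(1))
 interpret k: ring "ring_on R Quot ?M" by (rule ideal.quotient_is_ring[OF I])
 have hom: "(+>\<^bsub>ring_on R\<^esub>) ?M \<in> ring_hom (ring_on R) (ring_on R Quot ?M)" by (rule ideal.rcos_ring_hom[OF I])
 have N: "of_nat n \<in> R" for n by (induction n) auto
 have one: "\<one>\<^bsub>ring_on R Quot ?M\<^esub> = ?M +>\<^bsub>ring_on R\<^esub> 1" using ring_hom_one[OF hom] by simp
 have pow: "[n] \<cdot>\<^bsub>ring_on R Quot ?M\<^esub> \<one>\<^bsub>ring_on R Quot ?M\<^esub> = ?M +>\<^bsub>ring_on R\<^esub> (of_nat n)" for n :: nat
 proof (induction n)
  case 0
  show ?case using ring_hom_zero[OF hom cring.axioms(1)[OF cring_R] k.ring_axioms] by simp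
 next
  case (Suc n)
  have "of_nat n \<in> carrier (ring_on R)" "1 \<in> carrier (ring_on R)" using N[of n] closed(2) by simp_all
  from ring_hom_add[OF hom this]
  have a: "?M +>\<^bsub>ring_on R\<^esub> (of_nat n + 1) = (?M +>\<^bsub>ring_on R\<^esub> (of_nat n)) \<oplus>\<^bsub>ring_on R Quot ?M\<^esub> (?M +>\<^bsub>ring_on R\<^esub> 1)"
   by (simp only: ring_on_simps)
  have "[Suc n] \<cdot>\<^bsub>ring_on R Quot ?M\<^esub> \<one>\<^bsub>ring_on R Quot ?M\<^esub>
   = [n] \<cdot>\<^bsub>ring_on R Quot ?M\<^esub> \<one>\<^bsub>ring_on R Quot ?M\<^esub> \<oplus>\<^bsub>ring_on R Quot ?M\<^esub> \<one>\<^bsub>ring_on R Quot ?M\<^esub>"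
   by (simp only: add_pow_def nat_pow_def old.nat.simps(7) monoid.simps)
  also have "\<dots> = ?M +>\<^bsub>ring_on R\<^esub> (of_nat n + 1)" unfolding a Suc unfolding one ..
  also have "(of_nat n + 1 :: 'l) = of_nat (Suc n)" by simp
  finally show ?case .
 qed
 have all: "!!M. maximalideal M (ring_on R) ==>
   [p] \<cdot>\<^bsub>ring_on R Quot M\<^esub> \<one>\<^bsub>ring_on R Quot M\<^esub> = \<zero>\<^bsub>ring_on R Quot M\<^esub>"
  using assms dvd_refl[of p] unfolding residue_char_def Let_def by simp
 have "?M +>\<^bsub>ring_on R\<^esub> (of_nat p) = \<zero>\<^bsub>ring_on R Quot ?M\<^esub>"
  using all[OF maximal] unfolding pow .
 then have "?M +>\<^bsub>ring_on R\<^esub> (of_nat p) = ?M" unfolding FactRing_def ring.simps .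
 moreover have "of_nat p \<in> ?M +>\<^bsub>ring_on R\<^esub> (of_nat p)"
  using abelian_subgroup.a_rcos_self[OF abelian_subgroupI3[OF ideal.axioms(1)[OF I] ring.is_abelian_group[OF cring.axioms(1)[OF cring_R]]]] N[of p] by simp
 ultimately show ?thesis by auto
qed

text \<open>Divisibility by \<tau>^n means n <= \<open>\<nu> x\<close>, so the supremum is attained.
  The uniformizer \<tau> may differ from t, as it does in \<open>purely_ramified\<close>.\<close>

lemma (in valuation_frame) val_eq_nu:
 assumes "\<tau> \<in> T" "\<tau> ~= 0" "\<nu> \<tau> = 1" "x \<in> T" "x ~= 0"
 shows "val T \<tau> x = enat (nat (\<nu> x))"
proof -
 have pos: "\<nu> x \<ge> 0" using assms(4,5) by (simp add: mem_T_iff)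
 have "(\<exists>y\<in>T. x = \<tau> ^ n * y) \<longleftrightarrow> n \<le> nat (\<nu> x)" for n
 proof
  assume "\<exists>y\<in>T. x = \<tau> ^ n * y"
  then obtain y where y: "y \<in> T" "x = \<tau> ^ n * y" by blast
  then have "y ~= 0" "\<nu> x = int n + \<nu> y" using assms by (auto simp: nu_mult nu_power)
  then show "n \<le> nat (\<nu> x)" using y(1) by (auto simp: mem_T_iff)
 next
  assume n: "n \<le> nat (\<nu> x)"
  have "\<nu> (x / \<tau> ^ n) = \<nu> x - int n" using assms by (simp add: nu_divide nu_power)
  moreover have "int n \<le> \<nu> x" using n pos by linarith
  ultimately have "x / \<tau> ^ n \<in> T" by (simp add: mem_T_iff)
  then show "\<exists>y\<in>T. x = \<tau> ^ n * y" using assms(2) by (intro bexI[of _ "x / \<tau> ^ n"]) simp_all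
 qed
 then have "{enat n | n. \<exists>y\<in>T. x = \<tau> ^ n * y} = {enat n | n. n \<le> nat (\<nu> x)}" by simp
 then show ?thesis unfolding val_def by (auto intro!: antisym Sup_least Sup_upper)
qed

section \<open>Valuation data extracted from the Galois and ramification hypotheses\<close>

locale ramified_galois_extension =
 fixes S T K :: "'l::field set" and G :: "('l => 'l) set" and \<sigma> :: "'l => 'l" and t s :: 'l and p b :: nat
  and \<pi> \<tau> :: 'l and n :: nat and B :: "'l set"
 assumes prime_p: "prime p" and p_ge_3: "p \<ge> 3" and dvr_S: "dvr S" and dvr_T: "dvr T"
  and S_sub: "S \<subseteq> T" and B: "finite B" "T = {\<Sum>v\<in>B. c v * v | c. c \<in> B \<rightarrow> S}"
  and rc: "residue_char T p" and frac: "fraction_field T = UNIV" and K: "K = fraction_field S"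
  and gal: "{x. \<forall>\<rho>\<in>galois_group K. \<rho> x = x} = K" and G: "G = galois_group K"
  and G_range: "G = range (\<lambda>k::nat. \<sigma> ^^ k)" and card_G: "card G = p"
  and unif_t: "uniformizer T t" and s: "s = galois_norm G t"
  and b: "enat b = val T t (\<sigma> t - t) - 1" "b \<ge> 1"
  and unif_pi: "uniformizer S \<pi>" and unif_tau: "uniformizer T \<tau>"
  and dim: "ring.dimension ring_of_type_algebra n K (UNIV :: 'l set)" and val_pi: "val T \<tau> \<pi> = enat n"
begin

sublocale DT: dvr_in_field T t by unfold_locales (fact dvr_T, fact unif_t)

sublocale DU: dvr_in_field T \<tau> by unfold_locales (fact dvr_T, fact unif_tau)

sublocale DS: dvr_in_field S \<pi> by unfold_locales (fact dvr_S, fact unif_pi)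

sublocale valuation_frame T t
proof
 show "\<exists>y\<in>T. \<exists>z\<in>T. z ~= 0 & x = y / z" for x
 proof -
  have "x \<in> fraction_field T" using frac by simp
  then show ?thesis unfolding fraction_field_def by blast
 qed
qed (use DT.pi_nonzero DT.pi_not_unit DT.factorization in auto)

lemma sigma_G: "\<sigma> \<in> G"
proof -
 have "\<sigma> ^^ 1 \<in> G" unfolding G_range by (rule rangeI)
 then show ?thesis by simp
qed

lemma G_hom: assumes "\<rho> \<in> G"
 shows "\<rho> (x + y) = \<rho> x + \<rho> y" "\<rho> (x * y) = \<rho> x * \<rho> y" "\<rho> 1 = 1" "k \<in> K ==> \<rho> k = k"
proof -
 have h: "\<rho> \<in> ring_hom ring_of_type_algebra ring_of_type_algebra" "\<forall>x\<in>K. \<rho> x = x"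
  using assms unfolding G galois_group_def ring_iso_def by auto
 show "\<rho> (x + y) = \<rho> x + \<rho> y" using ring_hom_add[OF h(1), of x y] by simp
 show "\<rho> (x * y) = \<rho> x * \<rho> y" using ring_hom_mult[OF h(1), of x y] by simp
 show "\<rho> 1 = 1" using ring_hom_one[OF h(1)] by simp
 show "k \<in> K ==> \<rho> k = k" using h(2) by blast
qed

lemmas sig = G_hom[OF sigma_G]

lemma sig_zero: "\<sigma> 0 = 0"
 using sig(1)[of 0 0] by (metis add_cancel_right_right add_0)

lemma sig_nonzero: "x ~= 0 ==> \<sigma> x ~= 0"
 using sig(2)[of x "inverse x"] sig(3) by auto

lemma sig_inverse: "\<sigma> (inverse x) = inverse (\<sigma> x)"
proof (cases "x = 0")
 case False
 then have "\<sigma> x * \<sigma> (inverse x) = 1" using sig(2)[of x "inverse x"] sig(3) by simp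
 then show ?thesis by (simp add: inverse_unique)
qed (simp add: sig_zero)

lemma sig_uminus: "\<sigma> (- x) = - \<sigma> x"
 using sig(1)[of x "- x"] sig_zero by (simp add: eq_neg_iff_add_eq_0 add.commute)

lemma sig_sum: "\<sigma> (sum f I) = (\<Sum>i\<in>I. \<sigma> (f i))"
 by (induction I rule: infinite_finite_induct) (auto simp: sig sig_zero)

lemma sig_prod: "\<sigma> (prod f I) = (\<Prod>i\<in>I. \<sigma> (f i))"
 by (induction I rule: infinite_finite_induct) (auto simp: sig)

lemma sig_power: "\<sigma> (x ^ k) = \<sigma> x ^ k"
 by (induction k) (auto simp: sig)

lemma S_K: "x \<in> S ==> x \<in> K"
 unfolding K fraction_field_def using DS.closed(2) by (intro CollectI exI[of _ x] exI[of _ 1]) simp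

lemma K_iff: "x \<in> K \<longleftrightarrow> \<sigma> x = x"
proof
 assume x: "\<sigma> x = x"
 have "(\<sigma> ^^ k) x = x" for k by (induction k) (auto simp: x)
 then have "\<forall>\<rho>\<in>galois_group K. \<rho> x = x" unfolding G[symmetric] G_range by auto
 then show "x \<in> K" using gal by blast
qed (rule sig(4))

text \<open>As \<open>T\<close> is spanned by the finite set \<open>B\<close> over \<open>S\<close>,
  the conjugates of all powers of x lie in one \<open>F (- N)\<close>. A conjugate of negative
  valuation would violate this bound at the exponent N + 1.\<close>

lemma sig_T: assumes x: "x \<in> T" shows "\<sigma> x \<in> T"
proof (rule ccontr)
 assume nT: "\<sigma> x \<notin> T"
 then have neg: "\<nu> (\<sigma> x) < 0" "\<sigma> x ~= 0" by (auto simp: mem_T_iff)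
 define N where "N = nat (\<Sum>v\<in>B. \<bar>\<nu> (\<sigma> v)\<bar>)"
 have Nv: "\<sigma> v \<in> F (- int N)" if "v \<in> B" for v
 proof -
  have "\<bar>\<nu> (\<sigma> v)\<bar> \<le> (\<Sum>v\<in>B. \<bar>\<nu> (\<sigma> v)\<bar>)" by (rule member_le_sum[OF that]) (use B(1) in auto)
  moreover have "0 \<le> (\<Sum>v\<in>B. \<bar>\<nu> (\<sigma> v)\<bar>)" by (rule sum_nonneg) simp
  ultimately have "- int N \<le> \<nu> (\<sigma> v)" unfolding N_def by linarith
  then show ?thesis by (simp add: F_def)
 qed
 obtain c where c: "c \<in> B \<rightarrow> S" "x ^ Suc N = (\<Sum>v\<in>B. c v * v)" using power_T[OF x, of "Suc N"] unfolding B(2) by blast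
 have "\<sigma> (x ^ Suc N) = (\<Sum>v\<in>B. c v * \<sigma> v)"
  unfolding c(2) sig_sum by (rule sum.cong) (use funcset_mem[OF c(1)] S_K in \<open>simp_all add: sig\<close>)
 also have "\<dots> \<in> F (- int N)" using c(1) S_sub Nv by (intro F_sum F_mult_T) auto
 finally have "\<sigma> x ^ Suc N \<in> F (- int N)" by (simp only: sig_power)
 then have "\<nu> (\<sigma> x ^ Suc N) \<ge> - int N" using neg(2) by (auto simp: F_def)
 then have "int (Suc N) * \<nu> (\<sigma> x) \<ge> - int N" unfolding nu_power[OF neg(2)] .
 moreover have "int (Suc N) * \<nu> (\<sigma> x) \<le> int (Suc N) * (-1)" using neg(1) by (intro mult_left_mono) auto
 ultimately show False by simp
qed

lemma nu_tau: "\<nu> \<tau> = 1"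
proof -
 obtain k u where u: "u \<in> T" "inverse u \<in> T" "t = \<tau> ^ k * u" using DU.factorization[OF t_T t_nonzero] by blast
 have u0: "u ~= 0" using u(3) t_nonzero by auto
 then have "\<nu> u = 0" using u by (intro nu_tunit) (simp add: tunit_def)
 then have "int k * \<nu> \<tau> = 1" using u0 arg_cong[OF u(3), of \<nu>] DU.pi_nonzero by (simp add: nu_mult nu_power)
 moreover have "\<nu> \<tau> \<ge> 0" using DU.pi_in DU.pi_nonzero by (simp add: mem_T_iff)
 ultimately show ?thesis using zmult_eq_1_iff[of "int k" "\<nu> \<tau>"] by linarith
qed

lemma pi_T: "\<pi> \<in> T" "\<pi> ~= 0"
 using DS.pi_in S_sub DS.pi_nonzero by auto

lemma nu_pi: "\<nu> \<pi> = int n"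
proof -
 have "\<nu> \<pi> \<ge> 0" using pi_T by (simp add: mem_T_iff)
 moreover have "enat (nat (\<nu> \<pi>)) = enat n"
  using val_eq_nu[OF DU.pi_in DU.pi_nonzero nu_tau pi_T] val_pi by simp
 ultimately show ?thesis by simp
qed

lemma nu_S: assumes "x \<in> S" "x ~= 0" shows "\<exists>i u. u \<in> S & inverse u \<in> S & u ~= 0 & x = \<pi> ^ i * u & \<nu> x = int i * int n"
proof -
 obtain i u where u: "u \<in> S" "inverse u \<in> S" "x = \<pi> ^ i * u" using DS.factorization[OF assms] by blast
 have u0: "u ~= 0" using u(3) assms(2) by auto
 then have "\<nu> u = 0" using u S_sub by (intro nu_tunit) (auto simp: tunit_def)
 then show ?thesis using u u0 pi_T by (intro exI[of _ i] exI[of _ u]) (simp add: nu_mult nu_power nu_pi)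
qed

lemma nu_K: assumes "x \<in> K" "x ~= 0" shows "int n dvd \<nu> x"
proof -
 obtain y z where yz: "y \<in> S" "z \<in> S" "z ~= 0" "x = y / z" using assms(1) unfolding K fraction_field_def by blast
 then have y0: "y ~= 0" using assms(2) by auto
 have "int n dvd \<nu> y" "int n dvd \<nu> z" using nu_S[OF yz(1) y0] nu_S[OF yz(2,3)] by auto
 then show ?thesis using yz y0 by (simp add: nu_divide)
qed

lemma K_closed: "x \<in> K ==> y \<in> K ==> x + y \<in> K" "x \<in> K ==> y \<in> K ==> x * y \<in> K" "x \<in> K ==> - x \<in> K"
 "x \<in> K ==> inverse x \<in> K" "0 \<in> K" "1 \<in> K"
 by (auto simp: K_iff sig sig_inverse sig_uminus sig_zero)

interpretation R: field "ring_of_type_algebra :: 'l ring" by (rule field_from_type_algebra)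

lemma subfield_K: "subfield K ring_of_type_algebra"
proof (rule R.subfieldI')
 have um: "\<ominus>\<^bsub>ring_of_type_algebra\<^esub> x = - x" for x :: 'l
  using R.minus_equality[of "- x" x] by simp
 show "subring K ring_of_type_algebra"
  by (rule R.subringI) (use K_closed um in auto)
 fix k assume k: "k \<in> K - {\<zero>\<^bsub>ring_of_type_algebra\<^esub>}"
 then have "m_inv ring_of_type_algebra k = inverse k"
  by (intro R.inv_unique'[symmetric]) auto
 then show "m_inv ring_of_type_algebra k \<in> K" using k K_closed by auto
qed

lemma n_pos: "n ~= 0"
proof
 assume "n = 0"
 then have "(UNIV :: 'l set) = {0}" using R.dimension_zero[OF subfield_K] dim by simp
 then have "(1 :: 'l) \<in> {0}" by blast
 then show False by simp
qed

text \<open>A fixed element of \<open>T\<close> is a quotient of elements of \<open>S\<close>, each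
  a power of \<pi> times a unit. Since \<pi> has positive valuation in \<open>T\<close>, integrality
  in \<open>T\<close> makes the resulting power of \<pi> nonnegative.\<close>

lemma S_fixed: "S = {x \<in> T. \<sigma> x = x}"
proof (intro subset_antisym subsetI)
 fix x assume "x \<in> {x \<in> T. \<sigma> x = x}"
 then have x: "x \<in> T" "x \<in> K" by (auto simp: K_iff)
 show "x \<in> S"
 proof (cases "x = 0")
  case False
  obtain y z where yz: "y \<in> S" "z \<in> S" "z ~= 0" "x = y / z" using x(2) unfolding K fraction_field_def by blast
  then have y0: "y ~= 0" using False by auto
  obtain i u where u: "u \<in> S" "u ~= 0" "y = \<pi> ^ i * u" "\<nu> y = int i * int n" using nu_S[OF yz(1) y0] by blast
  obtain j v where v: "inverse v \<in> S" "v ~= 0" "z = \<pi> ^ j * v" "\<nu> z = int j * int n" using nu_S[OF yz(2,3)] by blast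
  have "0 \<le> \<nu> x" using x(1) False by (simp add: mem_T_iff)
  then have "int j * int n \<le> int i * int n" using u(4) v(4) yz y0 by (simp add: nu_divide)
  then have ji: "j \<le> i" using n_pos by simp
  then have "x = \<pi> ^ (i - j) * (u * inverse v)"
   unfolding yz(4) u(3) v(3) using pi_T v(2) by (simp add: power_diff field_simps)
  then show ?thesis using u(1) v(1) by auto
 qed auto
qed (use S_sub S_K K_iff in auto)

lemma delta_t: "\<sigma> t - t ~= 0" "\<nu> (\<sigma> t - t) = int b + 1"
proof -
 \<comment> \<open>The subtraction in \<open>enat\<close> neither truncates, because b >= 1, nor
   involves infinity, because the result is finite.\<close>
 obtain m where m: "val T t (\<sigma> t - t) = enat m" "m = b + 1"
  using b by (cases "val T t (\<sigma> t - t)") (auto simp: one_enat_def)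
 show nz: "\<sigma> t - t ~= 0"
 proof
  assume z: "\<sigma> t - t = 0"
  have "enat (Suc m) \<le> val T t (\<sigma> t - t)"
   unfolding val_def z by (rule Sup_upper) (auto intro!: exI[of _ "Suc m"] bexI[of _ 0])
  then show False using m by simp
 qed
 have dT: "\<sigma> t - t \<in> T" using sig_T by auto
 then have "\<nu> (\<sigma> t - t) \<ge> 0" using nz by (simp add: mem_T_iff)
 moreover have "enat (nat (\<nu> (\<sigma> t - t))) = enat m" using val_eq_nu[OF t_T t_nonzero nu_t dT nz] m(1) by simp
 ultimately show "\<nu> (\<sigma> t - t) = int b + 1" using m(2) by simp
qed

lemma nu_orbit: "(\<sigma> ^^ k) t ~= 0 & \<nu> ((\<sigma> ^^ k) t) = 1"
proof (induction k)
 case (Suc k)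
 define y where "y = (\<sigma> ^^ k) t"
 obtain u where u: "tunit u" "y = t powi \<nu> y * u" using Suc nu_decompose[of y] unfolding y_def by blast
 then have y: "y = t * u" using Suc by (simp add: y_def)
 have "\<sigma> t - t \<in> F (1 + 1)" using delta_t b(2) by (simp add: F_def)
 then have st: "\<sigma> t ~= 0" "\<nu> (\<sigma> t) = 1" using nu_eqI[of t 1 "\<sigma> t"] by auto
 have "tunit (\<sigma> u)" using u(1) sig_T[of u] sig_T[of "inverse u"] sig_nonzero by (auto simp: tunit_def sig_inverse)
 then have su: "\<sigma> u ~= 0" "\<nu> (\<sigma> u) = 0" using nu_tunit by (auto simp: tunit_def)
 have "(\<sigma> ^^ Suc k) t = \<sigma> t * \<sigma> u" using sig(2)[of t u] y by (simp add: y_def)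
 then show ?case using st su by (simp add: nu_mult del: funpow.simps)
qed simp

lemma finite_G: "finite G"
 using card_G prime_p prime_gt_0_nat[of p] by (intro card_ge_0_finite) simp

lemma s_props': "s \<in> K" "s ~= 0" "\<nu> s = int p"
proof -
 have G1: "\<rho> t ~= 0 & \<nu> (\<rho> t) = 1" if "\<rho> \<in> G" for \<rho> using that nu_orbit unfolding G_range by auto
 show "s ~= 0" unfolding s galois_norm_def using finite_G G1 by simp
 have "\<nu> s = (\<Sum>\<rho>\<in>G. \<nu> (\<rho> t))" unfolding s galois_norm_def using G1 by (intro nu_prod finite_G) auto
 then show "\<nu> s = int p" using G1 card_G by simp
 have inj: "inj \<sigma>"
 proof (rule injI)
  fix x y assume "\<sigma> x = \<sigma> y"
  then have "\<sigma> (x + - y) = 0" by (simp only: sig sig_uminus) simp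
  then show "x = y" using sig_nonzero[of "x + - y"] by auto
 qed
 have "(%\<rho>. \<sigma> \<circ> \<rho>) ` G \<subseteq> G"
 proof (clarsimp simp: G_range simp del: o_apply)
  fix k
  have "\<sigma> \<circ> \<sigma> ^^ k = \<sigma> ^^ Suc k" by simp
  then show "\<sigma> \<circ> \<sigma> ^^ k \<in> range (%k. \<sigma> ^^ k)" by blast
 qed
 moreover have inj': "inj_on (%\<rho>. \<sigma> \<circ> \<rho>) G"   proof (rule inj_onI)
  fix \<rho> \<rho>' assume e: "\<sigma> \<circ> \<rho> = \<sigma> \<circ> \<rho>'"
  show "\<rho> = \<rho>'"
  proof
   fix x
   have "\<sigma> (\<rho> x) = \<sigma> (\<rho>' x)" using fun_cong[OF e, of x] by simp
   then show "\<rho> x = \<rho>' x" by (rule injD[OF inj])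
  qed
 qed
 ultimately have im: "(%\<rho>. \<sigma> \<circ> \<rho>) ` G = G" using endo_inj_surj[OF finite_G] by blast
 have "s = (\<Prod>\<rho>\<in>(%\<rho>. \<sigma> \<circ> \<rho>) ` G. \<rho> t)" unfolding im s galois_norm_def ..
 also have "\<dots> = \<sigma> s" unfolding prod.reindex[OF inj'] s galois_norm_def sig_prod by simp
 finally show "s \<in> K" by (simp add: K_iff)
qed

text \<open>n is both the degree and the ramification index, so it divides the valuation p of the
  norm s. If n were 1, L would equal K and \<sigma> would fix t.\<close>

lemma n_eq_p: "n = p"
proof -
 have "int n dvd int p" using nu_K[OF s_props'(1,2)] s_props'(3) by simp
 then have "n = 1 \<or> n = p" using prime_p unfolding prime_nat_iff by auto
 moreover have "n ~= 1"
 proof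
  assume "n = 1"
  then have d: "ring.dimension ring_of_type_algebra (Suc 0) K (UNIV :: 'l set)" using dim by simp
  obtain v E where vE: "(UNIV :: 'l set) = ring.line_extension ring_of_type_algebra K v E" "ring.dimension ring_of_type_algebra 0 K E"
   using d by (cases rule: R.dimension.cases) auto
  have E: "E = {0}" using R.dimension_zero[OF subfield_K vE(2)] by simp
  have mult: "\<exists>k\<in>K. x = k * v" for x
  proof -
   have "x \<in> ring.line_extension ring_of_type_algebra K v E" using vE(1) by blast
   then show ?thesis unfolding R.line_extension_mem_iff E by simp
  qed
  obtain k where k: "k \<in> K" "1 = k * v" using mult by blast
  then have "v = inverse k" by (simp add: inverse_unique)
  then have "v \<in> K" using k(1) K_closed(4) by simp
  then have "t \<in> K" using mult[of t] K_closed(2) by blast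
  then show False using delta_t(1) by (simp add: K_iff)
 qed
 ultimately show ?thesis by blast
qed

lemma nu_coeff: assumes "a \<in> K" "a ~= 0" "w ~= 0" shows "\<nu> (a * w) mod int p = \<nu> w mod int p"
 using nu_K[OF assms(1,2)] assms n_eq_p by (auto simp: nu_mult elim!: dvdE)

text \<open>In a linear relation the summands would have valuations distinct modulo p, as
  coefficients in K contribute multiples of p; hence the vectors are independent. There are p of
  them, and p = n is the dimension.\<close>

lemma adapted_span:
 assumes I: "finite I" "card I = p" and w: "!!i. i \<in> I ==> w i ~= 0" and inj: "inj_on (%i. \<nu> (w i) mod int p) I"
 shows "\<exists>a. (\<forall>i\<in>I. \<sigma> (a i) = a i) & x = (\<Sum>i\<in>I. a i * w i)"
proof -
 have span: "y \<in> ring.Span ring_of_type_algebra K (map w js) ==> \<exists>a. (\<forall>i. a i \<in> K) & y = (\<Sum>i\<in>set js. a i * w i)"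
  if "distinct js" for js y
  using that
 proof (induction js arbitrary: y)
  case Nil
  then show ?case using K_closed by (auto simp: R.Span.simps)
 next
  case (Cons i js)
  then have "y \<in> ring.line_extension ring_of_type_algebra K (w i) (ring.Span ring_of_type_algebra K (map w js))" by simp
  then obtain k v where k: "k \<in> K" "v \<in> ring.Span ring_of_type_algebra K (map w js)" "y = k * w i + v"
   unfolding R.line_extension_mem_iff by auto
  obtain a where a: "\<forall>i. a i \<in> K" "v = (\<Sum>i\<in>set js. a i * w i)" using Cons.IH[OF k(2)] Cons.prems by auto
  have "(\<Sum>j\<in>set js. (a(i := k)) j * w j) = (\<Sum>j\<in>set js. a j * w j)" by (rule sum.cong) (use Cons.prems in auto)
  then show ?case using k a Cons.prems(2) by (intro exI[of _ "a(i := k)"]) auto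
 qed
 have indep: "distinct js ==> set js \<subseteq> I ==> ring.independent ring_of_type_algebra K (map w js)" for js
 proof (induction js)
  case (Cons i js)
  have "w i \<notin> ring.Span ring_of_type_algebra K (map w js)"
  proof
   assume "w i \<in> ring.Span ring_of_type_algebra K (map w js)"
   then obtain a where a: "\<forall>i. a i \<in> K" "w i = (\<Sum>j\<in>set js. a j * w j)" using span Cons.prems by fastforce
   define f where "f j = (if j = i then - w i else a j * w j)" for j
   have f: "\<nu> (f j) mod int p = \<nu> (w j) mod int p" if "j \<in> set (i # js)" "f j ~= 0" for j
    using that a(1) nu_coeff[of "a j" "w j"] by (auto simp: f_def split: if_splits)
   have "(\<Sum>j\<in>set js. f j) = w i" unfolding a(2) by (rule sum.cong) (use Cons.prems in \<open>auto simp: f_def a(2)[symmetric]\<close>)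
   then have "sum f (set (i # js)) = 0" using Cons.prems by (simp add: f_def)
   moreover have "f i \<in> F (\<nu> (w i) + 1)"
   proof (rule sum_distinct_nu[where I = "set (i # js)"])
    show "sum f (set (i # js)) \<in> F (\<nu> (w i) + 1)" using calculation by simp
    show "\<nu> (f j) ~= \<nu> (f k)" if "j \<in> set (i # js)" "k \<in> set (i # js)" "j ~= k" "f j ~= 0" "f k ~= 0" for j k
    proof
     assume "\<nu> (f j) = \<nu> (f k)"
     then have "\<nu> (w j) mod int p = \<nu> (w k) mod int p" using f[OF that(1,4)] f[OF that(2,5)] by simp
     from inj_onD[OF inj this] show False using that(1,2,3) Cons.prems(2) by blast
    qed
   qed auto
   ultimately show False using w[of i] Cons.prems(2) by (simp add: f_def F_def)
  qed
  then show ?case using Cons by (auto intro!: R.li_Cons simp del: R.Span.simps)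
 qed simp
 obtain l where l: "set l = I" "distinct l" using finite_distinct_list[OF I(1)] by blast
 have "ring.Span ring_of_type_algebra K (map w l) = UNIV"
  using R.independent_length_eq_dimension[OF subfield_K dim indep[OF l(2)]] l I(2) n_eq_p distinct_card[OF l(2)] by simp
 then have "x \<in> ring.Span ring_of_type_algebra K (map w l)" by simp
 from span[OF l(2) this] show ?thesis unfolding l(1) by (auto simp: K_iff)
qed

lemma cyclic: "cyclic_action T S \<sigma> p G"
 by unfold_locales (use sig sig_T G_range card_G p_ge_3 S_fixed in auto)

theorem wild: "wild_extension T S t \<sigma> p G b s"
proof -
 interpret C: cyclic_action T S \<sigma> p G by (rule cyclic)
 show ?thesis
 proof
  show "of_nat p \<in> F 1"
  proof -
   obtain y where "y \<in> T" "of_nat p = y * t" using DT.residue_char_multiple[OF rc] by blast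
   then show ?thesis using F_mult_T[of y t 1] by (simp add: F_def)
  qed
  show "int p dvd \<nu> a" if "\<sigma> a = a" "a ~= 0" for a using nu_K[of a] that n_eq_p by (simp add: K_iff)
  show "C.\<delta> t ~= 0" "\<nu> (C.\<delta> t) = int b + 1" using delta_t by (simp_all add: C.\<delta>_def)
  show "s = (\<Prod>\<rho>\<in>G. \<rho> t)" by (simp add: s galois_norm_def)
 qed (use prime_p p_ge_3 b(2) adapted_span in auto)
qed

end

text \<open>By \<open>q_iff\<close> both evaluation maps on the free algebra have the fibres of q,
  so they can be compared directly and no isomorphism has to be inverted.\<close>

lemma cohomology_models_isomorphic:
 assumes M: "cohomology_presentation T S t \<sigma> p G b s E pr e cl \<chi>" and N: "cohomology_presentation T S t \<sigma> p G b s E' pr' e' cl' \<chi>'"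
 shows "\<exists>\<psi>. \<psi> \<in> graded_algebra_iso S (total_algebra E pr e) (total_algebra E' pr' e')"
proof -
 interpret M: cohomology_presentation T S t \<sigma> p G b s E pr e cl \<chi> by (rule M)
 note rules = cohomology_presentation.carrier_Tot cohomology_presentation.homog_Tot cohomology_presentation.Phi_mult
  cohomology_presentation.Phi_add cohomology_presentation.Phi_one cohomology_presentation.Phi_smult
 show ?thesis
 proof (rule graded_algebra_isoI[where q = M.\<Phi> and \<Phi> = "cohomology_presentation.\<Phi> T t \<sigma> p G b s cl' \<chi>'" and C = "carrier M.Fr"
   and H = "homog M.Fr" and m = "monoid.mult M.Fr" and a = "add M.Fr" and u = "one M.Fr" and sm = "module.smult M.Fr"])
  show "M.\<Phi> f = M.\<Phi> g \<longleftrightarrow> cohomology_presentation.\<Phi> T t \<sigma> p G b s cl' \<chi>' f = cohomology_presentation.\<Phi> T t \<sigma> p G b s cl' \<chi>' g"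
   if "f \<in> carrier M.Fr" "g \<in> carrier M.Fr" for f g
   using cohomology_presentation.q_iff[OF N that] M.q_iff[OF that] by (simp only:)
  show "homog M.Fr n \<subseteq> carrier M.Fr" for n using M.homogD(1) by blast
 qed (rule rules[OF M] rules[OF N] M.FA.Fr.m_closed M.FA.Fr.a_closed M.FA.Fr.one_closed M.P1.smult_closed | assumption)+
qed

theorem theorem4p10:
  fixes S T K :: "'l::field set"
    and G :: "('l \<Rightarrow> 'l) set"
    and \<sigma> :: "'l \<Rightarrow> 'l"
    and t s :: 'l
    and p b :: nat
    and P :: "nat \<Rightarrow> (('l \<Rightarrow> 'l) \<Rightarrow> 'l, 'm) module"
    and d :: "nat \<Rightarrow> 'm \<Rightarrow> 'm"
    and \<epsilon> :: "'m \<Rightarrow> 'l"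
  assumes "prime p" and "p \<ge> 3"
    and "dvr S" and "dvr T" and "finite_extension S T" and "purely_ramified S T"
    and "residue_char S p" and "residue_char T p"
    and "fraction_field T = UNIV" and "K = fraction_field S"
    and "galois_extension K" and "G = galois_group K"
    and "G = range (\<lambda>k::nat. \<sigma> ^^ k)" and "card G = p"
    and "uniformizer T t" and "s = galois_norm G t"
    and "enat b = val T t (\<sigma> t - t) - 1" and "b \<ge> 1"
    and "val S s (of_nat p) \<ge> enat (b - b div p)"
    and "projective_resolution (twisted_group_ring G T) (galois_module G T) P d \<epsilon>"
  shows "\<exists>\<phi> \<psi>.
    \<phi> \<in> graded_algebra_iso S (h_algebra S s p b)
          (ext_algebra (twisted_group_ring G T) (galois_module G T) P d \<epsilon>) \<and>
    \<psi> \<in> graded_algebra_iso S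
          (ext_algebra (twisted_group_ring G T) (galois_module G T) P d \<epsilon>)
          (group_cohomology_algebra G T S)"
proof -
  obtain B where B: "S \<subseteq> T" "finite B" "T = {\<Sum>v\<in>B. c v * v | c. c \<in> B \<rightarrow> S}"
    using assms(5) unfolding finite_extension_def by blast
  obtain \<pi> \<tau> n where ram: "uniformizer S \<pi>" "uniformizer T \<tau>"
      "ring.dimension ring_of_type_algebra n (fraction_field S) (fraction_field T)" "val T \<tau> \<pi> = enat n"
    using assms(6) unfolding purely_ramified_def by blast
  have dim: "ring.dimension ring_of_type_algebra n K (UNIV :: 'l set)" using ram(3) assms(9,10) by simp
  have gal: "{x. \<forall>\<rho>\<in>galois_group K. \<rho> x = x} = K" using assms(11) unfolding galois_extension_def by blast
  have "ramified_galois_extension S T K G \<sigma> t s p b \<pi> \<tau> n B"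
    by (rule ramified_galois_extension.intro) (fact assms B ram dim gal)+
  then have wild: "wild_extension T S t \<sigma> p G b s" by (rule ramified_galois_extension.wild)
  interpret W: wild_extension T S t \<sigma> p G b s by (rule wild)
  interpret Ex: ext_setup T S \<sigma> p G P d \<epsilon> by unfold_locales (fact assms(20))
  \<comment> \<open>The ring axioms are part of the hypothesis that P consists of right
    modules.\<close>
  have "ring (twisted_group_ring G T)" using Ex.right_P[of 0] by (simp add: right_module_def)
  then interpret Gr: bar_setup T S \<sigma> p G by unfold_locales
  have ext: "ext_algebra (twisted_group_ring G T) (galois_module G T) P d \<epsilon>
    = total_algebra (ext_module (twisted_group_ring G T) P d (galois_module G T))
      (yoneda_product (twisted_group_ring G T) (galois_module G T) P d \<epsilon>) (ext_class (twisted_group_ring G T) P d (galois_module G T) 0 \<epsilon>)"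
    by (simp only: ext_algebra_def)
  note M = cohomology_presentation.intro[OF wild cohomology_presentation_axioms.intro[OF Ex.ext_model]]
  note N = cohomology_presentation.intro[OF wild cohomology_presentation_axioms.intro[OF Gr.group_cohomology_model]]
  obtain \<phi> where \<phi>: "\<phi> \<in> graded_algebra_iso S (h_algebra S s p b) (ext_algebra (twisted_group_ring G T) (galois_module G T) P d \<epsilon>)"
    using cohomology_presentation.presentation[OF M] unfolding ext by blast
  have "\<exists>\<psi>. \<psi> \<in> graded_algebra_iso S (ext_algebra (twisted_group_ring G T) (galois_module G T) P d \<epsilon>) (group_cohomology_algebra G T S)"
    unfolding ext group_cohomology_algebra_def by (rule cohomology_models_isomorphic[OF M N])
  then show ?thesis using \<phi> by blast
qed

end
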